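(* Let $f(x)$ be a monic degree-$n$ polynomial with coefficients in a ring $R$, and let $n_1,n_2,\dots,n_k$ be natural numbers whose sum is $n$. Then $\mathrm{S}_{n_1}\times\dots\times\mathrm{S}_{n_k}$-closure data of $A=R[x]/(f(x))$ over $R$ correspond to factorizations of $f$ into monic factors $f_1(x),\dots,f_k(x)$ of degrees $n_1,\dots,n_k$, respectively. Given such a factorization $f(x)=f_1(x)\cdots f_k(x)$, set $A_i=R[x]/(f_i(x))$. Then the $\mathrm{S}_{n_1}\times\dots\times\mathrm{S}_{n_k}$-closure algebra associated to this factorization is isomorphic to $\bigotimes_{i=1}^k A_i^{\otimes n_i}/\Phi_{A_i}$.
   Context: All rings and algebras are commutative with 1; tensor products and tensor powers are over $R$ unless indicated. $\mathrm{S}_{n_1}\times\dots\times\mathrm{S}_{n_k}$ is regarded as a subgroup of $\mathrm{S}_n$, with $\mathrm{S}_{n_i}$ permuting the $n_i$ elements $\{n_1+\dots+n_{i-1}+1,\dots,n_1+\dots+n_{i-1}+n_i\}$. For an $R$-algebra $A$ that is locally free of rank $n$ as an $R$-module and $a\in A$, $a^{(i)}\in A^{\otimes n}$ is the pure tensor with $a$ in position $i$ and $1$ elsewhere. $\mathrm{S}_n$ acts on $A^{\otimes n}$ by the $R$-algebra automorphisms with $\sigma\cdot a^{(i)}=a^{(\sigma(i))}$, and $(A^{\otimes n})^G$ is the subalgebra of $G$-invariants for $G\subseteq\mathrm{S}_n$. $e_k(a)\in(A^{\otimes n})^{\mathrm{S}_n}$ is the $k$-th elementary symmetric polynomial in $a^{(1)},\dots,a^{(n)}$,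 and $s_k(a)\in R$ is defined by the characteristic polynomial of multiplication by $a$ on $A$: $\lambda^n-s_1(a)\lambda^{n-1}+\dots+(-1)^ns_n(a)$. A $G$-closure datum for (or of) $A$ over $R$ is an $R$-algebra homomorphism $\varphi:(A^{\otimes n})^G\to R$ with $\varphi(e_k(a))=s_k(a)$ for all $a\in A$, $1\le k\le n$; its closure algebra is $A^{\otimes n}/\varphi:=A^{\otimes n}\otimes_{(A^{\otimes n})^G}R$, formed along $\varphi$. The closure algebra associated to a factorization is the closure algebra of the closure datum corresponding to it. For $G=\mathrm{S}_n$ there is exactly one closure datum, the Ferrand homomorphism $\Phi_A:(A^{\otimes n})^{\mathrm{S}_n}\to R$; so $A_i^{\otimes n_i}/\Phi_{A_i}$ is the $\mathrm{S}_{n_i}$-closure algebra of $A_i$. *)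

theory Defs
  imports "HOL-Algebra.UnivPoly" "HOL-Algebra.QuotRing" "HOL-Algebra.Product_Groups"
    "HOL-Algebra.Sym_Groups"
begin

text \<open>
  An \<open>R\<close>-algebra is a \<^typ>\<open>('r, 'a) module\<close> record satisfying \<^locale>\<open>algebra\<close>.
  All carriers may be trivial; in particular the zero ring is a commutative ring.
  Positions in tensor powers are numbered \<open>1..n\<close>, in agreement with \<^const>\<open>sym_group\<close>.
\<close>

definition with_smult :: "('a, 'm) ring_scheme \<Rightarrow> ('r \<Rightarrow> 'a \<Rightarrow> 'a) \<Rightarrow> ('r, 'a) module" where
  "with_smult A s = \<lparr>carrier = carrier A, monoid.mult = monoid.mult A, one = \<one>\<^bsub>A\<^esub>,
     ring.zero = \<zero>\<^bsub>A\<^esub>, ring.add = ring.add A, smult = s\<rparr>"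

definition self_alg :: "('r, 'm) ring_scheme \<Rightarrow> ('r, 'r) module" where
  "self_alg R = with_smult R (monoid.mult R)"

definition alg_hom ::
    "('r, 'm) ring_scheme \<Rightarrow> ('r, 'a, 'p) module_scheme \<Rightarrow> ('r, 'b, 'q) module_scheme \<Rightarrow> ('a \<Rightarrow> 'b) set" where
  "alg_hom R A B =
     {h \<in> ring_hom A B. \<forall>r\<in>carrier R. \<forall>a\<in>carrier A. h (r \<odot>\<^bsub>A\<^esub> a) = r \<odot>\<^bsub>B\<^esub> h a}"

definition alg_iso ::
    "('r, 'm) ring_scheme \<Rightarrow> ('r, 'a, 'p) module_scheme \<Rightarrow> ('r, 'b, 'q) module_scheme \<Rightarrow> ('a \<Rightarrow> 'b) set" where
  "alg_iso R A B = {h \<in> alg_hom R A B. bij_betw h (carrier A) (carrier B)}"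

definition alg_isomorphic ::
    "('r, 'm) ring_scheme \<Rightarrow> ('r, 'a, 'p) module_scheme \<Rightarrow> ('r, 'b, 'q) module_scheme \<Rightarrow> bool" where
  "alg_isomorphic R A B \<longleftrightarrow> alg_iso R A B \<noteq> {}"

text \<open>
  The quotient of an algebra by an ideal; a scalar \<open>r\<close> acts on a coset as multiplication by
  the class of \<open>r \<odot> 1\<close>.
\<close>

definition quot_alg :: "('r, 'a, 'p) module_scheme \<Rightarrow> 'a set \<Rightarrow> ('r, 'a set) module" where
  "quot_alg A I =
     with_smult (A Quot I) (\<lambda>r c. (I +>\<^bsub>A\<^esub> (r \<odot>\<^bsub>A\<^esub> \<one>\<^bsub>A\<^esub>)) \<otimes>\<^bsub>A Quot I\<^esub> c)"


text \<open>
  The free \<open>R\<close>-module on the elements of a commutative monoid \<open>M\<close>, with the convolution product.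
  Its elements are the finitely supported functions, extended by zero outside \<open>M\<close>.
\<close>

definition monoid_alg :: "('r, 'm) ring_scheme \<Rightarrow> ('x, 'q) monoid_scheme \<Rightarrow> ('r, 'x \<Rightarrow> 'r) module" where
  "monoid_alg R M =
     \<lparr>carrier = {u. (\<forall>x\<in>carrier M. u x \<in> carrier R) \<and> (\<forall>x. x \<notin> carrier M \<longrightarrow> u x = \<zero>\<^bsub>R\<^esub>) \<and>
                    finite {x. u x \<noteq> \<zero>\<^bsub>R\<^esub>}},
      monoid.mult = (\<lambda>u v z. \<Oplus>\<^bsub>R\<^esub>p\<in>{p. u (fst p) \<noteq> \<zero>\<^bsub>R\<^esub> \<and> v (snd p) \<noteq> \<zero>\<^bsub>R\<^esub> \<and> fst p \<otimes>\<^bsub>M\<^esub> snd p = z}.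
                        u (fst p) \<otimes>\<^bsub>R\<^esub> v (snd p)),
      one = (\<lambda>z. if z = \<one>\<^bsub>M\<^esub> then \<one>\<^bsub>R\<^esub> else \<zero>\<^bsub>R\<^esub>),
      ring.zero = (\<lambda>z. \<zero>\<^bsub>R\<^esub>),
      ring.add = (\<lambda>u v z. u z \<oplus>\<^bsub>R\<^esub> v z),
      smult = (\<lambda>r u z. r \<otimes>\<^bsub>R\<^esub> u z)\<rparr>"

definition delta :: "('r, 'm) ring_scheme \<Rightarrow> 'x \<Rightarrow> 'x \<Rightarrow> 'r" where
  "delta R x = (\<lambda>z. if z = x then \<one>\<^bsub>R\<^esub> else \<zero>\<^bsub>R\<^esub>)"

text \<open>
  The tensor product over \<open>R\<close> of the family \<open>A i\<close> (\<open>i \<in> I\<close>, \<open>I\<close> finite): the free module on the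
  tuples, divided by the multilinearity relations. The submodule spanned by these relations is
  stable under multiplication by tuples, so it is the ideal that they generate, and the
  multiplication of tuples induces the usual product of the tensor product of algebras.
\<close>

definition multilinear_rels ::
    "('r, 'm) ring_scheme \<Rightarrow> 'i set \<Rightarrow> ('i \<Rightarrow> ('r, 'a, 'p) module_scheme) \<Rightarrow> (('i \<Rightarrow> 'a) \<Rightarrow> 'r) set" where
  "multilinear_rels R I A =
     (let F = monoid_alg R (product_group I A) in
       {delta R (x(i := a \<oplus>\<^bsub>A i\<^esub> b)) \<ominus>\<^bsub>F\<^esub> (delta R (x(i := a)) \<oplus>\<^bsub>F\<^esub> delta R (x(i := b))) | x i a b.
          x \<in> (\<Pi>\<^sub>E j\<in>I. carrier (A j)) \<and> i \<in> I \<and> a \<in> carrier (A i) \<and> b \<in> carrier (A i)} \<union>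
       {delta R (x(i := r \<odot>\<^bsub>A i\<^esub> a)) \<ominus>\<^bsub>F\<^esub> r \<odot>\<^bsub>F\<^esub> delta R (x(i := a)) | x i r a.
          x \<in> (\<Pi>\<^sub>E j\<in>I. carrier (A j)) \<and> i \<in> I \<and> r \<in> carrier R \<and> a \<in> carrier (A i)})"

definition tensor_prod ::
    "('r, 'm) ring_scheme \<Rightarrow> 'i set \<Rightarrow> ('i \<Rightarrow> ('r, 'a, 'p) module_scheme)
       \<Rightarrow> ('r, (('i \<Rightarrow> 'a) \<Rightarrow> 'r) set) module" where
  "tensor_prod R I A =
     (let F = monoid_alg R (product_group I A) in quot_alg F (Idl\<^bsub>F\<^esub> (multilinear_rels R I A)))"

definition pure_tensor ::
    "('r, 'm) ring_scheme \<Rightarrow> 'i set \<Rightarrow> ('i \<Rightarrow> ('r, 'a, 'p) module_scheme) \<Rightarrow> ('i \<Rightarrow> 'a)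
       \<Rightarrow> (('i \<Rightarrow> 'a) \<Rightarrow> 'r) set" where
  "pure_tensor R I A x =
     (let F = monoid_alg R (product_group I A) in Idl\<^bsub>F\<^esub> (multilinear_rels R I A) +>\<^bsub>F\<^esub> delta R x)"

definition bilinear_rels ::
    "('s, 'm) ring_scheme \<Rightarrow> ('s, 'a, 'p) module_scheme \<Rightarrow> ('s, 'b, 'q) module_scheme
       \<Rightarrow> ('a \<times> 'b \<Rightarrow> 's) set" where
  "bilinear_rels S A B =
     (let F = monoid_alg S (A \<times>\<times> B) in
       {delta S (a \<oplus>\<^bsub>A\<^esub> a', b) \<ominus>\<^bsub>F\<^esub> (delta S (a, b) \<oplus>\<^bsub>F\<^esub> delta S (a', b)) | a a' b.
          a \<in> carrier A \<and> a' \<in> carrier A \<and> b \<in> carrier B} \<union>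
       {delta S (a, b \<oplus>\<^bsub>B\<^esub> b') \<ominus>\<^bsub>F\<^esub> (delta S (a, b) \<oplus>\<^bsub>F\<^esub> delta S (a, b')) | a b b'.
          a \<in> carrier A \<and> b \<in> carrier B \<and> b' \<in> carrier B} \<union>
       {delta S (s \<odot>\<^bsub>A\<^esub> a, b) \<ominus>\<^bsub>F\<^esub> s \<odot>\<^bsub>F\<^esub> delta S (a, b) | s a b.
          s \<in> carrier S \<and> a \<in> carrier A \<and> b \<in> carrier B} \<union>
       {delta S (a, s \<odot>\<^bsub>B\<^esub> b) \<ominus>\<^bsub>F\<^esub> s \<odot>\<^bsub>F\<^esub> delta S (a, b) | s a b.
          s \<in> carrier S \<and> a \<in> carrier A \<and> b \<in> carrier B})"

definition tensor_prod2 ::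
    "('s, 'm) ring_scheme \<Rightarrow> ('s, 'a, 'p) module_scheme \<Rightarrow> ('s, 'b, 'q) module_scheme
       \<Rightarrow> ('s, ('a \<times> 'b \<Rightarrow> 's) set) module" where
  "tensor_prod2 S A B =
     (let F = monoid_alg S (A \<times>\<times> B) in quot_alg F (Idl\<^bsub>F\<^esub> (bilinear_rels S A B)))"


definition cring_det :: "('r, 'm) ring_scheme \<Rightarrow> nat \<Rightarrow> (nat \<Rightarrow> nat \<Rightarrow> 'r) \<Rightarrow> 'r" where
  "cring_det R n M =
     (\<Oplus>\<^bsub>R\<^esub>\<pi>\<in>carrier (sym_group n).
        (if evenperm \<pi> then \<one>\<^bsub>R\<^esub> else \<ominus>\<^bsub>R\<^esub> \<one>\<^bsub>R\<^esub>) \<otimes>\<^bsub>R\<^esub> (\<Otimes>\<^bsub>R\<^esub>i\<in>{1..n}. M i (\<pi> i)))"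

definition is_coords ::
    "('r, 'm) ring_scheme \<Rightarrow> ('r, 'a, 'p) module_scheme \<Rightarrow> nat \<Rightarrow> (nat \<Rightarrow> 'a) \<Rightarrow> 'a \<Rightarrow> (nat \<Rightarrow> 'r) \<Rightarrow> bool" where
  "is_coords R A n b a c \<longleftrightarrow>
     c \<in> {1..n} \<rightarrow>\<^sub>E carrier R \<and> a = (\<Oplus>\<^bsub>A\<^esub>i\<in>{1..n}. c i \<odot>\<^bsub>A\<^esub> b i)"

definition is_basis ::
    "('r, 'm) ring_scheme \<Rightarrow> ('r, 'a, 'p) module_scheme \<Rightarrow> nat \<Rightarrow> (nat \<Rightarrow> 'a) \<Rightarrow> bool" where
  "is_basis R A n b \<longleftrightarrow>
     b \<in> {1..n} \<rightarrow> carrier A \<and> (\<forall>a\<in>carrier A. \<exists>!c. is_coords R A n b a c)"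

definition mult_matrix ::
    "('r, 'm) ring_scheme \<Rightarrow> ('r, 'a, 'p) module_scheme \<Rightarrow> nat \<Rightarrow> (nat \<Rightarrow> 'a) \<Rightarrow> 'a \<Rightarrow> nat \<Rightarrow> nat \<Rightarrow> 'r" where
  "mult_matrix R A n b a i j = (THE c. is_coords R A n b (a \<otimes>\<^bsub>A\<^esub> b j) c) i"

text \<open>
  The characteristic polynomial of multiplication by \<open>a\<close> on an algebra \<open>A\<close> that is free of
  rank \<open>n\<close>. It does not depend on the basis.
\<close>

definition mult_char_poly ::
    "('r, 'm) ring_scheme \<Rightarrow> ('r, 'a, 'p) module_scheme \<Rightarrow> nat \<Rightarrow> 'a \<Rightarrow> nat \<Rightarrow> 'r" where
  "mult_char_poly R A n a =
     (let b = (SOME b. is_basis R A n b) in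
       cring_det (UP R) n (\<lambda>i j.
         (if i = j then monom (UP R) \<one>\<^bsub>R\<^esub> 1 else \<zero>\<^bsub>UP R\<^esub>)
           \<ominus>\<^bsub>UP R\<^esub> monom (UP R) (mult_matrix R A n b a i j) 0))"

text \<open>\<open>s\<^sub>k(a)\<close>: the coefficient of \<open>\<lambda>\<^sup>n\<^sup>-\<^sup>k\<close> is \<open>(-1)\<^sup>k s\<^sub>k(a)\<close>.\<close>

definition char_coeff ::
    "('r, 'm) ring_scheme \<Rightarrow> ('r, 'a, 'p) module_scheme \<Rightarrow> nat \<Rightarrow> nat \<Rightarrow> 'a \<Rightarrow> 'r" where
  "char_coeff R A n k a =
     (\<ominus>\<^bsub>R\<^esub> \<one>\<^bsub>R\<^esub>) [^]\<^bsub>R\<^esub> k \<otimes>\<^bsub>R\<^esub> coeff (UP R) (mult_char_poly R A n a) (n - k)"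


definition tensor_power ::
    "('r, 'm) ring_scheme \<Rightarrow> ('r, 'a, 'p) module_scheme \<Rightarrow> nat
       \<Rightarrow> ('r, ((nat \<Rightarrow> 'a) \<Rightarrow> 'r) set) module" where
  "tensor_power R A n = tensor_prod R {1..n} (\<lambda>_. A)"

text \<open>\<open>a\<^sup>(\<^sup>i\<^sup>)\<close>\<close>

definition at_pos ::
    "('r, 'm) ring_scheme \<Rightarrow> ('r, 'a, 'p) module_scheme \<Rightarrow> nat \<Rightarrow> nat \<Rightarrow> 'a
       \<Rightarrow> ((nat \<Rightarrow> 'a) \<Rightarrow> 'r) set" where
  "at_pos R A n i a =
     pure_tensor R {1..n} (\<lambda>_. A) (\<lambda>j\<in>{1..n}. if j = i then a else \<one>\<^bsub>A\<^esub>)"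

definition perm_action ::
    "('r, 'm) ring_scheme \<Rightarrow> ('r, 'a, 'p) module_scheme \<Rightarrow> nat \<Rightarrow> (nat \<Rightarrow> nat)
       \<Rightarrow> ((nat \<Rightarrow> 'a) \<Rightarrow> 'r) set \<Rightarrow> ((nat \<Rightarrow> 'a) \<Rightarrow> 'r) set" where
  "perm_action R A n \<sigma> =
     (let T = tensor_power R A n in
       THE h. h \<in> alg_iso R T T \<and> h \<in> extensional (carrier T) \<and>
         (\<forall>i\<in>{1..n}. \<forall>a\<in>carrier A. h (at_pos R A n i a) = at_pos R A n (\<sigma> i) a))"

definition invariants ::
    "('r, 'm) ring_scheme \<Rightarrow> ('r, 'a, 'p) module_scheme \<Rightarrow> nat \<Rightarrow> (nat \<Rightarrow> nat) set
       \<Rightarrow> ('r, ((nat \<Rightarrow> 'a) \<Rightarrow> 'r) set) module" where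
  "invariants R A n G =
     (let T = tensor_power R A n in
       T\<lparr>carrier := {t \<in> carrier T. \<forall>\<sigma>\<in>G. perm_action R A n \<sigma> t = t}\<rparr>)"

definition elem_sym ::
    "('r, 'm) ring_scheme \<Rightarrow> ('r, 'a, 'p) module_scheme \<Rightarrow> nat \<Rightarrow> nat \<Rightarrow> 'a
       \<Rightarrow> ((nat \<Rightarrow> 'a) \<Rightarrow> 'r) set" where
  "elem_sym R A n k a =
     (let T = tensor_power R A n in
       \<Oplus>\<^bsub>T\<^esub>S\<in>{S. S \<subseteq> {1..n} \<and> card S = k}. \<Otimes>\<^bsub>T\<^esub>i\<in>S. at_pos R A n i a)"

text \<open>
  \<open>G\<close>-closure data, only meaningful for \<open>A\<close> free (not merely locally free) of rank \<open>n\<close>, as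
  \<open>R[x]/(f)\<close> is, and \<open>G\<close> a set of permutations of \<open>{1..n}\<close>. Homomorphisms are taken to be extensional, so that equal homomorphisms are equal functions.
\<close>

definition closure_data ::
    "('r, 'm) ring_scheme \<Rightarrow> ('r, 'a, 'p) module_scheme \<Rightarrow> nat \<Rightarrow> (nat \<Rightarrow> nat) set
       \<Rightarrow> (((nat \<Rightarrow> 'a) \<Rightarrow> 'r) set \<Rightarrow> 'r) set" where
  "closure_data R A n G =
     {\<phi> \<in> alg_hom R (invariants R A n G) (self_alg R).
        \<phi> \<in> extensional (carrier (invariants R A n G)) \<and>
        (\<forall>a\<in>carrier A. \<forall>k\<in>{1..n}. \<phi> (elem_sym R A n k a) = char_coeff R A n k a)}"

text \<open>
  The closure algebra, as an \<open>R\<close>-algebra: the tensor product of the tensor power with \<open>R\<close>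
  over the ring \<open>S\<close> of invariants, where \<open>S\<close> acts on \<open>R\<close> along \<open>\<phi>\<close>, with scalars
  restricted along \<open>R \<rightarrow> S\<close>.
\<close>

definition closure_alg ::
    "('r, 'm) ring_scheme \<Rightarrow> ('r, 'a, 'p) module_scheme \<Rightarrow> nat \<Rightarrow> (nat \<Rightarrow> nat) set
       \<Rightarrow> (((nat \<Rightarrow> 'a) \<Rightarrow> 'r) set \<Rightarrow> 'r)
       \<Rightarrow> ('r, (((nat \<Rightarrow> 'a) \<Rightarrow> 'r) set \<times> 'r \<Rightarrow> ((nat \<Rightarrow> 'a) \<Rightarrow> 'r) set) set) module" where
  "closure_alg R A n G \<phi> =
     (let T = tensor_power R A n;
          C = tensor_prod2 (invariants R A n G)
                (with_smult T (monoid.mult T)) (with_smult R (\<lambda>s r. \<phi> s \<otimes>\<^bsub>R\<^esub> r))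
      in with_smult C (\<lambda>r c. (r \<odot>\<^bsub>T\<^esub> \<one>\<^bsub>T\<^esub>) \<odot>\<^bsub>C\<^esub> c))"

definition ferrand_hom ::
    "('r, 'm) ring_scheme \<Rightarrow> ('r, 'a, 'p) module_scheme \<Rightarrow> nat \<Rightarrow> ((nat \<Rightarrow> 'a) \<Rightarrow> 'r) set \<Rightarrow> 'r" where
  "ferrand_hom R A n = (THE \<phi>. \<phi> \<in> closure_data R A n (carrier (sym_group n)))"


text \<open>Not phrased with \<^const>\<open>deg\<close>, which is \<open>0\<close> for every polynomial over the zero ring.\<close>

definition monic_of_degree :: "('r, 'm) ring_scheme \<Rightarrow> nat \<Rightarrow> (nat \<Rightarrow> 'r) \<Rightarrow> bool" where
  "monic_of_degree R n f \<longleftrightarrow>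
     f \<in> carrier (UP R) \<and> coeff (UP R) f n = \<one>\<^bsub>R\<^esub> \<and> (\<forall>m>n. coeff (UP R) f m = \<zero>\<^bsub>R\<^esub>)"

text \<open>\<open>R[x]/(f)\<close> and the class of \<open>x\<close> in it\<close>

definition adjoin_root :: "('r, 'm) ring_scheme \<Rightarrow> (nat \<Rightarrow> 'r) \<Rightarrow> ('r, (nat \<Rightarrow> 'r) set) module" where
  "adjoin_root R f = quot_alg (UP R) (PIdl\<^bsub>UP R\<^esub> f)"

definition root_of :: "('r, 'm) ring_scheme \<Rightarrow> (nat \<Rightarrow> 'r) \<Rightarrow> (nat \<Rightarrow> 'r) set" where
  "root_of R f = PIdl\<^bsub>UP R\<^esub> f +>\<^bsub>UP R\<^esub> monom (UP R) \<one>\<^bsub>R\<^esub> 1"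

definition block :: "(nat \<Rightarrow> nat) \<Rightarrow> nat \<Rightarrow> nat set" where
  "block d i = {(\<Sum>j=1..<i. d j) + 1 .. (\<Sum>j=1..<i. d j) + d i}"

text \<open>The subgroup \<open>S\<^sub>d\<^sub>1 \<times> \<dots> \<times> S\<^sub>d\<^sub>k\<close> of \<open>S\<^sub>n\<close>, where \<open>n = d\<^sub>1 + \<dots> + d\<^sub>k\<close>\<close>

definition young_subgroup :: "(nat \<Rightarrow> nat) \<Rightarrow> nat \<Rightarrow> (nat \<Rightarrow> nat) set" where
  "young_subgroup d k =
     {\<sigma> \<in> carrier (sym_group (\<Sum>i=1..k. d i)). \<forall>i\<in>{1..k}. \<sigma> ` block d i = block d i}"

definition factorizations ::
    "('r, 'm) ring_scheme \<Rightarrow> (nat \<Rightarrow> 'r) \<Rightarrow> (nat \<Rightarrow> nat) \<Rightarrow> nat \<Rightarrow> (nat \<Rightarrow> nat \<Rightarrow> 'r) set" where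
  "factorizations R f d k =
     {F \<in> extensional {1..k}. (\<forall>i\<in>{1..k}. monic_of_degree R (d i) (F i)) \<and>
        f = (\<Otimes>\<^bsub>UP R\<^esub>i\<in>{1..k}. F i)}"

text \<open>
  The factors attached to a closure datum \<open>\<phi>\<close> of \<open>R[x]/(f)\<close>: the \<open>i\<close>-th one is the image under \<open>\<phi>\<close> of
  the product of the \<open>X - x\<^sup>(\<^sup>l\<^sup>)\<close> over the \<open>l\<close> in the \<open>i\<close>-th block, whose coefficients are,
  up to sign, the elementary symmetric polynomials in these \<open>x\<^sup>(\<^sup>l\<^sup>)\<close>.
\<close>

definition datum_factors ::
    "('r, 'm) ring_scheme \<Rightarrow> (nat \<Rightarrow> 'r) \<Rightarrow> (nat \<Rightarrow> nat) \<Rightarrow> nat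
       \<Rightarrow> (((nat \<Rightarrow> (nat \<Rightarrow> 'r) set) \<Rightarrow> 'r) set \<Rightarrow> 'r) \<Rightarrow> nat \<Rightarrow> nat \<Rightarrow> 'r" where
  "datum_factors R f d k \<phi> =
     (let n = \<Sum>i=1..k. d i; A = adjoin_root R f; P = UP (tensor_power R A n) in
       (\<lambda>i\<in>{1..k}. \<lambda>m. \<phi> (coeff P (\<Otimes>\<^bsub>P\<^esub>l\<in>block d i.
         monom P \<one>\<^bsub>tensor_power R A n\<^esub> 1 \<ominus>\<^bsub>P\<^esub> monom P (at_pos R A n l (root_of R f)) 0) m)))"

end

theory Submission
  imports Defs "HOL-Algebra.Subrings" "HOL-Algebra.Weak_Morphisms"
begin

text \<open>
  Let \<open>A = R[x]/(f)\<close>, let \<open>T\<close> be its \<open>n\<close>-th tensor power,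
  \<open>x\<^sub>l\<close> the root \<open>x\<^sup>(\<^sup>l\<^sup>)\<close> of \<open>f\<close> in \<open>T\<close>,
  and let \<open>G\<close> be the product of the symmetric groups of the blocks. Put \<open>g\<^sub>i = \<Prod>(X -
  x\<^sub>l)\<close> with \<open>l\<close> in the \<open>i\<close>-th block. The theorem rests on two facts.

  (1) The invariants \<open>T\<^sup>G\<close> are generated as an \<open>R\<close>-algebra by the coefficients of the
  \<open>g\<^sub>i\<close> (\<open>Inv_young_generated\<close>).

  (2) If \<open>f = \<Prod>(X - \<theta>\<^sub>l)\<close> over a ring \<open>K\<close> over \<open>R\<close>, and
  \<open>h\<^sub>l: A \<rightarrow> K\<close> sends \<open>x\<close> to \<open>\<theta>\<^sub>l\<close>, then the
  characteristic polynomial of multiplication by \<open>a\<close> is \<open>\<Prod>(X - h\<^sub>l(a))\<close> over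
  \<open>K\<close> (\<open>char_poly_split\<close>).

  Given these, a closure datum \<open>\<phi>\<close> is determined by the polynomials
  \<open>\<phi>(g\<^sub>i)\<close>. They are monic of degree \<open>d\<^sub>i\<close>, and their product is the image
  of \<open>\<Prod>(X - x\<^sub>l)\<close>, which is the characteristic polynomial of \<open>x\<close>, hence
  \<open>f\<close>. Conversely, let \<open>f = F\<^sub>1 \<dots> F\<^sub>k\<close>. Adjoining roots one after another
  gives a ring \<open>K\<close> containing \<open>R\<close> in which every \<open>F\<^sub>i\<close> is a product of
  linear factors. Sending the \<open>x\<^sub>l\<close> to the roots of the \<open>F\<^sub>i\<close>, block by block,
  defines a homomorphism \<open>T \<rightarrow> K\<close> that carries \<open>g\<^sub>i\<close> to
  \<open>F\<^sub>i\<close>. By (1) it maps \<open>T\<^sup>G\<close> to \<open>R\<close>, and by (2) the resulting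
  \<open>\<phi>: T\<^sup>G \<rightarrow> R\<close> satisfies \<open>\<phi>(e\<^sub>m(a)) = s\<^sub>m(a)\<close> for
  every \<open>a\<close>, not only for \<open>x\<close>.

  For (2), multiplication by \<open>a\<close> has a triangular matrix with the diagonal entries
  \<open>h\<^sub>l(a)\<close> in the Newton basis \<open>1, X - \<theta>\<^sub>1, (X - \<theta>\<^sub>1) (X -
  \<theta>\<^sub>2), \<dots>\<close> of \<open>K[X]/(f)\<close>. For (1), the tensor power has the basis of the
  monomials with exponents below \<open>n\<close>, so an invariant is a linear combination of orbit sums of monomials.
  By (2), a product \<open>\<Prod>c(x\<^sub>l)\<close> over a block is a norm (\<open>norm_in_subring\<close>): it is
  a polynomial in the coefficients of \<open>g\<^sub>i\<close> and of \<open>c\<close>. This is applied to polynomials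
  \<open>c\<close> whose coefficients are powers of an auxiliary variable, chosen so that the product over all blocks
  is a generating function of the orbit sums (\<open>orbit_sum_in_subring\<close>).

  For the closure algebras, (1) shows that homomorphisms from the closure algebra of the factorization to a ring
  \<open>B\<close> over \<open>R\<close> are the same as families \<open>b\<^sub>1, \<dots>, b\<^sub>n\<close> in
  \<open>B\<close> such that, for each \<open>i\<close>, the product of the \<open>X - b\<^sub>l\<close> with
  \<open>l\<close> in the \<open>i\<close>-th block is \<open>F\<^sub>i\<close>. With only one block this describes
  \<open>A\<^sub>i\<^sup>\<otimes>\<^sup>d\<^sup>i/\<Phi>\<close>, where \<open>A\<^sub>i = R[x]/(F\<^sub>i)\<close>.
  The tensor product of these algebras represents the same families, which yields the isomorphism
  (\<open>closure_alg_iso\<close>).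
\<close>

section \<open>Finite products and monoid algebras\<close>

lemma (in comm_monoid) finprod_Sigma:
  assumes "finite A" "\<And>a. a \<in> A \<Longrightarrow> finite (B a)"
    and "\<And>a b. a \<in> A \<Longrightarrow> b \<in> B a \<Longrightarrow> f a b \<in> carrier G"
  shows "(\<Otimes>a\<in>A. \<Otimes>b\<in>B a. f a b) = (\<Otimes>p\<in>Sigma A B. f (fst p) (snd p))"
  using assms
proof (induction A rule: finite_induct)
  case empty
  then show ?case by simp
next
  case (insert x F)
  have S: "Sigma (insert x F) B = Pair x ` B x \<union> Sigma F B" by auto
  have "(\<Otimes>p\<in>Pair x ` B x \<union> Sigma F B. f (fst p) (snd p)) =
      (\<Otimes>p\<in>Pair x ` B x. f (fst p) (snd p)) \<otimes> (\<Otimes>p\<in>Sigma F B. f (fst p) (snd p))"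
    using insert by (intro finprod_Un_disjoint) auto
  moreover have "(\<Otimes>p\<in>Pair x ` B x. f (fst p) (snd p)) = (\<Otimes>b\<in>B x. f x b)"
    using insert by (subst finprod_reindex) (auto simp: inj_on_def)
  ultimately show ?case
    using insert unfolding S by (subst finprod_insert) (auto intro!: finprod_closed)
qed

lemma (in comm_monoid) finprod_swap:
  assumes "finite A" "finite B"
    and "\<And>a b. a \<in> A \<Longrightarrow> b \<in> B \<Longrightarrow> f a b \<in> carrier G"
  shows "(\<Otimes>a\<in>A. \<Otimes>b\<in>B. f a b) = (\<Otimes>b\<in>B. \<Otimes>a\<in>A. f a b)"
  using assms
proof (induction A rule: finite_induct)
  case (insert x F)
  then have "(\<Otimes>a\<in>insert x F. \<Otimes>b\<in>B. f a b) = (\<Otimes>b\<in>B. f x b) \<otimes> (\<Otimes>b\<in>B. \<Otimes>a\<in>F. f a b)"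
    by (subst finprod_insert) (auto intro!: finprod_closed)
  also have "\<dots> = (\<Otimes>b\<in>B. f x b \<otimes> (\<Otimes>a\<in>F. f a b))"
    using insert by (subst finprod_multf) (auto intro!: finprod_closed)
  also have "\<dots> = (\<Otimes>b\<in>B. \<Otimes>a\<in>insert x F. f a b)"
    using insert by (intro finprod_cong') (auto intro!: finprod_closed)
  finally show ?case .
qed simp

lemmas (in abelian_monoid) finsum_Sigma = add.finprod_Sigma
lemmas (in abelian_monoid) finsum_swap = add.finprod_swap
lemmas (in abelian_monoid) finsum_mono_neutral_cong_left = add.finprod_mono_neutral_cong_left
lemmas (in abelian_monoid) finsum_mono_neutral_cong_right = add.finprod_mono_neutral_cong_right

lemma (in abelian_monoid) finsum_delta:
  assumes "finite A" "a \<in> A" "c a \<in> carrier G"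
  shows "(\<Oplus>i\<in>A. if a = i then c i else \<zero>) = c a"
proof -
  have "(\<Oplus>i\<in>A. if a = i then c i else \<zero>) = (\<Oplus>i\<in>{a}. c i)"
    using assms by (intro finsum_mono_neutral_cong_right) auto
  then show ?thesis using assms by simp
qed

text \<open>
  This expansion is behind the monomial basis of a tensor power, the product formula for determinants and the
  generating function of the orbit sums.
\<close>

lemma (in cring) finprod_finsum_distrib:
  assumes "finite I" "\<And>i. i \<in> I \<Longrightarrow> finite (J i)"
    and "\<And>i j. i \<in> I \<Longrightarrow> j \<in> J i \<Longrightarrow> c i j \<in> carrier R"
  shows "(\<Otimes>i\<in>I. \<Oplus>j\<in>J i. c i j) = (\<Oplus>g\<in>PiE I J. \<Otimes>i\<in>I. c i (g i))"
  using assms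
proof (induction I rule: finite_induct)
  case empty
  then show ?case by simp
next
  case (insert x F)
  have fin: "finite (PiE F J)" using insert by (intro finite_PiE) auto
  have cl: "(\<Otimes>i\<in>F. c i (g i)) \<in> carrier R" if "g \<in> PiE F J" for g
    using that insert.prems by (intro finprod_closed) (auto simp: PiE_def Pi_def)
  have upd: "(\<Otimes>i\<in>F. c i ((g(x := y)) i)) = (\<Otimes>i\<in>F. c i (g i))" if "g \<in> PiE F J" for g y
    using that insert by (intro finprod_cong') (auto simp: PiE_def Pi_def)
  have "(\<Otimes>i\<in>insert x F. \<Oplus>j\<in>J i. c i j) =
      (\<Oplus>j\<in>J x. c x j) \<otimes> (\<Oplus>g\<in>PiE F J. \<Otimes>i\<in>F. c i (g i))"
    using insert by (subst finprod_insert) (auto intro!: finsum_closed)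
  also have "\<dots> = (\<Oplus>j\<in>J x. c x j \<otimes> (\<Oplus>g\<in>PiE F J. \<Otimes>i\<in>F. c i (g i)))"
    using insert.prems cl by (intro finsum_ldistr) (auto intro!: finsum_closed)
  also have "\<dots> = (\<Oplus>j\<in>J x. \<Oplus>g\<in>PiE F J. c x j \<otimes> (\<Otimes>i\<in>F. c i (g i)))"
    using insert.prems cl fin
    by (intro finsum_cong') (auto intro!: finsum_closed finsum_rdistr)
  also have "\<dots> = (\<Oplus>p\<in>J x \<times> PiE F J. c x (fst p) \<otimes> (\<Otimes>i\<in>F. c i (snd p i)))"
    using insert.prems cl fin by (intro finsum_Sigma) auto
  also have "\<dots> = (\<Oplus>p\<in>J x \<times> PiE F J.
      \<Otimes>i\<in>insert x F. c i (((\<lambda>(y, g). g(x := y)) p) i))"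
    using insert.prems insert.hyps cl upd
    by (intro finsum_cong') (auto simp: finprod_insert PiE_def Pi_def)
  also have "\<dots> = (\<Oplus>g\<in>(\<lambda>(y, g). g(x := y)) ` (J x \<times> PiE F J). \<Otimes>i\<in>insert x F. c i (g i))"
    using insert.prems insert.hyps cl upd
    by (intro finsum_reindex[symmetric] inj_combinator)
       (auto simp: PiE_def Pi_def intro!: finprod_closed)
  also have "(\<lambda>(y, g). g(x := y)) ` (J x \<times> PiE F J) = PiE (insert x F) J"
    by (simp add: PiE_insert_eq)
  finally show ?case .
qed

subsection \<open>Monoid algebras\<close>

text \<open>
  The structure map \<open>R \<rightarrow> A\<close>. Treating algebras through it reduces statements about algebra
  homomorphisms to statements about ring homomorphisms with prescribed values on the image of \<open>R\<close>.
\<close>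

definition scal :: "('r, 'a, 'p) module_scheme \<Rightarrow> 'r \<Rightarrow> 'a" where
  "scal A r = r \<odot>\<^bsub>A\<^esub> \<one>\<^bsub>A\<^esub>"

definition comm_alg :: "('r, 'm) ring_scheme \<Rightarrow> ('r, 'a, 'p) module_scheme \<Rightarrow> bool" where
  "comm_alg R A \<longleftrightarrow> cring R \<and> cring A \<and> scal A \<in> ring_hom R A \<and>
     (\<forall>r\<in>carrier R. \<forall>a\<in>carrier A. r \<odot>\<^bsub>A\<^esub> a = scal A r \<otimes>\<^bsub>A\<^esub> a)"

locale monoid_algebra = R: cring R + M: comm_monoid M
  for R :: "('r, 'm) ring_scheme" (structure) and M :: "('x, 'q) monoid_scheme" +
  fixes F
  defines "F \<equiv> monoid_alg R M"
begin

abbreviation "supp u \<equiv> {x. u x \<noteq> \<zero>}"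

lemma F_carrier: "u \<in> carrier F \<longleftrightarrow>
    (\<forall>x\<in>carrier M. u x \<in> carrier R) \<and> (\<forall>x. x \<notin> carrier M \<longrightarrow> u x = \<zero>) \<and> finite (supp u)"
  by (simp add: F_def monoid_alg_def)

lemma F_ops:
  "u \<oplus>\<^bsub>F\<^esub> v = (\<lambda>z. u z \<oplus> v z)" "\<zero>\<^bsub>F\<^esub> = (\<lambda>z. \<zero>)" "\<one>\<^bsub>F\<^esub> = delta R \<one>\<^bsub>M\<^esub>"
  "r \<odot>\<^bsub>F\<^esub> u = (\<lambda>z. r \<otimes> u z)"
  by (simp_all add: F_def monoid_alg_def delta_def)

lemma F_val [simp]: "u \<in> carrier F \<Longrightarrow> u x \<in> carrier R"
  using F_carrier by (metis R.zero_closed)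

lemma F_supp: assumes "u \<in> carrier F" shows "finite (supp u)" "supp u \<subseteq> carrier M"
  using assms by (auto simp: F_carrier)

lemma conv_eq:
  assumes u: "u \<in> carrier F" and v: "v \<in> carrier F"
    and X: "finite X" "supp u \<subseteq> X" and Y: "finite Y" "supp v \<subseteq> Y"
  shows "(u \<otimes>\<^bsub>F\<^esub> v) z = (\<Oplus>x\<in>X. \<Oplus>y\<in>Y. if x \<otimes>\<^bsub>M\<^esub> y = z then u x \<otimes> v y else \<zero>)"
proof -
  have "(u \<otimes>\<^bsub>F\<^esub> v) z = (\<Oplus>p\<in>{p. u (fst p) \<noteq> \<zero> \<and> v (snd p) \<noteq> \<zero> \<and> fst p \<otimes>\<^bsub>M\<^esub> snd p = z}.
      u (fst p) \<otimes> v (snd p))"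
    unfolding F_def monoid_alg_def monoid.select_convs by (rule refl)
  also have "\<dots> = (\<Oplus>p\<in>X \<times> Y. if fst p \<otimes>\<^bsub>M\<^esub> snd p = z then u (fst p) \<otimes> v (snd p) else \<zero>)"
    using u v X Y by (intro R.finsum_mono_neutral_cong_left) auto
  also have "\<dots> = (\<Oplus>x\<in>X. \<Oplus>y\<in>Y. if x \<otimes>\<^bsub>M\<^esub> y = z then u x \<otimes> v y else \<zero>)"
    using u v X Y by (intro R.finsum_Sigma[symmetric]) auto
  finally show ?thesis .
qed

lemma conv_supp:
  assumes u: "u \<in> carrier F" and v: "v \<in> carrier F"
  shows "supp (u \<otimes>\<^bsub>F\<^esub> v) \<subseteq> (\<lambda>(x, y). x \<otimes>\<^bsub>M\<^esub> y) ` (supp u \<times> supp v)" (is "_ \<subseteq> ?Z")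
proof
  fix z assume z: "z \<in> supp (u \<otimes>\<^bsub>F\<^esub> v)"
  show "z \<in> ?Z"
  proof (rule ccontr)
    assume n: "z \<notin> ?Z"
    have "(u \<otimes>\<^bsub>F\<^esub> v) z =
        (\<Oplus>x\<in>supp u. \<Oplus>y\<in>supp v. if x \<otimes>\<^bsub>M\<^esub> y = z then u x \<otimes> v y else \<zero>)"
      using F_supp[OF u] F_supp[OF v] by (intro conv_eq u v) auto
    also have "\<dots> = \<zero>"
      using n by (intro R.add.finprod_one_eqI) force
    finally show False using z by simp
  qed
qed

lemma conv_closed:
  assumes u: "u \<in> carrier F" and v: "v \<in> carrier F"
  shows "u \<otimes>\<^bsub>F\<^esub> v \<in> carrier F"
proof -
  note s = conv_supp[OF u v] F_supp[OF u] F_supp[OF v]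
  have 1: "finite (supp (u \<otimes>\<^bsub>F\<^esub> v))"
    by (rule finite_subset[OF s(1)]) (use s in auto)
  have 2: "(u \<otimes>\<^bsub>F\<^esub> v) z = \<zero>" if "z \<notin> carrier M" for z
  proof (rule ccontr)
    assume "(u \<otimes>\<^bsub>F\<^esub> v) z \<noteq> \<zero>"
    then have "z \<in> supp (u \<otimes>\<^bsub>F\<^esub> v)" by simp
    then have "z \<in> (\<lambda>(x, y). x \<otimes>\<^bsub>M\<^esub> y) ` (supp u \<times> supp v)" using s(1) by (rule rev_subsetD)
    then obtain x y where "z = x \<otimes>\<^bsub>M\<^esub> y" "x \<in> supp u" "y \<in> supp v" by auto
    then show False using s(3,5) that M.m_closed[of x y] by (simp add: subset_iff)
  qed
  have 3: "(u \<otimes>\<^bsub>F\<^esub> v) z \<in> carrier R" for z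
    using s u v by (subst conv_eq[OF u v, of "supp u" "supp v"]) (auto intro!: R.finsum_closed)
  show ?thesis using 1 2 3 by (auto simp: F_carrier)
qed

text \<open>
  The linear extension of \<open>h\<close>, semilinear along \<open>j\<close>; the target \<open>B\<close> carries no
  module structure, so that it can be any ring over \<open>R\<close>.
\<close>

definition lin :: "('b, 'n) ring_scheme \<Rightarrow> ('r \<Rightarrow> 'b) \<Rightarrow> ('x \<Rightarrow> 'b) \<Rightarrow> ('x \<Rightarrow> 'r) \<Rightarrow> 'b" where
  "lin B j h u = (\<Oplus>\<^bsub>B\<^esub>x\<in>supp u. j (u x) \<otimes>\<^bsub>B\<^esub> h x)"

context
  fixes B :: "('b, 'n) ring_scheme" and j and h
  assumes B: "cring B" and j: "j \<in> ring_hom R B" and h: "h \<in> carrier M \<rightarrow> carrier B"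
begin

interpretation B: cring B by (rule B)
interpretation j: ring_hom_cring R B j by (rule ring_hom_cringI[OF R.is_cring B j])

lemma lin_eq:
  assumes u: "u \<in> carrier F" and X: "finite X" "supp u \<subseteq> X" "X \<subseteq> carrier M"
  shows "lin B j h u = (\<Oplus>\<^bsub>B\<^esub>x\<in>X. j (u x) \<otimes>\<^bsub>B\<^esub> h x)"
  unfolding lin_def using u X h
  by (intro B.finsum_mono_neutral_cong_left) (auto simp: Pi_def subset_iff)

lemma lin_closed: "u \<in> carrier F \<Longrightarrow> lin B j h u \<in> carrier B"
  unfolding lin_def using F_supp[of u] h by (intro B.finsum_closed) (auto simp: Pi_def subset_iff)

lemma lin_add:
  assumes u: "u \<in> carrier F" and v: "v \<in> carrier F"
  shows "lin B j h (u \<oplus>\<^bsub>F\<^esub> v) = lin B j h u \<oplus>\<^bsub>B\<^esub> lin B j h v"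
proof -
  let ?X = "supp u \<union> supp v"
  note s = F_supp[OF u] F_supp[OF v]
  have uv: "u \<oplus>\<^bsub>F\<^esub> v \<in> carrier F" "supp (u \<oplus>\<^bsub>F\<^esub> v) \<subseteq> ?X"
  proof -
    show 1: "supp (u \<oplus>\<^bsub>F\<^esub> v) \<subseteq> ?X" by (auto simp: F_ops)
    have "finite (supp (u \<oplus>\<^bsub>F\<^esub> v))" by (rule finite_subset[OF 1]) (use s in auto)
    then show "u \<oplus>\<^bsub>F\<^esub> v \<in> carrier F" using u v by (auto simp: F_carrier F_ops)
  qed
  have hx: "x \<in> ?X \<Longrightarrow> h x \<in> carrier B" for x using s h by (auto simp: Pi_def subset_iff)
  have "lin B j h (u \<oplus>\<^bsub>F\<^esub> v) = (\<Oplus>\<^bsub>B\<^esub>x\<in>?X. j ((u \<oplus>\<^bsub>F\<^esub> v) x) \<otimes>\<^bsub>B\<^esub> h x)"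
    using s uv by (intro lin_eq) auto
  also have "\<dots> = (\<Oplus>\<^bsub>B\<^esub>x\<in>?X. j (u x) \<otimes>\<^bsub>B\<^esub> h x \<oplus>\<^bsub>B\<^esub> j (v x) \<otimes>\<^bsub>B\<^esub> h x)"
    using u v hx by (intro B.finsum_cong') (auto simp: F_ops B.l_distr)
  also have "\<dots> = (\<Oplus>\<^bsub>B\<^esub>x\<in>?X. j (u x) \<otimes>\<^bsub>B\<^esub> h x) \<oplus>\<^bsub>B\<^esub> (\<Oplus>\<^bsub>B\<^esub>x\<in>?X. j (v x) \<otimes>\<^bsub>B\<^esub> h x)"
    using u v hx by (intro B.finsum_addf) auto
  also have "\<dots> = lin B j h u \<oplus>\<^bsub>B\<^esub> lin B j h v"
    using s u v by (intro arg_cong2[where f="(\<oplus>\<^bsub>B\<^esub>)"] lin_eq[symmetric]) auto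
  finally show ?thesis .
qed

lemma lin_conv:
  assumes u: "u \<in> carrier F" and v: "v \<in> carrier F"
  shows "lin B j h (u \<otimes>\<^bsub>F\<^esub> v) =
    (\<Oplus>\<^bsub>B\<^esub>x\<in>supp u. \<Oplus>\<^bsub>B\<^esub>y\<in>supp v. j (u x) \<otimes>\<^bsub>B\<^esub> j (v y) \<otimes>\<^bsub>B\<^esub> h (x \<otimes>\<^bsub>M\<^esub> y))"
proof -
  note s = F_supp[OF u] F_supp[OF v]
  define Z where "Z = (\<lambda>(x, y). x \<otimes>\<^bsub>M\<^esub> y) ` (supp u \<times> supp v)"
  have Z: "finite Z" "supp (u \<otimes>\<^bsub>F\<^esub> v) \<subseteq> Z" "Z \<subseteq> carrier M"
    using s conv_supp[OF u v] by (auto simp: Z_def)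
  have hx: "x \<in> carrier M \<Longrightarrow> h x \<in> carrier B" for x using h by auto
  let ?f = "\<lambda>z x y. if x \<otimes>\<^bsub>M\<^esub> y = z then j (u x) \<otimes>\<^bsub>B\<^esub> j (v y) \<otimes>\<^bsub>B\<^esub> h z else \<zero>\<^bsub>B\<^esub>"
  have fc: "?f z x y \<in> carrier B" if "z \<in> Z" for z x y using that u v Z hx by auto
  have "lin B j h (u \<otimes>\<^bsub>F\<^esub> v) = (\<Oplus>\<^bsub>B\<^esub>z\<in>Z. j ((u \<otimes>\<^bsub>F\<^esub> v) z) \<otimes>\<^bsub>B\<^esub> h z)"
    using Z conv_closed[OF u v] by (intro lin_eq) auto
  also have "\<dots> = (\<Oplus>\<^bsub>B\<^esub>z\<in>Z. \<Oplus>\<^bsub>B\<^esub>x\<in>supp u. \<Oplus>\<^bsub>B\<^esub>y\<in>supp v. ?f z x y)"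
  proof (intro B.finsum_cong' refl)
    fix z assume z: "z \<in> Z"
    then have hz: "h z \<in> carrier B" using Z hx by auto
    have "j ((u \<otimes>\<^bsub>F\<^esub> v) z) \<otimes>\<^bsub>B\<^esub> h z =
       j (\<Oplus>x\<in>supp u. \<Oplus>y\<in>supp v. if x \<otimes>\<^bsub>M\<^esub> y = z then u x \<otimes> v y else \<zero>) \<otimes>\<^bsub>B\<^esub> h z"
      using s by (subst conv_eq[OF u v, of "supp u" "supp v"]) auto
    also have "\<dots> = (\<Oplus>\<^bsub>B\<^esub>x\<in>supp u. \<Oplus>\<^bsub>B\<^esub>y\<in>supp v. if x \<otimes>\<^bsub>M\<^esub> y = z then j (u x) \<otimes>\<^bsub>B\<^esub> j (v y) else \<zero>\<^bsub>B\<^esub>) \<otimes>\<^bsub>B\<^esub> h z"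
      using u v by (subst j.hom_finsum)
        (auto intro!: R.finsum_closed B.finsum_closed B.finsum_cong' arg_cong2[where f="(\<otimes>\<^bsub>B\<^esub>)"] simp: comp_def)
    also have "\<dots> = (\<Oplus>\<^bsub>B\<^esub>x\<in>supp u. \<Oplus>\<^bsub>B\<^esub>y\<in>supp v. ?f z x y)"
      using u v s hz by (subst B.finsum_ldistr)
        (auto simp: B.finsum_ldistr intro!: B.finsum_closed B.finsum_cong')
    finally show "j ((u \<otimes>\<^bsub>F\<^esub> v) z) \<otimes>\<^bsub>B\<^esub> h z = \<dots>" .
  qed (use fc in \<open>auto intro!: B.finsum_closed\<close>)
  also have "\<dots> = (\<Oplus>\<^bsub>B\<^esub>x\<in>supp u. \<Oplus>\<^bsub>B\<^esub>z\<in>Z. \<Oplus>\<^bsub>B\<^esub>y\<in>supp v. ?f z x y)"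
    using fc s Z by (intro B.finsum_swap) (auto intro!: B.finsum_closed)
  also have "\<dots> = (\<Oplus>\<^bsub>B\<^esub>x\<in>supp u. \<Oplus>\<^bsub>B\<^esub>y\<in>supp v. \<Oplus>\<^bsub>B\<^esub>z\<in>Z. ?f z x y)"
    using fc s Z by (intro B.finsum_cong' refl B.finsum_swap) (auto intro!: B.finsum_closed)
  also have "\<dots> = (\<Oplus>\<^bsub>B\<^esub>x\<in>supp u. \<Oplus>\<^bsub>B\<^esub>y\<in>supp v. j (u x) \<otimes>\<^bsub>B\<^esub> j (v y) \<otimes>\<^bsub>B\<^esub> h (x \<otimes>\<^bsub>M\<^esub> y))"
  proof -
    have "(\<Oplus>\<^bsub>B\<^esub>z\<in>Z. ?f z x y) = j (u x) \<otimes>\<^bsub>B\<^esub> j (v y) \<otimes>\<^bsub>B\<^esub> h (x \<otimes>\<^bsub>M\<^esub> y)"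
      if "x \<in> supp u" "y \<in> supp v" for x y
    proof -
      have "x \<otimes>\<^bsub>M\<^esub> y \<in> Z" using that by (auto simp: Z_def)
      then show ?thesis using Z hx u v
        by (intro B.finsum_delta[where c = "\<lambda>z. j (u x) \<otimes>\<^bsub>B\<^esub> j (v y) \<otimes>\<^bsub>B\<^esub> h z"]) auto
    qed
    then show ?thesis using s hx u v
      by (intro B.finsum_cong' refl) (auto intro!: B.finsum_closed simp: subset_iff)
  qed
  finally show ?thesis .
qed

end

lemma conv_comm:
  assumes u: "u \<in> carrier F" and v: "v \<in> carrier F"
  shows "u \<otimes>\<^bsub>F\<^esub> v = v \<otimes>\<^bsub>F\<^esub> u"
proof
  fix z
  note s = F_supp[OF u] F_supp[OF v]
  have "(u \<otimes>\<^bsub>F\<^esub> v) z = (\<Oplus>x\<in>supp u. \<Oplus>y\<in>supp v. if x \<otimes>\<^bsub>M\<^esub> y = z then u x \<otimes> v y else \<zero>)"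
    using s by (intro conv_eq u v) auto
  also have "\<dots> = (\<Oplus>y\<in>supp v. \<Oplus>x\<in>supp u. if x \<otimes>\<^bsub>M\<^esub> y = z then u x \<otimes> v y else \<zero>)"
    using s u v by (intro R.finsum_swap) auto
  also have "\<dots> = (\<Oplus>y\<in>supp v. \<Oplus>x\<in>supp u. if y \<otimes>\<^bsub>M\<^esub> x = z then v y \<otimes> u x else \<zero>)"
    using s u v by (intro R.finsum_cong' refl) (auto intro!: R.finsum_closed simp: R.m_comm M.m_comm subset_iff)
  also have "\<dots> = (v \<otimes>\<^bsub>F\<^esub> u) z"
    using s by (intro conv_eq[symmetric] u v) auto
  finally show "(u \<otimes>\<^bsub>F\<^esub> v) z = (v \<otimes>\<^bsub>F\<^esub> u) z" .
qed

text \<open>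
  Written out, the triple convolution is symmetric under cyclic permutation of the factors. With commutativity this
  gives associativity.
\<close>

lemma conv3:
  assumes u: "u \<in> carrier F" and v: "v \<in> carrier F" and w: "w \<in> carrier F"
  shows "((u \<otimes>\<^bsub>F\<^esub> v) \<otimes>\<^bsub>F\<^esub> w) z =
    (\<Oplus>x\<in>supp u. \<Oplus>y\<in>supp v. \<Oplus>t\<in>supp w.
       if x \<otimes>\<^bsub>M\<^esub> y \<otimes>\<^bsub>M\<^esub> t = z then u x \<otimes> v y \<otimes> w t else \<zero>)"
proof -
  note s = F_supp[OF u] F_supp[OF v] F_supp[OF w]
  note uv = conv_closed[OF u v]
  let ?h = "\<lambda>a. \<Oplus>t\<in>supp w. if a \<otimes>\<^bsub>M\<^esub> t = z then w t else \<zero>"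
  have h: "?h \<in> carrier M \<rightarrow> carrier R" using w by (auto intro!: R.finsum_closed)
  have d: "(\<Oplus>t\<in>supp w. if a \<otimes>\<^bsub>M\<^esub> t = z then c \<otimes> w t else \<zero>) = c \<otimes> ?h a"
    if "c \<in> carrier R" for a c
  proof -
    have "c \<otimes> ?h a = (\<Oplus>t\<in>supp w. c \<otimes> (if a \<otimes>\<^bsub>M\<^esub> t = z then w t else \<zero>))"
      using that s w by (intro R.finsum_rdistr) auto
    also have "\<dots> = (\<Oplus>t\<in>supp w. if a \<otimes>\<^bsub>M\<^esub> t = z then c \<otimes> w t else \<zero>)"
      using that w by (intro R.finsum_cong') auto
    finally show ?thesis ..
  qed
  have "((u \<otimes>\<^bsub>F\<^esub> v) \<otimes>\<^bsub>F\<^esub> w) z = (\<Oplus>a\<in>supp (u \<otimes>\<^bsub>F\<^esub> v). \<Oplus>t\<in>supp w.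
      if a \<otimes>\<^bsub>M\<^esub> t = z then (u \<otimes>\<^bsub>F\<^esub> v) a \<otimes> w t else \<zero>)"
    using F_supp[OF uv] s by (intro conv_eq uv w) auto
  also have "\<dots> = lin R id ?h (u \<otimes>\<^bsub>F\<^esub> v)"
    unfolding lin_def using F_val[OF uv] h F_supp[OF uv]
    by (intro R.finsum_cong' refl) (auto simp: d simp: Pi_def subset_iff intro!: R.m_closed)
  also have "\<dots> = (\<Oplus>x\<in>supp u. \<Oplus>y\<in>supp v. id (u x) \<otimes> id (v y) \<otimes> ?h (x \<otimes>\<^bsub>M\<^esub> y))"
    by (intro lin_conv R.is_cring u v h) auto
  also have "\<dots> = (\<Oplus>x\<in>supp u. \<Oplus>y\<in>supp v. \<Oplus>t\<in>supp w.
       if x \<otimes>\<^bsub>M\<^esub> y \<otimes>\<^bsub>M\<^esub> t = z then u x \<otimes> v y \<otimes> w t else \<zero>)"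
    using u v w by (intro R.finsum_cong' refl) (auto simp: d intro!: R.finsum_closed)
  finally show ?thesis .
qed

lemma conv_assoc:
  assumes u: "u \<in> carrier F" and v: "v \<in> carrier F" and w: "w \<in> carrier F"
  shows "(u \<otimes>\<^bsub>F\<^esub> v) \<otimes>\<^bsub>F\<^esub> w = u \<otimes>\<^bsub>F\<^esub> (v \<otimes>\<^bsub>F\<^esub> w)"
proof -
  note s = F_supp[OF u] F_supp[OF v] F_supp[OF w]
  have "(u \<otimes>\<^bsub>F\<^esub> v) \<otimes>\<^bsub>F\<^esub> w = (v \<otimes>\<^bsub>F\<^esub> w) \<otimes>\<^bsub>F\<^esub> u"
  proof
    fix z
    let ?f = "\<lambda>x y t. if x \<otimes>\<^bsub>M\<^esub> y \<otimes>\<^bsub>M\<^esub> t = z then u x \<otimes> v y \<otimes> w t else \<zero>"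
    have "((u \<otimes>\<^bsub>F\<^esub> v) \<otimes>\<^bsub>F\<^esub> w) z = (\<Oplus>x\<in>supp u. \<Oplus>y\<in>supp v. \<Oplus>t\<in>supp w. ?f x y t)"
      by (rule conv3[OF u v w])
    also have "\<dots> = (\<Oplus>y\<in>supp v. \<Oplus>x\<in>supp u. \<Oplus>t\<in>supp w. ?f x y t)"
      using s u v w by (intro R.finsum_swap) (auto intro!: R.finsum_closed)
    also have "\<dots> = (\<Oplus>y\<in>supp v. \<Oplus>t\<in>supp w. \<Oplus>x\<in>supp u. ?f x y t)"
      using s u v w by (intro R.finsum_cong' refl R.finsum_swap) (auto intro!: R.finsum_closed)
    also have "\<dots> = (\<Oplus>y\<in>supp v. \<Oplus>t\<in>supp w. \<Oplus>x\<in>supp u.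
       if y \<otimes>\<^bsub>M\<^esub> t \<otimes>\<^bsub>M\<^esub> x = z then v y \<otimes> w t \<otimes> u x else \<zero>)"
      using s u v w by (intro R.finsum_cong' refl)
        (auto intro!: R.finsum_closed simp: R.m_ac M.m_ac subset_iff)
    also have "\<dots> = ((v \<otimes>\<^bsub>F\<^esub> w) \<otimes>\<^bsub>F\<^esub> u) z"
      by (rule conv3[OF v w u, symmetric])
    finally show "((u \<otimes>\<^bsub>F\<^esub> v) \<otimes>\<^bsub>F\<^esub> w) z = ((v \<otimes>\<^bsub>F\<^esub> w) \<otimes>\<^bsub>F\<^esub> u) z" .
  qed
  then show ?thesis using conv_comm[OF u conv_closed[OF v w]] by simp
qed

lemma delta_supp: "supp (\<lambda>z. if z = x then r else \<zero>) \<subseteq> {x}"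
  by auto

lemma single_closed: "x \<in> carrier M \<Longrightarrow> r \<in> carrier R \<Longrightarrow> (\<lambda>z. if z = x then r else \<zero>) \<in> carrier F"
  using finite_subset[OF delta_supp[of x r]] by (auto simp: F_carrier)

lemma delta_closed: "x \<in> carrier M \<Longrightarrow> delta R x \<in> carrier F"
  unfolding delta_def by (intro single_closed) auto

lemma conv_single:
  assumes "x \<in> carrier M" "r \<in> carrier R" "u \<in> carrier F"
  shows "((\<lambda>z. if z = x then r else \<zero>) \<otimes>\<^bsub>F\<^esub> u) z = (\<Oplus>y\<in>supp u. if x \<otimes>\<^bsub>M\<^esub> y = z then r \<otimes> u y else \<zero>)"
proof -
  have "((\<lambda>z. if z = x then r else \<zero>) \<otimes>\<^bsub>F\<^esub> u) z =
     (\<Oplus>a\<in>{x}. \<Oplus>y\<in>supp u. if a \<otimes>\<^bsub>M\<^esub> y = z then (if a = x then r else \<zero>) \<otimes> u y else \<zero>)"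
    using assms F_supp[OF assms(3)] by (intro conv_eq single_closed) auto
  then show ?thesis using assms by (simp add: R.finsum_insert)
qed

lemma conv_one:
  assumes r: "r \<in> carrier R" and u: "u \<in> carrier F"
  shows "(\<lambda>z. if z = \<one>\<^bsub>M\<^esub> then r else \<zero>) \<otimes>\<^bsub>F\<^esub> u = r \<odot>\<^bsub>F\<^esub> u"
proof
  fix z
  note s = F_supp[OF u]
  have "((\<lambda>z. if z = \<one>\<^bsub>M\<^esub> then r else \<zero>) \<otimes>\<^bsub>F\<^esub> u) z = (\<Oplus>y\<in>supp u. if z = y then r \<otimes> u y else \<zero>)"
    using s r u by (subst conv_single) (auto intro!: R.finsum_cong' simp: subset_iff)
  also have "\<dots> = (r \<odot>\<^bsub>F\<^esub> u) z"
  proof (cases "z \<in> supp u")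
    case True
    then show ?thesis using s u r by (subst R.finsum_delta) (auto simp: F_ops)
  next
    case False
    then show ?thesis using r by (subst R.add.finprod_one_eqI) (auto simp: F_ops)
  qed
  finally show "((\<lambda>z. if z = \<one>\<^bsub>M\<^esub> then r else \<zero>) \<otimes>\<^bsub>F\<^esub> u) z = (r \<odot>\<^bsub>F\<^esub> u) z" .
qed

lemma add_closed: "u \<in> carrier F \<Longrightarrow> v \<in> carrier F \<Longrightarrow> u \<oplus>\<^bsub>F\<^esub> v \<in> carrier F"
proof -
  assume u: "u \<in> carrier F" and v: "v \<in> carrier F"
  have "supp (u \<oplus>\<^bsub>F\<^esub> v) \<subseteq> supp u \<union> supp v" by (auto simp: F_ops)
  then have "finite (supp (u \<oplus>\<^bsub>F\<^esub> v))" using F_supp[OF u] F_supp[OF v] finite_subset by blast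
  then show ?thesis using u v by (auto simp: F_carrier F_ops)
qed

lemma smult_closed: "r \<in> carrier R \<Longrightarrow> u \<in> carrier F \<Longrightarrow> r \<odot>\<^bsub>F\<^esub> u \<in> carrier F"
proof -
  assume r: "r \<in> carrier R" and u: "u \<in> carrier F"
  have "supp (r \<odot>\<^bsub>F\<^esub> u) \<subseteq> supp u" using r by (auto simp: F_ops)
  then have "finite (supp (r \<odot>\<^bsub>F\<^esub> u))" using F_supp[OF u] finite_subset by blast
  then show ?thesis using r u by (auto simp: F_carrier F_ops)
qed

lemma F_cring: "cring F"
proof (rule cringI)
  show "abelian_group F"
  proof (rule abelian_groupI)
    fix u assume u: "u \<in> carrier F"
    have "(\<lambda>z. \<ominus> u z) \<in> carrier F"
    proof -
      have "supp (\<lambda>z. \<ominus> u z) \<subseteq> supp u" by auto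
      then have "finite (supp (\<lambda>z. \<ominus> u z))" using F_supp[OF u] finite_subset by blast
      then show ?thesis using u by (auto simp: F_carrier)
    qed
    moreover have "(\<lambda>z. \<ominus> u z) \<oplus>\<^bsub>F\<^esub> u = \<zero>\<^bsub>F\<^esub>" using u by (auto simp: F_ops R.l_neg)
    ultimately show "\<exists>v\<in>carrier F. v \<oplus>\<^bsub>F\<^esub> u = \<zero>\<^bsub>F\<^esub>" by blast
  next
    show "\<zero>\<^bsub>F\<^esub> \<in> carrier F" by (simp add: F_carrier F_ops)
  next
    show "u \<oplus>\<^bsub>F\<^esub> v \<in> carrier F" if "u \<in> carrier F" "v \<in> carrier F" for u v
      using that by (rule add_closed)
  qed (auto simp: F_ops R.a_ac)
  show "comm_monoid F"
  proof (rule comm_monoidI)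
    fix u assume u: "u \<in> carrier F"
    have "\<one>\<^bsub>F\<^esub> \<otimes>\<^bsub>F\<^esub> u = \<one> \<odot>\<^bsub>F\<^esub> u"
      using conv_one[OF R.one_closed u] by (simp add: F_ops delta_def)
    then show "\<one>\<^bsub>F\<^esub> \<otimes>\<^bsub>F\<^esub> u = u" using u by (simp add: F_ops)
  qed (auto intro: conv_closed conv_comm conv_assoc delta_closed simp: F_ops)
  fix u v w assume u: "u \<in> carrier F" and v: "v \<in> carrier F" and w: "w \<in> carrier F"
  show "(u \<oplus>\<^bsub>F\<^esub> v) \<otimes>\<^bsub>F\<^esub> w = u \<otimes>\<^bsub>F\<^esub> w \<oplus>\<^bsub>F\<^esub> v \<otimes>\<^bsub>F\<^esub> w"
  proof
    fix z
    note s = F_supp[OF u] F_supp[OF v] F_supp[OF w]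
    let ?X = "supp u \<union> supp v" and ?Y = "supp w"
    let ?f = "\<lambda>u x y. if x \<otimes>\<^bsub>M\<^esub> y = z then u x \<otimes> w y else \<zero>"
    have "((u \<oplus>\<^bsub>F\<^esub> v) \<otimes>\<^bsub>F\<^esub> w) z = (\<Oplus>x\<in>?X. \<Oplus>y\<in>?Y. ?f (u \<oplus>\<^bsub>F\<^esub> v) x y)"
      using s u v w by (intro conv_eq add_closed) (auto simp: F_ops)
    also have "\<dots> = (\<Oplus>x\<in>?X. \<Oplus>y\<in>?Y. ?f u x y \<oplus> ?f v x y)"
      using u v w by (intro R.finsum_cong' refl) (auto intro!: R.finsum_closed simp: F_ops R.l_distr)
    also have "\<dots> = (\<Oplus>x\<in>?X. (\<Oplus>y\<in>?Y. ?f u x y) \<oplus> (\<Oplus>y\<in>?Y. ?f v x y))"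
      using u v w by (intro R.finsum_cong' refl R.finsum_addf) (auto intro!: R.finsum_closed)
    also have "\<dots> = (\<Oplus>x\<in>?X. \<Oplus>y\<in>?Y. ?f u x y) \<oplus> (\<Oplus>x\<in>?X. \<Oplus>y\<in>?Y. ?f v x y)"
      using u v w by (intro R.finsum_addf) (auto intro!: R.finsum_closed)
    also have "\<dots> = (u \<otimes>\<^bsub>F\<^esub> w \<oplus>\<^bsub>F\<^esub> v \<otimes>\<^bsub>F\<^esub> w) z"
      using s u v w by (simp add: F_ops conv_eq[of _ _ ?X ?Y])
    finally show "((u \<oplus>\<^bsub>F\<^esub> v) \<otimes>\<^bsub>F\<^esub> w) z = (u \<otimes>\<^bsub>F\<^esub> w \<oplus>\<^bsub>F\<^esub> v \<otimes>\<^bsub>F\<^esub> w) z" .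
  qed
qed

lemma F_scal: assumes "r \<in> carrier R" shows "scal F r = (\<lambda>z. if z = \<one>\<^bsub>M\<^esub> then r else \<zero>)"
  using assms by (auto simp: scal_def F_ops delta_def)

lemma F_alg: "comm_alg R F"
  unfolding comm_alg_def
proof (intro conjI ballI R.is_cring F_cring)
  show "scal F \<in> ring_hom R F"
  proof (rule ring_hom_memI)
    fix r s assume r: "r \<in> carrier R" and s: "s \<in> carrier R"
    show "scal F r \<in> carrier F" using r by (auto simp: F_scal intro!: single_closed)
    show "scal F (r \<otimes> s) = scal F r \<otimes>\<^bsub>F\<^esub> scal F s"
      using r s by (auto simp: F_scal conv_one single_closed F_ops)
    show "scal F (r \<oplus> s) = scal F r \<oplus>\<^bsub>F\<^esub> scal F s"
      using r s by (auto simp: F_scal F_ops)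
  qed (auto simp: F_scal F_ops delta_def)
  fix r u assume r: "r \<in> carrier R" and u: "u \<in> carrier F"
  show "r \<odot>\<^bsub>F\<^esub> u = scal F r \<otimes>\<^bsub>F\<^esub> u" using r u by (simp add: F_scal conv_one)
qed

lemma delta_mult:
  assumes "x \<in> carrier M" "y \<in> carrier M"
  shows "delta R x \<otimes>\<^bsub>F\<^esub> delta R y = delta R (x \<otimes>\<^bsub>M\<^esub> y)"
proof
  fix z
  have "(delta R x \<otimes>\<^bsub>F\<^esub> delta R y) z =
     (\<Oplus>a\<in>{x}. \<Oplus>b\<in>{y}. if a \<otimes>\<^bsub>M\<^esub> b = z then delta R x a \<otimes> delta R y b else \<zero>)"
    using assms by (intro conv_eq delta_closed) (auto simp: delta_def)
  then show "(delta R x \<otimes>\<^bsub>F\<^esub> delta R y) z = delta R (x \<otimes>\<^bsub>M\<^esub> y) z"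
    using assms by (simp add: delta_def R.finsum_insert)
qed

lemma F_induct:
  assumes u: "u \<in> carrier F"
    and add: "\<And>u v. u \<in> carrier F \<Longrightarrow> v \<in> carrier F \<Longrightarrow> Q u \<Longrightarrow> Q v \<Longrightarrow> Q (u \<oplus>\<^bsub>F\<^esub> v)"
    and zero: "Q \<zero>\<^bsub>F\<^esub>"
    and single: "\<And>r x. r \<in> carrier R \<Longrightarrow> x \<in> carrier M \<Longrightarrow> Q (r \<odot>\<^bsub>F\<^esub> delta R x)"
  shows "Q u"
  using u
proof (induction "card (supp u)" arbitrary: u rule: less_induct)
  case (less u)
  note s = F_supp[OF less.prems]
  show ?case
  proof (cases "supp u = {}")
    case True
    then have "u = \<zero>\<^bsub>F\<^esub>" by (auto simp: F_ops)
    then show ?thesis using zero by simp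
  next
    case False
    then obtain x where x: "x \<in> supp u" by blast
    let ?v = "u(x := \<zero>)"
    have sv: "supp ?v = supp u - {x}" by auto
    have v: "?v \<in> carrier F" using less.prems sv s by (auto simp: F_carrier)
    have "card (supp ?v) < card (supp u)" unfolding sv by (rule card_Diff1_less) (use s x in auto)
    then have "Q ?v" using less.hyps v by blast
    moreover have "Q (u x \<odot>\<^bsub>F\<^esub> delta R x)" using s x less.prems by (intro single) auto
    ultimately have "Q (?v \<oplus>\<^bsub>F\<^esub> u x \<odot>\<^bsub>F\<^esub> delta R x)"
      using s x less.prems v by (intro add smult_closed delta_closed) auto
    also have "?v \<oplus>\<^bsub>F\<^esub> u x \<odot>\<^bsub>F\<^esub> delta R x = u" using less.prems by (auto simp: F_ops delta_def)
    finally show ?thesis .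
  qed
qed

text \<open>
  The convolution product is made so that the linear extension of a multiplicative map is multiplicative. All
  homomorphisms out of tensor products and closure algebras are built from these extensions.
\<close>

lemma F_universal:
  assumes B: "cring B" and j: "j \<in> ring_hom R B" and h: "h \<in> carrier M \<rightarrow> carrier B"
    and h1: "h \<one>\<^bsub>M\<^esub> = \<one>\<^bsub>B\<^esub>"
    and hm: "\<And>x y. x \<in> carrier M \<Longrightarrow> y \<in> carrier M \<Longrightarrow> h (x \<otimes>\<^bsub>M\<^esub> y) = h x \<otimes>\<^bsub>B\<^esub> h y"
  shows "\<exists>H\<in>ring_hom F B. (\<forall>r\<in>carrier R. H (scal F r) = j r) \<and> (\<forall>x\<in>carrier M. H (delta R x) = h x)"
proof (intro bexI conjI ballI)
  interpret B: cring B by (rule B)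
  interpret j: ring_hom_cring R B j by (rule ring_hom_cringI[OF R.is_cring B j])
  let ?H = "lin B j h"
  have hx: "x \<in> carrier M \<Longrightarrow> h x \<in> carrier B" for x using h by auto
  have single: "?H (\<lambda>z. if z = x then r else \<zero>) = j r \<otimes>\<^bsub>B\<^esub> h x" if "x \<in> carrier M" "r \<in> carrier R" for x r
    using that hx[of x]
    by (subst lin_eq[OF B j h single_closed, of x r "{x}"]) (auto simp: B.finsum_insert)
  show sc: "?H (scal F r) = j r" if "r \<in> carrier R" for r
    using that by (simp add: F_scal single h1)
  show dl: "?H (delta R x) = h x" if "x \<in> carrier M" for x
    using single[OF that R.one_closed] that hx[OF that] by (simp add: delta_def)
  show "?H \<in> ring_hom F B"
  proof (rule ring_hom_memI)
    show "?H \<one>\<^bsub>F\<^esub> = \<one>\<^bsub>B\<^esub>" using dl[of "\<one>\<^bsub>M\<^esub>"] h1 by (simp add: F_ops)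
    fix u v assume u: "u \<in> carrier F" and v: "v \<in> carrier F"
    note s = F_supp[OF u] F_supp[OF v]
    show "?H u \<in> carrier B" by (rule lin_closed[OF B j h u])
    show "?H (u \<oplus>\<^bsub>F\<^esub> v) = ?H u \<oplus>\<^bsub>B\<^esub> ?H v" by (rule lin_add[OF B j h u v])
    have hu: "j (u x) \<otimes>\<^bsub>B\<^esub> h x \<in> carrier B" if "x \<in> supp u" for x using s that u hx by auto
    have hv: "j (v x) \<otimes>\<^bsub>B\<^esub> h x \<in> carrier B" if "x \<in> supp v" for x using s that v hx by auto
    have "?H (u \<otimes>\<^bsub>F\<^esub> v) = (\<Oplus>\<^bsub>B\<^esub>x\<in>supp u. \<Oplus>\<^bsub>B\<^esub>y\<in>supp v. (j (u x) \<otimes>\<^bsub>B\<^esub> h x) \<otimes>\<^bsub>B\<^esub> (j (v y) \<otimes>\<^bsub>B\<^esub> h y))"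
      unfolding lin_conv[OF B j h u v] using s u v hx hu hv
      by (intro B.finsum_cong' refl) (auto intro!: B.finsum_closed simp: hm subset_iff B.m_ac)
    also have "\<dots> = (\<Oplus>\<^bsub>B\<^esub>x\<in>supp u. (j (u x) \<otimes>\<^bsub>B\<^esub> h x) \<otimes>\<^bsub>B\<^esub> ?H v)"
      unfolding lin_def using s hu hv
      by (intro B.finsum_cong' refl B.finsum_rdistr[symmetric]) (auto intro!: B.finsum_closed)
    also have "\<dots> = ?H u \<otimes>\<^bsub>B\<^esub> ?H v"
      unfolding lin_def[of _ _ _ u] using s hu lin_closed[OF B j h v]
      by (intro B.finsum_ldistr[symmetric]) auto
    finally show "?H (u \<otimes>\<^bsub>F\<^esub> v) = ?H u \<otimes>\<^bsub>B\<^esub> ?H v" .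
  qed
qed

end

section \<open>Quotients and tensor products\<close>

lemma comm_algD:
  assumes "comm_alg R A"
  shows "cring R" "cring A" "scal A \<in> ring_hom R A"
    "\<And>r. r \<in> carrier R \<Longrightarrow> scal A r \<in> carrier A"
    "\<And>r a. r \<in> carrier R \<Longrightarrow> a \<in> carrier A \<Longrightarrow> r \<odot>\<^bsub>A\<^esub> a = scal A r \<otimes>\<^bsub>A\<^esub> a"
    "scal A \<one>\<^bsub>R\<^esub> = \<one>\<^bsub>A\<^esub>"
    "scal A \<zero>\<^bsub>R\<^esub> = \<zero>\<^bsub>A\<^esub>"
proof -
  show 1: "cring R" "cring A" "scal A \<in> ring_hom R A"
    and "\<And>r a. r \<in> carrier R \<Longrightarrow> a \<in> carrier A \<Longrightarrow> r \<odot>\<^bsub>A\<^esub> a = scal A r \<otimes>\<^bsub>A\<^esub> a"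
    using assms by (auto simp: comm_alg_def)
  interpret h: ring_hom_cring R A "scal A" by (rule ring_hom_cringI[OF 1])
  show "\<And>r. r \<in> carrier R \<Longrightarrow> scal A r \<in> carrier A" "scal A \<one>\<^bsub>R\<^esub> = \<one>\<^bsub>A\<^esub>" "scal A \<zero>\<^bsub>R\<^esub> = \<zero>\<^bsub>A\<^esub>" by auto
qed

lemma with_smult_simps [simp]:
  "carrier (with_smult A s) = carrier A" "monoid.mult (with_smult A s) = monoid.mult A"
  "one (with_smult A s) = one A" "ring.zero (with_smult A s) = ring.zero A"
  "ring.add (with_smult A s) = ring.add A" "smult (with_smult A s) = s"
  by (simp_all add: with_smult_def)

lemma with_smult_ring_hom [simp]:
  "ring_hom A (with_smult B s) = ring_hom A B" "ring_hom (with_smult B s) A = ring_hom B A"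
  by (simp_all add: ring_hom_def)

lemma with_smult_cring [simp]: assumes "cring A" shows "cring (with_smult A s)"
proof -
  interpret A: cring A by fact
  show ?thesis
    by (intro cringI abelian_groupI comm_monoidI)
       (auto simp: A.a_ac A.m_ac A.l_distr A.r_distr intro: A.l_neg)
qed

lemma quot_alg_props:
  assumes F: "comm_alg R F" and I: "ideal I F"
  shows "comm_alg R (quot_alg F I)"
    and "(+>\<^bsub>F\<^esub>) I \<in> ring_hom F (quot_alg F I)"
    and "carrier (quot_alg F I) = (+>\<^bsub>F\<^esub>) I ` carrier F"
    and "r \<in> carrier R \<Longrightarrow> scal (quot_alg F I) r = I +>\<^bsub>F\<^esub> scal F r"
    and "u \<in> carrier F \<Longrightarrow> v \<in> carrier F \<Longrightarrow> I +>\<^bsub>F\<^esub> u = I +>\<^bsub>F\<^esub> v \<longleftrightarrow> u \<ominus>\<^bsub>F\<^esub> v \<in> I"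
proof -
  interpret F: cring F using comm_algD[OF F] by simp
  interpret I: ideal I F by fact
  let ?Q = "quot_alg F I"
  have cr: "cring (F Quot I)" by (rule I.quotient_is_cring[OF F.is_cring])
  interpret Q: cring "F Quot I" by (rule cr)
  have c: "cring ?Q" using cr by (simp add: quot_alg_def)
  show hom: "(+>\<^bsub>F\<^esub>) I \<in> ring_hom F ?Q" using I.rcos_ring_hom by (simp add: quot_alg_def)
  show "carrier ?Q = (+>\<^bsub>F\<^esub>) I ` carrier F" by (auto simp: quot_alg_def FactRing_def A_RCOSETS_def')
  have sc: "scal ?Q r = I +>\<^bsub>F\<^esub> scal F r" if "r \<in> carrier R" for r
  proof -
    have "I +>\<^bsub>F\<^esub> scal F r \<in> carrier (F Quot I)"
      using ring_hom_closed[OF I.rcos_ring_hom] comm_algD(4)[OF F that] by auto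
    then show ?thesis by (simp add: scal_def quot_alg_def)
  qed
  then show "r \<in> carrier R \<Longrightarrow> scal ?Q r = I +>\<^bsub>F\<^esub> scal F r" by blast
  have "(\<lambda>r. I +>\<^bsub>F\<^esub> scal F r) \<in> ring_hom R ?Q"
    using ring_hom_trans[OF comm_algD(3)[OF F] hom] by (simp add: comp_def)
  then have "scal ?Q \<in> ring_hom R ?Q" using sc comm_algD(1)[OF F]
    by (auto simp: ring_hom_def Pi_def cring.cring_simprules)
  moreover have "r \<odot>\<^bsub>?Q\<^esub> a = scal ?Q r \<otimes>\<^bsub>?Q\<^esub> a" if "r \<in> carrier R" for r a
    using sc[OF that] by (simp add: quot_alg_def scal_def[of F])
  ultimately show "comm_alg R ?Q" unfolding comm_alg_def using c comm_algD[OF F] by blast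
  show "u \<in> carrier F \<Longrightarrow> v \<in> carrier F \<Longrightarrow> I +>\<^bsub>F\<^esub> u = I +>\<^bsub>F\<^esub> v \<longleftrightarrow> u \<ominus>\<^bsub>F\<^esub> v \<in> I"
    using F.quotient_eq_iff_same_a_r_cos[OF I] by blast
qed

lemma quot_alg_hom:
  assumes F: "comm_alg R F" and I: "ideal I F" and B: "cring B" and H: "H \<in> ring_hom F B"
    and k: "\<And>u. u \<in> I \<Longrightarrow> H u = \<zero>\<^bsub>B\<^esub>"
  shows "\<exists>h\<in>ring_hom (quot_alg F I) B. \<forall>u\<in>carrier F. h (I +>\<^bsub>F\<^esub> u) = H u"
proof -
  interpret F: cring F using comm_algD[OF F] by simp
  interpret B: cring B by fact
  interpret H: ring_hom_cring F B H by (rule ring_hom_cringI[OF F.is_cring B H])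
  note q = quot_alg_props[OF F I]
  let ?q = "(+>\<^bsub>F\<^esub>) I"
  let ?Q = "quot_alg F I"
  define h where "h c = H (SOME u. u \<in> carrier F \<and> c = ?q u)" for c
  have h: "h (?q u) = H u" if u: "u \<in> carrier F" for u
  proof -
    let ?v = "SOME v. v \<in> carrier F \<and> ?q u = ?q v"
    have v: "?v \<in> carrier F \<and> ?q u = ?q ?v"
      by (rule someI[of _ u]) (use u in auto)
    then have "u \<ominus>\<^bsub>F\<^esub> ?v \<in> I" using q(5)[OF u, of ?v] by blast
    then have "H (u \<ominus>\<^bsub>F\<^esub> ?v) = \<zero>\<^bsub>B\<^esub>" by (rule k)
    then have "H u \<oplus>\<^bsub>B\<^esub> \<ominus>\<^bsub>B\<^esub> H ?v = \<zero>\<^bsub>B\<^esub>" using u v by (simp add: F.minus_eq)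
    then show ?thesis unfolding h_def using u v B.sum_zero_eq_neg[of "H u" "\<ominus>\<^bsub>B\<^esub> H ?v"] by simp
  qed
  have "h \<in> ring_hom ?Q B"
  proof (rule ring_hom_memI)
    show "h \<one>\<^bsub>?Q\<^esub> = \<one>\<^bsub>B\<^esub>" using h[of "\<one>\<^bsub>F\<^esub>"] ring_hom_one[OF q(2)] by simp
    fix a assume "a \<in> carrier ?Q"
    then obtain u where u: "u \<in> carrier F" "a = ?q u" using q(3) by blast
    then show "h a \<in> carrier B" using h by simp
    fix b assume "b \<in> carrier ?Q"
    then obtain v where v: "v \<in> carrier F" "b = ?q v" using q(3) by blast
    show "h (a \<otimes>\<^bsub>?Q\<^esub> b) = h a \<otimes>\<^bsub>B\<^esub> h b"
      using u v ring_hom_mult[OF q(2) u(1) v(1), symmetric] h by simp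
    show "h (a \<oplus>\<^bsub>?Q\<^esub> b) = h a \<oplus>\<^bsub>B\<^esub> h b"
      using u v ring_hom_add[OF q(2) u(1) v(1), symmetric] h by simp
  qed
  with h show ?thesis by blast
qed

lemma quot_genideal_hom:
  assumes F: "comm_alg R F" and X: "X \<subseteq> carrier F" and B: "cring B" and H: "H \<in> ring_hom F B"
    and k: "\<And>u. u \<in> X \<Longrightarrow> H u = \<zero>\<^bsub>B\<^esub>"
  shows "\<exists>h\<in>ring_hom (quot_alg F (Idl\<^bsub>F\<^esub> X)) B. \<forall>u\<in>carrier F. h (Idl\<^bsub>F\<^esub> X +>\<^bsub>F\<^esub> u) = H u"
proof -
  interpret F: cring F using comm_algD[OF F] by simp
  interpret B: cring B by fact
  interpret H: ring_hom_ring F B H by (rule ring_hom_ringI2[OF F.ring_axioms B.ring_axioms H])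
  have "X \<subseteq> a_kernel F B H" unfolding a_kernel_def' using X k by blast
  then have "Idl\<^bsub>F\<^esub> X \<subseteq> a_kernel F B H" by (rule F.genideal_minimal[OF H.kernel_is_ideal])
  then have 1: "H u = \<zero>\<^bsub>B\<^esub>" if "u \<in> Idl\<^bsub>F\<^esub> X" for u
    using that unfolding a_kernel_def' by blast
  show ?thesis by (rule quot_alg_hom[OF F F.genideal_ideal[OF X] B H 1])
qed

subsection \<open>Tensor products of families\<close>

text \<open>
  The canonical map of the \<open>i\<close>-th factor into the tensor product; for equal factors its values are the
  \<open>a\<^sup>(\<^sup>i\<^sup>)\<close>.
\<close>

definition tensor_emb ::
    "('r, 'm) ring_scheme \<Rightarrow> 'i set \<Rightarrow> ('i \<Rightarrow> ('r, 'a, 'p) module_scheme) \<Rightarrow> 'i \<Rightarrow> 'a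
       \<Rightarrow> (('i \<Rightarrow> 'a) \<Rightarrow> 'r) set" where
  "tensor_emb R I A i a = pure_tensor R I A (\<lambda>j\<in>I. if j = i then a else \<one>\<^bsub>A j\<^esub>)"

locale tensor_family =
  fixes R :: "('r, 'm) ring_scheme" and I :: "'i set" and A :: "'i \<Rightarrow> ('r, 'a, 'p) module_scheme"
  assumes R: "cring R" and finite_I: "finite I" and A: "\<And>i. i \<in> I \<Longrightarrow> comm_alg R (A i)"
begin

abbreviation "M \<equiv> product_group I A"
abbreviation "T \<equiv> tensor_prod R I A"
abbreviation "q \<equiv> pure_tensor R I A"
abbreviation "rels \<equiv> multilinear_rels R I A"

lemma A_cring: "i \<in> I \<Longrightarrow> cring (A i)" using comm_algD[OF A] by blast

lemma A_ops:
  assumes "i \<in> I"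
  shows "\<one>\<^bsub>A i\<^esub> \<in> carrier (A i)"
    "x \<in> carrier (A i) \<Longrightarrow> \<one>\<^bsub>A i\<^esub> \<otimes>\<^bsub>A i\<^esub> x = x"
    "x \<in> carrier (A i) \<Longrightarrow> x \<otimes>\<^bsub>A i\<^esub> \<one>\<^bsub>A i\<^esub> = x"
    "x \<in> carrier (A i) \<Longrightarrow> y \<in> carrier (A i) \<Longrightarrow> x \<otimes>\<^bsub>A i\<^esub> y \<in> carrier (A i)"
    "x \<in> carrier (A i) \<Longrightarrow> y \<in> carrier (A i) \<Longrightarrow> x \<oplus>\<^bsub>A i\<^esub> y \<in> carrier (A i)"
    "r \<in> carrier R \<Longrightarrow> x \<in> carrier (A i) \<Longrightarrow> r \<odot>\<^bsub>A i\<^esub> x \<in> carrier (A i)"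
proof -
  interpret cring "A i" using assms by (rule A_cring)
  show "\<one>\<^bsub>A i\<^esub> \<in> carrier (A i)"
    "x \<in> carrier (A i) \<Longrightarrow> \<one>\<^bsub>A i\<^esub> \<otimes>\<^bsub>A i\<^esub> x = x"
    "x \<in> carrier (A i) \<Longrightarrow> x \<otimes>\<^bsub>A i\<^esub> \<one>\<^bsub>A i\<^esub> = x"
    "x \<in> carrier (A i) \<Longrightarrow> y \<in> carrier (A i) \<Longrightarrow> x \<otimes>\<^bsub>A i\<^esub> y \<in> carrier (A i)"
    "x \<in> carrier (A i) \<Longrightarrow> y \<in> carrier (A i) \<Longrightarrow> x \<oplus>\<^bsub>A i\<^esub> y \<in> carrier (A i)"
    "r \<in> carrier R \<Longrightarrow> x \<in> carrier (A i) \<Longrightarrow> r \<odot>\<^bsub>A i\<^esub> x \<in> carrier (A i)"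
    using comm_algD(4,5)[OF A[OF assms]] by simp_all
qed

lemma M: "comm_monoid M"
proof (rule comm_monoidI)
  show "\<one>\<^bsub>M\<^esub> \<in> carrier M" using A_ops by auto
  fix x y z assume x: "x \<in> carrier M" and y: "y \<in> carrier M" and z: "z \<in> carrier M"
  have c: "x i \<in> carrier (A i)" "y i \<in> carrier (A i)" "z i \<in> carrier (A i)" if "i \<in> I" for i
    using x y z that by auto
  show "x \<otimes>\<^bsub>M\<^esub> y \<in> carrier M" using c A_ops by auto
  show "\<one>\<^bsub>M\<^esub> \<otimes>\<^bsub>M\<^esub> x = x" using x c A_ops by (auto simp: fun_eq_iff PiE_def extensional_def)
  show "x \<otimes>\<^bsub>M\<^esub> y = y \<otimes>\<^bsub>M\<^esub> x" using c A_cring by (auto simp: fun_eq_iff intro: cring.cring_simprules)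
  show "x \<otimes>\<^bsub>M\<^esub> y \<otimes>\<^bsub>M\<^esub> z = x \<otimes>\<^bsub>M\<^esub> (y \<otimes>\<^bsub>M\<^esub> z)"
    using c A_cring by (auto simp: fun_eq_iff intro: cring.cring_simprules)
qed

sublocale monoid_algebra R M "monoid_alg R M"
  by (intro monoid_algebra.intro R M)

abbreviation "F \<equiv> monoid_alg R M"

lemma upd_M: "x \<in> carrier M \<Longrightarrow> i \<in> I \<Longrightarrow> a \<in> carrier (A i) \<Longrightarrow> x(i := a) \<in> carrier M"
  by (auto simp: PiE_def Pi_def extensional_def)

lemma rels_sub: "rels \<subseteq> carrier F"
proof -
  interpret F: cring F by (rule F_cring)
  have m: "x \<in> carrier M \<longleftrightarrow> x \<in> (\<Pi>\<^sub>E j\<in>I. carrier (A j))" for x by simp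
  show ?thesis unfolding multilinear_rels_def Let_def m[symmetric]
    by (intro Un_least subsetI)
       (auto intro!: F.minus_closed F.a_closed delta_closed smult_closed upd_M A_ops simp del: carrier_product_group)
qed

lemma T_def': "T = quot_alg F (Idl\<^bsub>F\<^esub> rels)"
  by (simp add: tensor_prod_def Let_def)

lemma ideal_rels: "ideal (Idl\<^bsub>F\<^esub> rels) F"
  using cring.axioms(1)[OF F_cring] rels_sub by (rule ring.genideal_ideal)

lemmas Tprops = quot_alg_props[OF F_alg ideal_rels, folded T_def']

lemma T_alg: "comm_alg R T" by (rule Tprops(1))

lemma T_cring: "cring T" using comm_algD[OF T_alg] by simp

sublocale T: cring T by (rule T_cring)

lemma q_eq: "q x = Idl\<^bsub>F\<^esub> rels +>\<^bsub>F\<^esub> delta R x"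
  by (simp add: pure_tensor_def Let_def)

lemma q_closed: "x \<in> carrier M \<Longrightarrow> q x \<in> carrier T"
  unfolding q_eq using Tprops(3) delta_closed by blast

lemma q_mult: "x \<in> carrier M \<Longrightarrow> y \<in> carrier M \<Longrightarrow> q x \<otimes>\<^bsub>T\<^esub> q y = q (x \<otimes>\<^bsub>M\<^esub> y)"
  unfolding q_eq using ring_hom_mult[OF Tprops(2), of "delta R x" "delta R y"]
  by (simp add: delta_closed delta_mult del: carrier_product_group mult_product_group)

lemma q_one: "q \<one>\<^bsub>M\<^esub> = \<one>\<^bsub>T\<^esub>"
  unfolding q_eq using ring_hom_one[OF Tprops(2)] by (simp add: F_ops del: one_product_group)

lemma F_smult: "r \<in> carrier R \<Longrightarrow> u \<in> carrier F \<Longrightarrow>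
    Idl\<^bsub>F\<^esub> rels +>\<^bsub>F\<^esub> (r \<odot>\<^bsub>F\<^esub> u) = scal T r \<otimes>\<^bsub>T\<^esub> (Idl\<^bsub>F\<^esub> rels +>\<^bsub>F\<^esub> u)"
  using ring_hom_mult[OF Tprops(2), of "scal F r" u] comm_algD(4,5)[OF F_alg] by (simp add: Tprops(4))

lemma q_add:
  assumes x: "x \<in> carrier M" and i: "i \<in> I" and a: "a \<in> carrier (A i)" "b \<in> carrier (A i)"
  shows "q (x(i := a \<oplus>\<^bsub>A i\<^esub> b)) = q (x(i := a)) \<oplus>\<^bsub>T\<^esub> q (x(i := b))"
proof -
  interpret F: cring F by (rule F_cring)
  interpret Ai: cring "A i" using i by (rule A_cring)
  have "delta R (x(i := a \<oplus>\<^bsub>A i\<^esub> b)) \<ominus>\<^bsub>F\<^esub> (delta R (x(i := a)) \<oplus>\<^bsub>F\<^esub> delta R (x(i := b))) \<in> rels"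
    unfolding multilinear_rels_def Let_def using assms by auto
  then have "delta R (x(i := a \<oplus>\<^bsub>A i\<^esub> b)) \<ominus>\<^bsub>F\<^esub> (delta R (x(i := a)) \<oplus>\<^bsub>F\<^esub> delta R (x(i := b))) \<in> Idl\<^bsub>F\<^esub> rels"
    using F.genideal_self[OF rels_sub] by blast
  then have "q (x(i := a \<oplus>\<^bsub>A i\<^esub> b)) = Idl\<^bsub>F\<^esub> rels +>\<^bsub>F\<^esub> (delta R (x(i := a)) \<oplus>\<^bsub>F\<^esub> delta R (x(i := b)))"
    unfolding q_eq using assms by (subst Tprops(5)) (auto intro!: F.a_closed delta_closed upd_M simp del: carrier_product_group)
  also have "\<dots> = q (x(i := a)) \<oplus>\<^bsub>T\<^esub> q (x(i := b))"
    unfolding q_eq using assms by (intro ring_hom_add[OF Tprops(2)] delta_closed upd_M)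
  finally show ?thesis .
qed

lemma q_smult:
  assumes x: "x \<in> carrier M" and i: "i \<in> I" and a: "r \<in> carrier R" "a \<in> carrier (A i)"
  shows "q (x(i := r \<odot>\<^bsub>A i\<^esub> a)) = scal T r \<otimes>\<^bsub>T\<^esub> q (x(i := a))"
proof -
  interpret F: cring F by (rule F_cring)
  interpret Ai: cring "A i" using i by (rule A_cring)
  have s: "r \<odot>\<^bsub>A i\<^esub> a \<in> carrier (A i)" using comm_algD(4,5)[OF A[OF i]] a by simp
  have "delta R (x(i := r \<odot>\<^bsub>A i\<^esub> a)) \<ominus>\<^bsub>F\<^esub> (r \<odot>\<^bsub>F\<^esub> delta R (x(i := a))) \<in> rels"
    unfolding multilinear_rels_def Let_def using assms by auto
  then have "delta R (x(i := r \<odot>\<^bsub>A i\<^esub> a)) \<ominus>\<^bsub>F\<^esub> (r \<odot>\<^bsub>F\<^esub> delta R (x(i := a))) \<in> Idl\<^bsub>F\<^esub> rels"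
    using F.genideal_self[OF rels_sub] by blast
  then have "q (x(i := r \<odot>\<^bsub>A i\<^esub> a)) = Idl\<^bsub>F\<^esub> rels +>\<^bsub>F\<^esub> (r \<odot>\<^bsub>F\<^esub> delta R (x(i := a)))"
    unfolding q_eq using assms s by (subst Tprops(5)) (auto intro!: smult_closed delta_closed upd_M simp del: carrier_product_group)
  also have "\<dots> = scal T r \<otimes>\<^bsub>T\<^esub> q (x(i := a))"
    unfolding q_eq using assms by (intro F_smult delta_closed upd_M)
  finally show ?thesis .
qed

abbreviation "emb \<equiv> tensor_emb R I A"

lemma emb_upd: "i \<in> I \<Longrightarrow> emb i a = q (\<one>\<^bsub>M\<^esub>(i := a))"
  unfolding tensor_emb_def by (rule arg_cong[where f = q]) auto

lemma one_M: "\<one>\<^bsub>M\<^esub> \<in> carrier M"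
  by (rule monoid.one_closed[OF comm_monoid.axioms(1)[OF M]])

lemma emb_hom: assumes i: "i \<in> I" shows "emb i \<in> ring_hom (A i) T"
proof (rule ring_hom_memI)
  interpret Ai: cring "A i" using i by (rule A_cring)
  have 1: "\<one>\<^bsub>M\<^esub>(i := \<one>\<^bsub>A i\<^esub>) = \<one>\<^bsub>M\<^esub>" using i by auto
  show "emb i \<one>\<^bsub>A i\<^esub> = \<one>\<^bsub>T\<^esub>" unfolding emb_upd[OF i] 1 by (rule q_one)
  fix a assume a: "a \<in> carrier (A i)"
  show "emb i a \<in> carrier T" unfolding emb_upd[OF i] by (intro q_closed upd_M one_M i a)
  fix b assume b: "b \<in> carrier (A i)"
  have 2: "\<one>\<^bsub>M\<^esub>(i := a) \<otimes>\<^bsub>M\<^esub> \<one>\<^bsub>M\<^esub>(i := b) = \<one>\<^bsub>M\<^esub>(i := a \<otimes>\<^bsub>A i\<^esub> b)"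
    using i a b A_ops by (auto simp: fun_eq_iff)
  show "emb i (a \<otimes>\<^bsub>A i\<^esub> b) = emb i a \<otimes>\<^bsub>T\<^esub> emb i b"
    unfolding emb_upd[OF i] using q_mult[OF upd_M[OF one_M i a] upd_M[OF one_M i b]] 2 by simp
  show "emb i (a \<oplus>\<^bsub>A i\<^esub> b) = emb i a \<oplus>\<^bsub>T\<^esub> emb i b"
    unfolding emb_upd[OF i] by (rule q_add[OF one_M i a b])
qed

lemma emb_closed: "i \<in> I \<Longrightarrow> a \<in> carrier (A i) \<Longrightarrow> emb i a \<in> carrier T"
  using ring_hom_closed[OF emb_hom] .

lemma emb_scal: assumes i: "i \<in> I" and r: "r \<in> carrier R" shows "emb i (scal (A i) r) = scal T r"
proof -
  interpret Ai: cring "A i" using i by (rule A_cring)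
  have "emb i (scal (A i) r) = scal T r \<otimes>\<^bsub>T\<^esub> q (\<one>\<^bsub>M\<^esub>(i := \<one>\<^bsub>A i\<^esub>))"
    unfolding emb_upd[OF i] scal_def[of "A i"] by (rule q_smult[OF one_M i r Ai.one_closed])
  also have "\<one>\<^bsub>M\<^esub>(i := \<one>\<^bsub>A i\<^esub>) = \<one>\<^bsub>M\<^esub>" using i by auto
  finally show ?thesis using comm_algD(4)[OF T_alg r] by (simp only: q_one T.r_one)
qed

lemma q_eq_prod:
  assumes x: "x \<in> carrier M"
  shows "q x = (\<Otimes>\<^bsub>T\<^esub>i\<in>I. emb i (x i))"
proof -
  have xi: "i \<in> I \<Longrightarrow> x i \<in> carrier (A i)" for i using x by auto
  have "(\<Otimes>\<^bsub>T\<^esub>i\<in>J. emb i (x i)) = q (\<lambda>i\<in>I. if i \<in> J then x i else \<one>\<^bsub>A i\<^esub>)" if "J \<subseteq> I" for J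
    using finite_subset[OF that finite_I] that
  proof (induction J rule: finite_induct)
    case empty
    have "(\<lambda>i\<in>I. if i \<in> {} then x i else \<one>\<^bsub>A i\<^esub>) = \<one>\<^bsub>M\<^esub>" by simp
    then show ?case using q_one by (simp only: T.finprod_empty)
  next
    case (insert i J)
    let ?y = "\<lambda>i\<in>I. if i \<in> J then x i else \<one>\<^bsub>A i\<^esub>"
    have y: "?y \<in> carrier M" using xi A_ops by auto
    have "(\<Otimes>\<^bsub>T\<^esub>i\<in>insert i J. emb i (x i)) = emb i (x i) \<otimes>\<^bsub>T\<^esub> (\<Otimes>\<^bsub>T\<^esub>i\<in>J. emb i (x i))"
      using insert.hyps insert.prems xi by (intro T.finprod_insert) (auto intro!: emb_closed)
    also have "(\<Otimes>\<^bsub>T\<^esub>i\<in>J. emb i (x i)) = q ?y"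
      by (rule insert.IH) (use insert.prems in blast)
    also have "emb i (x i) \<otimes>\<^bsub>T\<^esub> q ?y = q (\<one>\<^bsub>M\<^esub>(i := x i) \<otimes>\<^bsub>M\<^esub> ?y)"
      unfolding emb_upd[OF insert.prems[THEN subsetD, OF insertI1]]
      using insert.prems xi by (intro q_mult upd_M one_M y) auto
    also have "\<one>\<^bsub>M\<^esub>(i := x i) \<otimes>\<^bsub>M\<^esub> ?y = (\<lambda>j\<in>I. if j \<in> insert i J then x j else \<one>\<^bsub>A j\<^esub>)"
      using insert xi A_ops by (auto simp: fun_eq_iff)
    finally show ?case .
  qed
  from this[of I] have "(\<Otimes>\<^bsub>T\<^esub>i\<in>I. emb i (x i)) = q (\<lambda>i\<in>I. if i \<in> I then x i else \<one>\<^bsub>A i\<^esub>)" by simp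
  also have "(\<lambda>i\<in>I. if i \<in> I then x i else \<one>\<^bsub>A i\<^esub>) = x" using x by (auto simp: fun_eq_iff PiE_def extensional_def)
  finally show ?thesis ..
qed

lemma T_induct_pure [consumes 1, case_names zero add pure]:
  assumes t: "t \<in> carrier T" and zero: "Q \<zero>\<^bsub>T\<^esub>"
    and add: "\<And>s t. s \<in> carrier T \<Longrightarrow> t \<in> carrier T \<Longrightarrow> Q s \<Longrightarrow> Q t \<Longrightarrow> Q (s \<oplus>\<^bsub>T\<^esub> t)"
    and pure: "\<And>r x. r \<in> carrier R \<Longrightarrow> (\<And>i. i \<in> I \<Longrightarrow> x i \<in> carrier (A i)) \<Longrightarrow>
      Q (scal T r \<otimes>\<^bsub>T\<^esub> (\<Otimes>\<^bsub>T\<^esub>i\<in>I. emb i (x i)))"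
  shows "Q t"
proof -
  let ?q = "(+>\<^bsub>F\<^esub>) (Idl\<^bsub>F\<^esub> rels)"
  obtain u where u: "u \<in> carrier F" "t = ?q u" using t Tprops(3) by blast
  have "Q (?q u)"
  proof (rule F_induct[OF u(1)], goal_cases)
    case (1 u v)
    then show ?case using ring_hom_add[OF Tprops(2), of u v] add[of "?q u" "?q v"] ring_hom_closed[OF Tprops(2)]
      by simp
  next
    case 2
    interpret hq: ring_hom_cring F T ?q by (rule ring_hom_cringI[OF F_cring T_cring Tprops(2)])
    show ?case using zero by (simp del: F_ops)
  next
    case (3 r x)
    then have "?q (r \<odot>\<^bsub>F\<^esub> delta R x) = scal T r \<otimes>\<^bsub>T\<^esub> q x"
      unfolding q_eq by (intro F_smult delta_closed)
    then show ?case using 3 pure[of r x] q_eq_prod[of x] by auto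
  qed
  then show ?thesis using u by simp
qed

lemma T_induct [consumes 1, case_names scal emb add mult]:
  assumes t: "t \<in> carrier T"
    and sc: "\<And>r. r \<in> carrier R \<Longrightarrow> Q (scal T r)"
    and em: "\<And>i a. i \<in> I \<Longrightarrow> a \<in> carrier (A i) \<Longrightarrow> Q (emb i a)"
    and ad: "\<And>s t. s \<in> carrier T \<Longrightarrow> t \<in> carrier T \<Longrightarrow> Q s \<Longrightarrow> Q t \<Longrightarrow> Q (s \<oplus>\<^bsub>T\<^esub> t)"
    and mu: "\<And>s t. s \<in> carrier T \<Longrightarrow> t \<in> carrier T \<Longrightarrow> Q s \<Longrightarrow> Q t \<Longrightarrow> Q (s \<otimes>\<^bsub>T\<^esub> t)"
  shows "Q t"
  using t
proof (induction rule: T_induct_pure)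
  case zero
  show ?case using sc[OF R.zero_closed] comm_algD(7)[OF T_alg] by simp
next
  case (pure r x)
  have "J \<subseteq> I \<Longrightarrow> Q (\<Otimes>\<^bsub>T\<^esub>i\<in>J. emb i (x i))" if "finite J" for J
    using that
  proof (induction J rule: finite_induct)
    case empty
    then show ?case using sc[OF R.one_closed] comm_algD(6)[OF T_alg] by simp
  next
    case (insert i J)
    then show ?case using pure(2)
      by (subst T.finprod_insert) (auto intro!: mu em emb_closed T.finprod_closed)
  qed
  then show ?case using finite_I pure sc comm_algD(4)[OF T_alg]
    by (intro mu) (auto intro!: T.finprod_closed emb_closed)
qed (rule ad)

text \<open>
  The tensor product is the coproduct of commutative algebras: multiplying the images \<open>h i (x i)\<close> is a
  multiplicative and multilinear function of the tuple \<open>x\<close>, so it extends to the free module and kills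
  the relations.
\<close>

lemma T_universal:
  assumes B: "cring B" and j: "j \<in> ring_hom R B"
    and h: "\<And>i. i \<in> I \<Longrightarrow> h i \<in> ring_hom (A i) B"
    and hj: "\<And>i r. i \<in> I \<Longrightarrow> r \<in> carrier R \<Longrightarrow> h i (scal (A i) r) = j r"
  shows "\<exists>H\<in>ring_hom T B. (\<forall>r\<in>carrier R. H (scal T r) = j r) \<and>
           (\<forall>i\<in>I. \<forall>a\<in>carrier (A i). H (emb i a) = h i a)"
proof -
  interpret B: cring B by fact
  let ?h = "\<lambda>x. \<Otimes>\<^bsub>B\<^esub>i\<in>I. h i (x i)"
  have hc: "i \<in> I \<Longrightarrow> a \<in> carrier (A i) \<Longrightarrow> h i a \<in> carrier B" for i a
    using ring_hom_closed[OF h] .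
  have xc: "x \<in> carrier M \<Longrightarrow> i \<in> I \<Longrightarrow> h i (x i) \<in> carrier B" for x i using hc by auto
  have "?h \<in> carrier M \<rightarrow> carrier B" using xc by (auto intro!: B.finprod_closed)
  moreover have "?h \<one>\<^bsub>M\<^esub> = \<one>\<^bsub>B\<^esub>"
    using ring_hom_one[OF h] by (intro B.finprod_one_eqI) auto
  moreover have "?h (x \<otimes>\<^bsub>M\<^esub> y) = ?h x \<otimes>\<^bsub>B\<^esub> ?h y" if x: "x \<in> carrier M" and y: "y \<in> carrier M" for x y
  proof -
    have "?h (x \<otimes>\<^bsub>M\<^esub> y) = (\<Otimes>\<^bsub>B\<^esub>i\<in>I. h i (x i) \<otimes>\<^bsub>B\<^esub> h i (y i))"
      using x y xc[OF x] xc[OF y] ring_hom_mult[OF h]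
      by (intro B.finprod_cong') (auto simp: PiE_def Pi_def)
    also have "\<dots> = ?h x \<otimes>\<^bsub>B\<^esub> ?h y"
      using xc[OF x] xc[OF y] by (intro B.finprod_multf) auto
    finally show ?thesis .
  qed
  ultimately obtain H where H: "H \<in> ring_hom F B" "\<And>r. r \<in> carrier R \<Longrightarrow> H (scal F r) = j r"
     "\<And>x. x \<in> carrier M \<Longrightarrow> H (delta R x) = ?h x"
    using F_universal[OF B j, of ?h] by auto
  interpret H: ring_hom_cring F B H by (rule ring_hom_cringI[OF F_cring B H(1)])
  have upd: "?h (x(i := a)) = h i a \<otimes>\<^bsub>B\<^esub> (\<Otimes>\<^bsub>B\<^esub>j\<in>I - {i}. h j (x j))" (is "_ = _ \<otimes>\<^bsub>B\<^esub> ?r x i")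
    if x: "x \<in> carrier M" and i: "i \<in> I" and a: "a \<in> carrier (A i)" for x i a
  proof -
    have I: "I = insert i (I - {i})" using i by auto
    have "?h (x(i := a)) = (\<Otimes>\<^bsub>B\<^esub>j\<in>insert i (I - {i}). h j ((x(i := a)) j))" using I by simp
    also have "\<dots> = h i ((x(i := a)) i) \<otimes>\<^bsub>B\<^esub> (\<Otimes>\<^bsub>B\<^esub>j\<in>I - {i}. h j ((x(i := a)) j))"
      using finite_I hc[OF i a] xc[OF x] by (intro B.finprod_insert) auto
    also have "(\<Otimes>\<^bsub>B\<^esub>j\<in>I - {i}. h j ((x(i := a)) j)) = ?r x i"
      using xc[OF x] by (intro B.finprod_cong') auto
    finally show ?thesis by simp
  qed
  have rc: "?r x i \<in> carrier B" if "x \<in> carrier M" for x i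
    using xc[OF that] by (intro B.finprod_closed) auto
  have k: "H u = \<zero>\<^bsub>B\<^esub>" if u: "u \<in> rels" for u
  proof -
    from u consider (add) x i a b where "u = delta R (x(i := a \<oplus>\<^bsub>A i\<^esub> b)) \<ominus>\<^bsub>F\<^esub> (delta R (x(i := a)) \<oplus>\<^bsub>F\<^esub> delta R (x(i := b)))"
        "x \<in> carrier M" "i \<in> I" "a \<in> carrier (A i)" "b \<in> carrier (A i)"
      | (smult) x i r a where "u = delta R (x(i := r \<odot>\<^bsub>A i\<^esub> a)) \<ominus>\<^bsub>F\<^esub> r \<odot>\<^bsub>F\<^esub> delta R (x(i := a))"
        "x \<in> carrier M" "i \<in> I" "r \<in> carrier R" "a \<in> carrier (A i)"
      unfolding multilinear_rels_def Let_def by auto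
    then show ?thesis
    proof cases
      case add
      interpret Ai: cring "A i" by (rule A_cring) fact
      have m: "x(i := a \<oplus>\<^bsub>A i\<^esub> b) \<in> carrier M" "x(i := a) \<in> carrier M" "x(i := b) \<in> carrier M"
        using add by (auto intro!: upd_M simp del: carrier_product_group)
      have "H u = ?h (x(i := a \<oplus>\<^bsub>A i\<^esub> b)) \<ominus>\<^bsub>B\<^esub> (?h (x(i := a)) \<oplus>\<^bsub>B\<^esub> ?h (x(i := b)))"
        unfolding add(1) H.R.minus_eq B.minus_eq using H(3) m delta_closed
        by (simp del: fun_upd_apply carrier_product_group add: H.R.a_closed)
      also have "\<dots> = (h i a \<oplus>\<^bsub>B\<^esub> h i b) \<otimes>\<^bsub>B\<^esub> ?r x i \<ominus>\<^bsub>B\<^esub> (h i a \<otimes>\<^bsub>B\<^esub> ?r x i \<oplus>\<^bsub>B\<^esub> h i b \<otimes>\<^bsub>B\<^esub> ?r x i)"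
        using add(2-) by (simp del: fun_upd_apply carrier_product_group add: upd ring_hom_add[OF h])
      also have "\<dots> = \<zero>\<^bsub>B\<^esub>"
        using hc[OF add(3,4)] hc[OF add(3,5)] rc[OF add(2)] by (simp add: B.l_distr B.minus_eq B.r_neg)
      finally show ?thesis .
    next
      case smult
      interpret Ai: cring "A i" by (rule A_cring) fact
      have ra: "r \<odot>\<^bsub>A i\<^esub> a = scal (A i) r \<otimes>\<^bsub>A i\<^esub> a" "scal (A i) r \<in> carrier (A i)"
        using comm_algD(4,5)[OF A[OF smult(3)]] smult(4,5) by auto
      then have rac: "r \<odot>\<^bsub>A i\<^esub> a \<in> carrier (A i)" using smult(5) by simp
      have m: "x(i := r \<odot>\<^bsub>A i\<^esub> a) \<in> carrier M" "x(i := a) \<in> carrier M"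
        using smult rac by (auto intro!: upd_M simp del: carrier_product_group)
      have rs: "H (r \<odot>\<^bsub>F\<^esub> delta R (x(i := a))) = j r \<otimes>\<^bsub>B\<^esub> ?h (x(i := a))"
        using comm_algD(4,5)[OF F_alg smult(4)] delta_closed[OF m(2)] H(2)[OF smult(4)] H(3)[OF m(2)] by simp
      have "H u = ?h (x(i := r \<odot>\<^bsub>A i\<^esub> a)) \<ominus>\<^bsub>B\<^esub> j r \<otimes>\<^bsub>B\<^esub> ?h (x(i := a))"
        unfolding smult(1) H.R.minus_eq B.minus_eq using H(3) m delta_closed rs smult(4)
        by (simp del: fun_upd_apply carrier_product_group add: smult_closed)
      also have "\<dots> = (j r \<otimes>\<^bsub>B\<^esub> h i a) \<otimes>\<^bsub>B\<^esub> ?r x i \<ominus>\<^bsub>B\<^esub> j r \<otimes>\<^bsub>B\<^esub> (h i a \<otimes>\<^bsub>B\<^esub> ?r x i)"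
        using smult(2-) rac ra hj[OF smult(3,4)]
        by (simp del: fun_upd_apply carrier_product_group add: upd ring_hom_mult[OF h])
      also have "\<dots> = \<zero>\<^bsub>B\<^esub>"
        using hc[OF smult(3,5)] rc[OF smult(2)] ring_hom_closed[OF j smult(4)]
        by (simp add: B.m_assoc B.minus_eq B.r_neg)
      finally show ?thesis .
    qed
  qed
  obtain h' where h': "h' \<in> ring_hom T B" "\<And>u. u \<in> carrier F \<Longrightarrow> h' (Idl\<^bsub>F\<^esub> rels +>\<^bsub>F\<^esub> u) = H u"
    using quot_genideal_hom[OF F_alg rels_sub B H(1) k] unfolding T_def'[symmetric] by blast
  have "h' (scal T r) = j r" if "r \<in> carrier R" for r
    using that h'(2) H(2) comm_algD(4)[OF F_alg] by (simp add: Tprops(4))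
  moreover have "h' (emb i a) = h i a" if i: "i \<in> I" and a: "a \<in> carrier (A i)" for i a
  proof -
    have "h' (emb i a) = ?h (\<one>\<^bsub>M\<^esub>(i := a))"
      unfolding emb_upd[OF i] q_eq using H(3) h'(2) delta_closed upd_M[OF one_M i a]
      by (simp del: fun_upd_apply carrier_product_group one_product_group)
    also have "\<dots> = h i a \<otimes>\<^bsub>B\<^esub> (\<Otimes>\<^bsub>B\<^esub>j\<in>I - {i}. h j (\<one>\<^bsub>M\<^esub> j))" by (rule upd[OF one_M i a])
    also have "(\<Otimes>\<^bsub>B\<^esub>j\<in>I - {i}. h j (\<one>\<^bsub>M\<^esub> j)) = \<one>\<^bsub>B\<^esub>"
      using ring_hom_one[OF h] by (intro B.finprod_one_eqI) auto
    finally show ?thesis using hc[OF i a] by simp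
  qed
  ultimately show ?thesis using h'(1) by blast
qed

end

subsection \<open>Base change along a retraction onto the scalars\<close>

text \<open>
  The construction of the closure algebra for an arbitrary algebra \<open>T\<close>, a subalgebra \<open>Sc\<close>
  and a homomorphism \<open>\<phi>\<close> of algebras from \<open>Sc\<close> to \<open>R\<close>. As
  \<open>\<phi>\<close> is a retraction of the structure map, it is surjective, and base change along it amounts to a
  quotient of \<open>T\<close>.
\<close>

locale subring_base_change =
  fixes R :: "('r, 'm) ring_scheme" and T :: "('r, 't) module" and Sc :: "'t set" and \<phi> :: "'t \<Rightarrow> 'r"
  assumes T: "comm_alg R T" and Sc: "subring Sc T" and scal_Sc: "\<And>r. r \<in> carrier R \<Longrightarrow> scal T r \<in> Sc"
    and \<phi>: "\<phi> \<in> ring_hom (T\<lparr>carrier := Sc\<rparr>) R" and \<phi>_scal: "\<And>r. r \<in> carrier R \<Longrightarrow> \<phi> (scal T r) = r"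
begin

abbreviation "S \<equiv> T\<lparr>carrier := Sc\<rparr>"
abbreviation "T' \<equiv> with_smult T (monoid.mult T)"
abbreviation "R' \<equiv> with_smult R (\<lambda>s r. \<phi> s \<otimes>\<^bsub>R\<^esub> r)"
abbreviation "M \<equiv> T' \<times>\<times> R'"
abbreviation "C0 \<equiv> tensor_prod2 S T' R'"
abbreviation "C \<equiv> with_smult C0 (\<lambda>r c. (r \<odot>\<^bsub>T\<^esub> \<one>\<^bsub>T\<^esub>) \<odot>\<^bsub>C0\<^esub> c)"
abbreviation "rels \<equiv> bilinear_rels S T' R'"

sublocale T: cring T using comm_algD[OF T] by simp
sublocale K: cring R using comm_algD[OF T] by simp

lemma S_cring: "cring S"
  using T.subcringI'[OF Sc] T.subcring_iff[OF subringE(1)[OF Sc]] by simp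

lemma M_sel: "carrier M = carrier T \<times> carrier R" "\<one>\<^bsub>M\<^esub> = (\<one>\<^bsub>T\<^esub>, \<one>\<^bsub>R\<^esub>)"
    "(a, b) \<otimes>\<^bsub>M\<^esub> (c, d) = (a \<otimes>\<^bsub>T\<^esub> c, b \<otimes>\<^bsub>R\<^esub> d)"
  by (simp_all add: DirProd_def)

lemma M: "comm_monoid M"
  by (intro comm_monoidI) (auto simp: M_sel T.m_ac K.m_ac)

sublocale monoid_algebra S M "monoid_alg S M"
  by (intro monoid_algebra.intro S_cring M)

abbreviation "F \<equiv> monoid_alg S M"

lemma Sc_T: "s \<in> Sc \<Longrightarrow> s \<in> carrier T" using subringE(1)[OF Sc] by blast

lemma \<phi>_closed: "s \<in> Sc \<Longrightarrow> \<phi> s \<in> carrier R" using ring_hom_closed[OF \<phi>] by simp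

lemma rels_sub: "rels \<subseteq> carrier F"
proof -
  interpret F: cring F by (rule F_cring)
  have d: "t \<in> carrier T \<Longrightarrow> r \<in> carrier R \<Longrightarrow> delta S (t, r) \<in> carrier F" for t r
    by (intro delta_closed) (simp add: M_sel)
  show ?thesis unfolding bilinear_rels_def Let_def
    by (intro Un_least subsetI)
       (auto intro!: F.minus_closed F.a_closed d smult_closed simp: Sc_T \<phi>_closed)
qed

lemma C0_def': "C0 = quot_alg F (Idl\<^bsub>F\<^esub> rels)"
  by (simp add: tensor_prod2_def Let_def)

lemma ideal_rels: "ideal (Idl\<^bsub>F\<^esub> rels) F"
  using cring.axioms(1)[OF F_cring] rels_sub by (rule ring.genideal_ideal)

lemmas Cprops = quot_alg_props[OF F_alg ideal_rels, folded C0_def']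

abbreviation "qq \<equiv> (+>\<^bsub>F\<^esub>) (Idl\<^bsub>F\<^esub> rels)"
abbreviation "cl t r \<equiv> qq (delta S (t, r))"

sublocale C0: cring C0 using comm_algD[OF Cprops(1)] by simp

lemma d_closed: "t \<in> carrier T \<Longrightarrow> r \<in> carrier R \<Longrightarrow> delta S (t, r) \<in> carrier F"
  by (intro delta_closed) (simp add: M_sel)

lemma qq_closed: "u \<in> carrier F \<Longrightarrow> qq u \<in> carrier C0"
  using ring_hom_closed[OF Cprops(2)] .

lemma cl_closed: "t \<in> carrier T \<Longrightarrow> r \<in> carrier R \<Longrightarrow> cl t r \<in> carrier C0"
  by (intro qq_closed d_closed)

lemma rel_eq:
  assumes "u \<ominus>\<^bsub>F\<^esub> v \<in> rels" "u \<in> carrier F" "v \<in> carrier F"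
  shows "qq u = qq v"
  using ring.genideal_self[OF cring.axioms(1)[OF F_cring] rels_sub] assms Cprops(5)[OF assms(2,3)] by blast

lemma qq_smult: "s \<in> Sc \<Longrightarrow> u \<in> carrier F \<Longrightarrow> qq (s \<odot>\<^bsub>F\<^esub> u) = scal C0 s \<otimes>\<^bsub>C0\<^esub> qq u"
  using ring_hom_mult[OF Cprops(2), of "scal F s" u] comm_algD(4,5)[OF F_alg] by (simp add: Cprops(4))

lemma cl_mult:
  assumes "t \<in> carrier T" "r \<in> carrier R" "t' \<in> carrier T" "r' \<in> carrier R"
  shows "cl t r \<otimes>\<^bsub>C0\<^esub> cl t' r' = cl (t \<otimes>\<^bsub>T\<^esub> t') (r \<otimes>\<^bsub>R\<^esub> r')"
  using ring_hom_mult[OF Cprops(2) d_closed[OF assms(1,2)] d_closed[OF assms(3,4)]]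
    delta_mult[of "(t, r)" "(t', r')"] assms by (simp add: M_sel)

lemma cl_one: "cl \<one>\<^bsub>T\<^esub> \<one>\<^bsub>R\<^esub> = \<one>\<^bsub>C0\<^esub>"
  using ring_hom_one[OF Cprops(2)] F_ops(3) M_sel by simp

lemma cl_add:
  assumes "t \<in> carrier T" "t' \<in> carrier T" "r \<in> carrier R"
  shows "cl (t \<oplus>\<^bsub>T\<^esub> t') r = cl t r \<oplus>\<^bsub>C0\<^esub> cl t' r"
proof -
  have "cl (t \<oplus>\<^bsub>T\<^esub> t') r = qq (delta S (t, r) \<oplus>\<^bsub>F\<^esub> delta S (t', r))"
  proof (rule rel_eq)
    show "delta S (t \<oplus>\<^bsub>T\<^esub> t', r) \<ominus>\<^bsub>F\<^esub> (delta S (t, r) \<oplus>\<^bsub>F\<^esub> delta S (t', r)) \<in> rels"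
      unfolding bilinear_rels_def Let_def with_smult_simps
      by (rule UnI1, rule UnI1, rule UnI1,
          rule CollectI, (rule exI)+, rule conjI[OF refl]) (use assms in auto)
  qed (use assms in \<open>auto intro: add_closed d_closed\<close>)
  also have "\<dots> = cl t r \<oplus>\<^bsub>C0\<^esub> cl t' r"
    using assms by (intro ring_hom_add[OF Cprops(2)] d_closed)
  finally show ?thesis .
qed

lemma cl_smult1:
  assumes "s \<in> Sc" "t \<in> carrier T" "r \<in> carrier R"
  shows "cl (s \<otimes>\<^bsub>T\<^esub> t) r = scal C0 s \<otimes>\<^bsub>C0\<^esub> cl t r"
proof -
  have "cl (s \<otimes>\<^bsub>T\<^esub> t) r = qq (s \<odot>\<^bsub>F\<^esub> delta S (t, r))"
  proof (rule rel_eq)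
    show "delta S (s \<otimes>\<^bsub>T\<^esub> t, r) \<ominus>\<^bsub>F\<^esub> s \<odot>\<^bsub>F\<^esub> delta S (t, r) \<in> rels"
      unfolding bilinear_rels_def Let_def with_smult_simps
      by (rule UnI1, rule UnI2,
          rule CollectI, (rule exI)+, rule conjI[OF refl]) (use assms in auto)
  qed (use assms Sc_T in \<open>auto intro: smult_closed d_closed\<close>)
  then show ?thesis using assms by (simp add: qq_smult d_closed)
qed

lemma cl_smult2:
  assumes "s \<in> Sc" "t \<in> carrier T" "r \<in> carrier R"
  shows "cl t (\<phi> s \<otimes>\<^bsub>R\<^esub> r) = scal C0 s \<otimes>\<^bsub>C0\<^esub> cl t r"
proof -
  have "cl t (\<phi> s \<otimes>\<^bsub>R\<^esub> r) = qq (s \<odot>\<^bsub>F\<^esub> delta S (t, r))"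
  proof (rule rel_eq)
    show "delta S (t, \<phi> s \<otimes>\<^bsub>R\<^esub> r) \<ominus>\<^bsub>F\<^esub> s \<odot>\<^bsub>F\<^esub> delta S (t, r) \<in> rels"
      unfolding bilinear_rels_def Let_def with_smult_simps
      by (rule UnI2,
          rule CollectI, (rule exI)+, rule conjI[OF refl]) (use assms in auto)
  qed (use assms \<phi>_closed in \<open>auto intro: smult_closed d_closed\<close>)
  then show ?thesis using assms by (simp add: qq_smult d_closed)
qed

definition "proj t = cl t \<one>\<^bsub>R\<^esub>"

lemma proj_hom: "proj \<in> ring_hom T C"
  unfolding with_smult_ring_hom
proof (rule ring_hom_memI)
  fix t t' assume t: "t \<in> carrier T" "t' \<in> carrier T"
  show "proj t \<in> carrier C0" using t by (simp add: proj_def cl_closed)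
  show "proj (t \<otimes>\<^bsub>T\<^esub> t') = proj t \<otimes>\<^bsub>C0\<^esub> proj t'" using t by (simp add: proj_def cl_mult)
  show "proj (t \<oplus>\<^bsub>T\<^esub> t') = proj t \<oplus>\<^bsub>C0\<^esub> proj t'" using t by (simp add: proj_def cl_add)
qed (simp add: proj_def cl_one)

lemma proj_scal0: "s \<in> Sc \<Longrightarrow> proj s = scal C0 s"
  using cl_smult1[of s "\<one>\<^bsub>T\<^esub>" "\<one>\<^bsub>R\<^esub>"] comm_algD(4)[OF Cprops(1), of s] by (simp add: proj_def Sc_T cl_one)

lemma C_scal: assumes "r \<in> carrier R" shows "scal C r = proj (scal T r)"
proof -
  have "scal C r = scal T r \<odot>\<^bsub>C0\<^esub> \<one>\<^bsub>C0\<^esub>" by (simp add: scal_def)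
  also have "\<dots> = scal C0 (scal T r)" by (simp add: scal_def[of C0])
  finally show ?thesis using proj_scal0[OF scal_Sc[OF assms]] by simp
qed

lemma C_alg: "comm_alg R C"
  unfolding comm_alg_def
proof (intro conjI ballI)
  show "cring R" by (rule K.is_cring)
  show "cring C" using C0.is_cring by (rule with_smult_cring)
  have "(\<lambda>r. proj (scal T r)) \<in> ring_hom R C"
    using ring_hom_trans[OF comm_algD(3)[OF T] proj_hom] by (simp add: comp_def)
  then show "scal C \<in> ring_hom R C" using C_scal by (simp add: ring_hom_def Pi_def)
  fix r a assume r: "r \<in> carrier R" and a: "a \<in> carrier C"
  have "r \<odot>\<^bsub>C\<^esub> a = scal T r \<odot>\<^bsub>C0\<^esub> a" by (simp add: scal_def)
  also have "\<dots> = scal C0 (scal T r) \<otimes>\<^bsub>C0\<^esub> a" using comm_algD(5)[OF Cprops(1)] scal_Sc[OF r] a by simp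
  also have "\<dots> = scal C r \<otimes>\<^bsub>C\<^esub> a" using proj_scal0[OF scal_Sc[OF r]] C_scal[OF r] by simp
  finally show "r \<odot>\<^bsub>C\<^esub> a = scal C r \<otimes>\<^bsub>C\<^esub> a" .
qed

lemma proj_Sc: assumes s: "s \<in> Sc" shows "proj s = scal C (\<phi> s)"
proof -
  have s': "scal T (\<phi> s) \<in> Sc" using s by (intro scal_Sc \<phi>_closed)
  have "proj s = cl \<one>\<^bsub>T\<^esub> (\<phi> s)"
    using cl_smult2[OF s, of "\<one>\<^bsub>T\<^esub>" "\<one>\<^bsub>R\<^esub>"] proj_scal0[OF s] s comm_algD(4)[OF Cprops(1), of s]
    by (simp add: \<phi>_closed cl_one)
  moreover have "proj (scal T (\<phi> s)) = cl \<one>\<^bsub>T\<^esub> (\<phi> s)"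
    using cl_smult2[OF s', of "\<one>\<^bsub>T\<^esub>" "\<one>\<^bsub>R\<^esub>"] proj_scal0[OF s'] s s' comm_algD(4)[OF Cprops(1), of "scal T (\<phi> s)"]
    by (simp add: \<phi>_closed cl_one \<phi>_scal)
  ultimately show ?thesis using C_scal[OF \<phi>_closed[OF s]] by simp
qed

text \<open>
  The tensor \<open>t \<otimes> r\<close> equals \<open>r t \<otimes> 1\<close>, because \<open>r\<close> is the value
  of \<open>\<phi>\<close> at the scalar \<open>r\<close> of \<open>T\<close>.
\<close>

lemma proj_surj: "carrier C = proj ` carrier T"
proof
  interpret p: ring_hom_cring T C proj
    by (rule ring_hom_cringI[OF T.is_cring with_smult_cring[OF C0.is_cring] proj_hom])
  show "proj ` carrier T \<subseteq> carrier C" using ring_hom_closed[OF proj_hom] by blast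
  have "qq u \<in> proj ` carrier T" if "u \<in> carrier F" for u
  proof (rule F_induct[OF that], goal_cases)
    case (1 u v)
    then obtain s t where "s \<in> carrier T" "t \<in> carrier T" "qq u = proj s" "qq v = proj t" by blast
    then have "qq (u \<oplus>\<^bsub>F\<^esub> v) = proj (s \<oplus>\<^bsub>T\<^esub> t)" "s \<oplus>\<^bsub>T\<^esub> t \<in> carrier T"
      using ring_hom_add[OF Cprops(2) 1(1,2)] by simp_all
    then show ?case by blast
  next
    case 2
    interpret qq: ring_hom_cring F C0 qq by (rule ring_hom_cringI[OF F_cring C0.is_cring Cprops(2)])
    have "qq \<zero>\<^bsub>F\<^esub> = proj \<zero>\<^bsub>T\<^esub>" using p.hom_zero by (simp del: F_ops)
    then show ?case by blast
  next
    case (3 s x)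
    then obtain t r where x: "x = (t, r)" "t \<in> carrier T" "r \<in> carrier R" and s: "s \<in> Sc" by (auto simp: M_sel)
    have sr: "scal T r \<in> Sc" using x by (intro scal_Sc)
    have st: "s \<otimes>\<^bsub>T\<^esub> t \<in> carrier T" "scal T r \<in> carrier T" using s x Sc_T sr by auto
    have "qq (s \<odot>\<^bsub>F\<^esub> delta S x) = cl (s \<otimes>\<^bsub>T\<^esub> t) r" using s x by (simp add: cl_smult1 qq_smult d_closed)
    also have "\<dots> = cl (s \<otimes>\<^bsub>T\<^esub> t) (\<phi> (scal T r) \<otimes>\<^bsub>R\<^esub> \<one>\<^bsub>R\<^esub>)" using x by (simp add: \<phi>_scal)
    also have "\<dots> = cl (scal T r \<otimes>\<^bsub>T\<^esub> (s \<otimes>\<^bsub>T\<^esub> t)) \<one>\<^bsub>R\<^esub>"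
      using cl_smult1[OF sr st(1), of "\<one>\<^bsub>R\<^esub>"] cl_smult2[OF sr st(1), of "\<one>\<^bsub>R\<^esub>"] by simp
    also have "\<dots> = proj (scal T r \<otimes>\<^bsub>T\<^esub> (s \<otimes>\<^bsub>T\<^esub> t))" by (simp add: proj_def)
    finally show ?case using T.m_closed[OF st(2,1)] by (rule image_eqI)
  qed
  then show "carrier C \<subseteq> proj ` carrier T" using Cprops(3) by auto
qed

text \<open>
  With \<open>proj_Sc\<close> and \<open>proj_surj\<close> this characterizes \<open>C\<close> as the universal
  quotient of \<open>T\<close> in which every \<open>s \<in> Sc\<close> becomes equal to its value \<open>\<phi>
  s\<close>.
\<close>

lemma C_universal:
  assumes B: "cring B" and u: "u \<in> ring_hom T B" and us: "\<And>s. s \<in> Sc \<Longrightarrow> u s = u (scal T (\<phi> s))"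
  shows "\<exists>w\<in>ring_hom C B. \<forall>t\<in>carrier T. w (proj t) = u t"
proof -
  interpret B: cring B by fact
  interpret u: ring_hom_cring T B u by (rule ring_hom_cringI[OF T.is_cring B u])
  interpret F: cring F by (rule F_cring)
  note sc = comm_algD(4)[OF T]
  have uS: "u \<in> ring_hom S B" using u Sc_T by (auto simp: ring_hom_def Pi_def)
  let ?h = "\<lambda>(t, r). u t \<otimes>\<^bsub>B\<^esub> u (scal T r)"
  have "\<exists>H\<in>ring_hom F B. (\<forall>r\<in>carrier S. H (scal F r) = u r) \<and> (\<forall>x\<in>carrier M. H (delta S x) = ?h x)"
    using sc comm_algD(6)[OF T] ring_hom_mult[OF comm_algD(3)[OF T]]
    by (intro F_universal B uS) (auto simp: M_sel B.m_ac simp del: F_ops)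
  then obtain H where H: "H \<in> ring_hom F B" "\<And>r. r \<in> Sc \<Longrightarrow> H (scal F r) = u r"
    "\<And>t r. t \<in> carrier T \<Longrightarrow> r \<in> carrier R \<Longrightarrow> H (delta S (t, r)) = u t \<otimes>\<^bsub>B\<^esub> u (scal T r)"
    by (auto simp: M_sel)
  interpret H: ring_hom_cring F B H by (rule ring_hom_cringI[OF F_cring B H(1)])
  have Hs: "H (s \<odot>\<^bsub>F\<^esub> delta S (t, r)) = u s \<otimes>\<^bsub>B\<^esub> (u t \<otimes>\<^bsub>B\<^esub> u (scal T r))"
    if "s \<in> Sc" "t \<in> carrier T" "r \<in> carrier R" for s t r
    using comm_algD(4,5)[OF F_alg, of s] that d_closed H(2,3) by (simp del: F_ops)
  have Hm: "H (x \<ominus>\<^bsub>F\<^esub> y) = \<zero>\<^bsub>B\<^esub>" if "H x = H y" "x \<in> carrier F" "y \<in> carrier F" for x y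
    using that by (simp add: F.minus_eq B.r_neg)
  have k: "H x = \<zero>\<^bsub>B\<^esub>" if x: "x \<in> rels" for x
    using x unfolding bilinear_rels_def Let_def
  proof (elim UnE CollectE exE conjE, goal_cases)
    case (1 a a' b)
    then show ?case using sc d_closed
      by (auto intro!: Hm F.a_closed simp del: F_ops simp add: H(3) B.l_distr)
  next
    case (2 a b b')
    then show ?case using sc d_closed ring_hom_add[OF comm_algD(3)[OF T]]
      by (auto intro!: Hm F.a_closed simp del: F_ops simp add: H(3) B.r_distr)
  next
    case (3 s a b)
    then show ?case using sc d_closed Sc_T
      by (auto intro!: Hm smult_closed simp del: F_ops simp add: H(3) Hs B.m_assoc)
  next
    case (4 s a b)
    have s: "s \<in> Sc" using 4 by simp
    have "H (delta S (a, \<phi> s \<otimes>\<^bsub>R\<^esub> b)) = u a \<otimes>\<^bsub>B\<^esub> (u (scal T (\<phi> s)) \<otimes>\<^bsub>B\<^esub> u (scal T b))"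
      using 4 sc \<phi>_closed[OF s] ring_hom_mult[OF comm_algD(3)[OF T]] by (simp add: H(3) del: F_ops)
    also have "\<dots> = u s \<otimes>\<^bsub>B\<^esub> (u a \<otimes>\<^bsub>B\<^esub> u (scal T b))"
      using 4 sc Sc_T[OF s] us[OF s, symmetric] by (simp add: B.m_ac)
    finally show ?case using 4 d_closed \<phi>_closed[OF s] s
      by (auto intro!: Hm smult_closed simp del: F_ops simp add: Hs)
  qed
  obtain h' where h': "h' \<in> ring_hom C0 B" "\<And>x. x \<in> carrier F \<Longrightarrow> h' (qq x) = H x"
    using quot_genideal_hom[OF F_alg rels_sub B H(1) k] unfolding C0_def'[symmetric] by blast
  have "h' (proj t) = u t" if "t \<in> carrier T" for t
    using that h'(2) d_closed H(3) comm_algD(6)[OF T] by (simp add: proj_def)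
  then show ?thesis using h'(1) by auto
qed

end

declare One_nat_def [simp del]

section \<open>Monic polynomials and adjoined roots\<close>

definition map_up :: "('a \<Rightarrow> 'b) \<Rightarrow> (nat \<Rightarrow> 'a) \<Rightarrow> nat \<Rightarrow> 'b" where
  "map_up h p = (\<lambda>m. h (p m))"

locale up_cring = cring R for R :: "('r, 'm) ring_scheme" (structure)
begin

sublocale P: cring "UP R"
  by (rule UP_cring.UP_cring[OF UP_cring.intro[OF is_cring]])

sublocale U: UP_cring R "UP R"
  by unfold_locales

lemma carrier_UP: "p \<in> carrier (UP R) \<longleftrightarrow> (\<forall>n. p n \<in> carrier R) \<and> (\<exists>N. \<forall>m\<ge>N. p m = \<zero>)"
proof
  assume p: "p \<in> carrier (UP R)"
  then obtain N where "bound \<zero> N p" "\<And>n. p n \<in> carrier R" by (auto simp: UP_def up_def)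
  then show "(\<forall>n. p n \<in> carrier R) \<and> (\<exists>N. \<forall>m\<ge>N. p m = \<zero>)"
    unfolding bound_def by (metis less_eq_Suc_le)
next
  assume "(\<forall>n. p n \<in> carrier R) \<and> (\<exists>N. \<forall>m\<ge>N. p m = \<zero>)"
  then show "p \<in> carrier (UP R)"
    unfolding UP_def up_def bound_def by (auto intro: less_imp_le)
qed

lemma coeff_UP: "p \<in> carrier (UP R) \<Longrightarrow> coeff (UP R) p = p"
  by (simp add: UP_def fun_eq_iff)

lemma UP_val [simp]: "p \<in> carrier (UP R) \<Longrightarrow> p n \<in> carrier R"
  by (simp add: carrier_UP)

lemma UP_fun:
  "p \<in> carrier (UP R) \<Longrightarrow> q \<in> carrier (UP R) \<Longrightarrow> (p \<oplus>\<^bsub>UP R\<^esub> q) n = p n \<oplus> q n"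
  "p \<in> carrier (UP R) \<Longrightarrow> q \<in> carrier (UP R) \<Longrightarrow> (p \<otimes>\<^bsub>UP R\<^esub> q) n = (\<Oplus>i\<in>{..n}. p i \<otimes> q (n - i))"
  "p \<in> carrier (UP R) \<Longrightarrow> q \<in> carrier (UP R) \<Longrightarrow> (p \<ominus>\<^bsub>UP R\<^esub> q) n = p n \<ominus> q n"
  "\<one>\<^bsub>UP R\<^esub> n = (if n = 0 then \<one> else \<zero>)" "\<zero>\<^bsub>UP R\<^esub> n = \<zero>"
  "a \<in> carrier R \<Longrightarrow> monom (UP R) a m n = (if n = m then a else \<zero>)"
  using U.coeff_add[of p q n] U.coeff_mult[of p q n] U.coeff_minus[of p q n]
    U.coeff_one[of n] U.coeff_zero[of n] U.coeff_monom[of a m n]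
  by (simp_all add: coeff_UP)

lemma UP_finsum_fun:
  assumes "finite A" "\<And>a. a \<in> A \<Longrightarrow> p a \<in> carrier (UP R)"
  shows "(\<Oplus>\<^bsub>UP R\<^esub>a\<in>A. p a) n = (\<Oplus>a\<in>A. p a n)"
proof -
  have 1: "(\<Oplus>\<^bsub>UP R\<^esub>a\<in>A. p a) \<in> carrier (UP R)" using assms by (intro P.finsum_closed) auto
  have "(\<Oplus>\<^bsub>UP R\<^esub>a\<in>A. p a) n = (\<Oplus>a\<in>A. coeff (UP R) (p a) n)"
    using U.coeff_finsum[of A p n] assms coeff_UP[OF 1] by (simp add: Pi_def)
  then show ?thesis using assms by (simp add: coeff_UP cong: finsum_cong)
qed

lemma UP_scal: "r \<in> carrier R \<Longrightarrow> scal (UP R) r = monom (UP R) r 0"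
  using U.monom_mult_is_smult[of r "\<one>\<^bsub>UP R\<^esub>"] by (simp add: scal_def)

lemma UP_alg: "comm_alg R (UP R)"
  unfolding comm_alg_def
proof (intro conjI ballI)
  show "cring R" "cring (UP R)" by (rule is_cring, rule P.is_cring)
  show "scal (UP R) \<in> ring_hom R (UP R)"
    using U.const_ring_hom UP_scal by (simp add: ring_hom_def Pi_def)
  fix r p assume "r \<in> carrier R" "p \<in> carrier (UP R)"
  then show "r \<odot>\<^bsub>UP R\<^esub> p = scal (UP R) r \<otimes>\<^bsub>UP R\<^esub> p"
    by (simp add: UP_scal U.monom_mult_is_smult)
qed

lemma UP_bounded_repr:
  assumes p: "p \<in> carrier (UP R)" and n: "\<And>m. m \<ge> n \<Longrightarrow> p m = \<zero>"
  shows "p = (\<Oplus>\<^bsub>UP R\<^esub>i\<in>{..<n}. monom (UP R) (p i) i)"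
proof
  fix m
  have "(\<Oplus>\<^bsub>UP R\<^esub>i\<in>{..<n}. monom (UP R) (p i) i) m = (\<Oplus>i\<in>{..<n}. if m = i then p i else \<zero>)"
    using p by (subst UP_finsum_fun) (auto simp: UP_fun cong: finsum_cong)
  also have "\<dots> = p m"
  proof (cases "m < n")
    case True
    then show ?thesis using p by (intro finsum_delta) auto
  next
    case False
    then show ?thesis using n by (subst add.finprod_one_eqI) auto
  qed
  finally show "p m = (\<Oplus>\<^bsub>UP R\<^esub>i\<in>{..<n}. monom (UP R) (p i) i) m" ..
qed

lemma monom_eq: "a \<in> carrier R \<Longrightarrow> monom (UP R) a n =
    monom (UP R) a 0 \<otimes>\<^bsub>UP R\<^esub> monom (UP R) \<one> 1 [^]\<^bsub>UP R\<^esub> n"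
  using U.monom_pow[of \<one> 1 n] U.monom_mult[of a \<one> 0 n] by simp

lemma UP_induct [consumes 1, case_names const X add mult]:
  assumes p: "p \<in> carrier (UP R)"
    and const: "\<And>r. r \<in> carrier R \<Longrightarrow> Q (monom (UP R) r 0)" and X: "Q (monom (UP R) \<one> 1)"
    and add: "\<And>p q. p \<in> carrier (UP R) \<Longrightarrow> q \<in> carrier (UP R) \<Longrightarrow> Q p \<Longrightarrow> Q q \<Longrightarrow> Q (p \<oplus>\<^bsub>UP R\<^esub> q)"
    and mult: "\<And>p q. p \<in> carrier (UP R) \<Longrightarrow> q \<in> carrier (UP R) \<Longrightarrow> Q p \<Longrightarrow> Q q \<Longrightarrow> Q (p \<otimes>\<^bsub>UP R\<^esub> q)"
  shows "Q p"
proof -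
  have zero: "Q \<zero>\<^bsub>UP R\<^esub>" and one: "Q \<one>\<^bsub>UP R\<^esub>"
    using const[of \<zero>] const[of \<one>] by simp_all
  have pow: "Q (monom (UP R) \<one> 1 [^]\<^bsub>UP R\<^esub> (n::nat))" for n
    by (induction n) (auto intro!: mult one X)
  have mon: "Q (monom (UP R) a n)" if "a \<in> carrier R" for a n
    using that by (subst monom_eq) (auto intro!: mult const pow)
  obtain N where N: "\<And>m. m \<ge> N \<Longrightarrow> p m = \<zero>" using p by (auto simp: carrier_UP)
  have "Q (\<Oplus>\<^bsub>UP R\<^esub>i\<in>J. monom (UP R) (p i) i)" if "finite J" for J
    using that
  proof (induction J rule: finite_induct)
    case (insert i J)
    have "Q (monom (UP R) (p i) i \<oplus>\<^bsub>UP R\<^esub> (\<Oplus>\<^bsub>UP R\<^esub>i\<in>J. monom (UP R) (p i) i))"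
      using insert p by (intro add mon) (auto intro!: P.finsum_closed)
    then show ?case using insert p by (subst P.finsum_insert) auto
  qed (simp add: zero)
  then show ?thesis using UP_bounded_repr[OF p N] by (metis finite_lessThan)
qed

lemma UP_hom_eq:
  assumes B: "cring B" and g: "g \<in> ring_hom (UP R) B" and h: "h \<in> ring_hom (UP R) B"
    and const: "\<And>r. r \<in> carrier R \<Longrightarrow> g (monom (UP R) r 0) = h (monom (UP R) r 0)"
    and X: "g (monom (UP R) \<one> 1) = h (monom (UP R) \<one> 1)" and p: "p \<in> carrier (UP R)"
  shows "g p = h p"
  using p
proof (induction rule: UP_induct)
  case (add p q)
  then show ?case using ring_hom_add[OF g, of p q] ring_hom_add[OF h, of p q] by simp
next
  case (mult p q)
  then show ?case using ring_hom_mult[OF g, of p q] ring_hom_mult[OF h, of p q] by simp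
qed (use const X in auto)

lemma eval_hom:
  assumes B: "cring B" and j: "j \<in> ring_hom R B" and b: "b \<in> carrier B"
  shows "eval R B j b \<in> ring_hom (UP R) B"
    "r \<in> carrier R \<Longrightarrow> eval R B j b (monom (UP R) r 0) = j r"
    "eval R B j b (monom (UP R) \<one> 1) = b"
proof -
  interpret E: UP_pre_univ_prop R B j "UP R" by (rule UP_pre_univ_propI[OF is_cring B j])
  show "eval R B j b \<in> ring_hom (UP R) B" "r \<in> carrier R \<Longrightarrow> eval R B j b (monom (UP R) r 0) = j r"
    "eval R B j b (monom (UP R) \<one> 1) = b"
    using E.eval_ring_hom[OF b] E.eval_const[OF b] E.eval_monom1[OF b] by auto
qed

lemma eval_hom_commute:
  assumes B: "cring B" and C: "cring C" and j: "j \<in> ring_hom R B" and b: "b \<in> carrier B"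
    and h: "h \<in> ring_hom B C" and p: "p \<in> carrier (UP R)"
  shows "h (eval R B j b p) = eval R C (h \<circ> j) (h b) p"
proof -
  have hj: "h \<circ> j \<in> ring_hom R C" using ring_hom_trans[OF j h] .
  have hb: "h b \<in> carrier C" using ring_hom_closed[OF h b] .
  have "(h \<circ> eval R B j b) p = eval R C (h \<circ> j) (h b) p"
    by (rule UP_hom_eq[OF C ring_hom_trans[OF eval_hom(1)[OF B j b] h] eval_hom(1)[OF C hj hb] _ _ p])
       (simp_all only: comp_apply eval_hom(2,3)[OF B j b] eval_hom(2,3)[OF C hj hb])
  then show ?thesis by simp
qed

end

context
  fixes R :: "('r, 'm) ring_scheme" and S :: "('s, 'n) ring_scheme" and h :: "'r \<Rightarrow> 's"
  assumes R: "cring R" and S: "cring S" and h: "h \<in> ring_hom R S"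
begin

interpretation R: up_cring R using R by (rule up_cring.intro)
interpretation S: up_cring S using S by (rule up_cring.intro)
interpretation h: ring_hom_cring R S h by (rule ring_hom_cringI[OF R S h])

lemma map_up_closed: "p \<in> carrier (UP R) \<Longrightarrow> map_up h p \<in> carrier (UP S)"
  unfolding R.carrier_UP S.carrier_UP map_up_def by force

lemma map_up_hom: "map_up h \<in> ring_hom (UP R) (UP S)"
proof (rule ring_hom_memI)
  show "map_up h \<one>\<^bsub>UP R\<^esub> = \<one>\<^bsub>UP S\<^esub>" by (auto simp: map_up_def R.UP_fun S.UP_fun)
  fix p q assume p: "p \<in> carrier (UP R)" and q: "q \<in> carrier (UP R)"
  note c = map_up_closed[OF p] map_up_closed[OF q]
  show "map_up h p \<in> carrier (UP S)" by fact
  show "map_up h (p \<oplus>\<^bsub>UP R\<^esub> q) = map_up h p \<oplus>\<^bsub>UP S\<^esub> map_up h q"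
  proof
    fix n
    show "map_up h (p \<oplus>\<^bsub>UP R\<^esub> q) n = (map_up h p \<oplus>\<^bsub>UP S\<^esub> map_up h q) n"
      using p q c by (simp add: S.UP_fun) (simp add: map_up_def R.UP_fun)
  qed
  show "map_up h (p \<otimes>\<^bsub>UP R\<^esub> q) = map_up h p \<otimes>\<^bsub>UP S\<^esub> map_up h q"
  proof
    fix n
    have "map_up h (p \<otimes>\<^bsub>UP R\<^esub> q) n = h (\<Oplus>\<^bsub>R\<^esub>i\<in>{..n}. p i \<otimes>\<^bsub>R\<^esub> q (n - i))"
      using p q by (simp add: map_up_def R.UP_fun)
    also have "\<dots> = (\<Oplus>\<^bsub>S\<^esub>i\<in>{..n}. map_up h p i \<otimes>\<^bsub>S\<^esub> map_up h q (n - i))"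
      using p q by (subst h.hom_finsum) (auto simp: map_up_def comp_def)
    also have "\<dots> = (map_up h p \<otimes>\<^bsub>UP S\<^esub> map_up h q) n"
      using c by (simp add: S.UP_fun)
    finally show "map_up h (p \<otimes>\<^bsub>UP R\<^esub> q) n = (map_up h p \<otimes>\<^bsub>UP S\<^esub> map_up h q) n" .
  qed
qed

lemma map_up_monom: "a \<in> carrier R \<Longrightarrow> map_up h (monom (UP R) a n) = monom (UP S) (h a) n"
  by (auto simp: map_up_def R.UP_fun S.UP_fun)

lemma eval_map_up:
  assumes B: "cring B" and j: "j \<in> ring_hom S B" and b: "b \<in> carrier B" and p: "p \<in> carrier (UP R)"
  shows "eval S B j b (map_up h p) = eval R B (j \<circ> h) b p"
proof -
  have jh: "j \<circ> h \<in> ring_hom R B" using ring_hom_trans[OF h j] .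
  have "(eval S B j b \<circ> map_up h) p = eval R B (j \<circ> h) b p"
    using R.UP_hom_eq[OF B ring_hom_trans[OF map_up_hom S.eval_hom(1)[OF B j b]] R.eval_hom(1)[OF B jh b] _ _ p]
      R.eval_hom(2,3)[OF B jh b] S.eval_hom(2,3)[OF B j b]
    by (simp add: map_up_monom)
  then show ?thesis by simp
qed

end

subsection \<open>Monic polynomials\<close>

definition lin_fac :: "('r, 'm) ring_scheme \<Rightarrow> 'r \<Rightarrow> nat \<Rightarrow> 'r" where
  "lin_fac R a = monom (UP R) \<one>\<^bsub>R\<^esub> 1 \<ominus>\<^bsub>UP R\<^esub> monom (UP R) a 0"

definition root_prod :: "('r, 'm) ring_scheme \<Rightarrow> 'l set \<Rightarrow> ('l \<Rightarrow> 'r) \<Rightarrow> nat \<Rightarrow> 'r" where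
  "root_prod R L y = (\<Otimes>\<^bsub>UP R\<^esub>l\<in>L. lin_fac R (y l))"

context up_cring
begin

lemma monic_iff: "monic_of_degree R n f \<longleftrightarrow> f \<in> carrier (UP R) \<and> f n = \<one> \<and> (\<forall>m>n. f m = \<zero>)"
  unfolding monic_of_degree_def using coeff_UP by auto

lemma monic_mult:
  assumes p: "monic_of_degree R m p" and q: "monic_of_degree R n q"
  shows "monic_of_degree R (m + n) (p \<otimes>\<^bsub>UP R\<^esub> q)"
proof -
  have P: "p \<in> carrier (UP R)" "p m = \<one>" "\<And>k. k > m \<Longrightarrow> p k = \<zero>"
    and Q: "q \<in> carrier (UP R)" "q n = \<one>" "\<And>k. k > n \<Longrightarrow> q k = \<zero>"
    using p q by (auto simp: monic_iff)
  have "(p \<otimes>\<^bsub>UP R\<^esub> q) k = \<zero>" if "k > m + n" for k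
  proof -
    have "(p \<otimes>\<^bsub>UP R\<^esub> q) k = (\<Oplus>i\<in>{..k}. p i \<otimes> q (k - i))" using P Q by (simp add: UP_fun)
    also have "\<dots> = \<zero>"
    proof (rule add.finprod_one_eqI)
      fix i assume "i \<in> {..k}"
      show "p i \<otimes> q (k - i) = \<zero>"
        using that P Q by (cases "i > m") auto
    qed
    finally show ?thesis .
  qed
  moreover have "(p \<otimes>\<^bsub>UP R\<^esub> q) (m + n) = \<one>"
  proof -
    have "(p \<otimes>\<^bsub>UP R\<^esub> q) (m + n) = (\<Oplus>i\<in>{..m + n}. p i \<otimes> q (m + n - i))" using P Q by (simp add: UP_fun)
    also have "\<dots> = (\<Oplus>i\<in>{..m + n}. if m = i then p i \<otimes> q (m + n - i) else \<zero>)"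
    proof (intro finsum_cong' refl)
      fix i
      show "p i \<otimes> q (m + n - i) = (if m = i then p i \<otimes> q (m + n - i) else \<zero>)"
        using P Q by (cases i m rule: linorder_cases) auto
    qed (use P Q in auto)
    also have "\<dots> = p m \<otimes> q (m + n - m)" using P Q by (intro finsum_delta) auto
    finally show ?thesis using P Q by simp
  qed
  ultimately show ?thesis using P Q by (simp add: monic_iff)
qed

lemma monic_one: "monic_of_degree R 0 \<one>\<^bsub>UP R\<^esub>"
  by (simp add: monic_iff UP_fun)

lemma lin_fac_closed [simp]: "a \<in> carrier R \<Longrightarrow> lin_fac R a \<in> carrier (UP R)"
  by (simp add: lin_fac_def)

lemma monic_lin_fac: "a \<in> carrier R \<Longrightarrow> monic_of_degree R 1 (lin_fac R a)"
  unfolding monic_iff by (auto simp: lin_fac_def UP_fun minus_eq)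

lemma root_prod_closed: "(\<And>l. l \<in> L \<Longrightarrow> y l \<in> carrier R) \<Longrightarrow> root_prod R L y \<in> carrier (UP R)"
  unfolding root_prod_def by (intro P.finprod_closed) auto

lemma monic_prod:
  assumes "finite I" "\<And>i. i \<in> I \<Longrightarrow> monic_of_degree R (d i) (F i)"
  shows "monic_of_degree R (\<Sum>i\<in>I. d i) (\<Otimes>\<^bsub>UP R\<^esub>i\<in>I. F i)"
  using assms
proof (induction I rule: finite_induct)
  case (insert i I)
  then have "monic_of_degree R (d i + (\<Sum>i\<in>I. d i)) (F i \<otimes>\<^bsub>UP R\<^esub> (\<Otimes>\<^bsub>UP R\<^esub>i\<in>I. F i))"
    by (intro monic_mult) auto
  then show ?case using insert by (subst P.finprod_insert) (auto simp: monic_iff)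
qed (simp add: monic_one)

lemma monic_root_prod:
  assumes "finite L" "\<And>l. l \<in> L \<Longrightarrow> y l \<in> carrier R"
  shows "monic_of_degree R (card L) (root_prod R L y)"
  using monic_prod[of L "\<lambda>_. 1" "\<lambda>l. lin_fac R (y l)"] assms monic_lin_fac by (simp add: root_prod_def)

text \<open>
  By induction on a bound \<open>N\<close> for the support of \<open>p\<close>: the multiple \<open>p\<^sub>N
  X\<^sup>N\<^sup>-\<^sup>n f\<close> removes the top coefficient. Bounding supports instead of degrees keeps the
  argument valid over rings with zero divisors.
\<close>

lemma monic_division:
  assumes f: "monic_of_degree R n f" and p: "p \<in> carrier (UP R)"
  shows "\<exists>q\<in>carrier (UP R). \<exists>r\<in>carrier (UP R). p = q \<otimes>\<^bsub>UP R\<^esub> f \<oplus>\<^bsub>UP R\<^esub> r \<and> (\<forall>m\<ge>n. r m = \<zero>)"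
proof -
  have F: "f \<in> carrier (UP R)" "f n = \<one>" "\<And>k. k > n \<Longrightarrow> f k = \<zero>" using f by (auto simp: monic_iff)
  obtain N where "\<forall>m\<ge>N. p m = \<zero>" using p by (auto simp: carrier_UP)
  then show ?thesis using p
  proof (induction N arbitrary: p)
    case 0
    have "p = \<zero>\<^bsub>UP R\<^esub> \<otimes>\<^bsub>UP R\<^esub> f \<oplus>\<^bsub>UP R\<^esub> p" using 0(2) by (simp add: F)
    then show ?case using 0 by blast
  next
    case (Suc N)
    show ?case
    proof (cases "N < n")
      case True
      have "p = \<zero>\<^bsub>UP R\<^esub> \<otimes>\<^bsub>UP R\<^esub> f \<oplus>\<^bsub>UP R\<^esub> p" using Suc.prems by (simp add: F)
      moreover have "\<forall>m\<ge>n. p m = \<zero>" using True Suc.prems by simp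
      ultimately show ?thesis using Suc.prems P.zero_closed by blast
    next
      case False
      define c where "c = monom (UP R) (p N) (N - n)"
      have c: "c \<in> carrier (UP R)" using Suc.prems by (simp add: c_def)
      define p' where "p' = p \<ominus>\<^bsub>UP R\<^esub> c \<otimes>\<^bsub>UP R\<^esub> f"
      have p': "p' \<in> carrier (UP R)" using Suc.prems c F by (simp add: p'_def)
      have "p' m = \<zero>" if "m \<ge> N" for m
      proof -
        have "m = (m - (N - n)) + (N - n)" using that False by simp
        then have "(c \<otimes>\<^bsub>UP R\<^esub> f) m = p N \<otimes> f (m - (N - n))"
          using U.coeff_monom_mult[of "p N" f "N - n" "m - (N - n)"] Suc.prems F c
          by (simp add: coeff_UP c_def)
        then show ?thesis using that False Suc.prems F c
          by (cases "m = N") (auto simp: p'_def UP_fun minus_eq r_neg)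
      qed
      then obtain q r where qr: "q \<in> carrier (UP R)" "r \<in> carrier (UP R)"
        "p' = q \<otimes>\<^bsub>UP R\<^esub> f \<oplus>\<^bsub>UP R\<^esub> r" "\<forall>m\<ge>n. r m = \<zero>"
        using Suc.IH[of p'] p' by blast
      have "p = p' \<oplus>\<^bsub>UP R\<^esub> c \<otimes>\<^bsub>UP R\<^esub> f"
        using Suc.prems c F by (simp add: p'_def P.minus_eq P.a_assoc P.l_neg)
      also have "\<dots> = (q \<oplus>\<^bsub>UP R\<^esub> c) \<otimes>\<^bsub>UP R\<^esub> f \<oplus>\<^bsub>UP R\<^esub> r"
        using qr c F by (simp add: P.l_distr P.a_ac)
      finally show ?thesis using qr c by blast
    qed
  qed
qed

text \<open>
  The top coefficient of \<open>q\<close> reappears as the top coefficient of \<open>q f\<close>, as that of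
  \<open>f\<close> is \<open>1\<close>. Hence remainders modulo \<open>f\<close> are unique.
\<close>

lemma monic_multiple_degree:
  assumes f: "monic_of_degree R n f" and q: "q \<in> carrier (UP R)"
    and 0: "\<And>m. m \<ge> n \<Longrightarrow> (q \<otimes>\<^bsub>UP R\<^esub> f) m = \<zero>"
  shows "q = \<zero>\<^bsub>UP R\<^esub>"
proof -
  have F: "f \<in> carrier (UP R)" "f n = \<one>" "\<And>k. k > n \<Longrightarrow> f k = \<zero>" using f by (auto simp: monic_iff)
  obtain N where "\<And>m. m \<ge> N \<Longrightarrow> q m = \<zero>" using q by (auto simp: carrier_UP)
  then have "\<forall>m. q m = \<zero>"
  proof (induction N)
    case (Suc N)
    have "(q \<otimes>\<^bsub>UP R\<^esub> f) (N + n) = (\<Oplus>i\<in>{..N + n}. if N = i then q i \<otimes> f (N + n - i) else \<zero>)"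
    proof -
      have "q i \<otimes> f (N + n - i) = (if N = i then q i \<otimes> f (N + n - i) else \<zero>)" for i
        using q F Suc.prems by (cases i N rule: linorder_cases) auto
      then show ?thesis using q F by (simp add: UP_fun cong: finsum_cong)
    qed
    also have "\<dots> = q N \<otimes> f (N + n - N)" using q F by (intro finsum_delta) auto
    also have "\<dots> = q N" using q F by simp
    finally have "q N = \<zero>" using 0[of "N + n"] by simp
    then have "\<And>m. m \<ge> N \<Longrightarrow> q m = \<zero>" using Suc.prems by (metis Suc_leI le_neq_implies_less)
    then show ?case by (rule Suc.IH)
  qed simp
  then show ?thesis by (auto simp: UP_fun)
qed

end

lemma map_up_lin_fac:
  assumes "cring R" "cring S" "h \<in> ring_hom R S" "a \<in> carrier R"
  shows "map_up h (lin_fac R a) = lin_fac S (h a)"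
proof -
  interpret R: up_cring R using assms by (intro up_cring.intro)
  interpret S: up_cring S using assms by (intro up_cring.intro)
  interpret h: ring_hom_cring R S h using assms by (intro ring_hom_cringI)
  interpret H: ring_hom_cring "UP R" "UP S" "map_up h"
    by (rule ring_hom_cringI[OF R.P.is_cring S.P.is_cring map_up_hom[OF assms(1-3)]])
  show ?thesis using assms
    by (simp add: lin_fac_def R.P.minus_eq S.P.minus_eq map_up_monom[OF assms(1-3)] del: One_nat_def)
qed

lemma map_up_root_prod:
  assumes "cring R" "cring S" "h \<in> ring_hom R S" "\<And>l. l \<in> L \<Longrightarrow> y l \<in> carrier R"
  shows "map_up h (root_prod R L y) = root_prod S L (\<lambda>l. h (y l))"
proof -
  interpret R: up_cring R using assms by (intro up_cring.intro)
  interpret S: up_cring S using assms by (intro up_cring.intro)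
  interpret H: ring_hom_cring "UP R" "UP S" "map_up h"
    by (rule ring_hom_cringI[OF R.P.is_cring S.P.is_cring map_up_hom[OF assms(1-3)]])
  show ?thesis unfolding root_prod_def using assms ring_hom_closed[OF assms(3)]
    by (subst H.hom_finprod) (auto simp: comp_def map_up_lin_fac[OF assms(1-3)] intro!: S.P.finprod_cong')
qed

lemma monic_map_up:
  assumes "cring R" "cring S" "h \<in> ring_hom R S" "monic_of_degree R n f"
  shows "monic_of_degree S n (map_up h f)"
proof -
  interpret R: up_cring R using assms by (intro up_cring.intro)
  interpret S: up_cring S using assms by (intro up_cring.intro)
  interpret h: ring_hom_cring R S h using assms by (intro ring_hom_cringI)
  show ?thesis using assms map_up_closed[OF assms(1-3)]
    unfolding R.monic_iff S.monic_iff by (auto simp: map_up_def)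
qed

lemma eval_root_prod:
  assumes "cring R" "finite L" "\<And>l. l \<in> L \<Longrightarrow> y l \<in> carrier R" "a \<in> carrier R"
  shows "eval R R id a (root_prod R L y) = (\<Otimes>\<^bsub>R\<^esub>l\<in>L. a \<ominus>\<^bsub>R\<^esub> y l)"
proof -
  interpret R: up_cring R using assms by (intro up_cring.intro)
  interpret E: ring_hom_cring "UP R" R "eval R R id a"
    by (rule ring_hom_cringI[OF R.P.is_cring assms(1) R.eval_hom(1)[OF assms(1) id_ring_hom assms(4)]])
  have "eval R R id a (lin_fac R b) = a \<ominus>\<^bsub>R\<^esub> b" if "b \<in> carrier R" for b
    using that R.eval_hom(2,3)[OF assms(1) id_ring_hom assms(4)]
    by (simp add: lin_fac_def R.P.minus_eq R.minus_eq)
  then show ?thesis unfolding root_prod_def using assms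
    by (subst E.hom_finprod) (auto simp: comp_def R.minus_closed intro!: R.finprod_cong')
qed

lemma eval_root_prod_zero:
  assumes "cring R" "finite L" "\<And>l. l \<in> L \<Longrightarrow> y l \<in> carrier R" "m \<in> L"
  shows "eval R R id (y m) (root_prod R L y) = \<zero>\<^bsub>R\<^esub>"
proof -
  interpret R: cring R by fact
  have L: "L = insert m (L - {m})" using assms by blast
  have "(\<Otimes>\<^bsub>R\<^esub>l\<in>insert m (L - {m}). y m \<ominus>\<^bsub>R\<^esub> y l) =
      (y m \<ominus>\<^bsub>R\<^esub> y m) \<otimes>\<^bsub>R\<^esub> (\<Otimes>\<^bsub>R\<^esub>l\<in>L - {m}. y m \<ominus>\<^bsub>R\<^esub> y l)"
    using assms by (intro R.finprod_insert) (auto intro: R.minus_closed)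
  also have "\<dots> = \<zero>\<^bsub>R\<^esub>" using assms by (simp add: R.minus_eq R.r_neg R.finprod_closed Pi_def)
  finally show ?thesis using eval_root_prod[of R L y "y m"] assms(1,2) L assms(3,4) by simp
qed

subsection \<open>Adjoining a root of a monic polynomial\<close>

locale adjoin = up_cring R for R :: "('r, 'm) ring_scheme" (structure) +
  fixes f :: "nat \<Rightarrow> 'r" and n :: nat
  assumes monic: "monic_of_degree R n f"
begin

abbreviation "A \<equiv> adjoin_root R f"
abbreviation "x \<equiv> root_of R f"
abbreviation "J \<equiv> PIdl\<^bsub>UP R\<^esub> f"
abbreviation "cls p \<equiv> J +>\<^bsub>UP R\<^esub> p"

lemma f_closed: "f \<in> carrier (UP R)" using monic by (simp add: monic_iff)

lemma J: "ideal J (UP R)" by (rule P.cgenideal_ideal[OF f_closed])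

lemmas Aprops = quot_alg_props[OF UP_alg J, folded adjoin_root_def]

lemma A_alg: "comm_alg R A" by (rule Aprops(1))

sublocale A: cring A using comm_algD[OF A_alg] by simp

lemma cls_closed: "p \<in> carrier (UP R) \<Longrightarrow> cls p \<in> carrier A"
  using ring_hom_closed[OF Aprops(2)] .

lemma x_def': "x = cls (monom (UP R) \<one> 1)" by (simp add: root_of_def)

lemma x_closed: "x \<in> carrier A" unfolding x_def' by (intro cls_closed) simp

lemma scal_A: "r \<in> carrier R \<Longrightarrow> scal A r = cls (monom (UP R) r 0)"
  using Aprops(4) UP_scal by simp

lemma scal_closed: "r \<in> carrier R \<Longrightarrow> scal A r \<in> carrier A" using comm_algD(4)[OF A_alg] .

lemma cls_eval: assumes "p \<in> carrier (UP R)" shows "cls p = eval R A (scal A) x p"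
proof -
  note e = eval_hom[OF A.is_cring comm_algD(3)[OF A_alg] x_closed]
  show ?thesis
    by (rule UP_hom_eq[OF A.is_cring Aprops(2) e(1) _ _ assms])
       (simp_all only: e(2,3) scal_A x_def'[symmetric])
qed

lemma J_iff: "p \<in> J \<longleftrightarrow> (\<exists>q\<in>carrier (UP R). p = q \<otimes>\<^bsub>UP R\<^esub> f)"
  unfolding cgenideal_def by blast

lemma cls_zero: assumes "p \<in> carrier (UP R)" shows "cls p = \<zero>\<^bsub>A\<^esub> \<longleftrightarrow> p \<in> J"
proof -
  interpret h: ring_hom_cring "UP R" A "\<lambda>p. cls p"
    by (rule ring_hom_cringI[OF P.is_cring A.is_cring Aprops(2)])
  have "cls p = cls \<zero>\<^bsub>UP R\<^esub> \<longleftrightarrow> p \<ominus>\<^bsub>UP R\<^esub> \<zero>\<^bsub>UP R\<^esub> \<in> J"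
    using assms by (intro Aprops(5)) auto
  then show ?thesis using assms h.hom_zero by (simp add: P.minus_eq)
qed

lemma eval_f: "eval R A (scal A) x f = \<zero>\<^bsub>A\<^esub>"
proof -
  have "f \<in> J" unfolding J_iff using f_closed by (intro bexI[of _ "\<one>\<^bsub>UP R\<^esub>"]) auto
  then show ?thesis using cls_zero[OF f_closed] cls_eval[OF f_closed] by simp
qed

lemma A_induct [consumes 1, case_names scal root add mult]:
  assumes a: "a \<in> carrier A"
    and sc: "\<And>r. r \<in> carrier R \<Longrightarrow> Q (scal A r)" and X: "Q x"
    and add: "\<And>a b. a \<in> carrier A \<Longrightarrow> b \<in> carrier A \<Longrightarrow> Q a \<Longrightarrow> Q b \<Longrightarrow> Q (a \<oplus>\<^bsub>A\<^esub> b)"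
    and mult: "\<And>a b. a \<in> carrier A \<Longrightarrow> b \<in> carrier A \<Longrightarrow> Q a \<Longrightarrow> Q b \<Longrightarrow> Q (a \<otimes>\<^bsub>A\<^esub> b)"
  shows "Q a"
proof -
  obtain p where p: "p \<in> carrier (UP R)" "a = cls p" using a Aprops(3) by auto
  from p(1) have "Q (cls p)"
  proof (induction rule: UP_induct)
    case (const r)
    then show ?case using sc scal_A by simp
  next
    case X
    show ?case using assms(3) by (simp add: x_def' del: One_nat_def)
  next
    case (add p q)
    then show ?case using ring_hom_add[OF Aprops(2) add(1,2)] assms(4) cls_closed by simp
  next
    case (mult p q)
    then show ?case using ring_hom_mult[OF Aprops(2) mult(1,2)] assms(5) cls_closed by simp
  qed
  then show ?thesis using p by simp
qed

lemma A_universal: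
  assumes B: "cring B" and j: "j \<in> ring_hom R B" and b: "b \<in> carrier B"
    and 0: "eval R B j b f = \<zero>\<^bsub>B\<^esub>"
  shows "\<exists>h\<in>ring_hom A B. (\<forall>r\<in>carrier R. h (scal A r) = j r) \<and> h x = b"
proof -
  interpret B: cring B by fact
  note e = eval_hom[OF B j b]
  have k: "eval R B j b u = \<zero>\<^bsub>B\<^esub>" if "u \<in> J" for u
  proof -
    have "\<exists>q\<in>carrier (UP R). u = q \<otimes>\<^bsub>UP R\<^esub> f" using that J_iff by simp
    then obtain q where q: "q \<in> carrier (UP R)" "u = q \<otimes>\<^bsub>UP R\<^esub> f" by (rule bexE)
    then show ?thesis using ring_hom_mult[OF e(1) q(1) f_closed] 0 ring_hom_closed[OF e(1) q(1)] by simp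
  qed
  obtain h where h: "h \<in> ring_hom A B" "\<And>p. p \<in> carrier (UP R) \<Longrightarrow> h (cls p) = eval R B j b p"
    using quot_alg_hom[OF UP_alg J B e(1) k] unfolding adjoin_root_def[symmetric] by blast
  have "h (scal A r) = j r" if "r \<in> carrier R" for r
    using that h(2)[of "monom (UP R) r 0"] e(2) by (simp add: scal_A)
  moreover have "h x = b" unfolding x_def' using h(2)[of "monom (UP R) \<one> 1"] e(3) by simp
  ultimately show ?thesis using h(1) by blast
qed

lemma cls_bounded:
  assumes p: "p \<in> carrier (UP R)" "\<And>m. m \<ge> n \<Longrightarrow> p m = \<zero>"
  shows "cls p = (\<Oplus>\<^bsub>A\<^esub>i\<in>{..<n}. scal A (p i) \<otimes>\<^bsub>A\<^esub> x [^]\<^bsub>A\<^esub> i)"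
proof -
  interpret h: ring_hom_cring "UP R" A "\<lambda>p. cls p"
    by (rule ring_hom_cringI[OF P.is_cring A.is_cring Aprops(2)])
  have "cls p = cls (\<Oplus>\<^bsub>UP R\<^esub>i\<in>{..<n}. monom (UP R) (p i) i)"
    by (rule arg_cong[OF UP_bounded_repr[OF p]])
  also have "\<dots> = (\<Oplus>\<^bsub>A\<^esub>i\<in>{..<n}. cls (monom (UP R) (p i) i))"
    using p by (subst h.hom_finsum) (auto simp: comp_def)
  also have "\<dots> = (\<Oplus>\<^bsub>A\<^esub>i\<in>{..<n}. scal A (p i) \<otimes>\<^bsub>A\<^esub> x [^]\<^bsub>A\<^esub> i)"
  proof (intro A.finsum_cong' refl)
    fix i
    have "monom (UP R) (p i) i = monom (UP R) (p i) 0 \<otimes>\<^bsub>UP R\<^esub> monom (UP R) \<one> 1 [^]\<^bsub>UP R\<^esub> i"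
      using p by (intro monom_eq) auto
    then show "cls (monom (UP R) (p i) i) = scal A (p i) \<otimes>\<^bsub>A\<^esub> x [^]\<^bsub>A\<^esub> i"
      using p by (simp add: scal_A x_def')
  qed (use p x_closed scal_closed in auto)
  finally show ?thesis .
qed

text \<open>
  The powers of \<open>x\<close> below \<open>n\<close> form a basis of \<open>R[x]/(f)\<close>: remainders after
  division by the monic polynomial \<open>f\<close> exist (here) and are unique (\<open>A_indep\<close>).
\<close>

lemma A_span:
  assumes "a \<in> carrier A"
  shows "\<exists>c. (\<forall>i. c i \<in> carrier R) \<and> a = (\<Oplus>\<^bsub>A\<^esub>i\<in>{..<n}. scal A (c i) \<otimes>\<^bsub>A\<^esub> x [^]\<^bsub>A\<^esub> i)"
proof -
  obtain p where p: "p \<in> carrier (UP R)" "a = cls p" using assms Aprops(3) by auto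
  obtain q r where qr: "q \<in> carrier (UP R)" "r \<in> carrier (UP R)"
     "p = q \<otimes>\<^bsub>UP R\<^esub> f \<oplus>\<^bsub>UP R\<^esub> r" "\<forall>m\<ge>n. r m = \<zero>" using monic_division[OF monic p(1)] by blast
  have "q \<otimes>\<^bsub>UP R\<^esub> f \<oplus>\<^bsub>UP R\<^esub> r \<ominus>\<^bsub>UP R\<^esub> r \<in> J"
    using qr f_closed J_iff by (auto simp: P.minus_eq P.a_assoc P.r_neg)
  then have "a = cls r" using p qr f_closed Aprops(5)[of p r] by simp
  then show ?thesis using cls_bounded[OF qr(2)] qr(2,4) by (intro exI[of _ r]) auto
qed

lemma A_indep:
  assumes c: "\<And>i. i < n \<Longrightarrow> c i \<in> carrier R"
    and 0: "(\<Oplus>\<^bsub>A\<^esub>i\<in>{..<n}. scal A (c i) \<otimes>\<^bsub>A\<^esub> x [^]\<^bsub>A\<^esub> i) = \<zero>\<^bsub>A\<^esub>" and i: "i < n"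
  shows "c i = \<zero>"
proof -
  define p where "p m = (if m < n then c m else \<zero>)" for m
  have p: "p \<in> carrier (UP R)" "\<And>m. m \<ge> n \<Longrightarrow> p m = \<zero>"
    unfolding carrier_UP using c by (auto simp: p_def intro!: exI[of _ n])
  have "cls p = (\<Oplus>\<^bsub>A\<^esub>i\<in>{..<n}. scal A (c i) \<otimes>\<^bsub>A\<^esub> x [^]\<^bsub>A\<^esub> i)"
    unfolding cls_bounded[OF p(1), OF p(2), simplified] using c x_closed scal_closed
    by (intro A.finsum_cong' refl) (auto simp: p_def)
  then have "p \<in> J" using 0 cls_zero[OF p(1)] by simp
  then obtain q where q: "q \<in> carrier (UP R)" "p = q \<otimes>\<^bsub>UP R\<^esub> f" using J_iff by blast
  have "q = \<zero>\<^bsub>UP R\<^esub>" using monic_multiple_degree[OF monic q(1)] p(2) q(2) by simp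
  then have "p = \<zero>\<^bsub>UP R\<^esub>" using q f_closed by simp
  then have "p i = \<zero>" by (simp add: UP_fun)
  then show ?thesis using i by (simp add: p_def)
qed

end

lemma adjoinI: "cring R \<Longrightarrow> monic_of_degree R n f \<Longrightarrow> adjoin R f n"
  by (intro adjoin.intro up_cring.intro adjoin_axioms.intro)

section \<open>Elementary symmetric polynomials\<close>

definition esym :: "('r, 'm) ring_scheme \<Rightarrow> 'l set \<Rightarrow> ('l \<Rightarrow> 'r) \<Rightarrow> nat \<Rightarrow> 'r" where
  "esym R L y k = (\<Oplus>\<^bsub>R\<^esub>S\<in>{S. S \<subseteq> L \<and> card S = k}. \<Otimes>\<^bsub>R\<^esub>i\<in>S. y i)"

context up_cring
begin

lemma finite_subsets: "finite L \<Longrightarrow> finite {S. S \<subseteq> L \<and> card S = k}"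
  by (rule finite_subset[of _ "Pow L"]) auto

lemma esym_0: assumes "finite L" shows "esym R L y 0 = \<one>"
proof -
  have "{S. S \<subseteq> L \<and> card S = 0} = {{}}" using assms finite_subset by fastforce
  then show ?thesis by (simp add: esym_def finsum_insert)
qed

lemma esym_insert:
  assumes L: "finite L" "a \<notin> L" and y: "\<And>l. l \<in> insert a L \<Longrightarrow> y l \<in> carrier R"
  shows "esym R (insert a L) y (Suc k) = esym R L y (Suc k) \<oplus> y a \<otimes> esym R L y k"
proof -
  let ?S = "\<lambda>L k. {S. S \<subseteq> L \<and> card S = k}"
  let ?p = "\<lambda>S. \<Otimes>i\<in>S. y i"
  have fin: "finite S" if "S \<subseteq> L" for S using that L finite_subset by auto
  have "?S (insert a L) (Suc k) = ?S L (Suc k) \<union> insert a ` ?S L k" (is "?A = ?B")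
  proof
    show "?A \<subseteq> ?B"
    proof
      fix S assume S: "S \<in> ?A"
      show "S \<in> ?B"
      proof (cases "a \<in> S")
        case True
        then have "S = insert a (S - {a})" "S - {a} \<subseteq> L" "card (S - {a}) = k"
          using S by auto
        then show ?thesis by blast
      next
        case False
        then show ?thesis using S by auto
      qed
    qed
    show "?B \<subseteq> ?A" using L fin by (auto simp: card_insert_if)
  qed
  then have "esym R (insert a L) y (Suc k) = (\<Oplus>S\<in>?S L (Suc k) \<union> insert a ` ?S L k. ?p S)"
    by (simp add: esym_def)
  also have "\<dots> = (\<Oplus>S\<in>?S L (Suc k). ?p S) \<oplus> (\<Oplus>S\<in>insert a ` ?S L k. ?p S)"
    using L y finite_subsets[OF L(1)]
    by (intro finsum_Un_disjoint) (auto intro!: finprod_closed)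
  also have "(\<Oplus>S\<in>insert a ` ?S L k. ?p S) = (\<Oplus>S\<in>?S L k. ?p (insert a S))"
  proof (rule finsum_reindex)
    show "inj_on (insert a) (?S L k)"
      using L by (intro inj_onI) (metis (no_types, lifting) insert_ident subsetD mem_Collect_eq)
  qed (use y in \<open>auto intro!: finprod_closed\<close>)
  also have "\<dots> = (\<Oplus>S\<in>?S L k. y a \<otimes> ?p S)"
  proof (intro finsum_cong' refl)
    fix S assume "S \<in> ?S L k"
    then show "?p (insert a S) = y a \<otimes> ?p S"
      using L y fin[of S] by (intro finprod_insert) auto
  qed (use y in \<open>auto intro!: finprod_closed\<close>)
  also have "\<dots> = y a \<otimes> (\<Oplus>S\<in>?S L k. ?p S)"
    using y finite_subsets[OF L(1)] by (intro finsum_rdistr[symmetric]) (auto intro!: finprod_closed)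
  finally show ?thesis by (simp add: esym_def)
qed

lemma esym_large: assumes "finite L" "k > card L" shows "esym R L y k = \<zero>"
proof -
  have "{S. S \<subseteq> L \<and> card S = k} = {}" using assms card_mono by (auto simp: not_less[symmetric])
  then show ?thesis by (simp only: esym_def finsum_empty)
qed

lemma lin_fac_mult:
  assumes a: "a \<in> carrier R" and p: "p \<in> carrier (UP R)"
  shows "(lin_fac R a \<otimes>\<^bsub>UP R\<^esub> p) m = (case m of 0 \<Rightarrow> \<zero> | Suc i \<Rightarrow> p i) \<ominus> a \<otimes> p m"
proof -
  have "(monom (UP R) \<one> 1 \<otimes>\<^bsub>UP R\<^esub> p) m = (case m of 0 \<Rightarrow> \<zero> | Suc i \<Rightarrow> p i)"
  proof (cases m)
    case 0
    then show ?thesis using p by (simp add: UP_fun)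
  next
    case (Suc i)
    then show ?thesis using U.coeff_monom_mult[of \<one> p 1 i] p by (simp add: coeff_UP One_nat_def)
  qed
  moreover have "(monom (UP R) a 0 \<otimes>\<^bsub>UP R\<^esub> p) m = a \<otimes> p m"
    using U.coeff_monom_mult[of a p 0 m] a p by (simp add: coeff_UP)
  moreover have "lin_fac R a \<otimes>\<^bsub>UP R\<^esub> p = monom (UP R) \<one> 1 \<otimes>\<^bsub>UP R\<^esub> p \<ominus>\<^bsub>UP R\<^esub> monom (UP R) a 0 \<otimes>\<^bsub>UP R\<^esub> p"
    using a p by (simp add: lin_fac_def P.minus_eq P.l_distr P.l_minus)
  ultimately show ?thesis using a p by (simp add: UP_fun)
qed

text \<open>
  The elementary symmetric polynomials and the coefficients of the product satisfy the same recursion when an element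
  is added to \<open>L\<close>: \<open>esym_insert\<close> splits the subsets by whether they contain it,
  \<open>lin_fac_mult\<close> multiplies by \<open>X - y\<^sub>a\<close>.
\<close>

lemma vieta:
  assumes "finite L" "\<And>l. l \<in> L \<Longrightarrow> y l \<in> carrier R" "k \<le> card L"
  shows "esym R L y k = (\<ominus> \<one>) [^] k \<otimes> root_prod R L y (card L - k)"
  using assms
proof (induction L arbitrary: k rule: finite_induct)
  case empty
  then show ?case by (simp add: esym_0 root_prod_def UP_fun)
next
  case (insert a L)
  let ?p = "root_prod R L y"
  have ya: "y a \<in> carrier R" and p: "?p \<in> carrier (UP R)" using insert.prems by (auto intro: root_prod_closed)
  have ip: "root_prod R (insert a L) y = lin_fac R (y a) \<otimes>\<^bsub>UP R\<^esub> ?p"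
    unfolding root_prod_def using insert by (subst P.finprod_insert) auto
  show ?case
  proof (cases k)
    case 0
    have "root_prod R (insert a L) y (card (insert a L)) = \<one>"
      using monic_root_prod[of "insert a L" y] insert by (simp add: monic_iff)
    then show ?thesis using 0 insert by (simp add: esym_0)
  next
    case (Suc j)
    have j: "j \<le> card L" using Suc insert by simp
    let ?s = "(\<ominus> \<one>) [^] j"
    have s: "?s \<in> carrier R" "(\<ominus> \<one>) [^] k = \<ominus> ?s" using Suc by (auto simp: r_minus)
    have "esym R L y k = \<ominus> ?s \<otimes> (case card L - j of 0 \<Rightarrow> \<zero> | Suc i \<Rightarrow> ?p i)"
    proof (cases "j = card L")
      case True
      then show ?thesis using esym_large[of L k] Suc insert s by simp
    next
      case False
      then have "card L - j = Suc (card L - k)" using j Suc by simp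
      then show ?thesis using insert.IH[of k] insert.prems False j Suc s by simp
    qed
    moreover have "esym R L y j = ?s \<otimes> ?p (card L - j)" using insert.IH[of j] insert.prems j by simp
    moreover have "esym R (insert a L) y k = esym R L y k \<oplus> y a \<otimes> esym R L y j"
      unfolding Suc using insert by (intro esym_insert) auto
    moreover have "card (insert a L) - k = card L - j" using Suc insert by simp
    moreover have c: "(case card L - j of 0 \<Rightarrow> \<zero> | Suc i \<Rightarrow> ?p i) \<in> carrier R" using p by (simp split: nat.split)
    ultimately show ?thesis unfolding ip lin_fac_mult[OF ya p] s(2) using s(1) ya p
      by (simp add: minus_eq r_distr l_minus r_minus m_ac)
  qed
qed

end

section \<open>Determinants over commutative rings\<close>

declare atLeastAtMost_iff [simp del]

lemma carrier_sym_group: "carrier (sym_group n) = {p. p permutes {1..n}}"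
  by (simp add: sym_group_def)

context up_cring
begin

definition sg :: "(nat \<Rightarrow> nat) \<Rightarrow> 'r" where "sg \<pi> = (if evenperm \<pi> then \<one> else \<ominus> \<one>)"

lemma sg_closed [simp]: "sg \<pi> \<in> carrier R" by (simp add: sg_def)

lemma sg_comp:
  assumes "\<pi> permutes {1..n}" "\<rho> permutes {1..n}"
  shows "sg (\<pi> \<circ> \<rho>) = sg \<pi> \<otimes> sg \<rho>"
proof -
  have "permutation \<pi>" "permutation \<rho>" using assms permutation_permutes by blast+
  then show ?thesis by (auto simp: sg_def evenperm_comp l_minus r_minus)
qed

abbreviation "perms n \<equiv> {p. p permutes {1..n::nat}}"

lemma fin_perms: "finite (perms n)" by (intro finite_permutations) simp

lemma det_eq: "cring_det R n M = (\<Oplus>\<pi>\<in>perms n. sg \<pi> \<otimes> (\<Otimes>i\<in>{1..n}. M i (\<pi> i)))"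
  by (simp add: cring_det_def carrier_sym_group sg_def)

lemma perm_in: "\<pi> permutes {1..n} \<Longrightarrow> i \<in> {1..n} \<Longrightarrow> \<pi> i \<in> {1..n}"
  by (simp add: permutes_in_image)

lemma det_closed:
  assumes "\<And>i j. i \<in> {1..n} \<Longrightarrow> j \<in> {1..n} \<Longrightarrow> M i j \<in> carrier R"
  shows "cring_det R n M \<in> carrier R"
proof -
  have "M i (\<pi> i) \<in> carrier R" if "\<pi> permutes {1..n}" "i \<in> {1..n}" for \<pi> i
    using assms[OF that(2) perm_in[OF that]] .
  then show ?thesis unfolding det_eq by (intro finsum_closed) (auto intro!: finprod_closed m_closed)
qed

lemma det_cong:
  assumes "\<And>i j. i \<in> {1..n} \<Longrightarrow> j \<in> {1..n} \<Longrightarrow> N i j \<in> carrier R"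
    and "\<And>i j. i \<in> {1..n} \<Longrightarrow> j \<in> {1..n} \<Longrightarrow> M i j = N i j"
  shows "cring_det R n M = cring_det R n N"
proof -
  have "M i (\<pi> i) = N i (\<pi> i)" "N i (\<pi> i) \<in> carrier R" if "\<pi> permutes {1..n}" "i \<in> {1..n}" for \<pi> i
    using assms[OF that(2) perm_in[OF that]] by auto
  then show ?thesis unfolding det_eq
    by (intro finsum_cong' refl arg_cong2[where f="(\<otimes>)"] finprod_cong') (auto intro!: finprod_closed m_closed)
qed

text \<open>
  A permutation other than the identity moves some index up, where the matrix has a zero.
\<close>

lemma det_lower_triangular:
  assumes M: "\<And>i j. i \<in> {1..n} \<Longrightarrow> j \<in> {1..n} \<Longrightarrow> M i j \<in> carrier R"
    and 0: "\<And>i j. i \<in> {1..n} \<Longrightarrow> j \<in> {1..n} \<Longrightarrow> i < j \<Longrightarrow> M i j = \<zero>"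
  shows "cring_det R n M = (\<Otimes>i\<in>{1..n}. M i i)"
proof -
  have e: "M i (\<pi> i) \<in> carrier R" if "\<pi> permutes {1..n}" "i \<in> {1..n}" for \<pi> i
    using M[OF that(2) perm_in[OF that]] .
  have "(\<Oplus>\<pi>\<in>perms n. sg \<pi> \<otimes> (\<Otimes>i\<in>{1..n}. M i (\<pi> i))) = (\<Oplus>\<pi>\<in>{id}. sg \<pi> \<otimes> (\<Otimes>i\<in>{1..n}. M i (\<pi> i)))"
  proof (rule finsum_mono_neutral_cong_right)
    fix \<pi> assume "\<pi> \<in> perms n - {id}"
    then have \<pi>: "\<pi> permutes {1..n}" "\<pi> \<noteq> id" by auto
    then obtain i where i: "i \<in> {1..n}" "i < \<pi> i" using permutes_natset_le[of \<pi> "{1..n}"] by (metis not_le)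
    have "(\<Otimes>i\<in>insert i ({1..n} - {i}). M i (\<pi> i)) = M i (\<pi> i) \<otimes> (\<Otimes>i\<in>{1..n} - {i}. M i (\<pi> i))"
      using M perm_in[OF \<pi>(1)] i by (intro finprod_insert) auto
    also have "\<dots> = \<zero>"
      using M perm_in[OF \<pi>(1)] i 0[OF i(1), of "\<pi> i"] by (simp add: finprod_closed Pi_def)
    finally show "sg \<pi> \<otimes> (\<Otimes>i\<in>{1..n}. M i (\<pi> i)) = \<zero>" using i(1) by (simp add: insert_absorb)
  qed (use fin_perms permutes_id e in \<open>auto intro!: finprod_closed m_closed\<close>)
  also have "\<dots> = (\<Otimes>i\<in>{1..n}. M i i)"
  proof -
    have "(\<Otimes>i\<in>{1..n}. M i i) \<in> carrier R" using M by (intro finprod_closed) auto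
    then show ?thesis by (simp add: finsum_insert sg_def evenperm_id)
  qed
  finally show ?thesis by (simp add: det_eq)
qed

lemma prod_perm:
  assumes "\<rho> permutes {1..n}" "\<And>i. i \<in> {1..n} \<Longrightarrow> c i \<in> carrier R"
  shows "(\<Otimes>i\<in>{1..n}. c (\<rho> i)) = (\<Otimes>i\<in>{1..n}. c i)"
proof -
  have "(\<Otimes>i\<in>\<rho> ` {1..n}. c i) = (\<Otimes>i\<in>{1..n}. c (\<rho> i))"
    using assms permutes_inj_on[OF assms(1)] permutes_image[OF assms(1)] by (intro finprod_reindex) auto
  then show ?thesis using permutes_image[OF assms(1)] by simp
qed

text \<open>
  The transposition of two equal rows pairs each even permutation with an odd one that contributes the opposite term;
  this cancels the sum in every characteristic, also where \<open>2\<close> is a zero divisor.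
\<close>

lemma det_row_select_repeated:
  assumes Y: "\<And>i j. i \<in> {1..n} \<Longrightarrow> j \<in> {1..n} \<Longrightarrow> Y i j \<in> carrier R"
    and g: "g \<in> {1..n} \<rightarrow> {1..n}" and ab: "a \<in> {1..n}" "b \<in> {1..n}" "a \<noteq> b" "g a = g b"
  shows "(\<Oplus>\<pi>\<in>perms n. sg \<pi> \<otimes> (\<Otimes>i\<in>{1..n}. Y (g i) (\<pi> i))) = \<zero>"
proof -
  let ?\<tau> = "transpose a b"
  let ?P = "\<lambda>\<pi>. \<Otimes>i\<in>{1..n}. Y (g i) (\<pi> i)"
  let ?E = "{\<pi>\<in>perms n. evenperm \<pi>}" and ?O = "{\<pi>\<in>perms n. \<not> evenperm \<pi>}"
  have \<tau>: "?\<tau> permutes {1..n}" using ab by (intro permutes_swap_id)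
  have odd\<tau>: "\<not> evenperm ?\<tau>" using ab by (simp add: evenperm_swap)
  have perm: "permutation \<pi>" if "\<pi> permutes {1..n}" for \<pi> using that permutation_permutes by blast
  have P: "?P \<pi> \<in> carrier R" if "\<pi> permutes {1..n}" for \<pi>
    using Y g perm_in[OF that] by (intro finprod_closed) auto
  have inv: "?P (\<pi> \<circ> ?\<tau>) = ?P \<pi>" if "\<pi> permutes {1..n}" for \<pi>
  proof -
    have "g (?\<tau> i) = g i" for i using ab by (auto simp: transpose_def)
    then have "?P (\<pi> \<circ> ?\<tau>) = (\<Otimes>i\<in>{1..n}. Y (g (?\<tau> i)) (\<pi> (?\<tau> i)))" by simp
    also have "\<dots> = ?P \<pi>" using Y g perm_in[OF that] by (intro prod_perm \<tau>) auto
    finally show ?thesis .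
  qed
  have O: "?O = (\<lambda>\<pi>. \<pi> \<circ> ?\<tau>) ` ?E"
  proof
    show "(\<lambda>\<pi>. \<pi> \<circ> ?\<tau>) ` ?E \<subseteq> ?O"
      using perm \<tau> odd\<tau> by (auto simp: evenperm_comp permutes_compose)
    show "?O \<subseteq> (\<lambda>\<pi>. \<pi> \<circ> ?\<tau>) ` ?E"
    proof
      fix \<pi> assume "\<pi> \<in> ?O"
      then have "\<pi> \<circ> ?\<tau> \<in> ?E" "\<pi> = (\<pi> \<circ> ?\<tau>) \<circ> ?\<tau>"
        using perm \<tau> odd\<tau> by (auto simp: evenperm_comp permutes_compose comp_assoc)
      then show "\<pi> \<in> (\<lambda>\<pi>. \<pi> \<circ> ?\<tau>) ` ?E" by blast
    qed
  qed
  have inj: "inj_on (\<lambda>\<pi>. \<pi> \<circ> ?\<tau>) ?E"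
    by (rule inj_on_inverseI[of _ "\<lambda>\<pi>. \<pi> \<circ> ?\<tau>"]) (simp add: comp_assoc)
  have fE: "finite ?E" "finite ?O" using fin_perms by auto
  have EO: "?E \<union> ?O = perms n" "?E \<inter> ?O = {}" by auto
  have "(\<Oplus>\<pi>\<in>?E \<union> ?O. sg \<pi> \<otimes> ?P \<pi>) = (\<Oplus>\<pi>\<in>?E. sg \<pi> \<otimes> ?P \<pi>) \<oplus> (\<Oplus>\<pi>\<in>?O. sg \<pi> \<otimes> ?P \<pi>)"
    using fE P EO(2) by (intro finsum_Un_disjoint) auto
  also have "(\<Oplus>\<pi>\<in>?E. sg \<pi> \<otimes> ?P \<pi>) = (\<Oplus>\<pi>\<in>?E. ?P \<pi>)"
    using P by (intro finsum_cong') (auto simp: sg_def)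
  also have "(\<Oplus>\<pi>\<in>?O. sg \<pi> \<otimes> ?P \<pi>) = (\<Oplus>\<pi>\<in>?O. \<ominus> ?P \<pi>)"
    using P by (intro finsum_cong') (auto simp: sg_def l_minus)
  also have "\<dots> = (\<Oplus>\<pi>\<in>?E. \<ominus> ?P (\<pi> \<circ> ?\<tau>))"
    unfolding O using P[OF permutes_compose[OF \<tau>]] inj by (intro finsum_reindex) (auto simp: comp_def)
  also have "\<dots> = (\<Oplus>\<pi>\<in>?E. \<ominus> ?P \<pi>)"
    using P by (intro finsum_cong') (auto simp: inv[unfolded comp_def] comp_def)
  also have "(\<Oplus>\<pi>\<in>?E. ?P \<pi>) \<oplus> (\<Oplus>\<pi>\<in>?E. \<ominus> ?P \<pi>) = (\<Oplus>\<pi>\<in>?E. ?P \<pi> \<oplus> \<ominus> ?P \<pi>)"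
    using P fE by (intro finsum_addf[symmetric]) auto
  also have "\<dots> = \<zero>" using P by (intro add.finprod_one_eqI) (auto simp: r_neg)
  finally show ?thesis unfolding EO(1) .
qed

lemma det_row_select_perm:
  assumes Y: "\<And>i j. i \<in> {1..n} \<Longrightarrow> j \<in> {1..n} \<Longrightarrow> Y i j \<in> carrier R" and \<rho>: "\<rho> permutes {1..n}"
  shows "(\<Oplus>\<pi>\<in>perms n. sg \<pi> \<otimes> (\<Otimes>i\<in>{1..n}. Y (\<rho> i) (\<pi> i))) = sg \<rho> \<otimes> cring_det R n Y"
proof -
  have im: "(\<lambda>\<pi>. \<pi> \<circ> \<rho>) ` perms n = perms n"
  proof
    show "(\<lambda>\<pi>. \<pi> \<circ> \<rho>) ` perms n \<subseteq> perms n" using \<rho> by (auto intro: permutes_compose)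
    show "perms n \<subseteq> (\<lambda>\<pi>. \<pi> \<circ> \<rho>) ` perms n"
    proof
      fix \<pi> assume "\<pi> \<in> perms n"
      then have "\<pi> \<circ> inv_into UNIV \<rho> \<in> perms n" "\<pi> = (\<pi> \<circ> inv_into UNIV \<rho>) \<circ> \<rho>"
        using permutes_compose[OF permutes_inv[OF \<rho>]] \<rho> by (auto simp: comp_assoc permutes_inv_o)
      then show "\<pi> \<in> (\<lambda>\<pi>. \<pi> \<circ> \<rho>) ` perms n" by blast
    qed
  qed
  have inj: "inj_on (\<lambda>\<pi>. \<pi> \<circ> \<rho>) (perms n)"
    by (rule inj_on_inverseI[of _ "\<lambda>\<pi>. \<pi> \<circ> inv_into UNIV \<rho>"]) (simp add: comp_assoc permutes_inv_o[OF \<rho>])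
  have c: "(\<Otimes>i\<in>{1..n}. Y i (\<pi> i)) \<in> carrier R" if "\<pi> permutes {1..n}" for \<pi>
    using Y perm_in[OF that] by (intro finprod_closed) auto
  have c': "(\<Otimes>i\<in>{1..n}. Y (\<rho> i) (\<pi> i)) \<in> carrier R" if "\<pi> permutes {1..n}" for \<pi>
    using Y perm_in[OF that] perm_in[OF \<rho>] by (intro finprod_closed) auto
  have "(\<Oplus>\<pi>\<in>(\<lambda>\<pi>. \<pi> \<circ> \<rho>) ` perms n. sg \<pi> \<otimes> (\<Otimes>i\<in>{1..n}. Y (\<rho> i) (\<pi> i))) =
      (\<Oplus>\<pi>\<in>perms n. sg (\<pi> \<circ> \<rho>) \<otimes> (\<Otimes>i\<in>{1..n}. Y (\<rho> i) ((\<pi> \<circ> \<rho>) i)))"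
    using inj c' unfolding im by (subst im[symmetric], intro finsum_reindex) (auto simp: im)
  also have "\<dots> = (\<Oplus>\<pi>\<in>perms n. sg \<rho> \<otimes> (sg \<pi> \<otimes> (\<Otimes>i\<in>{1..n}. Y i (\<pi> i))))"
  proof (intro finsum_cong' refl)
    fix \<pi> assume "\<pi> \<in> perms n"
    then have \<pi>: "\<pi> permutes {1..n}" by simp
    have "(\<Otimes>i\<in>{1..n}. Y (\<rho> i) ((\<pi> \<circ> \<rho>) i)) = (\<Otimes>i\<in>{1..n}. Y i (\<pi> i))"
      using prod_perm[OF \<rho>, of "\<lambda>i. Y i (\<pi> i)"] Y perm_in[OF \<pi>] by simp
    then show "sg (\<pi> \<circ> \<rho>) \<otimes> (\<Otimes>i\<in>{1..n}. Y (\<rho> i) ((\<pi> \<circ> \<rho>) i)) = sg \<rho> \<otimes> (sg \<pi> \<otimes> (\<Otimes>i\<in>{1..n}. Y i (\<pi> i)))"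
      using sg_comp[OF \<pi> \<rho>] c[OF \<pi>] by (simp add: m_ac)
  qed (use c in auto)
  also have "\<dots> = sg \<rho> \<otimes> cring_det R n Y"
    unfolding det_eq using c fin_perms by (intro finsum_rdistr[symmetric]) auto
  finally show ?thesis unfolding im .
qed

text \<open>
  Expanding all entries of the product gives a sum over the maps \<open>g\<close> that choose for each row of
  \<open>X\<close> a row of \<open>Y\<close>. The maps that are not injective contribute zero, and the permutations
  contribute \<open>det Y\<close> up to sign.
\<close>

lemma det_mult:
  assumes X: "\<And>i j. i \<in> {1..n} \<Longrightarrow> j \<in> {1..n} \<Longrightarrow> X i j \<in> carrier R"
    and Y: "\<And>i j. i \<in> {1..n} \<Longrightarrow> j \<in> {1..n} \<Longrightarrow> Y i j \<in> carrier R"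
  shows "cring_det R n (\<lambda>i j. \<Oplus>l\<in>{1..n}. X i l \<otimes> Y l j) = cring_det R n X \<otimes> cring_det R n Y"
proof -
  let ?I = "{1..n}" and ?G = "{1..n} \<rightarrow>\<^sub>E {1..n}"
  let ?D = "\<lambda>g. \<Oplus>\<pi>\<in>perms n. sg \<pi> \<otimes> (\<Otimes>i\<in>?I. Y (g i) (\<pi> i))"
  have fG: "finite ?G" by (intro finite_PiE) auto
  have gi: "g i \<in> ?I" if "g \<in> ?G" "i \<in> ?I" for g i using that by auto
  have px: "(\<Otimes>i\<in>?I. X i (g i)) \<in> carrier R" if "g \<in> ?G" for g
    using X gi[OF that] by (intro finprod_closed) auto
  have py: "(\<Otimes>i\<in>?I. Y (g i) (\<pi> i)) \<in> carrier R" if "g \<in> ?I \<rightarrow> ?I" "\<pi> permutes ?I" for g \<pi>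
    using Y perm_in[OF that(2)] that(1) by (intro finprod_closed) auto
  have D: "?D g \<in> carrier R" if "g \<in> ?I \<rightarrow> ?I" for g using py[OF that] by (intro finsum_closed) auto
  have eX: "X i (\<pi> i) \<in> carrier R" if "\<pi> permutes ?I" "i \<in> ?I" for \<pi> i
    using X[OF that(2) perm_in[OF that]] .
  have "cring_det R n (\<lambda>i j. \<Oplus>l\<in>?I. X i l \<otimes> Y l j) =
     (\<Oplus>\<pi>\<in>perms n. \<Oplus>g\<in>?G. (\<Otimes>i\<in>?I. X i (g i)) \<otimes> (sg \<pi> \<otimes> (\<Otimes>i\<in>?I. Y (g i) (\<pi> i))))"
    unfolding det_eq
  proof (intro finsum_cong' refl)
    fix \<pi> assume "\<pi> \<in> perms n"
    then have \<pi>: "\<pi> permutes ?I" by simp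
    have "(\<Otimes>i\<in>?I. \<Oplus>l\<in>?I. X i l \<otimes> Y l (\<pi> i)) = (\<Oplus>g\<in>?G. \<Otimes>i\<in>?I. X i (g i) \<otimes> Y (g i) (\<pi> i))"
      using X Y perm_in[OF \<pi>] by (intro finprod_finsum_distrib) auto
    also have "\<dots> = (\<Oplus>g\<in>?G. (\<Otimes>i\<in>?I. X i (g i)) \<otimes> (\<Otimes>i\<in>?I. Y (g i) (\<pi> i)))"
      using X Y perm_in[OF \<pi>] gi px py \<pi>
      by (intro finsum_cong' refl finprod_multf) (auto simp: PiE_def)
    finally have 1: "(\<Otimes>i\<in>?I. \<Oplus>l\<in>?I. X i l \<otimes> Y l (\<pi> i)) =
      (\<Oplus>g\<in>?G. (\<Otimes>i\<in>?I. X i (g i)) \<otimes> (\<Otimes>i\<in>?I. Y (g i) (\<pi> i)))" .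
    have "sg \<pi> \<otimes> (\<Otimes>i\<in>?I. \<Oplus>l\<in>?I. X i l \<otimes> Y l (\<pi> i)) =
      (\<Oplus>g\<in>?G. sg \<pi> \<otimes> ((\<Otimes>i\<in>?I. X i (g i)) \<otimes> (\<Otimes>i\<in>?I. Y (g i) (\<pi> i))))"
      unfolding 1 using px py \<pi> fG by (intro finsum_rdistr) (auto simp: PiE_def)
    also have "\<dots> = (\<Oplus>g\<in>?G. (\<Otimes>i\<in>?I. X i (g i)) \<otimes> (sg \<pi> \<otimes> (\<Otimes>i\<in>?I. Y (g i) (\<pi> i))))"
      using px py \<pi> by (intro finsum_cong' refl) (auto simp: PiE_def m_ac)
    finally show "sg \<pi> \<otimes> (\<Otimes>i\<in>?I. \<Oplus>l\<in>?I. X i l \<otimes> Y l (\<pi> i)) = \<dots>" .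
  qed (use px py in \<open>auto intro!: finsum_closed m_closed simp: PiE_def\<close>)
  also have "\<dots> = (\<Oplus>g\<in>?G. \<Oplus>\<pi>\<in>perms n. (\<Otimes>i\<in>?I. X i (g i)) \<otimes> (sg \<pi> \<otimes> (\<Otimes>i\<in>?I. Y (g i) (\<pi> i))))"
    using px py fG fin_perms by (intro finsum_swap) (auto simp: PiE_def)
  also have "\<dots> = (\<Oplus>g\<in>?G. (\<Otimes>i\<in>?I. X i (g i)) \<otimes> ?D g)"
    using px py D fin_perms by (intro finsum_cong' refl finsum_rdistr[symmetric]) (auto simp: PiE_def)
  also have "\<dots> = (\<Oplus>g\<in>(\<lambda>\<rho>. restrict \<rho> ?I) ` perms n. (\<Otimes>i\<in>?I. X i (g i)) \<otimes> ?D g)"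
  proof (rule finsum_mono_neutral_cong_right[OF fG])
    show "(\<lambda>\<rho>. restrict \<rho> ?I) ` perms n \<subseteq> ?G" using perm_in by auto
    fix g assume g: "g \<in> ?G - (\<lambda>\<rho>. restrict \<rho> ?I) ` perms n"
    have "\<not> inj_on g ?I"
    proof
      assume "inj_on g ?I"
      then have bij: "bij_betw g ?I ?I"
        using g endo_inj_surj[of ?I g] by (auto simp: bij_betw_def PiE_def)
      let ?\<rho> = "\<lambda>i. if i \<in> ?I then g i else i"
      have "bij_betw ?\<rho> ?I ?I" using bij by (rule bij_betw_cong[THEN iffD1, rotated]) simp
      then have "?\<rho> permutes ?I" by (intro bij_imp_permutes) auto
      moreover have "restrict ?\<rho> ?I = g" using g by (auto simp: fun_eq_iff PiE_def extensional_def)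
      ultimately have "g \<in> (\<lambda>\<rho>. restrict \<rho> ?I) ` perms n" by (intro image_eqI[of _ _ ?\<rho>]) auto
      then show False using g by blast
    qed
    then obtain a b where "a \<in> ?I" "b \<in> ?I" "a \<noteq> b" "g a = g b" by (auto simp: inj_on_def)
    moreover have "g \<in> ?I \<rightarrow> ?I" using g by (auto simp: PiE_def)
    ultimately have "?D g = \<zero>" using Y by (intro det_row_select_repeated[of n Y g a b])
    then show "(\<Otimes>i\<in>?I. X i (g i)) \<otimes> ?D g = \<zero>" using px g by simp
  qed (use px D in \<open>auto simp: PiE_def\<close>)
  also have "\<dots> = (\<Oplus>\<rho>\<in>perms n. (\<Otimes>i\<in>?I. X i (restrict \<rho> ?I i)) \<otimes> ?D (restrict \<rho> ?I))"
  proof (rule finsum_reindex)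
    show "(\<lambda>g. (\<Otimes>i\<in>?I. X i (g i)) \<otimes> ?D g) \<in> (\<lambda>\<rho>. restrict \<rho> ?I) ` perms n \<rightarrow> carrier R"
    proof
      fix g assume "g \<in> (\<lambda>\<rho>. restrict \<rho> ?I) ` perms n"
      then have "g \<in> ?G" using perm_in by auto
      then show "(\<Otimes>i\<in>?I. X i (g i)) \<otimes> ?D g \<in> carrier R" using px D by (simp add: PiE_def)
    qed
    show "inj_on (\<lambda>\<rho>. restrict \<rho> ?I) (perms n)"
    proof (rule inj_onI)
      fix \<pi> \<rho> assume *: "\<pi> \<in> perms n" "\<rho> \<in> perms n" "restrict \<pi> ?I = restrict \<rho> ?I"
      show "\<pi> = \<rho>"
      proof
        fix i
        show "\<pi> i = \<rho> i"
        proof (cases "i \<in> ?I")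
          case True
          then show ?thesis using fun_cong[OF *(3), of i] by simp
        next
          case False
          then show ?thesis using *(1,2) by (auto simp: permutes_def)
        qed
      qed
    qed
  qed
  also have "\<dots> = (\<Oplus>\<rho>\<in>perms n. sg \<rho> \<otimes> (\<Otimes>i\<in>?I. X i (\<rho> i)) \<otimes> cring_det R n Y)"
  proof (intro finsum_cong' refl)
    fix \<rho> assume "\<rho> \<in> perms n"
    then have \<rho>: "\<rho> permutes ?I" by simp
    have 1: "(\<Otimes>i\<in>?I. X i (restrict \<rho> ?I i)) = (\<Otimes>i\<in>?I. X i (\<rho> i))"
      using X perm_in[OF \<rho>] by (intro finprod_cong') auto
    have 2: "(\<Otimes>i\<in>?I. X i (\<rho> i)) \<in> carrier R" using X perm_in[OF \<rho>] by (intro finprod_closed) auto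
    have e: "Y (\<rho> i) (\<pi> i) \<in> carrier R" if "\<pi> permutes ?I" "i \<in> ?I" for \<pi> i
      using Y[OF perm_in[OF \<rho> that(2)] perm_in[OF that]] .
    have "?D (restrict \<rho> ?I) = ?D \<rho>"
      using e
      by (intro finsum_cong' refl arg_cong2[where f="(\<otimes>)"] finprod_cong') (auto intro!: finprod_closed m_closed)
    also have "\<dots> = sg \<rho> \<otimes> cring_det R n Y" by (rule det_row_select_perm[OF Y \<rho>])
    finally show "(\<Otimes>i\<in>?I. X i (restrict \<rho> ?I i)) \<otimes> ?D (restrict \<rho> ?I) =
        sg \<rho> \<otimes> (\<Otimes>i\<in>?I. X i (\<rho> i)) \<otimes> cring_det R n Y"
      using 1 2 det_closed[of n Y] Y by (simp add: m_ac)
  qed (use eX det_closed[of n Y] Y in \<open>auto intro!: finprod_closed m_closed\<close>)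
  also have "\<dots> = cring_det R n X \<otimes> cring_det R n Y"
    unfolding det_eq[of n X] using eX det_closed[of n Y] Y fin_perms
    by (intro finsum_ldistr[symmetric]) (auto intro!: finprod_closed m_closed)
  finally show ?thesis .
qed

end

lemma det_hom:
  assumes R: "cring R" and S: "cring S" and h: "h \<in> ring_hom R S"
    and M: "\<And>i j. i \<in> {1..n} \<Longrightarrow> j \<in> {1..n} \<Longrightarrow> M i j \<in> carrier R"
  shows "h (cring_det R n M) = cring_det S n (\<lambda>i j. h (M i j))"
proof -
  interpret R: up_cring R using R by (rule up_cring.intro)
  interpret S: up_cring S using S by (rule up_cring.intro)
  interpret h: ring_hom_cring R S h by (rule ring_hom_cringI[OF R S h])
  have c: "(\<Otimes>\<^bsub>R\<^esub>i\<in>{1..n}. M i (\<pi> i)) \<in> carrier R" if "\<pi> permutes {1..n}" for \<pi>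
    using M R.perm_in[OF that] by (intro R.finprod_closed) auto
  have c': "(\<Otimes>\<^bsub>S\<^esub>i\<in>{1..n}. h (M i (\<pi> i))) \<in> carrier S" if "\<pi> permutes {1..n}" for \<pi>
    using M R.perm_in[OF that] by (intro S.finprod_closed) auto
  have e: "h (\<Otimes>\<^bsub>R\<^esub>i\<in>{1..n}. M i (\<pi> i)) = (\<Otimes>\<^bsub>S\<^esub>i\<in>{1..n}. h (M i (\<pi> i)))" if "\<pi> permutes {1..n}" for \<pi>
    using M R.perm_in[OF that] by (subst h.hom_finprod) (auto simp: comp_def)
  have s: "h (R.sg \<pi>) = S.sg \<pi>" for \<pi> by (simp add: R.sg_def S.sg_def)
  have "h (cring_det R n M) = (\<Oplus>\<^bsub>S\<^esub>\<pi>\<in>R.perms n. h (R.sg \<pi> \<otimes>\<^bsub>R\<^esub> (\<Otimes>\<^bsub>R\<^esub>i\<in>{1..n}. M i (\<pi> i))))"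
    unfolding R.det_eq using c by (subst h.hom_finsum) (auto simp: comp_def)
  also have "\<dots> = cring_det S n (\<lambda>i j. h (M i j))"
    unfolding S.det_eq using c c' by (intro S.finsum_cong' refl) (auto simp: e s)
  finally show ?thesis .
qed

declare atLeastAtMost_iff [simp]

section \<open>Linear combinations and bases\<close>

definition lcomb :: "('r, 'a, 'p) module_scheme \<Rightarrow> nat \<Rightarrow> (nat \<Rightarrow> 'r) \<Rightarrow> (nat \<Rightarrow> 'a) \<Rightarrow> 'a" where
  "lcomb A n c b = (\<Oplus>\<^bsub>A\<^esub>i\<in>{1..n}. scal A (c i) \<otimes>\<^bsub>A\<^esub> b i)"

definition lin_indep :: "('r, 'm) ring_scheme \<Rightarrow> ('r, 'a, 'p) module_scheme \<Rightarrow> nat \<Rightarrow> (nat \<Rightarrow> 'a) \<Rightarrow> bool" where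
  "lin_indep R A n b \<longleftrightarrow> (\<forall>c c'. (\<forall>i\<in>{1..n}. c i \<in> carrier R \<and> c' i \<in> carrier R) \<longrightarrow>
     lcomb A n c b = lcomb A n c' b \<longrightarrow> (\<forall>i\<in>{1..n}. c i = c' i))"

definition lin_span :: "('r, 'm) ring_scheme \<Rightarrow> ('r, 'a, 'p) module_scheme \<Rightarrow> nat \<Rightarrow> (nat \<Rightarrow> 'a) \<Rightarrow> bool" where
  "lin_span R A n b \<longleftrightarrow> (\<forall>a\<in>carrier A. \<exists>c. (\<forall>i\<in>{1..n}. c i \<in> carrier R) \<and> a = lcomb A n c b)"

lemma lin_spanE:
  assumes "lin_span R A n b" "a \<in> carrier A"
  obtains c where "\<And>i. i \<in> {1..n} \<Longrightarrow> c i \<in> carrier R" "a = lcomb A n c b"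
  using assms unfolding lin_span_def by blast

lemma lin_indepD:
  assumes "lin_indep R A n b" "lcomb A n c b = lcomb A n c' b"
    and "\<And>i. i \<in> {1..n} \<Longrightarrow> c i \<in> carrier R" "\<And>i. i \<in> {1..n} \<Longrightarrow> c' i \<in> carrier R" "i \<in> {1..n}"
  shows "c i = c' i"
  using assms unfolding lin_indep_def by blast

locale comm_algebra = R: cring R + A: cring A
  for R :: "('r, 'm) ring_scheme" and A :: "('r, 'a, 'p) module_scheme" +
  assumes alg: "comm_alg R A"
begin

lemma scal_hom: "scal A \<in> ring_hom R A" using comm_algD(3)[OF alg] .

sublocale s: ring_hom_cring R A "scal A"
  by (rule ring_hom_cringI[OF R.is_cring A.is_cring scal_hom])

lemma lcomb_closed:
  "(\<And>i. i \<in> {1..n} \<Longrightarrow> c i \<in> carrier R) \<Longrightarrow> (\<And>i. i \<in> {1..n} \<Longrightarrow> b i \<in> carrier A) \<Longrightarrow> lcomb A n c b \<in> carrier A"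
  unfolding lcomb_def by (intro A.finsum_closed) auto

lemma lcomb_cong:
  assumes "\<And>i. i \<in> {1..n} \<Longrightarrow> c' i \<in> carrier R" "\<And>i. i \<in> {1..n} \<Longrightarrow> b' i \<in> carrier A"
    "\<And>i. i \<in> {1..n} \<Longrightarrow> c i = c' i" "\<And>i. i \<in> {1..n} \<Longrightarrow> b i = b' i"
  shows "lcomb A n c b = lcomb A n c' b'"
  unfolding lcomb_def using assms by (intro A.finsum_cong') auto

text \<open>
  The columns of \<open>Q\<close> are the coordinates of the \<open>b' l\<close>, so coordinates with respect to
  \<open>b'\<close> are transformed to coordinates with respect to \<open>b\<close> by multiplication with
  \<open>Q\<close>.
\<close>

lemma lcomb_lcomb:
  assumes v: "\<And>i. i \<in> {1..n} \<Longrightarrow> v i \<in> carrier R" and b: "\<And>i. i \<in> {1..n} \<Longrightarrow> b i \<in> carrier A"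
    and Q: "\<And>i l. i \<in> {1..n} \<Longrightarrow> l \<in> {1..n} \<Longrightarrow> Q i l \<in> carrier R"
    and b': "\<And>l. l \<in> {1..n} \<Longrightarrow> b' l = lcomb A n (\<lambda>i. Q i l) b"
  shows "lcomb A n v b' = lcomb A n (\<lambda>i. \<Oplus>\<^bsub>R\<^esub>l\<in>{1..n}. Q i l \<otimes>\<^bsub>R\<^esub> v l) b"
proof -
  have "lcomb A n v b' = (\<Oplus>\<^bsub>A\<^esub>l\<in>{1..n}. \<Oplus>\<^bsub>A\<^esub>i\<in>{1..n}. scal A (v l) \<otimes>\<^bsub>A\<^esub> (scal A (Q i l) \<otimes>\<^bsub>A\<^esub> b i))"
    unfolding lcomb_def
  proof (intro A.finsum_cong' refl)
    fix l assume l: "l \<in> {1..n}"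
    show "scal A (v l) \<otimes>\<^bsub>A\<^esub> b' l = (\<Oplus>\<^bsub>A\<^esub>i\<in>{1..n}. scal A (v l) \<otimes>\<^bsub>A\<^esub> (scal A (Q i l) \<otimes>\<^bsub>A\<^esub> b i))"
      unfolding b'[OF l] lcomb_def using l v Q b by (intro A.finsum_rdistr) auto
  qed (use v Q b in \<open>auto intro!: A.finsum_closed\<close>)
  also have "\<dots> = (\<Oplus>\<^bsub>A\<^esub>i\<in>{1..n}. \<Oplus>\<^bsub>A\<^esub>l\<in>{1..n}. scal A (v l) \<otimes>\<^bsub>A\<^esub> (scal A (Q i l) \<otimes>\<^bsub>A\<^esub> b i))"
    using v Q b by (intro A.finsum_swap) auto
  also have "\<dots> = lcomb A n (\<lambda>i. \<Oplus>\<^bsub>R\<^esub>l\<in>{1..n}. Q i l \<otimes>\<^bsub>R\<^esub> v l) b"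
    unfolding lcomb_def
  proof (intro A.finsum_cong' refl)
    fix i assume i: "i \<in> {1..n}"
    have "scal A (\<Oplus>\<^bsub>R\<^esub>l\<in>{1..n}. Q i l \<otimes>\<^bsub>R\<^esub> v l) \<otimes>\<^bsub>A\<^esub> b i =
        (\<Oplus>\<^bsub>A\<^esub>l\<in>{1..n}. scal A (Q i l) \<otimes>\<^bsub>A\<^esub> scal A (v l)) \<otimes>\<^bsub>A\<^esub> b i"
      using i v Q by (subst s.hom_finsum) (auto intro!: arg_cong2[where f="(\<otimes>\<^bsub>A\<^esub>)"] A.finsum_cong')
    also have "\<dots> = (\<Oplus>\<^bsub>A\<^esub>l\<in>{1..n}. scal A (Q i l) \<otimes>\<^bsub>A\<^esub> scal A (v l) \<otimes>\<^bsub>A\<^esub> b i)"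
      using i v Q b by (intro A.finsum_ldistr) auto
    also have "\<dots> = (\<Oplus>\<^bsub>A\<^esub>l\<in>{1..n}. scal A (v l) \<otimes>\<^bsub>A\<^esub> (scal A (Q i l) \<otimes>\<^bsub>A\<^esub> b i))"
      using i v Q b by (intro A.finsum_cong' refl) (auto simp: A.m_ac)
    finally show "(\<Oplus>\<^bsub>A\<^esub>l\<in>{1..n}. scal A (v l) \<otimes>\<^bsub>A\<^esub> (scal A (Q i l) \<otimes>\<^bsub>A\<^esub> b i)) =
      scal A (\<Oplus>\<^bsub>R\<^esub>l\<in>{1..n}. Q i l \<otimes>\<^bsub>R\<^esub> v l) \<otimes>\<^bsub>A\<^esub> b i" ..
  qed (use v Q b in \<open>auto intro!: R.finsum_closed\<close>)
  finally show ?thesis .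
qed

lemma lcomb_mult:
  assumes "\<And>i. i \<in> {1..n} \<Longrightarrow> c i \<in> carrier R" "\<And>i. i \<in> {1..n} \<Longrightarrow> b i \<in> carrier A" "a \<in> carrier A"
  shows "a \<otimes>\<^bsub>A\<^esub> lcomb A n c b = lcomb A n c (\<lambda>i. a \<otimes>\<^bsub>A\<^esub> b i)"
proof -
  have "a \<otimes>\<^bsub>A\<^esub> lcomb A n c b = (\<Oplus>\<^bsub>A\<^esub>i\<in>{1..n}. a \<otimes>\<^bsub>A\<^esub> (scal A (c i) \<otimes>\<^bsub>A\<^esub> b i))"
    unfolding lcomb_def using assms by (intro A.finsum_rdistr) auto
  also have "\<dots> = lcomb A n c (\<lambda>i. a \<otimes>\<^bsub>A\<^esub> b i)"
    unfolding lcomb_def using assms by (intro A.finsum_cong' refl) (auto simp: A.m_ac)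
  finally show ?thesis .
qed

lemma lcomb_unit:
  assumes "l \<in> {1..n}" "\<And>i. i \<in> {1..n} \<Longrightarrow> b i \<in> carrier A"
  shows "lcomb A n (\<lambda>i. if l = i then \<one>\<^bsub>R\<^esub> else \<zero>\<^bsub>R\<^esub>) b = b l"
proof -
  have "lcomb A n (\<lambda>i. if l = i then \<one>\<^bsub>R\<^esub> else \<zero>\<^bsub>R\<^esub>) b = (\<Oplus>\<^bsub>A\<^esub>i\<in>{1..n}. if l = i then b i else \<zero>\<^bsub>A\<^esub>)"
    unfolding lcomb_def using assms by (intro A.finsum_cong' refl) auto
  also have "\<dots> = b l" using assms by (intro A.finsum_delta) auto
  finally show ?thesis .
qed

lemma lin_indepI:
  assumes b: "\<And>i. i \<in> {1..n} \<Longrightarrow> b i \<in> carrier A"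
    and 0: "\<And>c i. (\<And>i. i \<in> {1..n} \<Longrightarrow> c i \<in> carrier R) \<Longrightarrow> lcomb A n c b = \<zero>\<^bsub>A\<^esub> \<Longrightarrow> i \<in> {1..n} \<Longrightarrow> c i = \<zero>\<^bsub>R\<^esub>"
  shows "lin_indep R A n b"
  unfolding lin_indep_def
proof (intro allI impI ballI)
  fix c c' i assume c: "\<forall>i\<in>{1..n}. c i \<in> carrier R \<and> c' i \<in> carrier R"
    and eq: "lcomb A n c b = lcomb A n c' b" and i: "i \<in> {1..n}"
  have "lcomb A n c b = (\<Oplus>\<^bsub>A\<^esub>i\<in>{1..n}. scal A (c i \<ominus>\<^bsub>R\<^esub> c' i) \<otimes>\<^bsub>A\<^esub> b i \<oplus>\<^bsub>A\<^esub> scal A (c' i) \<otimes>\<^bsub>A\<^esub> b i)"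
    unfolding lcomb_def using b c
    by (intro A.finsum_cong' refl)
       (auto simp: A.l_distr[symmetric] R.minus_eq R.a_assoc R.l_neg simp flip: s.hom_add)
  also have "\<dots> = lcomb A n (\<lambda>i. c i \<ominus>\<^bsub>R\<^esub> c' i) b \<oplus>\<^bsub>A\<^esub> lcomb A n c' b"
    unfolding lcomb_def using b c by (intro A.finsum_addf) (auto simp: R.minus_eq)
  finally have "lcomb A n (\<lambda>i. c i \<ominus>\<^bsub>R\<^esub> c' i) b = \<zero>\<^bsub>A\<^esub>"
    using eq b c lcomb_closed[of n c' b] lcomb_closed[of n "\<lambda>i. c i \<ominus>\<^bsub>R\<^esub> c' i" b]
    by (simp add: R.minus_closed) 
  then have "c i \<ominus>\<^bsub>R\<^esub> c' i = \<zero>\<^bsub>R\<^esub>" using c by (intro 0 i) (auto simp: R.minus_eq)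
  then show "c i = c' i" using c i R.sum_zero_eq_neg[of "c i" "\<ominus>\<^bsub>R\<^esub> c' i"] by (simp add: R.minus_eq)
qed

lemma smult_eq: "r \<in> carrier R \<Longrightarrow> a \<in> carrier A \<Longrightarrow> r \<odot>\<^bsub>A\<^esub> a = scal A r \<otimes>\<^bsub>A\<^esub> a"
  using comm_algD(5)[OF alg] .

lemma is_coords_iff:
  assumes b: "\<And>i. i \<in> {1..n} \<Longrightarrow> b i \<in> carrier A"
  shows "is_coords R A n b a c \<longleftrightarrow> c \<in> {1..n} \<rightarrow>\<^sub>E carrier R \<and> a = lcomb A n c b"
proof -
  have "(\<Oplus>\<^bsub>A\<^esub>i\<in>{1..n}. c i \<odot>\<^bsub>A\<^esub> b i) = lcomb A n c b" if "c \<in> {1..n} \<rightarrow>\<^sub>E carrier R"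
    unfolding lcomb_def using that b by (intro A.finsum_cong') (auto simp: smult_eq PiE_def Pi_def)
  then show ?thesis unfolding is_coords_def by auto
qed

lemma lcomb_restrict:
  assumes "\<And>i. i \<in> {1..n} \<Longrightarrow> c i \<in> carrier R" "\<And>i. i \<in> {1..n} \<Longrightarrow> b i \<in> carrier A"
  shows "lcomb A n (restrict c {1..n}) b = lcomb A n c b"
  using assms by (intro lcomb_cong) auto

lemma is_basis_iff:
  "is_basis R A n b \<longleftrightarrow> (\<forall>i\<in>{1..n}. b i \<in> carrier A) \<and> lin_indep R A n b \<and> lin_span R A n b"
proof
  assume B: "is_basis R A n b"
  then have b: "\<And>i. i \<in> {1..n} \<Longrightarrow> b i \<in> carrier A" by (auto simp: is_basis_def)
  have ex1: "\<exists>!c. c \<in> {1..n} \<rightarrow>\<^sub>E carrier R \<and> a = lcomb A n c b" if "a \<in> carrier A" for a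
  proof -
    have "is_coords R A n b a = (\<lambda>c. c \<in> {1..n} \<rightarrow>\<^sub>E carrier R \<and> a = lcomb A n c b)"
      by (rule ext) (rule is_coords_iff[OF b])
    moreover have "\<exists>!c. is_coords R A n b a c" using B that unfolding is_basis_def by blast
    ultimately show ?thesis by simp
  qed
  have "lin_indep R A n b"
    unfolding lin_indep_def
  proof (intro allI impI ballI)
    fix c c' i assume c: "\<forall>i\<in>{1..n}. c i \<in> carrier R \<and> c' i \<in> carrier R"
      and eq: "lcomb A n c b = lcomb A n c' b" and i: "i \<in> {1..n}"
    have 1: "restrict c {1..n} \<in> {1..n} \<rightarrow>\<^sub>E carrier R \<and> lcomb A n c b = lcomb A n (restrict c {1..n}) b"
      using c lcomb_restrict[of n c b] b by auto
    have 2: "restrict c' {1..n} \<in> {1..n} \<rightarrow>\<^sub>E carrier R \<and> lcomb A n c b = lcomb A n (restrict c' {1..n}) b"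
      unfolding eq using c lcomb_restrict[of n c' b] b by auto
    have "lcomb A n c b \<in> carrier A" using c b by (intro lcomb_closed) auto
    then have "restrict c {1..n} = restrict c' {1..n}" using ex1 1 2 by blast
    then show "c i = c' i" using i by (metis restrict_apply')
  qed
  moreover have "lin_span R A n b"
    unfolding lin_span_def
  proof
    fix a assume "a \<in> carrier A"
    from ex1[OF this] obtain c where "c \<in> {1..n} \<rightarrow>\<^sub>E carrier R" "a = lcomb A n c b" by blast
    then show "\<exists>c. (\<forall>i\<in>{1..n}. c i \<in> carrier R) \<and> a = lcomb A n c b"
      by (intro exI[of _ c] conjI ballI) (auto simp del: atLeastAtMost_iff)
  qed
  ultimately show "(\<forall>i\<in>{1..n}. b i \<in> carrier A) \<and> lin_indep R A n b \<and> lin_span R A n b" using b by blast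
next
  assume B: "(\<forall>i\<in>{1..n}. b i \<in> carrier A) \<and> lin_indep R A n b \<and> lin_span R A n b"
  then have b: "\<And>i. i \<in> {1..n} \<Longrightarrow> b i \<in> carrier A" by auto
  show "is_basis R A n b"
    unfolding is_basis_def
  proof (intro conjI ballI)
    show "b \<in> {1..n} \<rightarrow> carrier A" using b by auto
    fix a assume "a \<in> carrier A"
    then obtain c where c: "\<And>i. i \<in> {1..n} \<Longrightarrow> c i \<in> carrier R" "a = lcomb A n c b"
      using B unfolding lin_span_def by blast
    show "\<exists>!c. is_coords R A n b a c"
    proof (rule ex1I[of _ "restrict c {1..n}"])
      show "is_coords R A n b a (restrict c {1..n})"
        using c b lcomb_restrict[of n c b] by (subst is_coords_iff) auto
      fix c' assume "is_coords R A n b a c'"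
      then have c': "c' \<in> {1..n} \<rightarrow>\<^sub>E carrier R" "a = lcomb A n c' b" using is_coords_iff[of n b a c'] b by auto
      have "\<forall>i\<in>{1..n}. c i = c' i"
        using B c c' unfolding lin_indep_def by (auto simp: PiE_def Pi_def)
      then show "c' = restrict c {1..n}" using c' by (intro ext) (auto simp: PiE_def extensional_def)
    qed
  qed
qed

lemma mult_matrix_props:
  assumes B: "is_basis R A n b" and a: "a \<in> carrier A" and l: "l \<in> {1..n}"
  shows "i \<in> {1..n} \<Longrightarrow> mult_matrix R A n b a i l \<in> carrier R"
    and "a \<otimes>\<^bsub>A\<^esub> b l = lcomb A n (\<lambda>i. mult_matrix R A n b a i l) b"
proof -
  have b: "\<And>i. i \<in> {1..n} \<Longrightarrow> b i \<in> carrier A" using B by (auto simp: is_basis_def)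
  have "\<exists>!c. is_coords R A n b (a \<otimes>\<^bsub>A\<^esub> b l) c" using B a b l unfolding is_basis_def by simp
  from theI'[OF this] have "is_coords R A n b (a \<otimes>\<^bsub>A\<^esub> b l) (\<lambda>i. mult_matrix R A n b a i l)"
    by (simp add: mult_matrix_def)
  then show "i \<in> {1..n} \<Longrightarrow> mult_matrix R A n b a i l \<in> carrier R"
    "a \<otimes>\<^bsub>A\<^esub> b l = lcomb A n (\<lambda>i. mult_matrix R A n b a i l) b"
    using is_coords_iff[of n b] b by auto
qed

end

lemma comm_algebraI: "comm_alg R A \<Longrightarrow> comm_algebra R A"
  using comm_algD by (intro comm_algebra.intro comm_algebra_axioms.intro) auto

lemma lcomb_hom:
  assumes "comm_algebra R A" "comm_algebra K E" "h \<in> ring_hom A E"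
    and "\<And>r. r \<in> carrier R \<Longrightarrow> h (scal A r) = scal E (j r)"
    and "\<And>i. i \<in> {1..n} \<Longrightarrow> c i \<in> carrier R" "\<And>i. i \<in> {1..n} \<Longrightarrow> b i \<in> carrier A"
  shows "h (lcomb A n c b) = lcomb E n (\<lambda>i. j (c i)) (\<lambda>i. h (b i))"
proof -
  interpret A: comm_algebra R A by fact
  interpret E: comm_algebra K E by fact
  interpret h: ring_hom_cring A E h by (rule ring_hom_cringI[OF A.A.is_cring E.A.is_cring assms(3)])
  show ?thesis unfolding lcomb_def using assms(4-)
    by (subst h.hom_finsum) (auto simp: comp_def simp flip: assms(4) intro!: E.A.finsum_cong')
qed

context adjoin
begin

sublocale AA: comm_algebra R A by (rule comm_algebraI[OF A_alg])

abbreviation "pw i \<equiv> x [^]\<^bsub>A\<^esub> (i - 1 :: nat)"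

lemma pw_closed: "pw i \<in> carrier A" using x_closed by simp

lemma lcomb_pw:
  assumes "\<And>i. i \<in> {1..n} \<Longrightarrow> c i \<in> carrier R"
  shows "lcomb A n c (\<lambda>i. pw i) = (\<Oplus>\<^bsub>A\<^esub>i\<in>{..<n}. scal A (c (Suc i)) \<otimes>\<^bsub>A\<^esub> x [^]\<^bsub>A\<^esub> i)"
proof -
  have S: "{1..n} = Suc ` {..<n}" by (auto simp: image_Suc_lessThan)
  show ?thesis unfolding lcomb_def S using assms x_closed
    by (subst A.finsum_reindex) (auto simp: One_nat_def)
qed

lemma basis_pw: "is_basis R A n (\<lambda>i. pw i)"
  unfolding AA.is_basis_iff
proof (intro conjI ballI)
  show "\<And>i. pw i \<in> carrier A" by (rule pw_closed)
  show "lin_span R A n (\<lambda>i. pw i)"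
    unfolding lin_span_def
  proof
    fix a assume "a \<in> carrier A"
    then obtain c where c: "\<And>i. c i \<in> carrier R" "a = (\<Oplus>\<^bsub>A\<^esub>i\<in>{..<n}. scal A (c i) \<otimes>\<^bsub>A\<^esub> x [^]\<^bsub>A\<^esub> i)"
      using A_span by blast
    then show "\<exists>c. (\<forall>i\<in>{1..n}. c i \<in> carrier R) \<and> a = lcomb A n c (\<lambda>i. pw i)"
      using lcomb_pw[of "\<lambda>i. c (i - 1)"] by (intro exI[of _ "\<lambda>i. c (i - 1)"]) (auto simp: One_nat_def)
  qed
  show "lin_indep R A n (\<lambda>i. pw i)"
  proof (rule AA.lin_indepI)
    fix c i assume c: "\<And>i. i \<in> {1..n} \<Longrightarrow> c i \<in> carrier R" and 0: "lcomb A n c (\<lambda>i. pw i) = \<zero>\<^bsub>A\<^esub>"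
      and i: "i \<in> {1..n}"
    have "c (Suc (i - 1)) = \<zero>"
    proof (rule A_indep[of "\<lambda>i. c (Suc i)"])
      show "(\<Oplus>\<^bsub>A\<^esub>i\<in>{..<n}. scal A (c (Suc i)) \<otimes>\<^bsub>A\<^esub> x [^]\<^bsub>A\<^esub> i) = \<zero>\<^bsub>A\<^esub>"
        using lcomb_pw[OF c] 0 by simp
    qed (use c i in auto)
    then show "c i = \<zero>" using i by simp
  qed (rule pw_closed)
qed

end

section \<open>The characteristic polynomial of a multiplication\<close>

context up_cring
begin

abbreviation "cst a \<equiv> monom (UP R) a 0"
abbreviation "XX \<equiv> monom (UP R) \<one> 1"

definition charmat :: "(nat \<Rightarrow> nat \<Rightarrow> 'r) \<Rightarrow> nat \<Rightarrow> nat \<Rightarrow> nat \<Rightarrow> 'r" where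
  "charmat M i j = (if i = j then XX else \<zero>\<^bsub>UP R\<^esub>) \<ominus>\<^bsub>UP R\<^esub> cst (M i j)"

sublocale c: ring_hom_cring R "UP R" "\<lambda>a. monom (UP R) a 0"
  by (rule ring_hom_cringI[OF is_cring P.is_cring U.const_ring_hom])

lemma charmat_mult_cst:
  assumes M: "\<And>l. l \<in> {1..n} \<Longrightarrow> M i l \<in> carrier R" and V: "\<And>l. l \<in> {1..n} \<Longrightarrow> V l j \<in> carrier R" and i: "i \<in> {1..n}"
  shows "(\<Oplus>\<^bsub>UP R\<^esub>l\<in>{1..n}. charmat M i l \<otimes>\<^bsub>UP R\<^esub> cst (V l j)) =
     XX \<otimes>\<^bsub>UP R\<^esub> cst (V i j) \<ominus>\<^bsub>UP R\<^esub> cst (\<Oplus>l\<in>{1..n}. M i l \<otimes> V l j)"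
proof -
  have "(\<Oplus>\<^bsub>UP R\<^esub>l\<in>{1..n}. charmat M i l \<otimes>\<^bsub>UP R\<^esub> cst (V l j)) =
    (\<Oplus>\<^bsub>UP R\<^esub>l\<in>{1..n}. (if i = l then XX \<otimes>\<^bsub>UP R\<^esub> cst (V l j) else \<zero>\<^bsub>UP R\<^esub>) \<oplus>\<^bsub>UP R\<^esub> \<ominus>\<^bsub>UP R\<^esub> (cst (M i l \<otimes> V l j)))"
    using M V by (intro P.finsum_cong' refl)
      (auto simp: charmat_def P.minus_eq P.l_distr P.l_minus c.hom_mult simp del: U.monom_a_inv)
  also have "\<dots> = (\<Oplus>\<^bsub>UP R\<^esub>l\<in>{1..n}. if i = l then XX \<otimes>\<^bsub>UP R\<^esub> cst (V l j) else \<zero>\<^bsub>UP R\<^esub>) \<oplus>\<^bsub>UP R\<^esub>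
     (\<Oplus>\<^bsub>UP R\<^esub>l\<in>{1..n}. \<ominus>\<^bsub>UP R\<^esub> (cst (M i l \<otimes> V l j)))"
    using M V by (intro P.finsum_addf) auto
  also have "(\<Oplus>\<^bsub>UP R\<^esub>l\<in>{1..n}. if i = l then XX \<otimes>\<^bsub>UP R\<^esub> cst (V l j) else \<zero>\<^bsub>UP R\<^esub>) = XX \<otimes>\<^bsub>UP R\<^esub> cst (V i j)"
    using V i by (intro P.finsum_delta) auto
  also have "(\<Oplus>\<^bsub>UP R\<^esub>l\<in>{1..n}. \<ominus>\<^bsub>UP R\<^esub> (cst (M i l \<otimes> V l j))) = (\<Oplus>\<^bsub>UP R\<^esub>l\<in>{1..n}. \<ominus>\<^bsub>UP R\<^esub> \<one>\<^bsub>UP R\<^esub> \<otimes>\<^bsub>UP R\<^esub> cst (M i l \<otimes> V l j))"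
    using M V by (intro P.finsum_cong' refl) (auto simp: P.l_minus simp del: U.monom_a_inv c.hom_mult)
  also have "\<dots> = \<ominus>\<^bsub>UP R\<^esub> \<one>\<^bsub>UP R\<^esub> \<otimes>\<^bsub>UP R\<^esub> (\<Oplus>\<^bsub>UP R\<^esub>l\<in>{1..n}. cst (M i l \<otimes> V l j))"
    using M V by (intro P.finsum_rdistr[symmetric]) auto
  also have "(\<Oplus>\<^bsub>UP R\<^esub>l\<in>{1..n}. cst (M i l \<otimes> V l j)) = cst (\<Oplus>l\<in>{1..n}. M i l \<otimes> V l j)"
    using M V by (subst c.hom_finsum) (auto simp: comp_def)
  finally show ?thesis
    using M V finsum_closed[of "\<lambda>l. M i l \<otimes> V l j" "{1..n}"] by (simp add: P.minus_eq P.l_minus Pi_def del: U.monom_a_inv)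
qed

lemma cst_mult_charmat:
  assumes M: "\<And>l. l \<in> {1..n} \<Longrightarrow> M l j \<in> carrier R" and V: "\<And>l. l \<in> {1..n} \<Longrightarrow> V i l \<in> carrier R" and j: "j \<in> {1..n}"
  shows "(\<Oplus>\<^bsub>UP R\<^esub>l\<in>{1..n}. cst (V i l) \<otimes>\<^bsub>UP R\<^esub> charmat M l j) =
     XX \<otimes>\<^bsub>UP R\<^esub> cst (V i j) \<ominus>\<^bsub>UP R\<^esub> cst (\<Oplus>l\<in>{1..n}. V i l \<otimes> M l j)"
proof -
  have "(\<Oplus>\<^bsub>UP R\<^esub>l\<in>{1..n}. cst (V i l) \<otimes>\<^bsub>UP R\<^esub> charmat M l j) =
      (\<Oplus>\<^bsub>UP R\<^esub>l\<in>{1..n}. charmat (\<lambda>a b. M b a) j l \<otimes>\<^bsub>UP R\<^esub> cst (V i l))"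
    using M V by (intro P.finsum_cong' refl) (auto simp: charmat_def P.m_comm P.minus_closed)
  also have "\<dots> = XX \<otimes>\<^bsub>UP R\<^esub> cst (V i j) \<ominus>\<^bsub>UP R\<^esub> cst (\<Oplus>l\<in>{1..n}. M l j \<otimes> V i l)"
    using M V j by (intro charmat_mult_cst[where V = "\<lambda>a b. V i a" and M = "\<lambda>a b. M b a"]) auto
  also have "(\<Oplus>l\<in>{1..n}. M l j \<otimes> V i l) = (\<Oplus>l\<in>{1..n}. V i l \<otimes> M l j)"
    using M V by (intro finsum_cong' refl) (auto simp: m_comm)
  finally show ?thesis .
qed

lemma charmat_closed: "M i j \<in> carrier R \<Longrightarrow> charmat M i j \<in> carrier (UP R)"
  by (simp add: charmat_def P.minus_closed)

text \<open>
  From \<open>M V = V N\<close> the product formula gives \<open>det (X - M) det V = det V det (X - N)\<close>, and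
  \<open>det V\<close> cancels because \<open>V Q = 1\<close> makes it a unit.
\<close>

lemma charpoly_conj:
  assumes M: "\<And>i j. i \<in> {1..n} \<Longrightarrow> j \<in> {1..n} \<Longrightarrow> M i j \<in> carrier R"
    and U': "\<And>i j. i \<in> {1..n} \<Longrightarrow> j \<in> {1..n} \<Longrightarrow> N i j \<in> carrier R"
    and V: "\<And>i j. i \<in> {1..n} \<Longrightarrow> j \<in> {1..n} \<Longrightarrow> V i j \<in> carrier R"
    and Q: "\<And>i j. i \<in> {1..n} \<Longrightarrow> j \<in> {1..n} \<Longrightarrow> Q i j \<in> carrier R"
    and conj: "\<And>i j. i \<in> {1..n} \<Longrightarrow> j \<in> {1..n} \<Longrightarrow>
       (\<Oplus>l\<in>{1..n}. M i l \<otimes> V l j) = (\<Oplus>l\<in>{1..n}. V i l \<otimes> N l j)"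
    and inv: "\<And>i j. i \<in> {1..n} \<Longrightarrow> j \<in> {1..n} \<Longrightarrow>
       (\<Oplus>l\<in>{1..n}. V i l \<otimes> Q l j) = (if j = i then \<one> else \<zero>)"
  shows "cring_det (UP R) n (charmat M) = cring_det (UP R) n (charmat N)"
proof -
  interpret L: up_cring "UP R" by (intro up_cring.intro P.is_cring)
  let ?V = "\<lambda>i j. cst (V i j)" and ?Q = "\<lambda>i j. cst (Q i j)"
  let ?d = "cring_det (UP R) n"
  have d: "?d (charmat M) \<in> carrier (UP R)" "?d (charmat N) \<in> carrier (UP R)"
     "?d ?V \<in> carrier (UP R)" "?d ?Q \<in> carrier (UP R)"
    using M U' V Q by (auto intro!: L.det_closed charmat_closed)
  have "?d (charmat M) \<otimes>\<^bsub>UP R\<^esub> ?d ?V = ?d (\<lambda>i j. \<Oplus>\<^bsub>UP R\<^esub>l\<in>{1..n}. charmat M i l \<otimes>\<^bsub>UP R\<^esub> ?V l j)"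
    using M V by (intro L.det_mult[symmetric]) (auto intro!: charmat_closed)
  also have "\<dots> = ?d (\<lambda>i j. \<Oplus>\<^bsub>UP R\<^esub>l\<in>{1..n}. ?V i l \<otimes>\<^bsub>UP R\<^esub> charmat N l j)"
    using M U' V conj by (intro L.det_cong)
      (auto simp del: atLeastAtMost_iff simp: charmat_mult_cst cst_mult_charmat intro!: P.finsum_closed charmat_closed)
  also have "\<dots> = ?d ?V \<otimes>\<^bsub>UP R\<^esub> ?d (charmat N)"
    using U' V by (intro L.det_mult) (auto intro!: charmat_closed)
  finally have 1: "?d (charmat M) \<otimes>\<^bsub>UP R\<^esub> ?d ?V = ?d ?V \<otimes>\<^bsub>UP R\<^esub> ?d (charmat N)" .
  have "?d ?V \<otimes>\<^bsub>UP R\<^esub> ?d ?Q = ?d (\<lambda>i j. \<Oplus>\<^bsub>UP R\<^esub>l\<in>{1..n}. ?V i l \<otimes>\<^bsub>UP R\<^esub> ?Q l j)"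
    using V Q by (intro L.det_mult[symmetric]) auto
  also have "\<dots> = ?d (\<lambda>i j. if j = i then \<one>\<^bsub>UP R\<^esub> else \<zero>\<^bsub>UP R\<^esub>)"
  proof (rule L.det_cong)
    fix i j assume ij: "i \<in> {1..n}" "j \<in> {1..n}"
    have "(\<Oplus>\<^bsub>UP R\<^esub>l\<in>{1..n}. ?V i l \<otimes>\<^bsub>UP R\<^esub> ?Q l j) = cst (\<Oplus>l\<in>{1..n}. V i l \<otimes> Q l j)"
      using V[OF ij(1)] Q[OF _ ij(2)] by (subst c.hom_finsum) (auto simp: comp_def intro!: P.finsum_cong')
    then show "(\<Oplus>\<^bsub>UP R\<^esub>l\<in>{1..n}. ?V i l \<otimes>\<^bsub>UP R\<^esub> ?Q l j) = (if j = i then \<one>\<^bsub>UP R\<^esub> else \<zero>\<^bsub>UP R\<^esub>)"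
      using inv[OF ij] by simp
  qed auto
  also have "\<dots> = (\<Otimes>\<^bsub>UP R\<^esub>i\<in>{1..n}. if i = i then \<one>\<^bsub>UP R\<^esub> else \<zero>\<^bsub>UP R\<^esub>)"
    by (rule L.det_lower_triangular) auto
  also have "\<dots> = \<one>\<^bsub>UP R\<^esub>" by simp
  finally have 2: "?d ?V \<otimes>\<^bsub>UP R\<^esub> ?d ?Q = \<one>\<^bsub>UP R\<^esub>" .
  have "?d (charmat M) = ?d (charmat M) \<otimes>\<^bsub>UP R\<^esub> ?d ?V \<otimes>\<^bsub>UP R\<^esub> ?d ?Q" using 2 d by (simp add: P.m_assoc)
  also have "\<dots> = ?d (charmat N) \<otimes>\<^bsub>UP R\<^esub> (?d ?V \<otimes>\<^bsub>UP R\<^esub> ?d ?Q)" unfolding 1 using d by (simp add: P.m_ac)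
  finally show ?thesis using 2 d by simp
qed

lemma charpoly_lower_triangular:
  assumes M: "\<And>i j. i \<in> {1..n} \<Longrightarrow> j \<in> {1..n} \<Longrightarrow> M i j \<in> carrier R"
    and 0: "\<And>i j. i \<in> {1..n} \<Longrightarrow> j \<in> {1..n} \<Longrightarrow> i < j \<Longrightarrow> M i j = \<zero>"
  shows "cring_det (UP R) n (charmat M) = root_prod R {1..n} (\<lambda>i. M i i)"
proof -
  interpret L: up_cring "UP R" by (intro up_cring.intro P.is_cring)
  have "cring_det (UP R) n (charmat M) = (\<Otimes>\<^bsub>UP R\<^esub>i\<in>{1..n}. charmat M i i)"
    using assms by (intro L.det_lower_triangular) (auto intro!: charmat_closed simp: charmat_def P.minus_eq)
  also have "\<dots> = root_prod R {1..n} (\<lambda>i. M i i)"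
    unfolding root_prod_def lin_fac_def using M by (intro P.finprod_cong') (auto simp: charmat_def)
  finally show ?thesis .
qed

end

text \<open>
  A ring \<open>K\<close> over \<open>R\<close> in which \<open>f\<close> is a product of linear factors \<open>X -
  \<theta> l\<close>, together with the homomorphisms \<open>h l: A \<rightarrow> K\<close> that send \<open>x\<close>
  to \<open>\<theta> l\<close>. Over \<open>K\<close>, the characteristic polynomial of multiplication by
  \<open>a\<close> is the product of the \<open>X - h l a\<close>. As differences of roots may be zero divisors,
  \<open>A\<close> does not become a product of copies of \<open>K\<close>. Instead, its base change \<open>E =
  K[X]/(f)\<close> gets the Newton basis \<open>1, X - \<theta> 1, (X - \<theta> 1) (X - \<theta> 2), \<dots>\<close>,
  in which multiplication by any element is triangular.
\<close>

locale split_adjoin = adjoin R f n for R :: "('r, 'm) ring_scheme" (structure) and f n +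
  fixes K :: "('k, 'q) ring_scheme" and j :: "'r \<Rightarrow> 'k" and h :: "nat \<Rightarrow> (nat \<Rightarrow> 'r) set \<Rightarrow> 'k"
  assumes K: "cring K" and j: "j \<in> ring_hom R K"
    and h: "\<And>l. l \<in> {1..n} \<Longrightarrow> h l \<in> ring_hom (adjoin_root R f) K"
    and h_scal: "\<And>l r. l \<in> {1..n} \<Longrightarrow> r \<in> carrier R \<Longrightarrow> h l (scal (adjoin_root R f) r) = j r"
    and split: "map_up j f = root_prod K {1..n} (\<lambda>l. h l (root_of R f))"
begin

sublocale K: up_cring K by (rule up_cring.intro[OF K])

abbreviation "fK \<equiv> map_up j f"
abbreviation "E \<equiv> adjoin_root K fK"
abbreviation "y \<equiv> root_of K fK"
abbreviation "\<theta> l \<equiv> h l x"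

sublocale E: adjoin K fK n
  by (rule adjoinI[OF K monic_map_up[OF is_cring K j monic]])

lemma \<theta>_closed: "l \<in> {1..n} \<Longrightarrow> \<theta> l \<in> carrier K"
  using ring_hom_closed[OF h x_closed] .

lemma h_closed: "l \<in> {1..n} \<Longrightarrow> a \<in> carrier A \<Longrightarrow> h l a \<in> carrier K"
  using ring_hom_closed[OF h] .

definition "\<delta> l = y \<ominus>\<^bsub>E\<^esub> scal E (\<theta> l)"

lemma \<delta>_closed: "l \<in> {1..n} \<Longrightarrow> \<delta> l \<in> carrier E"
  unfolding \<delta>_def using E.x_closed E.scal_closed \<theta>_closed by (intro E.A.minus_closed) auto

definition "Nw i = (\<Otimes>\<^bsub>E\<^esub>l\<in>{1..<i}. \<delta> l)"

lemma Nw_closed: "i \<le> n + 1 \<Longrightarrow> Nw i \<in> carrier E"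
  unfolding Nw_def using \<delta>_closed by (intro E.A.finprod_closed) auto

lemma Nw_1: "Nw 1 = \<one>\<^bsub>E\<^esub>" by (simp add: Nw_def)

lemma Nw_Suc: assumes "i \<in> {1..n}" shows "Nw (Suc i) = \<delta> i \<otimes>\<^bsub>E\<^esub> Nw i"
proof -
  have "{1..<Suc i} = insert i {1..<i}" using assms by auto
  then show ?thesis unfolding Nw_def using assms \<delta>_closed by (simp add: E.A.finprod_insert Pi_def)
qed

lemma Nw_last: "Nw (Suc n) = \<zero>\<^bsub>E\<^esub>"
proof -
  note sE = comm_algD(3)[OF E.A_alg]
  have "\<zero>\<^bsub>E\<^esub> = eval K E (scal E) y fK" using E.eval_f ..
  also have "\<dots> = eval E E id y (map_up (scal E) fK)"
    using eval_map_up[OF K E.A.is_cring sE E.A.is_cring id_ring_hom E.x_closed E.f_closed] by (simp add: comp_def)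
  also have "map_up (scal E) fK = root_prod E {1..n} (\<lambda>l. scal E (\<theta> l))"
    using arg_cong[OF split, of "map_up (scal E)"] map_up_root_prod[OF K E.A.is_cring sE, of "{1..n}" "\<lambda>l. \<theta> l", OF \<theta>_closed]
    by (rule trans)
  also have "eval E E id y \<dots> = (\<Otimes>\<^bsub>E\<^esub>l\<in>{1..n}. \<delta> l)"
    unfolding \<delta>_def using \<theta>_closed E.scal_closed
    by (intro eval_root_prod E.A.is_cring E.x_closed) auto
  finally show ?thesis unfolding Nw_def by (simp add: atLeastLessThanSuc_atLeastAtMost)
qed

lemma emb_ex: "\<exists>\<iota>\<in>ring_hom A E. (\<forall>r\<in>carrier R. \<iota> (scal A r) = scal E (j r)) \<and> \<iota> x = y"
proof -
  note sE = comm_algD(3)[OF E.A_alg]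
  have "eval R E (scal E \<circ> j) y f = eval K E (scal E) y fK"
    using eval_map_up[OF is_cring K j E.A.is_cring sE E.x_closed f_closed] ..
  then show ?thesis
    using A_universal[OF E.A.is_cring ring_hom_trans[OF j sE] E.x_closed] E.eval_f by simp
qed

definition "\<iota> = (SOME \<iota>. \<iota> \<in> ring_hom A E \<and> (\<forall>r\<in>carrier R. \<iota> (scal A r) = scal E (j r)) \<and> \<iota> x = y)"

lemma \<iota>: "\<iota> \<in> ring_hom A E" "\<And>r. r \<in> carrier R \<Longrightarrow> \<iota> (scal A r) = scal E (j r)" "\<iota> x = y"
proof -
  have "\<exists>\<iota>. \<iota> \<in> ring_hom A E \<and> (\<forall>r\<in>carrier R. \<iota> (scal A r) = scal E (j r)) \<and> \<iota> x = y" using emb_ex by blast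
  from someI_ex[OF this] show "\<iota> \<in> ring_hom A E" "\<And>r. r \<in> carrier R \<Longrightarrow> \<iota> (scal A r) = scal E (j r)" "\<iota> x = y"
    unfolding \<iota>_def by blast+
qed

lemma \<iota>_closed: "a \<in> carrier A \<Longrightarrow> \<iota> a \<in> carrier E" using ring_hom_closed[OF \<iota>(1)] .

text \<open>
  Every element of \<open>E\<close> is congruent to a scalar modulo \<open>\<delta> l = X - \<theta> l\<close>. The
  explicit quotients in the next two lemmas are the induction steps for this and for its refinement to elements of
  \<open>A\<close>.
\<close>

lemma congr_add:
  assumes "l \<in> {1..n}" "s \<in> carrier K" "t \<in> carrier K" "e \<in> carrier E" "e' \<in> carrier E"
  shows "(scal E s \<oplus>\<^bsub>E\<^esub> \<delta> l \<otimes>\<^bsub>E\<^esub> e) \<oplus>\<^bsub>E\<^esub> (scal E t \<oplus>\<^bsub>E\<^esub> \<delta> l \<otimes>\<^bsub>E\<^esub> e') =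
     scal E (s \<oplus>\<^bsub>K\<^esub> t) \<oplus>\<^bsub>E\<^esub> \<delta> l \<otimes>\<^bsub>E\<^esub> (e \<oplus>\<^bsub>E\<^esub> e')"
  using assms \<delta>_closed[OF assms(1)] E.scal_closed
  by (simp add: ring_hom_add[OF E.AA.scal_hom] E.A.r_distr E.A.a_ac)

lemma congr_mult:
  assumes "l \<in> {1..n}" "s \<in> carrier K" "t \<in> carrier K" "e \<in> carrier E" "e' \<in> carrier E"
  shows "(scal E s \<oplus>\<^bsub>E\<^esub> \<delta> l \<otimes>\<^bsub>E\<^esub> e) \<otimes>\<^bsub>E\<^esub> (scal E t \<oplus>\<^bsub>E\<^esub> \<delta> l \<otimes>\<^bsub>E\<^esub> e') =
     scal E (s \<otimes>\<^bsub>K\<^esub> t) \<oplus>\<^bsub>E\<^esub> \<delta> l \<otimes>\<^bsub>E\<^esub> (scal E s \<otimes>\<^bsub>E\<^esub> e' \<oplus>\<^bsub>E\<^esub> e \<otimes>\<^bsub>E\<^esub> (scal E t \<oplus>\<^bsub>E\<^esub> \<delta> l \<otimes>\<^bsub>E\<^esub> e'))"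
  using assms \<delta>_closed[OF assms(1)] E.scal_closed
  by (simp add: ring_hom_mult[OF E.AA.scal_hom] E.A.r_distr E.A.l_distr E.A.a_ac E.A.m_ac)

lemma root_congr: "l \<in> {1..n} \<Longrightarrow> y = scal E (\<theta> l) \<oplus>\<^bsub>E\<^esub> \<delta> l \<otimes>\<^bsub>E\<^esub> \<one>\<^bsub>E\<^esub>"
  using \<delta>_closed[of l] E.scal_closed[OF \<theta>_closed, of l] E.x_closed
  by (simp add: \<delta>_def E.A.minus_eq E.A.a_ac E.A.r_neg1 E.A.r_neg)

lemma congr_E:
  assumes l: "l \<in> {1..n}" and e: "e \<in> carrier E"
  shows "\<exists>k\<in>carrier K. \<exists>e'\<in>carrier E. e = scal E k \<oplus>\<^bsub>E\<^esub> \<delta> l \<otimes>\<^bsub>E\<^esub> e'"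
  using e
proof (induction rule: E.A_induct)
  case (scal k)
  then show ?case using \<delta>_closed[OF l] E.scal_closed
    by (intro bexI[of _ k] bexI[of _ "\<zero>\<^bsub>E\<^esub>"]) auto
next
  case root
  then show ?case using root_congr[OF l] \<theta>_closed[OF l] E.A.one_closed by blast
next
  case (add a b)
  then obtain s e t e' where st: "s \<in> carrier K" "t \<in> carrier K" "e \<in> carrier E" "e' \<in> carrier E"
    "a = scal E s \<oplus>\<^bsub>E\<^esub> \<delta> l \<otimes>\<^bsub>E\<^esub> e" "b = scal E t \<oplus>\<^bsub>E\<^esub> \<delta> l \<otimes>\<^bsub>E\<^esub> e'" by blast
  show ?case unfolding st(5,6) congr_add[OF l st(1-4)]
    using st by (intro bexI[of _ "s \<oplus>\<^bsub>K\<^esub> t"] bexI[of _ "e \<oplus>\<^bsub>E\<^esub> e'"]) auto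
next
  case (mult a b)
  then obtain s e t e' where st: "s \<in> carrier K" "t \<in> carrier K" "e \<in> carrier E" "e' \<in> carrier E"
    "a = scal E s \<oplus>\<^bsub>E\<^esub> \<delta> l \<otimes>\<^bsub>E\<^esub> e" "b = scal E t \<oplus>\<^bsub>E\<^esub> \<delta> l \<otimes>\<^bsub>E\<^esub> e'" by blast
  show ?case unfolding st(5,6) congr_mult[OF l st(1-4)]
    using st \<delta>_closed[OF l] E.scal_closed
    by (intro bexI[of _ "s \<otimes>\<^bsub>K\<^esub> t"]
        bexI[of _ "scal E s \<otimes>\<^bsub>E\<^esub> e' \<oplus>\<^bsub>E\<^esub> e \<otimes>\<^bsub>E\<^esub> (scal E t \<oplus>\<^bsub>E\<^esub> \<delta> l \<otimes>\<^bsub>E\<^esub> e')"]) auto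
qed

lemma congr_A:
  assumes l: "l \<in> {1..n}" and a: "a \<in> carrier A"
  shows "\<exists>e'\<in>carrier E. \<iota> a = scal E (h l a) \<oplus>\<^bsub>E\<^esub> \<delta> l \<otimes>\<^bsub>E\<^esub> e'"
  using a
proof (induction rule: A_induct)
  case (scal k)
  then show ?case using \<delta>_closed[OF l] E.scal_closed[OF ring_hom_closed[OF j]] \<iota>(2) h_scal[OF l]
    by (intro bexI[of _ "\<zero>\<^bsub>E\<^esub>"]) auto
next
  case root
  then show ?case using root_congr[OF l] \<iota>(3) E.A.one_closed by auto
next
  case (add a b)
  then obtain e e' where st: "e \<in> carrier E" "e' \<in> carrier E"
    "\<iota> a = scal E (h l a) \<oplus>\<^bsub>E\<^esub> \<delta> l \<otimes>\<^bsub>E\<^esub> e" "\<iota> b = scal E (h l b) \<oplus>\<^bsub>E\<^esub> \<delta> l \<otimes>\<^bsub>E\<^esub> e'" by blast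
  show ?case unfolding ring_hom_add[OF \<iota>(1) add(1,2)] ring_hom_add[OF h[OF l] add(1,2)] st(3,4)
      congr_add[OF l h_closed[OF l add(1)] h_closed[OF l add(2)] st(1,2)]
    using st by (intro bexI[of _ "e \<oplus>\<^bsub>E\<^esub> e'"]) auto
next
  case (mult a b)
  then obtain e e' where st: "e \<in> carrier E" "e' \<in> carrier E"
    "\<iota> a = scal E (h l a) \<oplus>\<^bsub>E\<^esub> \<delta> l \<otimes>\<^bsub>E\<^esub> e" "\<iota> b = scal E (h l b) \<oplus>\<^bsub>E\<^esub> \<delta> l \<otimes>\<^bsub>E\<^esub> e'" by blast
  show ?case unfolding ring_hom_mult[OF \<iota>(1) mult(1,2)] ring_hom_mult[OF h[OF l] mult(1,2)] st(3,4)
      congr_mult[OF l h_closed[OF l mult(1)] h_closed[OF l mult(2)] st(1,2)]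
    using st \<delta>_closed[OF l] E.scal_closed h_closed[OF l] mult(1,2)
    by (intro bexI[of _ "scal E (h l a) \<otimes>\<^bsub>E\<^esub> e' \<oplus>\<^bsub>E\<^esub> e \<otimes>\<^bsub>E\<^esub> (scal E (h l b) \<oplus>\<^bsub>E\<^esub> \<delta> l \<otimes>\<^bsub>E\<^esub> e')"]) auto
qed

text \<open>
  One step of Newton interpolation: the scalar \<open>k\<close> is the coefficient of \<open>Nw i\<close>, and the
  rest is a multiple of \<open>\<delta> i Nw i = Nw (i + 1)\<close>. The recursion ends because \<open>Nw (n + 1) =
  f(X) = 0\<close> in \<open>E\<close>.
\<close>

lemma newton_step:
  assumes i: "i \<in> {1..n}" and k: "k \<in> carrier K" and e': "e' \<in> carrier E"
    and u: "\<And>l. u l \<in> carrier K" "e' \<otimes>\<^bsub>E\<^esub> Nw (Suc i) = (\<Oplus>\<^bsub>E\<^esub>l\<in>{Suc i..n}. scal E (u l) \<otimes>\<^bsub>E\<^esub> Nw l)"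
  shows "(scal E k \<oplus>\<^bsub>E\<^esub> \<delta> i \<otimes>\<^bsub>E\<^esub> e') \<otimes>\<^bsub>E\<^esub> Nw i =
    (\<Oplus>\<^bsub>E\<^esub>l\<in>{i..n}. scal E ((u(i := k)) l) \<otimes>\<^bsub>E\<^esub> Nw l)"
proof -
  note c = E.scal_closed[OF k] E.scal_closed[OF u(1)] \<delta>_closed[OF i] Nw_closed
  have N: "Nw i \<in> carrier E" using i by (intro Nw_closed) auto
  have I: "{i..n} = insert i {Suc i..n}" using i by auto
  have "(scal E k \<oplus>\<^bsub>E\<^esub> \<delta> i \<otimes>\<^bsub>E\<^esub> e') \<otimes>\<^bsub>E\<^esub> Nw i = scal E k \<otimes>\<^bsub>E\<^esub> Nw i \<oplus>\<^bsub>E\<^esub> e' \<otimes>\<^bsub>E\<^esub> Nw (Suc i)"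
    unfolding Nw_Suc[OF i] using c N e' by (simp add: E.A.l_distr E.A.r_distr E.A.m_ac)
  also have "\<dots> = scal E ((u(i := k)) i) \<otimes>\<^bsub>E\<^esub> Nw i \<oplus>\<^bsub>E\<^esub> (\<Oplus>\<^bsub>E\<^esub>l\<in>{Suc i..n}. scal E ((u(i := k)) l) \<otimes>\<^bsub>E\<^esub> Nw l)"
    unfolding u(2) using c by (intro arg_cong2[where f="(\<oplus>\<^bsub>E\<^esub>)"] E.A.finsum_cong') auto
  also have "\<dots> = (\<Oplus>\<^bsub>E\<^esub>l\<in>{i..n}. scal E ((u(i := k)) l) \<otimes>\<^bsub>E\<^esub> Nw l)"
    unfolding I using c N by (intro E.A.finsum_insert[symmetric]) auto
  finally show ?thesis .
qed

lemma newton: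
  assumes "i \<le> Suc n" "1 \<le> i" "e \<in> carrier E"
  shows "\<exists>u. (\<forall>l. u l \<in> carrier K) \<and> e \<otimes>\<^bsub>E\<^esub> Nw i = (\<Oplus>\<^bsub>E\<^esub>l\<in>{i..n}. scal E (u l) \<otimes>\<^bsub>E\<^esub> Nw l)"
  using assms
proof (induction i arbitrary: e rule: inc_induct)
  case base
  then show ?case using Nw_last by (intro exI[of _ "\<lambda>_. \<zero>\<^bsub>K\<^esub>"]) auto
next
  case (step i)
  then have i: "i \<in> {1..n}" by auto
  obtain k e' where k: "k \<in> carrier K" "e' \<in> carrier E" "e = scal E k \<oplus>\<^bsub>E\<^esub> \<delta> i \<otimes>\<^bsub>E\<^esub> e'"
    using congr_E[OF i step.prems(2)] by blast
  obtain u where u: "\<And>l. u l \<in> carrier K" "e' \<otimes>\<^bsub>E\<^esub> Nw (Suc i) = (\<Oplus>\<^bsub>E\<^esub>l\<in>{Suc i..n}. scal E (u l) \<otimes>\<^bsub>E\<^esub> Nw l)"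
    using step.IH[of e'] k(2) by auto
  show ?case unfolding k(3) newton_step[OF i k(1,2) u]
    using k(1) u(1) by (intro exI[of _ "u(i := k)"]) auto
qed

text \<open>
  For an element \<open>a\<close> of \<open>A\<close> the scalar congruent to it modulo \<open>\<delta> i\<close> is
  \<open>h i a\<close>; this becomes the diagonal entry.
\<close>

lemma newton_A:
  assumes i: "i \<in> {1..n}" and a: "a \<in> carrier A"
  shows "\<exists>u. (\<forall>l. u l \<in> carrier K) \<and> u i = h i a \<and>
    \<iota> a \<otimes>\<^bsub>E\<^esub> Nw i = (\<Oplus>\<^bsub>E\<^esub>l\<in>{i..n}. scal E (u l) \<otimes>\<^bsub>E\<^esub> Nw l)"
proof -
  obtain e' where e': "e' \<in> carrier E" "\<iota> a = scal E (h i a) \<oplus>\<^bsub>E\<^esub> \<delta> i \<otimes>\<^bsub>E\<^esub> e'"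
    using congr_A[OF i a] by blast
  obtain u where u: "\<And>l. u l \<in> carrier K" "e' \<otimes>\<^bsub>E\<^esub> Nw (Suc i) = (\<Oplus>\<^bsub>E\<^esub>l\<in>{Suc i..n}. scal E (u l) \<otimes>\<^bsub>E\<^esub> Nw l)"
    using newton[of "Suc i" e'] i e'(1) by auto
  show ?thesis unfolding e'(2) newton_step[OF i h_closed[OF i a] e'(1) u]
    using h_closed[OF i a] u(1) by (intro exI[of _ "u(i := h i a)"]) auto
qed

lemma newton_triangular:
  assumes a: "a \<in> carrier A"
  shows "\<exists>U. (\<forall>i l. U i l \<in> carrier K) \<and> (\<forall>l\<in>{1..n}. U l l = h l a) \<and> (\<forall>i l. i < l \<longrightarrow> U i l = \<zero>\<^bsub>K\<^esub>) \<and>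
    (\<forall>l\<in>{1..n}. \<iota> a \<otimes>\<^bsub>E\<^esub> Nw l = lcomb E n (\<lambda>i. U i l) Nw)"
proof -
  have "\<forall>l\<in>{1..n}. \<exists>u. (\<forall>i. u i \<in> carrier K) \<and> u l = h l a \<and>
    \<iota> a \<otimes>\<^bsub>E\<^esub> Nw l = (\<Oplus>\<^bsub>E\<^esub>i\<in>{l..n}. scal E (u i) \<otimes>\<^bsub>E\<^esub> Nw i)" using newton_A[OF _ a] by blast
  from bchoice[OF this] obtain u where u: "\<And>l i. l \<in> {1..n} \<Longrightarrow> u l i \<in> carrier K" "\<And>l. l \<in> {1..n} \<Longrightarrow> u l l = h l a"
    "\<And>l. l \<in> {1..n} \<Longrightarrow> \<iota> a \<otimes>\<^bsub>E\<^esub> Nw l = (\<Oplus>\<^bsub>E\<^esub>i\<in>{l..n}. scal E (u l i) \<otimes>\<^bsub>E\<^esub> Nw i)"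
    by blast
  let ?U = "\<lambda>i l. if l \<in> {1..n} \<and> l \<le> i then u l i else \<zero>\<^bsub>K\<^esub>"
  have "\<iota> a \<otimes>\<^bsub>E\<^esub> Nw l = lcomb E n (\<lambda>i. ?U i l) Nw" if l: "l \<in> {1..n}" for l
    unfolding u(3)[OF l] lcomb_def using l u(1)[OF l] E.scal_closed Nw_closed
    by (intro E.A.finsum_mono_neutral_cong_left) auto
  then show ?thesis using u(1,2) by (intro exI[of _ ?U]) auto
qed

lemma newton_span: "e \<in> carrier E \<Longrightarrow> \<exists>u. (\<forall>l. u l \<in> carrier K) \<and> e = lcomb E n u Nw"
  using newton[of 1 e] Nw_1 by (auto simp: lcomb_def)

text \<open>
  The characteristic polynomial is defined with an arbitrary basis of \<open>A\<close>. The transition matrices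
  between it and the power basis are mutually inverse over \<open>R\<close>, hence over \<open>K\<close>, where the
  power basis is again a basis.
\<close>

lemma basis_base_change:
  assumes B: "is_basis R A n b"
  shows "lin_indep K E n (\<lambda>i. \<iota> (b i))" "lin_span K E n (\<lambda>i. \<iota> (b i))"
proof -
  have b: "\<And>i. i \<in> {1..n} \<Longrightarrow> b i \<in> carrier A" and bi: "lin_indep R A n b" and bs: "lin_span R A n b"
    using B AA.is_basis_iff by auto
  have ps: "lin_span R A n (\<lambda>i. pw i)" using basis_pw AA.is_basis_iff by auto
  have Es: "lin_span K E n (\<lambda>i. E.pw i)" and Ei: "lin_indep K E n (\<lambda>i. E.pw i)"
    using E.basis_pw E.AA.is_basis_iff by auto
  interpret \<iota>: ring_hom_cring A E \<iota> by (rule ring_hom_cringI[OF A.is_cring E.A.is_cring \<iota>(1)])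
  interpret j: ring_hom_cring R K j by (rule ring_hom_cringI[OF is_cring K j])
  have \<iota>pw: "\<iota> (pw i) = E.pw i" for i using x_closed \<iota>(3) by simp
  have \<iota>l: "\<iota> (lcomb A n c z) = lcomb E n (\<lambda>i. j (c i)) (\<lambda>i. \<iota> (z i))"
    if "\<And>i. i \<in> {1..n} \<Longrightarrow> c i \<in> carrier R" "\<And>i. i \<in> {1..n} \<Longrightarrow> z i \<in> carrier A" for c z
    using that by (intro lcomb_hom[OF AA.comm_algebra_axioms E.AA.comm_algebra_axioms \<iota>(1) \<iota>(2)])
  have "\<forall>l\<in>{1..n}. \<exists>c. (\<forall>i\<in>{1..n}. c i \<in> carrier R) \<and> pw l = lcomb A n c b"
    using bs pw_closed unfolding lin_span_def by blast
  from bchoice[OF this] obtain C' where C': "\<And>l i. l \<in> {1..n} \<Longrightarrow> i \<in> {1..n} \<Longrightarrow> C' l i \<in> carrier R"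
    "\<And>l. l \<in> {1..n} \<Longrightarrow> pw l = lcomb A n (C' l) b" by blast
  define C where "C i l = C' l i" for i l
  have C: "\<And>l i. l \<in> {1..n} \<Longrightarrow> i \<in> {1..n} \<Longrightarrow> C i l \<in> carrier R"
    "\<And>l. l \<in> {1..n} \<Longrightarrow> pw l = lcomb A n (\<lambda>i. C i l) b" using C' by (simp_all add: C_def)
  have "\<forall>l\<in>{1..n}. \<exists>c. (\<forall>i\<in>{1..n}. c i \<in> carrier R) \<and> b l = lcomb A n c (\<lambda>i. pw i)"
    using ps b unfolding lin_span_def by blast
  from bchoice[OF this] obtain D' where D': "\<And>l i. l \<in> {1..n} \<Longrightarrow> i \<in> {1..n} \<Longrightarrow> D' l i \<in> carrier R"
    "\<And>l. l \<in> {1..n} \<Longrightarrow> b l = lcomb A n (D' l) (\<lambda>i. pw i)" by blast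
  define D where "D i l = D' l i" for i l
  have D: "\<And>l i. l \<in> {1..n} \<Longrightarrow> i \<in> {1..n} \<Longrightarrow> D i l \<in> carrier R"
    "\<And>l. l \<in> {1..n} \<Longrightarrow> b l = lcomb A n (\<lambda>i. D i l) (\<lambda>i. pw i)" using D' by (simp_all add: D_def)
  have CD: "(\<Oplus>i\<in>{1..n}. C m i \<otimes> D i l) = (if l = m then \<one> else \<zero>)" if l: "l \<in> {1..n}" and m: "m \<in> {1..n}" for l m
  proof -
    have "lcomb A n (\<lambda>m. \<Oplus>i\<in>{1..n}. C m i \<otimes> D i l) b = b l"
      unfolding D(2)[OF l] using C D l b by (intro AA.lcomb_lcomb[symmetric]) auto
    also have "b l = lcomb A n (\<lambda>i. if l = i then \<one> else \<zero>) b"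
      using l b by (intro AA.lcomb_unit[symmetric]) auto
    finally have eq: "lcomb A n (\<lambda>m. \<Oplus>i\<in>{1..n}. C m i \<otimes> D i l) b = lcomb A n (\<lambda>i. if l = i then \<one> else \<zero>) b" .
    have "(\<Oplus>i\<in>{1..n}. C m i \<otimes> D i l) \<in> carrier R" if "m \<in> {1..n}" for m
      using that C(1) D(1)[OF l] by (intro finsum_closed) auto
    then show ?thesis using m by (intro lin_indepD[OF bi eq]) auto
  qed
  have Epw: "E.pw l = lcomb E n (\<lambda>i. j (C i l)) (\<lambda>i. \<iota> (b i))" if l: "l \<in> {1..n}" for l
    unfolding \<iota>pw[symmetric] C(2)[OF l] using C(1) l b by (intro \<iota>l) auto
  have Eb: "\<iota> (b l) = lcomb E n (\<lambda>i. j (D i l)) (\<lambda>i. E.pw i)" if l: "l \<in> {1..n}" for l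
    using \<iota>l[of "\<lambda>i. D i l" "\<lambda>i. pw i"] D(1)[OF l] D(2)[OF l] pw_closed by (simp add: \<iota>pw)
  show "lin_span K E n (\<lambda>i. \<iota> (b i))"
    unfolding lin_span_def
  proof
    fix e assume "e \<in> carrier E"
    then obtain v where v: "\<And>i. i \<in> {1..n} \<Longrightarrow> v i \<in> carrier K" "e = lcomb E n v (\<lambda>i. E.pw i)"
      using lin_spanE[OF Es] by blast
    have "e = lcomb E n (\<lambda>i. \<Oplus>\<^bsub>K\<^esub>l\<in>{1..n}. j (C i l) \<otimes>\<^bsub>K\<^esub> v l) (\<lambda>i. \<iota> (b i))"
      unfolding v(2) using v(1) C(1) b Epw \<iota>_closed by (intro E.AA.lcomb_lcomb) auto
    then show "\<exists>c. (\<forall>i\<in>{1..n}. c i \<in> carrier K) \<and> e = lcomb E n c (\<lambda>i. \<iota> (b i))"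
      using C(1) v(1) by (intro exI[of _ "\<lambda>i. \<Oplus>\<^bsub>K\<^esub>l\<in>{1..n}. j (C i l) \<otimes>\<^bsub>K\<^esub> v l"])
        (auto intro!: K.finsum_closed)
  qed
  show "lin_indep K E n (\<lambda>i. \<iota> (b i))"
  proof (rule E.AA.lin_indepI)
    show "\<And>i. i \<in> {1..n} \<Longrightarrow> \<iota> (b i) \<in> carrier E" using b \<iota>_closed by blast
    fix v m assume v: "\<And>i. i \<in> {1..n} \<Longrightarrow> v i \<in> carrier K"
      and 0: "lcomb E n v (\<lambda>i. \<iota> (b i)) = \<zero>\<^bsub>E\<^esub>" and m: "m \<in> {1..n}"
    let ?w = "\<lambda>i. \<Oplus>\<^bsub>K\<^esub>l\<in>{1..n}. j (D i l) \<otimes>\<^bsub>K\<^esub> v l"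
    have w: "?w i \<in> carrier K" if "i \<in> {1..n}" for i using that v D(1) by (auto intro!: K.finsum_closed)
    have "lcomb E n ?w (\<lambda>i. E.pw i) = lcomb E n v (\<lambda>i. \<iota> (b i))"
      using v D(1) E.pw_closed Eb by (intro E.AA.lcomb_lcomb[symmetric]) auto
    also have "\<dots> = lcomb E n (\<lambda>i. \<zero>\<^bsub>K\<^esub>) (\<lambda>i. E.pw i)"
    proof -
      have "lcomb E n (\<lambda>i. \<zero>\<^bsub>K\<^esub>) (\<lambda>i. E.pw i) = \<zero>\<^bsub>E\<^esub>"
        unfolding lcomb_def using E.pw_closed by (intro E.A.add.finprod_one_eqI) auto
      then show ?thesis using 0 by simp
    qed
    finally have w_eq: "lcomb E n ?w (\<lambda>i. E.pw i) = lcomb E n (\<lambda>i. \<zero>\<^bsub>K\<^esub>) (\<lambda>i. E.pw i)" .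
    have w0: "?w i = \<zero>\<^bsub>K\<^esub>" if "i \<in> {1..n}" for i
      using w that by (intro lin_indepD[OF Ei w_eq]) auto
    have "v m = (\<Oplus>\<^bsub>K\<^esub>l\<in>{1..n}. if m = l then v l else \<zero>\<^bsub>K\<^esub>)"
      using v m by (intro K.finsum_delta[symmetric]) auto
    also have "\<dots> = (\<Oplus>\<^bsub>K\<^esub>l\<in>{1..n}. \<Oplus>\<^bsub>K\<^esub>i\<in>{1..n}. j (C m i) \<otimes>\<^bsub>K\<^esub> (j (D i l) \<otimes>\<^bsub>K\<^esub> v l))"
    proof (intro K.finsum_cong' refl)
      fix l assume l: "l \<in> {1..n}"
      have "(if m = l then v l else \<zero>\<^bsub>K\<^esub>) = j (\<Oplus>i\<in>{1..n}. C m i \<otimes> D i l) \<otimes>\<^bsub>K\<^esub> v l"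
        using CD[OF l m] v[OF l] by auto
      also have "\<dots> = (\<Oplus>\<^bsub>K\<^esub>i\<in>{1..n}. j (C m i) \<otimes>\<^bsub>K\<^esub> j (D i l)) \<otimes>\<^bsub>K\<^esub> v l"
        using C(1)[OF _ m] D(1)[OF l]
        by (subst j.hom_finsum) (auto intro!: arg_cong2[where f="(\<otimes>\<^bsub>K\<^esub>)"] K.finsum_cong')
      also have "\<dots> = (\<Oplus>\<^bsub>K\<^esub>i\<in>{1..n}. j (C m i) \<otimes>\<^bsub>K\<^esub> j (D i l) \<otimes>\<^bsub>K\<^esub> v l)"
        using C(1)[OF _ m] D(1)[OF l] v[OF l] by (intro K.finsum_ldistr) auto
      also have "\<dots> = (\<Oplus>\<^bsub>K\<^esub>i\<in>{1..n}. j (C m i) \<otimes>\<^bsub>K\<^esub> (j (D i l) \<otimes>\<^bsub>K\<^esub> v l))"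
        using C(1)[OF _ m] D(1)[OF l] v[OF l] by (intro K.finsum_cong' refl) (auto simp: K.m_assoc)
      finally show "(if m = l then v l else \<zero>\<^bsub>K\<^esub>) = \<dots>" .
    qed (use C(1)[OF _ m] D(1) v in \<open>auto intro!: K.finsum_closed\<close>)
    also have "\<dots> = (\<Oplus>\<^bsub>K\<^esub>i\<in>{1..n}. \<Oplus>\<^bsub>K\<^esub>l\<in>{1..n}. j (C m i) \<otimes>\<^bsub>K\<^esub> (j (D i l) \<otimes>\<^bsub>K\<^esub> v l))"
      using C(1)[OF _ m] D(1) v by (intro K.finsum_swap) auto
    also have "\<dots> = (\<Oplus>\<^bsub>K\<^esub>i\<in>{1..n}. j (C m i) \<otimes>\<^bsub>K\<^esub> ?w i)"
      using C(1)[OF _ m] D(1) v w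
      by (intro K.finsum_cong' refl K.finsum_rdistr[symmetric]) (auto simp del: atLeastAtMost_iff)
    also have "\<dots> = \<zero>\<^bsub>K\<^esub>"
      using w0 C(1)[OF _ m] by (intro K.add.finprod_one_eqI) (auto simp del: atLeastAtMost_iff)
    finally show "v m = \<zero>\<^bsub>K\<^esub>" .
  qed
qed

text \<open>
  Over \<open>K\<close> the matrix of multiplication by \<open>a\<close> is conjugate to its matrix in the Newton
  basis, which is lower triangular with diagonal entries \<open>h l a\<close>.
\<close>

theorem char_poly_split:
  assumes a: "a \<in> carrier A"
  shows "map_up j (mult_char_poly R A n a) = root_prod K {1..n} (\<lambda>l. h l a)"
proof -
  define b where "b = (SOME b. is_basis R A n b)"
  have B: "is_basis R A n b" unfolding b_def by (rule someI[of "is_basis R A n", OF basis_pw])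
  have b: "\<And>i. i \<in> {1..n} \<Longrightarrow> b i \<in> carrier A" using B AA.is_basis_iff by auto
  define M where "M = mult_matrix R A n b a"
  have M: "M i l \<in> carrier R" if "i \<in> {1..n}" "l \<in> {1..n}" for i l
    using AA.mult_matrix_props(1)[OF B a that(2,1)] by (simp add: M_def)
  have Mb: "a \<otimes>\<^bsub>A\<^esub> b l = lcomb A n (\<lambda>i. M i l) b" if "l \<in> {1..n}" for l
    using AA.mult_matrix_props(2)[OF B a that] by (simp add: M_def)
  note bc = basis_base_change[OF B]
  let ?b = "\<lambda>i. \<iota> (b i)"
  have b': "\<And>i. i \<in> {1..n} \<Longrightarrow> ?b i \<in> carrier E" using b \<iota>_closed by blast
  have Nc: "\<And>i. i \<in> {1..n} \<Longrightarrow> Nw i \<in> carrier E" using Nw_closed by simp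
  interpret j: ring_hom_cring R K j by (rule ring_hom_cringI[OF is_cring K j])
  let ?M = "\<lambda>i l. j (M i l)"
  have M': "?M i l \<in> carrier K" if "i \<in> {1..n}" "l \<in> {1..n}" for i l using M[OF that] by simp
  obtain U where U: "\<And>i l. U i l \<in> carrier K" "\<And>l. l \<in> {1..n} \<Longrightarrow> U l l = h l a"
      "\<And>i l. i < l \<Longrightarrow> U i l = \<zero>\<^bsub>K\<^esub>" "\<And>l. l \<in> {1..n} \<Longrightarrow> \<iota> a \<otimes>\<^bsub>E\<^esub> Nw l = lcomb E n (\<lambda>i. U i l) Nw"
  proof -
    from newton_triangular[OF a] show ?thesis
    proof (elim exE conjE)
      fix U assume "\<forall>i l. U i l \<in> carrier K" "\<forall>l\<in>{1..n}. U l l = h l a" "\<forall>i l. i < l \<longrightarrow> U i l = \<zero>\<^bsub>K\<^esub>"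
        "\<forall>l\<in>{1..n}. \<iota> a \<otimes>\<^bsub>E\<^esub> Nw l = lcomb E n (\<lambda>i. U i l) Nw"
      then show ?thesis by (intro that) simp_all
    qed
  qed
  have "\<forall>l\<in>{1..n}. \<exists>c. (\<forall>i\<in>{1..n}. c i \<in> carrier K) \<and> Nw l = lcomb E n c ?b"
    using bc(2) Nc unfolding lin_span_def by blast
  from bchoice[OF this] obtain V' where V': "\<And>l i. l \<in> {1..n} \<Longrightarrow> i \<in> {1..n} \<Longrightarrow> V' l i \<in> carrier K"
    "\<And>l. l \<in> {1..n} \<Longrightarrow> Nw l = lcomb E n (V' l) ?b" by blast
  define V where "V i l = V' l i" for i l
  have V: "\<And>l i. i \<in> {1..n} \<Longrightarrow> l \<in> {1..n} \<Longrightarrow> V i l \<in> carrier K"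
    "\<And>l. l \<in> {1..n} \<Longrightarrow> Nw l = lcomb E n (\<lambda>i. V i l) ?b" using V' by (simp_all add: V_def)
  have "\<forall>l\<in>{1..n}. \<exists>c. (\<forall>i. c i \<in> carrier K) \<and> ?b l = lcomb E n c Nw"
    using newton_span b' by blast
  from bchoice[OF this] obtain Q' where Q': "\<And>l i. l \<in> {1..n} \<Longrightarrow> Q' l i \<in> carrier K"
    "\<And>l. l \<in> {1..n} \<Longrightarrow> ?b l = lcomb E n (Q' l) Nw" by blast
  define Q where "Q i l = Q' l i" for i l
  have Q: "\<And>l i. l \<in> {1..n} \<Longrightarrow> Q i l \<in> carrier K"
    "\<And>l. l \<in> {1..n} \<Longrightarrow> ?b l = lcomb E n (\<lambda>i. Q i l) Nw" using Q' by (simp_all add: Q_def)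
  have ind: "c i = c' i" if "lcomb E n c ?b = lcomb E n c' ?b" "i \<in> {1..n}"
     "\<And>i. i \<in> {1..n} \<Longrightarrow> c i \<in> carrier K" "\<And>i. i \<in> {1..n} \<Longrightarrow> c' i \<in> carrier K" for c c' i
    by (rule lin_indepD[OF bc(1) that(1) that(3,4) that(2)])
  have ab: "\<iota> a \<otimes>\<^bsub>E\<^esub> ?b l = lcomb E n (\<lambda>i. ?M i l) ?b" if l: "l \<in> {1..n}" for l
  proof -
    have "\<iota> a \<otimes>\<^bsub>E\<^esub> ?b l = \<iota> (lcomb A n (\<lambda>i. M i l) b)"
      using ring_hom_mult[OF \<iota>(1) a b[OF l]] Mb[OF l] by simp
    also have "\<dots> = lcomb E n (\<lambda>i. ?M i l) ?b"
      using M l b by (intro lcomb_hom[OF AA.comm_algebra_axioms E.AA.comm_algebra_axioms \<iota>(1) \<iota>(2)]) auto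
    finally show ?thesis .
  qed
  have "cring_det (UP K) n (K.charmat ?M) = cring_det (UP K) n (K.charmat U)"
  proof (rule K.charpoly_conj[where V = V and Q = Q])
    fix i l assume i: "i \<in> {1..n}" and l: "l \<in> {1..n}"
    have "lcomb E n (\<lambda>i. \<Oplus>\<^bsub>K\<^esub>m\<in>{1..n}. ?M i m \<otimes>\<^bsub>K\<^esub> V m l) ?b = lcomb E n (\<lambda>i. V i l) (\<lambda>i. \<iota> a \<otimes>\<^bsub>E\<^esub> ?b i)"
      using V(1) M' b' l ab by (intro E.AA.lcomb_lcomb[symmetric]) (auto simp del: atLeastAtMost_iff)
    also have "\<dots> = \<iota> a \<otimes>\<^bsub>E\<^esub> Nw l"
      unfolding V(2)[OF l] using V(1) b' l \<iota>_closed[OF a]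
      by (intro E.AA.lcomb_mult[symmetric]) (auto simp del: atLeastAtMost_iff)
    also have "\<dots> = lcomb E n (\<lambda>i. U i l) Nw" by (rule U(4)[OF l])
    also have "\<dots> = lcomb E n (\<lambda>i. \<Oplus>\<^bsub>K\<^esub>m\<in>{1..n}. V i m \<otimes>\<^bsub>K\<^esub> U m l) ?b"
      using V U(1) b' by (intro E.AA.lcomb_lcomb) (auto simp del: atLeastAtMost_iff)
    finally have eq: "lcomb E n (\<lambda>i. \<Oplus>\<^bsub>K\<^esub>m\<in>{1..n}. ?M i m \<otimes>\<^bsub>K\<^esub> V m l) ?b =
      lcomb E n (\<lambda>i. \<Oplus>\<^bsub>K\<^esub>m\<in>{1..n}. V i m \<otimes>\<^bsub>K\<^esub> U m l) ?b" .
    show "(\<Oplus>\<^bsub>K\<^esub>m\<in>{1..n}. ?M i m \<otimes>\<^bsub>K\<^esub> V m l) = (\<Oplus>\<^bsub>K\<^esub>m\<in>{1..n}. V i m \<otimes>\<^bsub>K\<^esub> U m l)"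
      using i l V(1) U(1) M' by (intro ind[OF eq]) (auto simp del: atLeastAtMost_iff intro!: K.finsum_closed)
    have "lcomb E n (\<lambda>i. \<Oplus>\<^bsub>K\<^esub>m\<in>{1..n}. V i m \<otimes>\<^bsub>K\<^esub> Q m l) ?b = lcomb E n (\<lambda>i. Q i l) Nw"
      using V Q(1)[OF l] b' by (intro E.AA.lcomb_lcomb[symmetric]) (auto simp del: atLeastAtMost_iff)
    also have "\<dots> = ?b l" using Q(2)[OF l] ..
    also have "\<dots> = lcomb E n (\<lambda>i. if l = i then \<one>\<^bsub>K\<^esub> else \<zero>\<^bsub>K\<^esub>) ?b"
      using E.AA.lcomb_unit[OF l, of ?b] b' by simp
    finally have eq': "lcomb E n (\<lambda>i. \<Oplus>\<^bsub>K\<^esub>m\<in>{1..n}. V i m \<otimes>\<^bsub>K\<^esub> Q m l) ?b =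
      lcomb E n (\<lambda>i. if l = i then \<one>\<^bsub>K\<^esub> else \<zero>\<^bsub>K\<^esub>) ?b" .
    show "(\<Oplus>\<^bsub>K\<^esub>m\<in>{1..n}. V i m \<otimes>\<^bsub>K\<^esub> Q m l) = (if l = i then \<one>\<^bsub>K\<^esub> else \<zero>\<^bsub>K\<^esub>)"
      using i V(1) Q(1)[OF l] by (intro ind[OF eq']) (auto simp del: atLeastAtMost_iff intro!: K.finsum_closed)
  qed (use M' U(1) V(1) Q(1) in \<open>auto simp del: atLeastAtMost_iff\<close>)
  also have "\<dots> = root_prod K {1..n} (\<lambda>l. U l l)"
    using U(1,3) by (intro K.charpoly_lower_triangular) auto
  also have "\<dots> = root_prod K {1..n} (\<lambda>l. h l a)"
    unfolding root_prod_def using U(2) h_closed[OF _ a] by (intro K.P.finprod_cong') (auto simp del: atLeastAtMost_iff)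
  finally have 1: "cring_det (UP K) n (K.charmat ?M) = root_prod K {1..n} (\<lambda>l. h l a)" .
  interpret m: ring_hom_cring "UP R" "UP K" "map_up j"
    by (rule ring_hom_cringI[OF P.is_cring K.P.is_cring map_up_hom[OF is_cring K j]])
  have "map_up j (mult_char_poly R A n a) = map_up j (cring_det (UP R) n (charmat M))"
    unfolding mult_char_poly_def Let_def b_def[symmetric] M_def[symmetric]
    by (rule arg_cong[where f = "\<lambda>z. map_up j (cring_det (UP R) n z)"]) (auto simp: charmat_def fun_eq_iff)
  also have "\<dots> = cring_det (UP K) n (\<lambda>i l. map_up j (charmat M i l))"
    using M by (intro det_hom[OF P.is_cring K.P.is_cring m.homh]) (auto simp del: atLeastAtMost_iff intro: charmat_closed)
  also have "\<dots> = cring_det (UP K) n (K.charmat ?M)"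
  proof -
    interpret L: up_cring "UP K" by (intro up_cring.intro K.P.is_cring)
    show ?thesis
    proof (rule L.det_cong)
      fix i l assume il: "i \<in> {1..n}" "l \<in> {1..n}"
      show "K.charmat ?M i l \<in> carrier (UP K)" using M'[OF il] by (rule K.charmat_closed)
      show "map_up j (charmat M i l) = K.charmat ?M i l"
        using M[OF il] by (auto simp: charmat_def K.charmat_def P.minus_eq K.P.minus_eq
            map_up_monom[OF is_cring K j] simp del: U.monom_a_inv K.U.monom_a_inv)
    qed
  qed
  finally show ?thesis using 1 by simp
qed

end

section \<open>Norms of polynomials with coefficients in a subring\<close>

lemma (in adjoin) mult_char_poly_closed:
  assumes a: "a \<in> carrier A"
  shows "mult_char_poly R A n a \<in> carrier (UP R)"
proof -
  define b where "b = (SOME b. is_basis R A n b)"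
  have B: "is_basis R A n b" unfolding b_def by (rule someI[of "is_basis R A n", OF basis_pw])
  interpret L: up_cring "UP R" by (intro up_cring.intro P.is_cring)
  show ?thesis
    unfolding mult_char_poly_def Let_def b_def[symmetric]
    using AA.mult_matrix_props(1)[OF B a]
    by (intro L.det_closed) (auto intro!: P.minus_closed simp del: atLeastAtMost_iff)
qed

lemma (in cring) subring_cring: "subring H R \<Longrightarrow> cring (R\<lparr>carrier := H\<rparr>)"
  using subcringI' subcring_iff subringE(1) by blast

lemma (in up_cring) root_prod_reindex:
  assumes "bij_betw g L' L" "\<And>l. l \<in> L \<Longrightarrow> y l \<in> carrier R"
  shows "root_prod R L' (\<lambda>l. y (g l)) = root_prod R L y"
proof -
  have L: "L = g ` L'" "inj_on g L'" using assms by (auto simp: bij_betw_def)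
  show ?thesis unfolding root_prod_def L(1) using assms L
    by (subst P.finprod_reindex) auto
qed

lemma (in up_cring) root_prod_norm:
  assumes "finite L" "\<And>l. l \<in> L \<Longrightarrow> y l \<in> carrier R"
  shows "(\<Otimes>l\<in>L. y l) = (\<ominus> \<one>) [^] card L \<otimes> root_prod R L y 0"
proof -
  have "{S. S \<subseteq> L \<and> card S = card L} = {L}" using assms(1) card_subset_eq by blast
  then have "esym R L y (card L) = (\<Otimes>l\<in>L. y l)"
    unfolding esym_def using assms by (simp add: finsum_insert Pi_def)
  then show ?thesis using vieta[of L y "card L"] assms by simp
qed

lemma subring_UP:
  assumes "cring B" "subring Pc B"
  shows "p \<in> carrier (UP (B\<lparr>carrier := Pc\<rparr>)) \<longleftrightarrow> p \<in> carrier (UP B) \<and> (\<forall>i. p i \<in> Pc)"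
proof -
  interpret B: up_cring B using assms by (intro up_cring.intro)
  interpret S: up_cring "B\<lparr>carrier := Pc\<rparr>" using B.subring_cring[OF assms(2)] by (intro up_cring.intro)
  show ?thesis unfolding B.carrier_UP S.carrier_UP using subringE(1)[OF assms(2)] by auto
qed

lemma map_up_id: "map_up id p = p" by (simp add: map_up_def)

text \<open>
  The product is the norm of \<open>a = \<Sum>c\<^sub>i x\<^sup>i\<close> for the algebra that adjoins to the subring
  \<open>Pc\<close> a root \<open>x\<close> of the polynomial \<open>\<Prod>(X - y\<^sub>l)\<close>: up to sign it is
  the constant term of the characteristic polynomial of \<open>a\<close>, which has coefficients in \<open>Pc\<close>
  and, over \<open>B\<close>, is the product of the \<open>X - \<Sum>c\<^sub>i y\<^sub>l\<^sup>i\<close>. The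
  fundamental theorem on symmetric polynomials will be deduced from this.
\<close>

lemma norm_in_subring:
  assumes B: "cring B" and Pc: "subring Pc B" and L: "finite L"
    and y: "\<And>l. l \<in> L \<Longrightarrow> y l \<in> carrier B"
    and g: "\<And>i. root_prod B L y i \<in> Pc" and c: "\<And>i. i < d \<Longrightarrow> c i \<in> Pc"
  shows "(\<Otimes>\<^bsub>B\<^esub>l\<in>L. \<Oplus>\<^bsub>B\<^esub>i\<in>{..<d}. c i \<otimes>\<^bsub>B\<^esub> y l [^]\<^bsub>B\<^esub> (i::nat)) \<in> Pc"
proof -
  interpret B: up_cring B using B by (intro up_cring.intro)
  let ?S = "B\<lparr>carrier := Pc\<rparr>" and ?n = "card L"
  have S: "cring ?S" by (rule B.subring_cring[OF Pc])
  interpret S: up_cring ?S using S by (intro up_cring.intro)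
  have sub: "Pc \<subseteq> carrier B" by (rule subringE(1)[OF Pc])
  have id: "id \<in> ring_hom ?S B" using sub by (auto simp: ring_hom_def)
  obtain \<sigma> where \<sigma>: "bij_betw \<sigma> {1..?n} L" using ex_bij_betw_nat_finite_1[OF L] by blast
  have \<sigma>L: "\<And>l. l \<in> {1..?n} \<Longrightarrow> \<sigma> l \<in> L" using \<sigma> by (auto simp: bij_betw_def)
  define f where "f = root_prod B L y"
  have f: "f = root_prod B {1..?n} (\<lambda>l. y (\<sigma> l))" unfolding f_def using B.root_prod_reindex[where y = y, OF \<sigma> y] by simp
  have fB: "monic_of_degree B ?n f" unfolding f_def using L y by (rule B.monic_root_prod)
  have "monic_of_degree ?S ?n f"
    using fB g unfolding B.monic_iff S.monic_iff subring_UP[OF B Pc] f_def by simp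
  interpret f: adjoin ?S f ?n by (rule adjoinI[OF S \<open>monic_of_degree ?S ?n f\<close>])
  have ex: "\<exists>h\<in>ring_hom f.A B. (\<forall>r\<in>carrier ?S. h (scal f.A r) = id r) \<and> h f.x = y (\<sigma> l)" if l: "l \<in> {1..?n}" for l
  proof (rule f.A_universal[OF B id])
    show "y (\<sigma> l) \<in> carrier B" using \<sigma>L[OF l] y by simp
    have "eval ?S B id (y (\<sigma> l)) f = eval B B id (y (\<sigma> l)) (map_up id f)"
      using eval_map_up[OF S B id B id_ring_hom _ f.f_closed, of "y (\<sigma> l)"] y \<sigma>L[OF l] by simp
    also have "\<dots> = \<zero>\<^bsub>B\<^esub>"
      unfolding map_up_id f_def using L y \<sigma>L[OF l] by (intro eval_root_prod_zero B) auto
    finally show "eval ?S B id (y (\<sigma> l)) f = \<zero>\<^bsub>B\<^esub>" .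
  qed
  have "\<forall>l\<in>{1..?n}. \<exists>h. h \<in> ring_hom f.A B \<and> (\<forall>r\<in>Pc. h (scal f.A r) = r) \<and> h f.x = y (\<sigma> l)"
    using ex by fastforce
  from bchoice[OF this] obtain h where h: "\<And>l. l \<in> {1..?n} \<Longrightarrow> h l \<in> ring_hom f.A B"
    "\<And>l r. l \<in> {1..?n} \<Longrightarrow> r \<in> Pc \<Longrightarrow> h l (scal f.A r) = r"
    "\<And>l. l \<in> {1..?n} \<Longrightarrow> h l f.x = y (\<sigma> l)" by blast
  interpret N: split_adjoin ?S f ?n B id h
  proof (intro split_adjoin.intro f.adjoin_axioms split_adjoin_axioms.intro B id h(1))
    show "h l (scal f.A r) = id r" if "l \<in> {1..?n}" "r \<in> carrier ?S" for l r using that h(2) by simp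
    show "map_up id f = root_prod B {1..?n} (\<lambda>l. h l f.x)"
    proof -
      have "root_prod B {1..?n} (\<lambda>l. h l f.x) = root_prod B {1..?n} (\<lambda>l. y (\<sigma> l))"
        unfolding root_prod_def
        using h(3) y \<sigma>L by (intro B.P.finprod_cong') (auto simp del: atLeastAtMost_iff)
      then show ?thesis unfolding map_up_id f[symmetric] ..
    qed
  qed
  define a where "a = (\<Oplus>\<^bsub>f.A\<^esub>i\<in>{..<d}. scal f.A (c i) \<otimes>\<^bsub>f.A\<^esub> f.x [^]\<^bsub>f.A\<^esub> i)"
  have cB: "\<And>i. i < d \<Longrightarrow> c i \<in> carrier B" using c sub by blast
  have sc: "\<And>i. i < d \<Longrightarrow> scal f.A (c i) \<in> carrier f.A" using c f.scal_closed by simp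
  have a: "a \<in> carrier f.A" unfolding a_def using sc f.x_closed by (intro f.A.finsum_closed) auto
  have ha: "h l a = (\<Oplus>\<^bsub>B\<^esub>i\<in>{..<d}. c i \<otimes>\<^bsub>B\<^esub> y (\<sigma> l) [^]\<^bsub>B\<^esub> i)" if l: "l \<in> {1..?n}" for l
  proof -
    interpret hl: ring_hom_cring f.A B "h l" by (rule ring_hom_cringI[OF f.A.is_cring B h(1)[OF l]])
    show ?thesis unfolding a_def using sc f.x_closed h(2,3)[OF l] c cB y \<sigma>L[OF l]
      by (subst hl.hom_finsum) (auto intro!: B.finsum_cong')
  qed
  have hac: "h l a \<in> carrier B" if l: "l \<in> {1..?n}" for l using ring_hom_closed[OF h(1)[OF l] a] .
  have "mult_char_poly ?S f.A ?n a = root_prod B {1..?n} (\<lambda>l. h l a)"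
    using N.char_poly_split[OF a] by (simp add: map_up_id)
  then have "root_prod B {1..?n} (\<lambda>l. h l a) 0 \<in> Pc"
    using f.mult_char_poly_closed[OF a] S.UP_val by fastforce
  then have "(\<ominus>\<^bsub>B\<^esub> \<one>\<^bsub>B\<^esub>) [^]\<^bsub>B\<^esub> ?n \<otimes>\<^bsub>B\<^esub> root_prod B {1..?n} (\<lambda>l. h l a) 0 \<in> Pc"
  proof -
    have "(\<ominus>\<^bsub>B\<^esub> \<one>\<^bsub>B\<^esub>) [^]\<^bsub>B\<^esub> k \<in> Pc" for k :: nat
      using subringE(3,5,6)[OF Pc] by (induction k) auto
    then show "root_prod B {1..?n} (\<lambda>l. h l a) 0 \<in> Pc \<Longrightarrow> ?thesis" using subringE(6)[OF Pc] by blast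
  qed
  then have "(\<Otimes>\<^bsub>B\<^esub>l\<in>{1..?n}. h l a) \<in> Pc"
    using B.root_prod_norm[of "{1..?n}" "\<lambda>l. h l a"] hac by simp
  also have "(\<Otimes>\<^bsub>B\<^esub>l\<in>{1..?n}. h l a) = (\<Otimes>\<^bsub>B\<^esub>l\<in>{1..?n}. \<Oplus>\<^bsub>B\<^esub>i\<in>{..<d}. c i \<otimes>\<^bsub>B\<^esub> y (\<sigma> l) [^]\<^bsub>B\<^esub> i)"
    using ha hac by (intro B.finprod_cong') (auto simp del: atLeastAtMost_iff)
  also have "\<dots> = (\<Otimes>\<^bsub>B\<^esub>l\<in>\<sigma> ` {1..?n}. \<Oplus>\<^bsub>B\<^esub>i\<in>{..<d}. c i \<otimes>\<^bsub>B\<^esub> y l [^]\<^bsub>B\<^esub> i)"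
    using \<sigma> cB y by (intro B.finprod_reindex[symmetric]) (auto simp: bij_betw_def intro!: B.finsum_closed)
  finally show ?thesis using \<sigma> by (simp add: bij_betw_def)
qed

section \<open>Splitting rings\<close>

text \<open>
  A type that is large enough to contain, with each ring of trees \<open>K\<close>, a copy of \<open>K[x]/(g)\<close>:
  an element of the quotient becomes the node with the coefficients of a representative as its children. So roots can
  be adjoined repeatedly, by induction, without leaving the type.
\<close>

datatype 'r tree = Leaf 'r | Node "'r tree list"

lemma transport_ring:
  assumes S: "cring S" and e: "inj_on e (carrier S)"
  shows "cring (image_ring e S)" "e \<in> ring_hom S (image_ring e S)"
    "carrier (image_ring e S) = e ` carrier S"
proof -
  interpret S: cring S by fact
  have "image_ring e S\<lparr>zero := e \<zero>\<^bsub>S\<^esub>\<rparr> = image_ring e S"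
    by (simp add: image_ring_def image_group_def monoid.defs)
  then show "cring (image_ring e S)"
    using S.ring_iso_imp_img_cring[OF inj_imp_image_ring_iso[OF e]] by simp
  show "e \<in> ring_hom S (image_ring e S)"
    using inj_imp_image_ring_iso[OF e] by (simp add: ring_iso_def)
  show "carrier (image_ring e S) = e ` carrier S" by (rule image_ring_carrier)
qed

text \<open>
  The ring \<open>L\<close> arises from \<open>K\<close> by adjoining a root \<open>y\<close> of \<open>g\<close>
  freely, in the sense that the powers of \<open>y\<close> below the degree \<open>m\<close> satisfy no linear
  relation.
\<close>

definition extends_by_root ::
  "('k, 'm) ring_scheme \<Rightarrow> (nat \<Rightarrow> 'k) \<Rightarrow> nat \<Rightarrow> ('l, 'q) ring_scheme \<Rightarrow> ('k \<Rightarrow> 'l) \<Rightarrow> 'l \<Rightarrow> bool" where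
  "extends_by_root K g m L i y \<longleftrightarrow> cring L \<and> i \<in> ring_hom K L \<and> y \<in> carrier L \<and> eval K L i y g = \<zero>\<^bsub>L\<^esub> \<and>
     (\<forall>c. (\<forall>a<m. c a \<in> carrier K) \<longrightarrow> (\<Oplus>\<^bsub>L\<^esub>a\<in>{..<m}. i (c a) \<otimes>\<^bsub>L\<^esub> y [^]\<^bsub>L\<^esub> (a::nat)) = \<zero>\<^bsub>L\<^esub> \<longrightarrow> (\<forall>a<m. c a = \<zero>\<^bsub>K\<^esub>))"

lemma root_extension_exists:
  fixes K :: "('r tree, 'm) ring_scheme"
  assumes K: "cring K" and g: "monic_of_degree K m g"
  shows "\<exists>(L :: 'r tree ring) i y. extends_by_root K g m L i y"
proof -
  interpret g: adjoin K g m by (rule adjoinI[OF K g])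
  define rep where "rep c = (SOME p. p \<in> carrier (UP K) \<and> c = g.cls p)" for c
  have rep: "rep c \<in> carrier (UP K) \<and> c = g.cls (rep c)" if "c \<in> carrier g.A" for c
  proof -
    have "\<exists>p. p \<in> carrier (UP K) \<and> c = g.cls p" using that g.Aprops(3) by auto
    from someI_ex[OF this] show ?thesis unfolding rep_def .
  qed
  define bd where "bd c = (SOME N. \<forall>m\<ge>N. rep c m = \<zero>\<^bsub>K\<^esub>)" for c
  have bd: "\<forall>m\<ge>bd c. rep c m = \<zero>\<^bsub>K\<^esub>" if "c \<in> carrier g.A" for c
  proof -
    have "\<exists>N. \<forall>m\<ge>N. rep c m = \<zero>\<^bsub>K\<^esub>" using rep[OF that] g.carrier_UP by blast
    from someI_ex[OF this] show ?thesis unfolding bd_def .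
  qed
  define e where "e c = Node (map (rep c) [0..<bd c])" for c
  have e: "inj_on e (carrier g.A)"
  proof (rule inj_onI)
    fix c c' assume c: "c \<in> carrier g.A" "c' \<in> carrier g.A" "e c = e c'"
    then have m: "map (rep c) [0..<bd c] = map (rep c') [0..<bd c']" by (simp add: e_def)
    from arg_cong[OF m, of length] have b: "bd c = bd c'" by simp
    have "rep c i = rep c' i" for i
    proof (cases "i < bd c")
      case True
      then show ?thesis using arg_cong[OF m, of "\<lambda>xs. xs ! i"] b by simp
    next
      case False
      then show ?thesis using bd[OF c(1)] bd[OF c(2)] b by simp
    qed
    then have "rep c = rep c'" by blast
    then show "c = c'" using rep[OF c(1)] rep[OF c(2)] by simp
  qed
  let ?L = "image_ring e g.A"
  note t = transport_ring[OF g.A.is_cring e]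
  interpret L: cring ?L by (rule t(1))
  interpret e: ring_hom_cring g.A ?L e by (rule ring_hom_cringI[OF g.A.is_cring t(1,2)])
  have "extends_by_root K g m ?L (\<lambda>r. e (scal g.A r)) (e g.x)"
    unfolding extends_by_root_def
  proof (intro conjI allI impI)
    show "(\<lambda>r. e (scal g.A r)) \<in> ring_hom K ?L"
      using ring_hom_trans[OF g.AA.scal_hom t(2)] by (simp add: comp_def)
    show "eval K ?L (\<lambda>r. e (scal g.A r)) (e g.x) g = \<zero>\<^bsub>?L\<^esub>"
      using g.eval_hom_commute[OF g.A.is_cring t(1) g.AA.scal_hom g.x_closed t(2) g.f_closed] g.eval_f
      by (simp add: comp_def)
    fix c a assume c: "\<forall>a<m. c a \<in> carrier K" and a: "a < m"
      and 0: "(\<Oplus>\<^bsub>?L\<^esub>a\<in>{..<m}. e (scal g.A (c a)) \<otimes>\<^bsub>?L\<^esub> e g.x [^]\<^bsub>?L\<^esub> a) = \<zero>\<^bsub>?L\<^esub>"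
    let ?s = "\<Oplus>\<^bsub>g.A\<^esub>a\<in>{..<m}. scal g.A (c a) \<otimes>\<^bsub>g.A\<^esub> g.x [^]\<^bsub>g.A\<^esub> a"
    have s: "?s \<in> carrier g.A" using c g.scal_closed g.x_closed by (intro g.A.finsum_closed) auto
    have "e ?s = (\<Oplus>\<^bsub>?L\<^esub>a\<in>{..<m}. e (scal g.A (c a)) \<otimes>\<^bsub>?L\<^esub> e g.x [^]\<^bsub>?L\<^esub> a)"
      using c g.scal_closed g.x_closed by (subst e.hom_finsum) (auto intro!: L.finsum_cong')
    then have "e ?s = e \<zero>\<^bsub>g.A\<^esub>" using 0 by simp
    then have "?s = \<zero>\<^bsub>g.A\<^esub>" using s by (rule inj_onD[OF e]) simp
    then show "c a = \<zero>\<^bsub>K\<^esub>" using c a by (intro g.A_indep[of c]) auto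
  qed (use t(1) g.x_closed in auto)
  then show ?thesis by blast
qed

lemma tree_copy:
  fixes R :: "('r, 'm) ring_scheme"
  assumes "cring R"
  shows "\<exists>(K :: 'r tree ring) j. cring K \<and> j \<in> ring_hom R K \<and> inj_on j (carrier R)"
  using transport_ring[OF assms, of Leaf] by (auto simp: inj_on_def intro!: exI[of _ "image_ring Leaf R"] exI[of _ Leaf])

lemma extends_by_rootD:
  assumes "extends_by_root K g m L i y"
  shows "cring L" "i \<in> ring_hom K L" "y \<in> carrier L" "eval K L i y g = \<zero>\<^bsub>L\<^esub>"
    "(\<And>a. a < m \<Longrightarrow> c a \<in> carrier K) \<Longrightarrow>
      (\<Oplus>\<^bsub>L\<^esub>a\<in>{..<m}. i (c a) \<otimes>\<^bsub>L\<^esub> y [^]\<^bsub>L\<^esub> a) = \<zero>\<^bsub>L\<^esub> \<Longrightarrow> a < m \<Longrightarrow> c a = \<zero>\<^bsub>K\<^esub>"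
proof -
  note L = assms[unfolded extends_by_root_def]
  show "cring L" "i \<in> ring_hom K L" "y \<in> carrier L" "eval K L i y g = \<zero>\<^bsub>L\<^esub>" using L by simp_all
  have "(\<forall>a<m. c a \<in> carrier K) \<longrightarrow> (\<Oplus>\<^bsub>L\<^esub>a\<in>{..<m}. i (c a) \<otimes>\<^bsub>L\<^esub> y [^]\<^bsub>L\<^esub> a) = \<zero>\<^bsub>L\<^esub> \<longrightarrow> (\<forall>a<m. c a = \<zero>\<^bsub>K\<^esub>)"
    using L by (elim conjE) (erule spec)
  then show "(\<And>a. a < m \<Longrightarrow> c a \<in> carrier K) \<Longrightarrow>
      (\<Oplus>\<^bsub>L\<^esub>a\<in>{..<m}. i (c a) \<otimes>\<^bsub>L\<^esub> y [^]\<^bsub>L\<^esub> a) = \<zero>\<^bsub>L\<^esub> \<Longrightarrow> a < m \<Longrightarrow> c a = \<zero>\<^bsub>K\<^esub>" by blast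
qed

text \<open>
  The degree is positive here, since adjoining a root of the polynomial \<open>1\<close> of degree \<open>0\<close>
  yields the zero ring.
\<close>

lemma extends_by_root_inj:
  assumes K: "cring K" and L: "extends_by_root K g (Suc m) L i y"
  shows "inj_on i (carrier K)"
proof -
  interpret K: cring K by fact
  note L' = extends_by_rootD[OF L]
  interpret L: cring L by (rule L'(1))
  interpret i: ring_hom_cring K L i by (rule ring_hom_cringI[OF K L'(1,2)])
  have y: "y \<in> carrier L" by (rule L'(3))
  have ker: "r = \<zero>\<^bsub>K\<^esub>" if r: "r \<in> carrier K" "i r = \<zero>\<^bsub>L\<^esub>" for r
  proof -
    let ?c = "\<lambda>a::nat. if a = 0 then r else \<zero>\<^bsub>K\<^esub>"
    have "(\<Oplus>\<^bsub>L\<^esub>a\<in>{..<Suc m}. i (?c a) \<otimes>\<^bsub>L\<^esub> y [^]\<^bsub>L\<^esub> a) = \<zero>\<^bsub>L\<^esub>"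
      using r y by (intro L.add.finprod_one_eqI) auto
    moreover have "\<forall>a<Suc m. ?c a \<in> carrier K" using r by simp
    ultimately have "?c 0 = \<zero>\<^bsub>K\<^esub>" by (intro L'(5)[of ?c 0]) auto
    then show ?thesis by simp
  qed
  show ?thesis
  proof (rule inj_onI)
    fix a b assume ab: "a \<in> carrier K" "b \<in> carrier K" "i a = i b"
    then have "a \<oplus>\<^bsub>K\<^esub> \<ominus>\<^bsub>K\<^esub> b = \<zero>\<^bsub>K\<^esub>" by (intro ker) (auto simp: L.r_neg)
    then show "a = b" using ab K.sum_zero_eq_neg[of a "\<ominus>\<^bsub>K\<^esub> b"] by simp
  qed
qed

text \<open>
  The remainder after division by \<open>X - y\<close> is the constant \<open>G(y) = 0\<close>. The coefficients of
  the quotient satisfy \<open>q\<^sub>m = G\<^sub>m\<^sub>+\<^sub>1 + y q\<^sub>m\<^sub>+\<^sub>1\<close>, so they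
  vanish above \<open>n\<close> by descending induction.
\<close>

lemma (in up_cring) factor_monic:
  assumes G: "monic_of_degree R (Suc n) G" and y: "y \<in> carrier R" and 0: "eval R R id y G = \<zero>"
  shows "\<exists>g. monic_of_degree R n g \<and> G = lin_fac R y \<otimes>\<^bsub>UP R\<^esub> g"
proof -
  have Gc: "G \<in> carrier (UP R)" "G (Suc n) = \<one>" "\<And>m. m > Suc n \<Longrightarrow> G m = \<zero>" using G by (auto simp: monic_iff)
  obtain q r where q: "q \<in> carrier (UP R)" and r: "r \<in> carrier (UP R)"
    and e: "G = q \<otimes>\<^bsub>UP R\<^esub> lin_fac R y \<oplus>\<^bsub>UP R\<^esub> r" and rb: "\<forall>m\<ge>1. r m = \<zero>"
    using monic_division[OF monic_lin_fac[OF y] Gc(1)] by blast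
  interpret E: ring_hom_cring "UP R" R "eval R R id y"
    by (rule ring_hom_cringI[OF P.is_cring is_cring eval_hom(1)[OF is_cring id_ring_hom y]])
  note ev = eval_hom(2,3)[OF is_cring id_ring_hom y]
  have r0: "r = cst (r 0)"
  proof
    fix m show "r m = cst (r 0) m" using r rb by (cases m) (auto simp: UP_fun One_nat_def)
  qed
  have "eval R R id y (lin_fac R y) = \<zero>"
    unfolding lin_fac_def P.minus_eq using y ev by (simp add: r_neg del: U.monom_a_inv)
  then have "eval R R id y G = eval R R id y r" unfolding e using q r y by simp
  also have "\<dots> = r 0" using ev(1)[of "r 0"] r r0 by simp
  finally have "r 0 = \<zero>" using 0 by simp
  then have rz: "r = \<zero>\<^bsub>UP R\<^esub>" using r0 by simp
  have e': "G = lin_fac R y \<otimes>\<^bsub>UP R\<^esub> q" unfolding e rz using q y by (simp add: P.m_comm)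
  have step: "q m = G (Suc m) \<oplus> y \<otimes> q (Suc m)" for m
    unfolding e' lin_fac_mult[OF y q] using q y by (simp add: minus_eq a_assoc l_neg)
  obtain N where N: "\<And>m. m \<ge> N \<Longrightarrow> q m = \<zero>" using q by (auto simp: carrier_UP)
  have "q m = \<zero>" if "m > n" for m
  proof -
    have "m \<ge> N - k \<Longrightarrow> m > n \<Longrightarrow> q m = \<zero>" for k m
    proof (induction k arbitrary: m)
      case 0
      then show ?case using N by simp
    next
      case (Suc k)
      then have "q (Suc m) = \<zero>" by (intro Suc.IH) auto
      then show ?case using step[of m] Suc.prems Gc y by simp
    qed
    then show ?thesis using that diff_self_eq_0[of N] by (metis le0)
  qed
  then have "monic_of_degree R n q" unfolding monic_iff using q step[of n] Gc(2) y by simp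
  then show ?thesis using e' by blast
qed

lemma splitting_ring_exists:
  fixes K :: "'r tree ring"
  assumes "cring K" "monic_of_degree K n g"
  shows "\<exists>(L :: 'r tree ring) i \<theta>. cring L \<and> i \<in> ring_hom K L \<and> inj_on i (carrier K) \<and>
    (\<forall>l\<in>{1..n}. \<theta> l \<in> carrier L) \<and> map_up i g = root_prod L {1..n} \<theta>"
  using assms
proof (induction n arbitrary: K g)
  case 0
  interpret K: up_cring K using 0 by (intro up_cring.intro)
  have "g = \<one>\<^bsub>UP K\<^esub>" using 0 by (auto simp: K.monic_iff K.UP_fun)
  then have "map_up id g = root_prod K {1..0::nat} (\<lambda>_. \<zero>\<^bsub>K\<^esub>)" by (simp add: root_prod_def map_up_id)
  then show ?case using 0
    by (intro exI[of _ K] exI[of _ id] exI[of _ "\<lambda>_. \<zero>\<^bsub>K\<^esub>"] conjI id_ring_hom) (auto simp: id_def)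
next
  case (Suc n)
  obtain L :: "'r tree ring" and i y where L: "extends_by_root K g (Suc n) L i y"
    using root_extension_exists[OF Suc.prems] by blast
  note L' = extends_by_rootD(1-4)[OF L]
  note inj = extends_by_root_inj[OF Suc.prems(1) L]
  interpret K: up_cring K using Suc by (intro up_cring.intro)
  interpret L: up_cring L using L' by (intro up_cring.intro)
  have gc: "g \<in> carrier (UP K)" using Suc.prems by (simp add: K.monic_iff)
  have "eval L L id y (map_up i g) = \<zero>\<^bsub>L\<^esub>"
    using eval_map_up[OF Suc.prems(1) L'(1,2) L'(1) id_ring_hom L'(3) gc] L'(4) by simp
  then obtain g1 where g1: "monic_of_degree L n g1" "map_up i g = lin_fac L y \<otimes>\<^bsub>UP L\<^esub> g1"
    using L.factor_monic[OF monic_map_up[OF Suc.prems(1) L'(1,2) Suc.prems(2)] L'(3)] by blast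
  obtain L2 :: "'r tree ring" and i2 \<theta> where L2: "cring L2" "i2 \<in> ring_hom L L2" "inj_on i2 (carrier L)"
    "\<And>l. l \<in> {1..n} \<Longrightarrow> \<theta> l \<in> carrier L2" "map_up i2 g1 = root_prod L2 {1..n} \<theta>"
    using Suc.IH[OF L'(1) g1(1)] by blast
  interpret L2: up_cring L2 using L2 by (intro up_cring.intro)
  let ?\<theta> = "\<theta>(Suc n := i2 y)"
  have \<theta>: "\<And>l. l \<in> {1..Suc n} \<Longrightarrow> ?\<theta> l \<in> carrier L2"
    using L2(4) ring_hom_closed[OF L2(2) L'(3)] by (auto simp: le_Suc_eq)
  have g1c: "g1 \<in> carrier (UP L)" using g1 by (simp add: L.monic_iff)
  have "map_up (i2 \<circ> i) g = map_up i2 (map_up i g)" by (simp add: map_up_def)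
  also have "\<dots> = lin_fac L2 (i2 y) \<otimes>\<^bsub>UP L2\<^esub> root_prod L2 {1..n} \<theta>"
    unfolding g1(2) using ring_hom_mult[OF map_up_hom[OF L'(1) L2(1,2)] L.lin_fac_closed[OF L'(3)] g1c]
      map_up_lin_fac[OF L'(1) L2(1,2) L'(3)] L2(5) by simp
  also have "root_prod L2 {1..n} \<theta> = root_prod L2 {1..n} ?\<theta>"
    unfolding root_prod_def using L2(4) by (intro L2.P.finprod_cong') auto
  also have "lin_fac L2 (i2 y) \<otimes>\<^bsub>UP L2\<^esub> root_prod L2 {1..n} ?\<theta> = root_prod L2 {1..Suc n} ?\<theta>"
  proof -
    have I: "{1..Suc n} = insert (Suc n) {1..n}" by auto
    show ?thesis unfolding root_prod_def I
      by (subst L2.P.finprod_insert) (auto intro!: L2.lin_fac_closed \<theta> simp del: fun_upd_apply, simp)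
  qed
  finally have "map_up (i2 \<circ> i) g = root_prod L2 {1..Suc n} ?\<theta>" .
  moreover have "inj_on (i2 \<circ> i) (carrier K)"
    using inj L2(3) ring_hom_closed[OF L'(2)] by (intro comp_inj_on) (auto intro: inj_on_subset)
  ultimately show ?case using L2(1) ring_hom_trans[OF L'(2) L2(2)] \<theta>
    by (intro exI[of _ L2] exI[of _ "i2 \<circ> i"] exI[of _ ?\<theta>]) blast
qed

lemma splitting_ring_exists_family:
  fixes R :: "('r, 'm) ring_scheme" and k :: nat
  assumes R: "cring R" and F: "\<And>i. i \<in> {1..k} \<Longrightarrow> monic_of_degree R (d i) (F i)"
  shows "\<exists>(K :: 'r tree ring) j \<theta>. cring K \<and> j \<in> ring_hom R K \<and> inj_on j (carrier R) \<and>
    (\<forall>i\<in>{1..k}. (\<forall>l\<in>{1..d i}. \<theta> i l \<in> carrier K) \<and> map_up j (F i) = root_prod K {1..d i} (\<theta> i))"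
  using F
proof (induction k)
  case 0
  then show ?case using tree_copy[OF R] by auto
next
  case (Suc k)
  have "\<exists>(K :: 'r tree ring) j \<theta>. cring K \<and> j \<in> ring_hom R K \<and> inj_on j (carrier R) \<and>
    (\<forall>i\<in>{1..k}. (\<forall>l\<in>{1..d i}. \<theta> i l \<in> carrier K) \<and> map_up j (F i) = root_prod K {1..d i} (\<theta> i))"
    by (rule Suc.IH) (use Suc.prems in auto)
  then obtain K :: "'r tree ring" and j \<theta> where K: "cring K" "j \<in> ring_hom R K" "inj_on j (carrier R)"
    "\<And>i l. i \<in> {1..k} \<Longrightarrow> l \<in> {1..d i} \<Longrightarrow> \<theta> i l \<in> carrier K"
    "\<And>i. i \<in> {1..k} \<Longrightarrow> map_up j (F i) = root_prod K {1..d i} (\<theta> i)" by blast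
  have "monic_of_degree K (d (Suc k)) (map_up j (F (Suc k)))"
    using Suc.prems by (intro monic_map_up[OF R K(1,2)]) auto
  from splitting_ring_exists[OF K(1) this] obtain L :: "'r tree ring" and i \<eta> where
    L: "cring L" "i \<in> ring_hom K L" "inj_on i (carrier K)"
    "\<And>l. l \<in> {1..d (Suc k)} \<Longrightarrow> \<eta> l \<in> carrier L"
    "map_up i (map_up j (F (Suc k))) = root_prod L {1..d (Suc k)} \<eta>" by blast
  let ?\<theta> = "\<lambda>a. if a = Suc k then \<eta> else (\<lambda>l. i (\<theta> a l))"
  have "inj_on (i \<circ> j) (carrier R)"
    using K(3) L(3) ring_hom_closed[OF K(2)] by (intro comp_inj_on) (auto intro: inj_on_subset)
  moreover have "i \<circ> j \<in> ring_hom R L" by (rule ring_hom_trans[OF K(2) L(2)])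
  moreover have "?\<theta> a l \<in> carrier L" if "a \<in> {1..Suc k}" "l \<in> {1..d a}" for a l
    using that L(4) ring_hom_closed[OF L(2) K(4)[of a l]] by (auto simp: le_Suc_eq)
  moreover have "map_up (i \<circ> j) (F a) = root_prod L {1..d a} (?\<theta> a)" if a: "a \<in> {1..Suc k}" for a
  proof (cases "a = Suc k")
    case True
    then show ?thesis using L(5) by (simp add: map_up_def)
  next
    case False
    then have a': "a \<in> {1..k}" using a by auto
    have "map_up (i \<circ> j) (F a) = map_up i (map_up j (F a))" by (simp add: map_up_def)
    also have "\<dots> = root_prod L {1..d a} (\<lambda>l. i (\<theta> a l))"
      unfolding K(5)[OF a'] by (rule map_up_root_prod[OF K(1) L(1,2) K(4)[OF a']])
    finally show ?thesis using False by simp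
  qed
  ultimately show ?case using L(1) by (intro exI[of _ L] exI[of _ "i \<circ> j"] exI[of _ ?\<theta>]) blast
qed

text \<open>
  In contrast to a splitting ring, each new root is a root of \<open>f\<close> itself and not of the cofactor that is
  left after dividing by the previous linear factors. So \<open>E\<close> is a copy of the \<open>m\<close>-th tensor
  power of \<open>R[x]/(f)\<close>, but one for which the independence of the monomials is known from the
  construction.
\<close>

definition independent_roots ::
  "('r, 'm) ring_scheme \<Rightarrow> (nat \<Rightarrow> 'r) \<Rightarrow> nat \<Rightarrow> nat \<Rightarrow> ('e, 'q) ring_scheme \<Rightarrow> ('r \<Rightarrow> 'e) \<Rightarrow> (nat \<Rightarrow> 'e) \<Rightarrow> bool" where
  "independent_roots R f n m E j x \<longleftrightarrow> cring E \<and> j \<in> ring_hom R E \<and>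
    (\<forall>l\<in>{1..m}. x l \<in> carrier E \<and> eval R E j (x l) f = \<zero>\<^bsub>E\<^esub>) \<and>
    (\<forall>c. (\<forall>\<alpha>\<in>{1..m} \<rightarrow>\<^sub>E {..<n}. c \<alpha> \<in> carrier R) \<longrightarrow>
      (\<Oplus>\<^bsub>E\<^esub>\<alpha>\<in>{1..m} \<rightarrow>\<^sub>E {..<n}. j (c \<alpha>) \<otimes>\<^bsub>E\<^esub> (\<Otimes>\<^bsub>E\<^esub>l\<in>{1..m}. x l [^]\<^bsub>E\<^esub> \<alpha> l)) = \<zero>\<^bsub>E\<^esub> \<longrightarrow>
      (\<forall>\<alpha>\<in>{1..m} \<rightarrow>\<^sub>E {..<n}. c \<alpha> = \<zero>\<^bsub>R\<^esub>))"

lemma independent_rootsD: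
  assumes "independent_roots R f n m E j x"
  shows "cring E" "j \<in> ring_hom R E" "l \<in> {1..m} \<Longrightarrow> x l \<in> carrier E"
    "l \<in> {1..m} \<Longrightarrow> eval R E j (x l) f = \<zero>\<^bsub>E\<^esub>"
    "(\<And>\<alpha>. \<alpha> \<in> {1..m} \<rightarrow>\<^sub>E {..<n} \<Longrightarrow> c \<alpha> \<in> carrier R) \<Longrightarrow>
      (\<Oplus>\<^bsub>E\<^esub>\<alpha>\<in>{1..m} \<rightarrow>\<^sub>E {..<n}. j (c \<alpha>) \<otimes>\<^bsub>E\<^esub> (\<Otimes>\<^bsub>E\<^esub>l\<in>{1..m}. x l [^]\<^bsub>E\<^esub> \<alpha> l)) = \<zero>\<^bsub>E\<^esub> \<Longrightarrow>
      \<alpha> \<in> {1..m} \<rightarrow>\<^sub>E {..<n} \<Longrightarrow> c \<alpha> = \<zero>\<^bsub>R\<^esub>"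
proof -
  note L = assms[unfolded independent_roots_def]
  show "cring E" "j \<in> ring_hom R E" "l \<in> {1..m} \<Longrightarrow> x l \<in> carrier E"
    "l \<in> {1..m} \<Longrightarrow> eval R E j (x l) f = \<zero>\<^bsub>E\<^esub>" using L by simp_all
  have "(\<forall>\<alpha>\<in>{1..m} \<rightarrow>\<^sub>E {..<n}. c \<alpha> \<in> carrier R) \<longrightarrow>
      (\<Oplus>\<^bsub>E\<^esub>\<alpha>\<in>{1..m} \<rightarrow>\<^sub>E {..<n}. j (c \<alpha>) \<otimes>\<^bsub>E\<^esub> (\<Otimes>\<^bsub>E\<^esub>l\<in>{1..m}. x l [^]\<^bsub>E\<^esub> \<alpha> l)) = \<zero>\<^bsub>E\<^esub> \<longrightarrow>
      (\<forall>\<alpha>\<in>{1..m} \<rightarrow>\<^sub>E {..<n}. c \<alpha> = \<zero>\<^bsub>R\<^esub>)"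
    using L by (elim conjE) (erule spec)
  then show "(\<And>\<alpha>. \<alpha> \<in> {1..m} \<rightarrow>\<^sub>E {..<n} \<Longrightarrow> c \<alpha> \<in> carrier R) \<Longrightarrow>
      (\<Oplus>\<^bsub>E\<^esub>\<alpha>\<in>{1..m} \<rightarrow>\<^sub>E {..<n}. j (c \<alpha>) \<otimes>\<^bsub>E\<^esub> (\<Otimes>\<^bsub>E\<^esub>l\<in>{1..m}. x l [^]\<^bsub>E\<^esub> \<alpha> l)) = \<zero>\<^bsub>E\<^esub> \<Longrightarrow>
      \<alpha> \<in> {1..m} \<rightarrow>\<^sub>E {..<n} \<Longrightarrow> c \<alpha> = \<zero>\<^bsub>R\<^esub>" by blast
qed

lemma independent_roots_exist:
  fixes R :: "('r, 'm) ring_scheme"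
  assumes R: "cring R" and f: "monic_of_degree R n f"
  shows "\<exists>(E :: 'r tree ring) j x. independent_roots R f n m E j x"
proof (induction m)
  case 0
  obtain K :: "'r tree ring" and j where K: "cring K" "j \<in> ring_hom R K" "inj_on j (carrier R)"
    using tree_copy[OF R] by blast
  interpret K: cring K by fact
  interpret j: ring_hom_cring R K j by (rule ring_hom_cringI[OF R K(1,2)])
  have "c (\<lambda>_. undefined) = \<zero>\<^bsub>R\<^esub>" if "c (\<lambda>_. undefined) \<in> carrier R" "j (c (\<lambda>_. undefined)) = \<zero>\<^bsub>K\<^esub>" for c :: "(nat \<Rightarrow> nat) \<Rightarrow> 'r"
    using K(3) that by (intro inj_onD[OF K(3)]) auto
  then have "independent_roots R f n 0 K j x" for x
    unfolding independent_roots_def using K by (auto simp: K.finsum_insert)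
  then show ?case by blast
next
  case (Suc m)
  then obtain E :: "'r tree ring" and j x where EE: "independent_roots R f n m E j x" by blast
  note E = independent_rootsD(1,2)[OF EE] and x = independent_rootsD(3,4)[OF EE] and ind = independent_rootsD(5)[OF EE]
  obtain L :: "'r tree ring" and i y where L: "extends_by_root E (map_up j f) n L i y"
    using root_extension_exists[OF E(1) monic_map_up[OF R E f]] by blast
  note L' = extends_by_rootD(1-4)[OF L] and Lind = extends_by_rootD(5)[OF L]
  interpret R: up_cring R using R by (rule up_cring.intro)
  interpret E: cring E by fact
  interpret L: cring L by fact
  interpret i: ring_hom_cring E L i by (rule ring_hom_cringI[OF E(1) L'(1,2)])
  interpret j: ring_hom_cring R E j by (rule ring_hom_cringI[OF R E])
  have fc: "f \<in> carrier (UP R)" using f by (simp add: R.monic_iff)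
  let ?x = "\<lambda>l. if l = Suc m then y else i (x l)" and ?j = "i \<circ> j"
  have xc: "?x l \<in> carrier L" if "l \<in> {1..Suc m}" for l using that x(1)[of l] L'(3) by (auto simp: le_Suc_eq)
  have xr: "eval R L ?j (?x l) f = \<zero>\<^bsub>L\<^esub>" if "l \<in> {1..Suc m}" for l
  proof (cases "l = Suc m")
    case True
    then show ?thesis using eval_map_up[OF R E L'(1,2,3) fc] L'(4) by simp
  next
    case False
    then have l: "l \<in> {1..m}" using that by auto
    show ?thesis using R.eval_hom_commute[OF E(1) L'(1) E(2) x(1)[OF l] L'(2) fc] x(2)[OF l] False by simp
  qed
  have "\<forall>\<alpha>\<in>{1..Suc m} \<rightarrow>\<^sub>E {..<n}. c \<alpha> = \<zero>\<^bsub>R\<^esub>" if c: "\<forall>\<alpha>\<in>{1..Suc m} \<rightarrow>\<^sub>E {..<n}. c \<alpha> \<in> carrier R"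
    and 0: "(\<Oplus>\<^bsub>L\<^esub>\<alpha>\<in>{1..Suc m} \<rightarrow>\<^sub>E {..<n}. ?j (c \<alpha>) \<otimes>\<^bsub>L\<^esub> (\<Otimes>\<^bsub>L\<^esub>l\<in>{1..Suc m}. ?x l [^]\<^bsub>L\<^esub> (\<alpha> l::nat))) = \<zero>\<^bsub>L\<^esub>" for c
  proof -
    let ?W = "{1..m} \<rightarrow>\<^sub>E {..<n}" and ?u = "\<lambda>p. (snd p)(Suc m := fst p)"
    have I: "{1..Suc m} = insert (Suc m) {1..m}" by auto
    have W: "{1..Suc m} \<rightarrow>\<^sub>E {..<n} = ?u ` ({..<n} \<times> ?W)"
      unfolding I PiE_insert_eq by (auto simp: image_def)
    have inj: "inj_on ?u ({..<n} \<times> ?W)"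
      using inj_combinator[of "Suc m" "{1..m}" "\<lambda>_. {..<n}"] by (simp add: case_prod_unfold)
    have fW: "finite ?W" by (intro finite_PiE) auto
    have mon: "(\<Otimes>\<^bsub>E\<^esub>l\<in>{1..m}. x l [^]\<^bsub>E\<^esub> \<alpha> l) \<in> carrier E" for \<alpha> :: "nat \<Rightarrow> nat"
      using x(1) by (intro E.finprod_closed) auto
    have cu: "c (?u p) \<in> carrier R" if "p \<in> {..<n} \<times> ?W" for p using c that W by blast
    let ?C = "\<lambda>a. \<Oplus>\<^bsub>E\<^esub>\<alpha>\<in>?W. j (c (?u (a, \<alpha>))) \<otimes>\<^bsub>E\<^esub> (\<Otimes>\<^bsub>E\<^esub>l\<in>{1..m}. x l [^]\<^bsub>E\<^esub> (\<alpha> l::nat))"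
    have tc: "j (c (?u (a, \<alpha>))) \<otimes>\<^bsub>E\<^esub> (\<Otimes>\<^bsub>E\<^esub>l\<in>{1..m}. x l [^]\<^bsub>E\<^esub> (\<alpha> l::nat)) \<in> carrier E"
      if "a < n" "\<alpha> \<in> ?W" for a \<alpha> using cu[of "(a, \<alpha>)"] that mon by auto
    have Cc: "?C a \<in> carrier E" if "a < n" for a using tc[OF that] by (intro E.finsum_closed) auto
    have prodc: "(\<Otimes>\<^bsub>L\<^esub>l\<in>{1..Suc m}. ?x l [^]\<^bsub>L\<^esub> (\<alpha> l::nat)) \<in> carrier L" for \<alpha> using xc by (intro L.finprod_closed) auto
    have "\<zero>\<^bsub>L\<^esub> = (\<Oplus>\<^bsub>L\<^esub>p\<in>{..<n} \<times> ?W. ?j (c (?u p)) \<otimes>\<^bsub>L\<^esub> (\<Otimes>\<^bsub>L\<^esub>l\<in>{1..Suc m}. ?x l [^]\<^bsub>L\<^esub> (?u p l)))"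
      unfolding 0[symmetric] W using inj cu prodc by (intro L.finsum_reindex) auto
    also have "\<dots> = (\<Oplus>\<^bsub>L\<^esub>p\<in>{..<n} \<times> ?W. i (j (c (?u (fst p, snd p))) \<otimes>\<^bsub>E\<^esub> (\<Otimes>\<^bsub>E\<^esub>l\<in>{1..m}. x l [^]\<^bsub>E\<^esub> snd p l)) \<otimes>\<^bsub>L\<^esub> y [^]\<^bsub>L\<^esub> fst p)"
    proof (intro L.finsum_cong' refl)
      fix p assume p: "p \<in> {..<n} \<times> ?W"
      have "(\<Otimes>\<^bsub>L\<^esub>l\<in>{1..Suc m}. ?x l [^]\<^bsub>L\<^esub> (?u p l)) = y [^]\<^bsub>L\<^esub> fst p \<otimes>\<^bsub>L\<^esub> (\<Otimes>\<^bsub>L\<^esub>l\<in>{1..m}. i (x l [^]\<^bsub>E\<^esub> snd p l))"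
        unfolding I using x(1) L'(3) xc
        by (subst L.finprod_insert) (auto intro!: arg_cong2[where f="(\<otimes>\<^bsub>L\<^esub>)"] L.finprod_cong')
      also have "(\<Otimes>\<^bsub>L\<^esub>l\<in>{1..m}. i (x l [^]\<^bsub>E\<^esub> snd p l)) = i (\<Otimes>\<^bsub>E\<^esub>l\<in>{1..m}. x l [^]\<^bsub>E\<^esub> snd p l)"
        using x(1) by (subst i.hom_finprod) (auto simp: comp_def)
      finally show "?j (c (?u p)) \<otimes>\<^bsub>L\<^esub> (\<Otimes>\<^bsub>L\<^esub>l\<in>{1..Suc m}. ?x l [^]\<^bsub>L\<^esub> (?u p l)) =
         i (j (c (?u (fst p, snd p))) \<otimes>\<^bsub>E\<^esub> (\<Otimes>\<^bsub>E\<^esub>l\<in>{1..m}. x l [^]\<^bsub>E\<^esub> snd p l)) \<otimes>\<^bsub>L\<^esub> y [^]\<^bsub>L\<^esub> fst p"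
        using cu[OF p] mon[of "snd p"] L'(3) by (simp add: L.m_ac)
    qed (use tc L'(3) in auto)
    also have "\<dots> = (\<Oplus>\<^bsub>L\<^esub>a\<in>{..<n}. \<Oplus>\<^bsub>L\<^esub>\<alpha>\<in>?W. i (j (c (?u (a, \<alpha>))) \<otimes>\<^bsub>E\<^esub> (\<Otimes>\<^bsub>E\<^esub>l\<in>{1..m}. x l [^]\<^bsub>E\<^esub> \<alpha> l)) \<otimes>\<^bsub>L\<^esub> y [^]\<^bsub>L\<^esub> a)"
      using fW tc L'(3)
      by (intro L.finsum_Sigma[symmetric, where f = "\<lambda>a \<alpha>. i (j (c (?u (a, \<alpha>))) \<otimes>\<^bsub>E\<^esub> (\<Otimes>\<^bsub>E\<^esub>l\<in>{1..m}. x l [^]\<^bsub>E\<^esub> \<alpha> l)) \<otimes>\<^bsub>L\<^esub> y [^]\<^bsub>L\<^esub> a"]) auto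
    also have "\<dots> = (\<Oplus>\<^bsub>L\<^esub>a\<in>{..<n}. i (?C a) \<otimes>\<^bsub>L\<^esub> y [^]\<^bsub>L\<^esub> a)"
    proof (intro L.finsum_cong' refl)
      fix a assume a: "a \<in> {..<n}"
      have "i (?C a) = (\<Oplus>\<^bsub>L\<^esub>\<alpha>\<in>?W. i (j (c (?u (a, \<alpha>))) \<otimes>\<^bsub>E\<^esub> (\<Otimes>\<^bsub>E\<^esub>l\<in>{1..m}. x l [^]\<^bsub>E\<^esub> \<alpha> l)))"
        using tc a by (subst i.hom_finsum) (auto simp: comp_def)
      then show "(\<Oplus>\<^bsub>L\<^esub>\<alpha>\<in>?W. i (j (c (?u (a, \<alpha>))) \<otimes>\<^bsub>E\<^esub> (\<Otimes>\<^bsub>E\<^esub>l\<in>{1..m}. x l [^]\<^bsub>E\<^esub> \<alpha> l)) \<otimes>\<^bsub>L\<^esub> y [^]\<^bsub>L\<^esub> a) =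
          i (?C a) \<otimes>\<^bsub>L\<^esub> y [^]\<^bsub>L\<^esub> a"
        using tc a L'(3) fW by (simp only:, intro L.finsum_ldistr[symmetric]) auto
    qed (use Cc L'(3) in auto)
    finally have C0: "(\<Oplus>\<^bsub>L\<^esub>a\<in>{..<n}. i (?C a) \<otimes>\<^bsub>L\<^esub> y [^]\<^bsub>L\<^esub> a) = \<zero>\<^bsub>L\<^esub>" ..
    have "?C a = \<zero>\<^bsub>E\<^esub>" if "a < n" for a using Lind[of ?C, OF Cc C0 that] .
    then have z: "c (?u (a, \<alpha>)) = \<zero>\<^bsub>R\<^esub>" if "a < n" "\<alpha> \<in> ?W" for a \<alpha>
      using that cu by (intro ind[of "\<lambda>\<alpha>. c (?u (a, \<alpha>))"]) auto
    show ?thesis unfolding W using z by auto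
  qed
  then have "independent_roots R f n (Suc m) L ?j ?x"
    unfolding independent_roots_def using L'(1) ring_hom_trans[OF E(2) L'(2)] xc xr by blast
  then show ?case by blast
qed

section \<open>The tensor power of a monogenic algebra\<close>

lemma alg_hom_iff:
  assumes A: "comm_alg R A" and B: "comm_alg R B"
  shows "h \<in> alg_hom R A B \<longleftrightarrow> h \<in> ring_hom A B \<and> (\<forall>r\<in>carrier R. h (scal A r) = scal B r)"
proof -
  interpret A: comm_algebra R A by (rule comm_algebraI[OF A])
  interpret B: comm_algebra R B by (rule comm_algebraI[OF B])
  show ?thesis
  proof
    assume h: "h \<in> alg_hom R A B"
    then have hr: "h \<in> ring_hom A B" by (simp add: alg_hom_def)
    then show "h \<in> ring_hom A B \<and> (\<forall>r\<in>carrier R. h (scal A r) = scal B r)"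
      using h ring_hom_one[OF hr] by (auto simp: alg_hom_def scal_def)
  next
    assume h: "h \<in> ring_hom A B \<and> (\<forall>r\<in>carrier R. h (scal A r) = scal B r)"
    then have hr: "h \<in> ring_hom A B" by simp
    show "h \<in> alg_hom R A B"
      unfolding alg_hom_def using h ring_hom_mult[OF hr] ring_hom_closed[OF hr]
      by (auto simp: A.smult_eq B.smult_eq)
  qed
qed

lemma (in cring) subring_finsum:
  assumes "subring S R" "\<And>a. a \<in> A \<Longrightarrow> g a \<in> S"
  shows "(\<Oplus>a\<in>A. g a) \<in> S"
  using assms(2)
proof (induction A rule: infinite_finite_induct)
  case (insert a A)
  then have "g a \<in> carrier R" "g \<in> A \<rightarrow> carrier R" using subringE(1)[OF assms(1)] by auto
  then show ?case using insert subringE(7)[OF assms(1)] by simp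
qed (use subringE(2)[OF assms(1)] in auto)

lemma (in cring) subring_finprod:
  assumes "subring S R" "\<And>a. a \<in> A \<Longrightarrow> g a \<in> S"
  shows "(\<Otimes>a\<in>A. g a) \<in> S"
  using assms(2)
proof (induction A rule: infinite_finite_induct)
  case (insert a A)
  then have "g a \<in> carrier R" "g \<in> A \<rightarrow> carrier R" using subringE(1)[OF assms(1)] by auto
  then show ?case using insert subringE(6)[OF assms(1)] by simp
qed (use subringE(3)[OF assms(1)] in auto)

lemma (in cring) subringI':
  assumes "S \<subseteq> carrier R" "\<one> \<in> S" "\<And>a. a \<in> S \<Longrightarrow> \<ominus> a \<in> S"
    "\<And>a b. a \<in> S \<Longrightarrow> b \<in> S \<Longrightarrow> a \<otimes> b \<in> S" "\<And>a b. a \<in> S \<Longrightarrow> b \<in> S \<Longrightarrow> a \<oplus> b \<in> S"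
  shows "subring S R"
  using assms by (intro subringI) auto

context adjoin
begin

sublocale TF: tensor_family R "{1..n}" "\<lambda>_. A"
  by (intro tensor_family.intro is_cring A_alg) auto

abbreviation "T \<equiv> tensor_prod R {1..n} (\<lambda>_. A)"
abbreviation "emb \<equiv> tensor_emb R {1..n} (\<lambda>_. A)"

lemma tensor_power_eq: "tensor_power R A n = T"
  by (simp add: tensor_power_def)

lemma at_pos_eq: "at_pos R A n i a = emb i a"
  by (simp add: at_pos_def tensor_emb_def)

sublocale TA: comm_algebra R T by (rule comm_algebraI[OF TF.T_alg])

sublocale TU: up_cring T by (intro up_cring.intro TF.T_cring)

text \<open>
  The \<open>n\<close> roots \<open>x\<^sup>(\<^sup>l\<^sup>)\<close> of \<open>f\<close> that generate the tensor
  power.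
\<close>

definition "xx l = emb l x"

lemma xx_closed: "l \<in> {1..n} \<Longrightarrow> xx l \<in> carrier T"
  unfolding xx_def using TF.emb_closed x_closed by simp

lemma T_gen [consumes 1, case_names scal root add mult]:
  assumes t: "t \<in> carrier T"
    and sc: "\<And>r. r \<in> carrier R \<Longrightarrow> Q (scal T r)" and X: "\<And>l. l \<in> {1..n} \<Longrightarrow> Q (xx l)"
    and add: "\<And>a b. a \<in> carrier T \<Longrightarrow> b \<in> carrier T \<Longrightarrow> Q a \<Longrightarrow> Q b \<Longrightarrow> Q (a \<oplus>\<^bsub>T\<^esub> b)"
    and mult: "\<And>a b. a \<in> carrier T \<Longrightarrow> b \<in> carrier T \<Longrightarrow> Q a \<Longrightarrow> Q b \<Longrightarrow> Q (a \<otimes>\<^bsub>T\<^esub> b)"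
  shows "Q t"
  using t
proof (induction rule: TF.T_induct)
  case (emb l a)
  note c = TF.emb_closed[OF emb(1)] and h = TF.emb_hom[OF emb(1)]
  show ?case using emb(2)
  proof (induction rule: A_induct)
    case (scal r)
    then show ?case using sc TF.emb_scal[OF emb(1)] by simp
  next
    case root
    show ?case using X[OF emb(1)] by (simp add: xx_def)
  next
    case (add a b)
    then show ?case using assms(4) c ring_hom_add[OF h add(1,2)] by simp
  next
    case (mult a b)
    then show ?case using assms(5) c ring_hom_mult[OF h mult(1,2)] by simp
  qed
qed (use assms in auto)

lemma T_hom_eq:
  assumes g: "g \<in> ring_hom T B" and h: "h \<in> ring_hom T B"
    and sc: "\<And>r. r \<in> carrier R \<Longrightarrow> g (scal T r) = h (scal T r)"
    and X: "\<And>l. l \<in> {1..n} \<Longrightarrow> g (xx l) = h (xx l)" and t: "t \<in> carrier T"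
  shows "g t = h t"
  using t
proof (induction rule: T_gen)
  case (add a b)
  then show ?case using ring_hom_add[OF g add(1,2)] ring_hom_add[OF h add(1,2)] by simp
next
  case (mult a b)
  then show ?case using ring_hom_mult[OF g mult(1,2)] ring_hom_mult[OF h mult(1,2)] by simp
qed (use sc X in auto)

lemma T_hom:
  assumes B: "cring B" and j: "j \<in> ring_hom R B"
    and b: "\<And>l. l \<in> {1..n} \<Longrightarrow> b l \<in> carrier B" "\<And>l. l \<in> {1..n} \<Longrightarrow> eval R B j (b l) f = \<zero>\<^bsub>B\<^esub>"
  shows "\<exists>H\<in>ring_hom T B. (\<forall>r\<in>carrier R. H (scal T r) = j r) \<and> (\<forall>l\<in>{1..n}. H (xx l) = b l)"
proof -
  have "\<forall>l\<in>{1..n}. \<exists>h. h \<in> ring_hom A B \<and> (\<forall>r\<in>carrier R. h (scal A r) = j r) \<and> h x = b l"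
    using A_universal[OF B j b] by blast
  from bchoice[OF this] obtain h where h: "\<And>l. l \<in> {1..n} \<Longrightarrow> h l \<in> ring_hom A B"
    "\<And>l r. l \<in> {1..n} \<Longrightarrow> r \<in> carrier R \<Longrightarrow> h l (scal A r) = j r" "\<And>l. l \<in> {1..n} \<Longrightarrow> h l x = b l" by blast
  obtain H where H: "H \<in> ring_hom T B" "\<And>r. r \<in> carrier R \<Longrightarrow> H (scal T r) = j r"
    "\<And>l a. l \<in> {1..n} \<Longrightarrow> a \<in> carrier A \<Longrightarrow> H (emb l a) = h l a"
    using TF.T_universal[of B j h, OF B j h(1,2)] by blast
  then show ?thesis using h(3) x_closed by (intro bexI[OF _ H(1)]) (auto simp: xx_def)
qed

subsection \<open>The monomial basis\<close>

abbreviation "W \<equiv> {1..n} \<rightarrow>\<^sub>E {..<n}"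

definition mon :: "(nat \<Rightarrow> nat) \<Rightarrow> ((nat \<Rightarrow> (nat \<Rightarrow> 'r) set) \<Rightarrow> 'r) set" where
  "mon \<alpha> = (\<Otimes>\<^bsub>T\<^esub>l\<in>{1..n}. xx l [^]\<^bsub>T\<^esub> \<alpha> l)"

lemma mon_closed: "mon \<alpha> \<in> carrier T"
  unfolding mon_def using xx_closed by (intro TF.T.finprod_closed) auto

lemma fin_W: "finite W" by (intro finite_PiE) auto

lemma T_span:
  assumes "t \<in> carrier T"
  shows "\<exists>c. (\<forall>\<alpha>. c \<alpha> \<in> carrier R) \<and> t = (\<Oplus>\<^bsub>T\<^esub>\<alpha>\<in>W. scal T (c \<alpha>) \<otimes>\<^bsub>T\<^esub> mon \<alpha>)"
  using assms
proof (induction rule: TF.T_induct_pure)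
  case zero
  have "(\<Oplus>\<^bsub>T\<^esub>\<alpha>\<in>W. scal T \<zero> \<otimes>\<^bsub>T\<^esub> mon \<alpha>) = \<zero>\<^bsub>T\<^esub>"
    using mon_closed by (intro TF.T.add.finprod_one_eqI) simp
  then show ?case by (intro exI[of _ "\<lambda>_. \<zero>"]) simp
next
  case (add s t)
  then obtain c c' where c: "\<And>\<alpha>. c \<alpha> \<in> carrier R" "\<And>\<alpha>. c' \<alpha> \<in> carrier R"
    "s = (\<Oplus>\<^bsub>T\<^esub>\<alpha>\<in>W. scal T (c \<alpha>) \<otimes>\<^bsub>T\<^esub> mon \<alpha>)" "t = (\<Oplus>\<^bsub>T\<^esub>\<alpha>\<in>W. scal T (c' \<alpha>) \<otimes>\<^bsub>T\<^esub> mon \<alpha>)" by blast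
  have "s \<oplus>\<^bsub>T\<^esub> t = (\<Oplus>\<^bsub>T\<^esub>\<alpha>\<in>W. scal T (c \<alpha>) \<otimes>\<^bsub>T\<^esub> mon \<alpha> \<oplus>\<^bsub>T\<^esub> scal T (c' \<alpha>) \<otimes>\<^bsub>T\<^esub> mon \<alpha>)"
    unfolding c(3,4) using c mon_closed by (intro TF.T.finsum_addf[symmetric]) auto
  also have "\<dots> = (\<Oplus>\<^bsub>T\<^esub>\<alpha>\<in>W. scal T (c \<alpha> \<oplus> c' \<alpha>) \<otimes>\<^bsub>T\<^esub> mon \<alpha>)"
    using c mon_closed by (intro TF.T.finsum_cong') (auto simp: TF.T.l_distr)
  finally show ?case using c by (intro exI[of _ "\<lambda>\<alpha>. c \<alpha> \<oplus> c' \<alpha>"]) auto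
next
  case (pure r a)
  have "\<forall>l\<in>{1..n}. \<exists>c. (\<forall>i. c i \<in> carrier R) \<and> a l = (\<Oplus>\<^bsub>A\<^esub>i\<in>{..<n}. scal A (c i) \<otimes>\<^bsub>A\<^esub> x [^]\<^bsub>A\<^esub> i)"
    using A_span pure(2) by blast
  from bchoice[OF this] obtain c where c: "\<And>l i. l \<in> {1..n} \<Longrightarrow> c l i \<in> carrier R"
    "\<And>l. l \<in> {1..n} \<Longrightarrow> a l = (\<Oplus>\<^bsub>A\<^esub>i\<in>{..<n}. scal A (c l i) \<otimes>\<^bsub>A\<^esub> x [^]\<^bsub>A\<^esub> i)" by blast
  have e: "emb l (a l) = (\<Oplus>\<^bsub>T\<^esub>i\<in>{..<n}. scal T (c l i) \<otimes>\<^bsub>T\<^esub> xx l [^]\<^bsub>T\<^esub> i)" if l: "l \<in> {1..n}" for l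
  proof -
    interpret el: ring_hom_cring A T "emb l" by (rule ring_hom_cringI[OF A.is_cring TF.T_cring TF.emb_hom[OF l]])
    have "emb l (a l) = (\<Oplus>\<^bsub>T\<^esub>i\<in>{..<n}. (emb l \<circ> (\<lambda>i. scal A (c l i) \<otimes>\<^bsub>A\<^esub> x [^]\<^bsub>A\<^esub> i)) i)"
      unfolding c(2)[OF l] using c(1)[OF l] x_closed scal_closed by (intro el.hom_finsum) auto
    also have "\<dots> = (\<Oplus>\<^bsub>T\<^esub>i\<in>{..<n}. scal T (c l i) \<otimes>\<^bsub>T\<^esub> xx l [^]\<^bsub>T\<^esub> i)"
      using c(1)[OF l] x_closed scal_closed xx_closed[OF l] TF.emb_scal[OF l]
      by (intro TF.T.finsum_cong' refl) (auto simp: xx_def)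
    finally show ?thesis .
  qed
  have "(\<Otimes>\<^bsub>T\<^esub>l\<in>{1..n}. emb l (a l)) = (\<Otimes>\<^bsub>T\<^esub>l\<in>{1..n}. \<Oplus>\<^bsub>T\<^esub>i\<in>{..<n}. scal T (c l i) \<otimes>\<^bsub>T\<^esub> xx l [^]\<^bsub>T\<^esub> i)"
    using e c(1) xx_closed by (intro TF.T.finprod_cong') (auto simp del: atLeastAtMost_iff intro!: TF.T.finsum_closed)
  also have "\<dots> = (\<Oplus>\<^bsub>T\<^esub>\<alpha>\<in>W. \<Otimes>\<^bsub>T\<^esub>l\<in>{1..n}. scal T (c l (\<alpha> l)) \<otimes>\<^bsub>T\<^esub> xx l [^]\<^bsub>T\<^esub> \<alpha> l)"
    using c(1) xx_closed by (intro TF.T.finprod_finsum_distrib) auto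
  also have "\<dots> = (\<Oplus>\<^bsub>T\<^esub>\<alpha>\<in>W. scal T (\<Otimes>l\<in>{1..n}. c l (\<alpha> l)) \<otimes>\<^bsub>T\<^esub> mon \<alpha>)"
  proof (intro TF.T.finsum_cong' refl)
    fix \<alpha>
    have "(\<Otimes>\<^bsub>T\<^esub>l\<in>{1..n}. scal T (c l (\<alpha> l)) \<otimes>\<^bsub>T\<^esub> xx l [^]\<^bsub>T\<^esub> \<alpha> l) = (\<Otimes>\<^bsub>T\<^esub>l\<in>{1..n}. scal T (c l (\<alpha> l))) \<otimes>\<^bsub>T\<^esub> mon \<alpha>"
      unfolding mon_def using c(1) xx_closed by (intro TF.T.finprod_multf) auto
    also have "(\<Otimes>\<^bsub>T\<^esub>l\<in>{1..n}. scal T (c l (\<alpha> l))) = scal T (\<Otimes>l\<in>{1..n}. c l (\<alpha> l))"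
      using c(1) by (subst TA.s.hom_finprod) (auto simp: comp_def)
    finally show "(\<Otimes>\<^bsub>T\<^esub>l\<in>{1..n}. scal T (c l (\<alpha> l)) \<otimes>\<^bsub>T\<^esub> xx l [^]\<^bsub>T\<^esub> \<alpha> l) =
      scal T (\<Otimes>l\<in>{1..n}. c l (\<alpha> l)) \<otimes>\<^bsub>T\<^esub> mon \<alpha>" .
  qed (use c(1) mon_closed in \<open>auto intro!: finprod_closed\<close>)
  finally have 1: "(\<Otimes>\<^bsub>T\<^esub>l\<in>{1..n}. emb l (a l)) = (\<Oplus>\<^bsub>T\<^esub>\<alpha>\<in>W. scal T (\<Otimes>l\<in>{1..n}. c l (\<alpha> l)) \<otimes>\<^bsub>T\<^esub> mon \<alpha>)" .
  have pc: "(\<Otimes>l\<in>{1..n}. c l (\<alpha> l)) \<in> carrier R" for \<alpha> using c(1) by (intro finprod_closed) auto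
  have "scal T r \<otimes>\<^bsub>T\<^esub> (\<Otimes>\<^bsub>T\<^esub>l\<in>{1..n}. emb l (a l)) =
     (\<Oplus>\<^bsub>T\<^esub>\<alpha>\<in>W. scal T r \<otimes>\<^bsub>T\<^esub> (scal T (\<Otimes>l\<in>{1..n}. c l (\<alpha> l)) \<otimes>\<^bsub>T\<^esub> mon \<alpha>))"
    unfolding 1 using pc pure(1) mon_closed fin_W by (intro TF.T.finsum_rdistr) auto
  also have "\<dots> = (\<Oplus>\<^bsub>T\<^esub>\<alpha>\<in>W. scal T (r \<otimes> (\<Otimes>l\<in>{1..n}. c l (\<alpha> l))) \<otimes>\<^bsub>T\<^esub> mon \<alpha>)"
    using pc pure(1) mon_closed by (intro TF.T.finsum_cong') (auto simp: TF.T.m_assoc)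
  finally show ?case using pc pure(1) by (intro exI[of _ "\<lambda>\<alpha>. r \<otimes> (\<Otimes>l\<in>{1..n}. c l (\<alpha> l))"]) auto
qed

text \<open>
  The relations that define the tensor power do not show directly that the monomials are independent; a homomorphism
  to a ring with independent roots of \<open>f\<close> does.
\<close>

lemma T_indep:
  assumes c: "\<And>\<alpha>. \<alpha> \<in> W \<Longrightarrow> c \<alpha> \<in> carrier R" "\<And>\<alpha>. \<alpha> \<in> W \<Longrightarrow> c' \<alpha> \<in> carrier R"
    and eq: "(\<Oplus>\<^bsub>T\<^esub>\<alpha>\<in>W. scal T (c \<alpha>) \<otimes>\<^bsub>T\<^esub> mon \<alpha>) = (\<Oplus>\<^bsub>T\<^esub>\<alpha>\<in>W. scal T (c' \<alpha>) \<otimes>\<^bsub>T\<^esub> mon \<alpha>)"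
    and \<alpha>: "\<alpha> \<in> W"
  shows "c \<alpha> = c' \<alpha>"
proof -
  obtain E :: "'r tree ring" and j y where I: "independent_roots R f n n E j y"
    using independent_roots_exist[OF is_cring monic] by blast
  note E = independent_rootsD[OF I]
  interpret E: cring E by (rule E(1))
  interpret j: ring_hom_cring R E j by (rule ring_hom_cringI[OF is_cring E(1,2)])
  obtain H where H: "H \<in> ring_hom T E" "\<And>r. r \<in> carrier R \<Longrightarrow> H (scal T r) = j r"
    "\<And>l. l \<in> {1..n} \<Longrightarrow> H (xx l) = y l" using T_hom[OF E(1,2), of y] E(3,4) by blast
  interpret H: ring_hom_cring T E H by (rule ring_hom_cringI[OF TF.T_cring E(1) H(1)])
  let ?m = "\<lambda>\<alpha>. \<Otimes>\<^bsub>E\<^esub>l\<in>{1..n}. y l [^]\<^bsub>E\<^esub> (\<alpha> l::nat)"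
  have mc: "?m \<alpha> \<in> carrier E" for \<alpha> using E(3) by (intro E.finprod_closed) auto
  have Hm: "H (mon \<alpha>) = ?m \<alpha>" for \<alpha>
    unfolding mon_def using xx_closed H(3) E(3) by (subst H.hom_finprod) (auto intro!: E.finprod_cong')
  have Hs: "H (\<Oplus>\<^bsub>T\<^esub>\<alpha>\<in>W. scal T (c \<alpha>) \<otimes>\<^bsub>T\<^esub> mon \<alpha>) = (\<Oplus>\<^bsub>E\<^esub>\<alpha>\<in>W. j (c \<alpha>) \<otimes>\<^bsub>E\<^esub> ?m \<alpha>)"
    if "\<And>\<alpha>. \<alpha> \<in> W \<Longrightarrow> c \<alpha> \<in> carrier R" for c
    using that mon_closed mc by (subst H.hom_finsum) (auto simp: Hm H(2) intro!: E.finsum_cong')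
  have jc: "(\<Oplus>\<^bsub>E\<^esub>\<alpha>\<in>W. j (c \<alpha>) \<otimes>\<^bsub>E\<^esub> ?m \<alpha>) \<in> carrier E" if "\<And>\<alpha>. \<alpha> \<in> W \<Longrightarrow> c \<alpha> \<in> carrier R" for c
    using that mc by (intro E.finsum_closed) auto
  have "(\<Oplus>\<^bsub>E\<^esub>\<alpha>\<in>W. j (c \<alpha>) \<otimes>\<^bsub>E\<^esub> ?m \<alpha>) =
     (\<Oplus>\<^bsub>E\<^esub>\<alpha>\<in>W. j (c \<alpha> \<ominus> c' \<alpha>) \<otimes>\<^bsub>E\<^esub> ?m \<alpha> \<oplus>\<^bsub>E\<^esub> j (c' \<alpha>) \<otimes>\<^bsub>E\<^esub> ?m \<alpha>)"
    using c mc by (intro E.finsum_cong')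
      (auto simp del: j.hom_add simp: E.l_distr[symmetric] j.hom_add[symmetric] minus_eq a_assoc l_neg)
  also have "\<dots> = (\<Oplus>\<^bsub>E\<^esub>\<alpha>\<in>W. j (c \<alpha> \<ominus> c' \<alpha>) \<otimes>\<^bsub>E\<^esub> ?m \<alpha>) \<oplus>\<^bsub>E\<^esub> (\<Oplus>\<^bsub>E\<^esub>\<alpha>\<in>W. j (c' \<alpha>) \<otimes>\<^bsub>E\<^esub> ?m \<alpha>)"
    using c mc by (intro E.finsum_addf) (auto simp: minus_closed)
  finally have "(\<Oplus>\<^bsub>E\<^esub>\<alpha>\<in>W. j (c \<alpha> \<ominus> c' \<alpha>) \<otimes>\<^bsub>E\<^esub> ?m \<alpha>) = \<zero>\<^bsub>E\<^esub>"
    using Hs[of c] Hs[of c'] c eq jc[of c'] jc[of "\<lambda>\<alpha>. c \<alpha> \<ominus> c' \<alpha>"] by (simp add: minus_closed)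
  then have "c \<alpha> \<ominus> c' \<alpha> = \<zero>" using c \<alpha> by (intro E(5)[of "\<lambda>\<alpha>. c \<alpha> \<ominus> c' \<alpha>"]) (auto simp: minus_closed)
  then show ?thesis using c[OF \<alpha>] sum_zero_eq_neg[of "c \<alpha>" "\<ominus> c' \<alpha>"] by (simp add: minus_eq)
qed

subsection \<open>The action of permutations\<close>

lemma perm_hom_exists:
  assumes \<sigma>: "\<sigma> permutes {1..n}"
  shows "\<exists>h\<in>ring_hom T T. (\<forall>r\<in>carrier R. h (scal T r) = scal T r) \<and>
    (\<forall>l\<in>{1..n}. \<forall>a\<in>carrier A. h (emb l a) = emb (\<sigma> l) a)"
proof (rule TF.T_universal[OF TF.T_cring TA.scal_hom])
  fix l assume l: "l \<in> {1..n}"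
  then have sl: "\<sigma> l \<in> {1..n}" using permutes_in_image[OF \<sigma>] by blast
  show "emb (\<sigma> l) \<in> ring_hom A T" using TF.emb_hom[OF sl] .
  show "\<And>r. r \<in> carrier R \<Longrightarrow> emb (\<sigma> l) (scal A r) = scal T r" using TF.emb_scal[OF sl] .
qed

lemma T_hom_eq_emb:
  assumes g: "g \<in> ring_hom T B" and h: "h \<in> ring_hom T B"
    and sc: "\<And>r. r \<in> carrier R \<Longrightarrow> g (scal T r) = h (scal T r)"
    and X: "\<And>l a. l \<in> {1..n} \<Longrightarrow> a \<in> carrier A \<Longrightarrow> g (emb l a) = h (emb l a)" and t: "t \<in> carrier T"
  shows "g t = h t"
  using g h sc _ t by (rule T_hom_eq) (auto simp: xx_def X x_closed)

text \<open>
  The action is defined by a description. It denotes the homomorphism that permutes the factors, which is bijective as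
  the inverse permutation gives its inverse, and unique as \<open>T\<close> is generated by the factors.
\<close>

lemma perm_action:
  assumes \<sigma>: "\<sigma> permutes {1..n}"
  shows "perm_action R A n \<sigma> \<in> ring_hom T T"
    and "r \<in> carrier R \<Longrightarrow> perm_action R A n \<sigma> (scal T r) = scal T r"
    and "l \<in> {1..n} \<Longrightarrow> a \<in> carrier A \<Longrightarrow> perm_action R A n \<sigma> (emb l a) = emb (\<sigma> l) a"
proof -
  let ?P = "\<lambda>h. h \<in> alg_iso R T T \<and> h \<in> extensional (carrier T) \<and>
         (\<forall>i\<in>{1..n}. \<forall>a\<in>carrier A. h (emb i a) = emb (\<sigma> i) a)"
  let ?\<tau> = "inv_into UNIV \<sigma>"
  have \<tau>: "?\<tau> permutes {1..n}" using \<sigma> by (rule permutes_inv)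
  obtain h where h: "h \<in> ring_hom T T" "\<And>r. r \<in> carrier R \<Longrightarrow> h (scal T r) = scal T r"
    "\<And>l a. l \<in> {1..n} \<Longrightarrow> a \<in> carrier A \<Longrightarrow> h (emb l a) = emb (\<sigma> l) a" using perm_hom_exists[OF \<sigma>] by blast
  obtain k where k: "k \<in> ring_hom T T" "\<And>r. r \<in> carrier R \<Longrightarrow> k (scal T r) = scal T r"
    "\<And>l a. l \<in> {1..n} \<Longrightarrow> a \<in> carrier A \<Longrightarrow> k (emb l a) = emb (?\<tau> l) a" using perm_hom_exists[OF \<tau>] by blast
  have \<sigma>i: "\<And>l. l \<in> {1..n} \<Longrightarrow> \<sigma> l \<in> {1..n}" "\<And>l. l \<in> {1..n} \<Longrightarrow> ?\<tau> l \<in> {1..n}"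
    using permutes_in_image[OF \<sigma>] permutes_in_image[OF \<tau>] by blast+
  have kh: "(k \<circ> h) t = id t" if "t \<in> carrier T" for t
    using ring_hom_trans[OF h(1) k(1)] id_ring_hom _ _ that
    by (rule T_hom_eq_emb) (auto simp: h k \<sigma>i permutes_inverses[OF \<sigma>] simp del: atLeastAtMost_iff)
  have hk: "(h \<circ> k) t = id t" if "t \<in> carrier T" for t
    using ring_hom_trans[OF k(1) h(1)] id_ring_hom _ _ that
    by (rule T_hom_eq_emb) (auto simp: h k \<sigma>i permutes_inverses[OF \<sigma>] simp del: atLeastAtMost_iff)
  let ?h = "restrict h (carrier T)"
  have rh: "?h \<in> ring_hom T T" using h(1) by (auto simp: ring_hom_def)
  have "bij_betw ?h (carrier T) (carrier T)"
    by (rule bij_betwI[where g = k])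
       (use ring_hom_closed[OF h(1)] ring_hom_closed[OF k(1)] kh hk in auto)
  moreover have "?h \<in> alg_hom R T T"
    using rh h(2) TA.s.hom_closed by (simp add: alg_hom_iff[OF TF.T_alg TF.T_alg])
  ultimately have P: "?P ?h" using h(3) TF.emb_closed by (auto simp: alg_iso_def)
  moreover have "g = ?h" if "?P g" for g
  proof
    fix t
    have g: "g \<in> ring_hom T T" "\<And>r. r \<in> carrier R \<Longrightarrow> g (scal T r) = scal T r"
      using that alg_hom_iff[OF TF.T_alg TF.T_alg] by (auto simp: alg_iso_def)
    show "g t = ?h t"
    proof (cases "t \<in> carrier T")
      case True
      show ?thesis using g(1) rh _ _ True
        by (rule T_hom_eq_emb) (use that g(2) h TF.emb_closed in auto)
    next
      case False
      then show ?thesis using that by (simp add: extensional_def)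
    qed
  qed
  ultimately have "(THE h. ?P h) = ?h" by (rule the_equality)
  then have "perm_action R A n \<sigma> = ?h"
    unfolding perm_action_def Let_def tensor_power_eq at_pos_eq .
  then show "perm_action R A n \<sigma> \<in> ring_hom T T"
    "r \<in> carrier R \<Longrightarrow> perm_action R A n \<sigma> (scal T r) = scal T r"
    "l \<in> {1..n} \<Longrightarrow> a \<in> carrier A \<Longrightarrow> perm_action R A n \<sigma> (emb l a) = emb (\<sigma> l) a"
    using rh h TF.emb_closed by auto
qed

definition "Inv G = {t \<in> carrier T. \<forall>\<sigma>\<in>G. perm_action R A n \<sigma> t = t}"

lemma invariants_eq: "invariants R A n G = T\<lparr>carrier := Inv G\<rparr>"
  by (simp add: invariants_def tensor_power_eq Inv_def Let_def)

lemma Inv_subring: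
  assumes "\<And>\<sigma>. \<sigma> \<in> G \<Longrightarrow> \<sigma> permutes {1..n}"
  shows "subring (Inv G) T"
proof -
  have h: "ring_hom_cring T T (perm_action R A n \<sigma>)" if "\<sigma> \<in> G" for \<sigma>
    by (rule ring_hom_cringI[OF TF.T_cring TF.T_cring perm_action(1)[OF assms[OF that]]])
  show ?thesis
  proof (rule TF.T.subringI')
    show "\<one>\<^bsub>T\<^esub> \<in> Inv G" using ring_hom_one[OF perm_action(1)[OF assms]] by (simp add: Inv_def)
    show "\<ominus>\<^bsub>T\<^esub> a \<in> Inv G" if "a \<in> Inv G" for a
      using that ring_hom_cring.hom_a_inv[OF h] by (simp add: Inv_def)
    show "a \<otimes>\<^bsub>T\<^esub> b \<in> Inv G" if "a \<in> Inv G" "b \<in> Inv G" for a b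
      using that ring_hom_mult[OF perm_action(1)[OF assms]] by (simp add: Inv_def)
    show "a \<oplus>\<^bsub>T\<^esub> b \<in> Inv G" if "a \<in> Inv G" "b \<in> Inv G" for a b
      using that ring_hom_add[OF perm_action(1)[OF assms]] by (simp add: Inv_def)
  qed (auto simp: Inv_def)
qed

lemma Inv_scal: "(\<And>\<sigma>. \<sigma> \<in> G \<Longrightarrow> \<sigma> permutes {1..n}) \<Longrightarrow> r \<in> carrier R \<Longrightarrow> scal T r \<in> Inv G"
  unfolding Inv_def using perm_action(2) by simp

lemma perm_root_prod:
  assumes \<sigma>: "\<sigma> permutes {1..n}" and L: "L \<subseteq> {1..n}" "\<sigma> ` L = L" and a: "a \<in> carrier A"
  shows "perm_action R A n \<sigma> (root_prod T L (\<lambda>l. emb l a) m) = root_prod T L (\<lambda>l. emb l a) m"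
proof -
  have e: "\<And>l. l \<in> L \<Longrightarrow> emb l a \<in> carrier T" using TF.emb_closed L a by blast
  have "map_up (perm_action R A n \<sigma>) (root_prod T L (\<lambda>l. emb l a)) = root_prod T L (\<lambda>l. perm_action R A n \<sigma> (emb l a))"
    by (rule map_up_root_prod[OF TF.T_cring TF.T_cring perm_action(1)[OF \<sigma>] e])
  also have "\<dots> = root_prod T L (\<lambda>l. emb (\<sigma> l) a)"
  proof -
    have "\<And>l. l \<in> L \<Longrightarrow> \<sigma> l \<in> L" using L(2) by blast
    then show ?thesis
    unfolding root_prod_def using perm_action(3)[OF \<sigma> _ a] L e
    by (intro TU.P.finprod_cong') (auto simp: subset_iff simp del: atLeastAtMost_iff)
  qed
  also have "\<dots> = root_prod T L (\<lambda>l. emb l a)"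
    using L e \<sigma> by (intro TU.root_prod_reindex) (auto simp: bij_betw_def permutes_inj_on)
  finally show ?thesis by (metis map_up_def)
qed

lemma coeff_root_prod_Inv:
  assumes "\<And>\<sigma>. \<sigma> \<in> G \<Longrightarrow> \<sigma> permutes {1..n}" "L \<subseteq> {1..n}" "\<And>\<sigma>. \<sigma> \<in> G \<Longrightarrow> \<sigma> ` L = L" "a \<in> carrier A"
  shows "root_prod T L (\<lambda>l. emb l a) m \<in> Inv G"
proof -
  have "root_prod T L (\<lambda>l. emb l a) \<in> carrier (UP T)"
    using assms TF.emb_closed by (intro TU.root_prod_closed) auto
  then show ?thesis unfolding Inv_def using perm_root_prod assms by auto
qed

end

section \<open>Blocks and orbits of exponents\<close>

lemma blocks_union: "(\<Union>i\<in>{1..k}. block d i) = {1..(\<Sum>i=1..k. d i)}"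
proof (induction k)
  case 0
  show ?case by simp
next
  case (Suc k)
  have I: "{1..Suc k} = insert (Suc k) {1..k}" "{1..<Suc k} = {1..k}" by auto
  have "(\<Union>i\<in>{1..Suc k}. block d i) = block d (Suc k) \<union> {1..(\<Sum>i=1..k. d i)}"
    unfolding I(1) using Suc by simp
  also have "block d (Suc k) = {(\<Sum>i=1..k. d i) + 1..(\<Sum>i=1..k. d i) + d (Suc k)}"
    unfolding block_def I(2) ..
  also have "\<dots> \<union> {1..(\<Sum>i=1..k. d i)} = {1..(\<Sum>i=1..Suc k. d i)}" by (auto simp: One_nat_def)
  finally show ?case .
qed

lemma blocks_disjoint:
  assumes "1 \<le> i" "i < i'"
  shows "block d i \<inter> block d i' = {}"
proof -
  have "(\<Sum>j=1..<i. d j) + d i = (\<Sum>j\<in>insert i {1..<i}. d j)" by simp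
  also have "\<dots> \<le> (\<Sum>j=1..<i'. d j)" using assms by (intro sum_mono2) auto
  finally show ?thesis by (auto simp: block_def)
qed

lemma block_unique:
  assumes "i \<in> {1..k}" "i' \<in> {1..k}" "l \<in> block d i" "l \<in> block d i'"
  shows "i = i'"
  using blocks_disjoint[of i i' d] blocks_disjoint[of i' i d] assms
  by (cases i i' rule: linorder_cases) auto

definition block_of :: "(nat \<Rightarrow> nat) \<Rightarrow> nat \<Rightarrow> nat \<Rightarrow> nat" where
  "block_of d k l = (SOME i. i \<in> {1..k} \<and> l \<in> block d i)"

lemma block_of:
  assumes "l \<in> {1..(\<Sum>i=1..k. d i)}"
  shows "block_of d k l \<in> {1..k}" "l \<in> block d (block_of d k l)"
proof -
  have "\<exists>i. i \<in> {1..k} \<and> l \<in> block d i" using assms blocks_union[of d k] by blast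
  from someI_ex[OF this] show "block_of d k l \<in> {1..k}" "l \<in> block d (block_of d k l)"
    unfolding block_of_def by blast+
qed

lemma block_sub: "i \<in> {1..k} \<Longrightarrow> block d i \<subseteq> {1..(\<Sum>i=1..k. d i)}"
  using blocks_union[of d k] by blast

lemma block_of_eq: "i \<in> {1..k} \<Longrightarrow> l \<in> block d i \<Longrightarrow> block_of d k l = i"
  using block_unique[of _ k i l d] block_of[of l d k] block_sub[of i k d] by blast

lemma finite_block [simp]: "finite (block d i)" by (simp add: block_def)

lemma digits_unique:
  fixes c c' :: "nat \<Rightarrow> nat"
  assumes "\<And>v. c v < N" "\<And>v. c' v < N" "(\<Sum>v<m. c v * N ^ v) = (\<Sum>v<m. c' v * N ^ v)" "v < m"
  shows "c v = c' v"
  using assms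
proof (induction m arbitrary: c c' v)
  case (Suc m)
  have s: "(\<Sum>v<Suc m. b v * N ^ v) = b 0 + N * (\<Sum>v<m. b (Suc v) * N ^ v)" for b
    by (subst sum.lessThan_Suc_shift) (simp add: sum_distrib_left mult_ac)
  have eq: "c 0 + N * (\<Sum>v<m. c (Suc v) * N ^ v) = c' 0 + N * (\<Sum>v<m. c' (Suc v) * N ^ v)"
    using Suc.prems(3) unfolding s .
  from arg_cong[OF eq, of "\<lambda>z. z mod N"] have 0: "c 0 = c' 0" using Suc.prems(1)[of 0] Suc.prems(2)[of 0] by simp
  then have "(\<Sum>v<m. c (Suc v) * N ^ v) = (\<Sum>v<m. c' (Suc v) * N ^ v)"
    using eq Suc.prems(1)[of 0] by simp
  then have "c (Suc u) = c' (Suc u)" if "u < m" for u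
    using Suc.IH[of "\<lambda>v. c (Suc v)" "\<lambda>v. c' (Suc v)" u] Suc.prems(1,2) that by simp
  then show ?case using 0 Suc.prems(4) by (cases v) auto
qed simp

text \<open>
  Since \<open>L\<close> has fewer than \<open>N\<close> elements, the multiplicities of the exponents are the digits
  of the sum in base \<open>N\<close>.
\<close>

lemma power_sum_image_mset:
  fixes w w' :: "'l \<Rightarrow> nat"
  assumes L: "finite L" "card L < N" and eq: "(\<Sum>l\<in>L. N ^ w l) = (\<Sum>l\<in>L. N ^ w' l)"
  shows "image_mset w (mset_set L) = image_mset w' (mset_set L)"
proof (rule multiset_eqI)
  fix v
  define m where "m = Suc (Max (insert v (w ` L \<union> w' ` L)))"
  have m: "v < m" "\<And>l. l \<in> L \<Longrightarrow> w l < m" "\<And>l. l \<in> L \<Longrightarrow> w' l < m"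
    using L by (auto simp: m_def less_Suc_eq_le)
  have s: "(\<Sum>l\<in>L. N ^ u l) = (\<Sum>v<m. card {l\<in>L. u l = v} * N ^ v)" if "\<And>l. l \<in> L \<Longrightarrow> u l < m" for u :: "'l \<Rightarrow> nat"
  proof -
    have "(\<Sum>l\<in>L. N ^ u l) = (\<Sum>v<m. \<Sum>l\<in>{l\<in>L. u l = v}. N ^ u l)"
      using L that by (intro sum.group[symmetric]) auto
    then show ?thesis by simp
  qed
  have card: "card {l\<in>L. u l = v} < N" for u :: "'l \<Rightarrow> nat" and v
    using L card_mono[of L "{l\<in>L. u l = v}"] by simp
  have "card {l\<in>L. w l = v} = card {l\<in>L. w' l = v}"
    using digits_unique[of "\<lambda>v. card {l\<in>L. w l = v}" N "\<lambda>v. card {l\<in>L. w' l = v}" m v] card eq s m by simp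
  then show "count (image_mset w (mset_set L)) v = count (image_mset w' (mset_set L)) v"
    using L by (simp add: count_image_mset' count_mset_set sum.If_cases Int_def eq_commute[of v] cong: conj_cong)
qed

context adjoin
begin

text \<open>
  A code for the orbit of an exponent vector under the Young subgroup, which is the multiset of the pairs (block of
  \<open>l\<close>, exponent \<open>\<alpha> l\<close>). As exponents are below \<open>n\<close>, the number \<open>n
  block + exponent\<close> determines the pair; as there are \<open>n\<close> positions, the sum of the powers of
  \<open>n + 1\<close> determines the multiset. Being additive over the positions, the code can be used as the
  exponent in a generating function.
\<close>

definition weight :: "(nat \<Rightarrow> nat) \<Rightarrow> nat \<Rightarrow> (nat \<Rightarrow> nat) \<Rightarrow> nat" where
  "weight d k \<alpha> = (\<Sum>l\<in>{1..n}. (n + 1) ^ (n * block_of d k l + \<alpha> l))"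

lemma young_permutes:
  "(\<Sum>i=1..k. d i) = n \<Longrightarrow> \<sigma> \<in> young_subgroup d k \<Longrightarrow> \<sigma> permutes {1..n}"
  by (simp add: young_subgroup_def sym_group_carrier)

lemma weight_orbit:
  assumes d: "(\<Sum>i=1..k. d i) = n" and \<alpha>: "\<alpha> \<in> W" and \<beta>: "\<beta> \<in> W"
    and eq: "weight d k \<alpha> = weight d k \<beta>"
  shows "\<exists>\<sigma>\<in>young_subgroup d k. \<alpha> = \<beta> \<circ> \<sigma>"
proof -
  let ?b = "block_of d k"
  have im: "image_mset (\<lambda>l. n * ?b l + \<alpha> l) (mset_set {1..n}) = image_mset (\<lambda>l. n * ?b l + \<beta> l) (mset_set {1..n})"
    using eq unfolding weight_def by (intro power_sum_image_mset) auto
  obtain \<sigma> where \<sigma>0: "\<sigma> permutes {1..n}" "\<forall>l\<in>{1..n}. n * ?b l + \<alpha> l = n * ?b (\<sigma> l) + \<beta> (\<sigma> l)"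
    by (rule image_mset_eq_implies_permutes[OF finite_atLeastAtMost im])
  then have \<sigma>: "\<sigma> permutes {1..n}" "\<And>l. l \<in> {1..n} \<Longrightarrow> n * ?b l + \<alpha> l = n * ?b (\<sigma> l) + \<beta> (\<sigma> l)" by blast+
  have in_\<sigma>: "\<sigma> l \<in> {1..n}" if "l \<in> {1..n}" for l using that permutes_in_image[OF \<sigma>(1)] by blast
  have lt: "\<alpha> l < n" "\<beta> (\<sigma> l) < n" if "l \<in> {1..n}" for l using that in_\<sigma>[OF that] \<alpha> \<beta> by auto
  have e: "\<alpha> l = \<beta> (\<sigma> l)" "?b l = ?b (\<sigma> l)" if l: "l \<in> {1..n}" for l
  proof -
    from arg_cong[OF \<sigma>(2)[OF l], of "\<lambda>z. z mod n"] show "\<alpha> l = \<beta> (\<sigma> l)" using lt[OF l] by simp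
    from arg_cong[OF \<sigma>(2)[OF l], of "\<lambda>z. z div n"] show "?b l = ?b (\<sigma> l)" using lt[OF l] by simp
  qed
  have "\<sigma> ` block d i = block d i" if i: "i \<in> {1..k}" for i
  proof (rule card_subset_eq)
    have sub: "block d i \<subseteq> {1..n}" using block_sub[OF i, of d] d by simp
    show "\<sigma> ` block d i \<subseteq> block d i"
    proof
      fix m assume "m \<in> \<sigma> ` block d i"
      then obtain l where l: "l \<in> block d i" "m = \<sigma> l" by blast
      then have "?b (\<sigma> l) = i" using block_of_eq[OF i l(1)] e(2)[of l] sub by auto
      then show "m \<in> block d i" using block_of(2)[of "\<sigma> l" d k] in_\<sigma>[of l] sub l d by auto
    qed
    show "card (\<sigma> ` block d i) = card (block d i)"
      using permutes_inj_on[OF \<sigma>(1)] by (rule card_image)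
  qed simp
  then have "\<sigma> \<in> young_subgroup d k" using \<sigma>(1) d by (simp add: young_subgroup_def sym_group_carrier)
  moreover have "\<alpha> = \<beta> \<circ> \<sigma>"
  proof
    fix l
    show "\<alpha> l = (\<beta> \<circ> \<sigma>) l"
    proof (cases "l \<in> {1..n}")
      case True
      then show ?thesis using e(1) by simp
    next
      case False
      then show ?thesis using \<alpha> \<beta> permutes_not_in[OF \<sigma>(1) False] by (auto simp: PiE_def extensional_def)
    qed
  qed
  ultimately show ?thesis by blast
qed

text \<open>
  The permutation permutes the monomial basis, so the coefficients of an invariant can be compared.
\<close>

lemma Inv_coeff_const:
  assumes c: "\<And>\<alpha>. c \<alpha> \<in> carrier R" and t: "t = (\<Oplus>\<^bsub>T\<^esub>\<alpha>\<in>W. scal T (c \<alpha>) \<otimes>\<^bsub>T\<^esub> mon \<alpha>)"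
    and inv: "perm_action R A n \<sigma> t = t" and \<sigma>: "\<sigma> permutes {1..n}" and \<beta>: "\<beta> \<in> W"
  shows "c (\<beta> \<circ> \<sigma>) = c \<beta>"
proof -
  let ?p = "perm_action R A n \<sigma>" and ?\<tau> = "inv_into UNIV \<sigma>"
  interpret p: ring_hom_cring T T ?p by (rule ring_hom_cringI[OF TF.T_cring TF.T_cring perm_action(1)[OF \<sigma>]])
  have \<tau>: "?\<tau> permutes {1..n}" using \<sigma> by (rule permutes_inv)
  have in\<sigma>: "\<sigma> l \<in> {1..n} \<longleftrightarrow> l \<in> {1..n}" "?\<tau> l \<in> {1..n} \<longleftrightarrow> l \<in> {1..n}" for l
    using permutes_in_image[OF \<sigma>] permutes_in_image[OF \<tau>] by blast+
  have WW: "\<alpha> \<circ> \<rho> \<in> W" if "\<alpha> \<in> W" "\<rho> permutes {1..n}" for \<alpha> \<rho>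
    using that permutes_in_image[OF that(2)] by (auto simp: PiE_def extensional_def Pi_def simp del: atLeastAtMost_iff)
  have pm: "?p (mon \<alpha>) = mon (\<alpha> \<circ> ?\<tau>)" for \<alpha>
  proof -
    have "?p (mon \<alpha>) = (\<Otimes>\<^bsub>T\<^esub>l\<in>{1..n}. (?p \<circ> (\<lambda>l. xx l [^]\<^bsub>T\<^esub> \<alpha> l)) l)"
      unfolding mon_def using xx_closed by (intro p.hom_finprod) auto
    also have "\<dots> = (\<Otimes>\<^bsub>T\<^esub>l\<in>{1..n}. (\<lambda>l. xx l [^]\<^bsub>T\<^esub> \<alpha> (?\<tau> l)) (\<sigma> l))"
      using xx_closed in\<sigma> perm_action(3)[OF \<sigma> _ x_closed]
      by (intro TF.T.finprod_cong' refl)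
         (auto simp: xx_def permutes_inverses[OF \<sigma>] simp del: atLeastAtMost_iff)
    also have "\<dots> = mon (\<alpha> \<circ> ?\<tau>)"
      unfolding mon_def comp_def using xx_closed by (intro TU.prod_perm \<sigma>) auto
    finally show ?thesis .
  qed
  have "t = ?p t" using inv ..
  also have "\<dots> = (\<Oplus>\<^bsub>T\<^esub>\<alpha>\<in>W. (?p \<circ> (\<lambda>\<alpha>. scal T (c \<alpha>) \<otimes>\<^bsub>T\<^esub> mon \<alpha>)) \<alpha>)"
    unfolding t using c mon_closed by (intro p.hom_finsum) auto
  also have "\<dots> = (\<Oplus>\<^bsub>T\<^esub>\<alpha>\<in>W. scal T (c ((\<alpha> \<circ> ?\<tau>) \<circ> \<sigma>)) \<otimes>\<^bsub>T\<^esub> mon (\<alpha> \<circ> ?\<tau>))"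
    using c mon_closed perm_action(2)[OF \<sigma>]
    by (intro TF.T.finsum_cong' refl) (auto simp: pm comp_assoc permutes_inv_o[OF \<sigma>])
  also have "\<dots> = (\<Oplus>\<^bsub>T\<^esub>\<alpha>\<in>(\<lambda>\<alpha>. \<alpha> \<circ> ?\<tau>) ` W. scal T (c (\<alpha> \<circ> \<sigma>)) \<otimes>\<^bsub>T\<^esub> mon \<alpha>)"
  proof (intro TF.T.finsum_reindex[symmetric])
    show "inj_on (\<lambda>\<alpha>. \<alpha> \<circ> ?\<tau>) W"
      by (rule inj_on_inverseI[of _ "\<lambda>\<alpha>. \<alpha> \<circ> \<sigma>"]) (simp add: comp_assoc permutes_inv_o[OF \<sigma>])
  qed (use c mon_closed in auto)
  also have "(\<lambda>\<alpha>. \<alpha> \<circ> ?\<tau>) ` W = W"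
  proof
    show "(\<lambda>\<alpha>. \<alpha> \<circ> ?\<tau>) ` W \<subseteq> W" using WW[OF _ \<tau>] by blast
    show "W \<subseteq> (\<lambda>\<alpha>. \<alpha> \<circ> ?\<tau>) ` W"
    proof
      fix \<alpha> assume "\<alpha> \<in> W"
      then have "\<alpha> \<circ> \<sigma> \<in> W" "\<alpha> = (\<alpha> \<circ> \<sigma>) \<circ> ?\<tau>" using WW[OF _ \<sigma>] by (auto simp: comp_assoc permutes_inv_o[OF \<sigma>])
      then show "\<alpha> \<in> (\<lambda>\<alpha>. \<alpha> \<circ> ?\<tau>) ` W" by blast
    qed
  qed
  finally have eq: "(\<Oplus>\<^bsub>T\<^esub>\<alpha>\<in>W. scal T (c (\<alpha> \<circ> \<sigma>)) \<otimes>\<^bsub>T\<^esub> mon \<alpha>) = (\<Oplus>\<^bsub>T\<^esub>\<alpha>\<in>W. scal T (c \<alpha>) \<otimes>\<^bsub>T\<^esub> mon \<alpha>)"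
    unfolding t by (rule sym)
  show ?thesis by (rule T_indep[OF _ _ eq \<beta>]) (use c in auto)
qed

end

lemma (in up_cring) monom_prod:
  assumes "finite L" "\<And>l. l \<in> L \<Longrightarrow> a l \<in> carrier R"
  shows "(\<Otimes>\<^bsub>UP R\<^esub>l\<in>L. monom (UP R) (a l) (w l)) = monom (UP R) (\<Otimes>l\<in>L. a l) (\<Sum>l\<in>L. w l)"
  using assms
proof (induction L rule: finite_induct)
  case (insert l L)
  then have "(\<Otimes>l\<in>L. a l) \<in> carrier R" by (intro finprod_closed) auto
  then show ?case using insert by (subst P.finprod_insert) auto
qed simp

lemma UP_coeff_subring:
  assumes B: "cring B" and S: "subring S B"
  shows "subring {u \<in> carrier (UP B). \<forall>i. u i \<in> S} (UP B)"
proof -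
  interpret B: up_cring B using B by (intro up_cring.intro)
  show ?thesis
  proof (rule B.P.subringI')
    fix u assume u: "u \<in> {u \<in> carrier (UP B). \<forall>i. u i \<in> S}"
    then have "(\<ominus>\<^bsub>UP B\<^esub> u) i = \<ominus>\<^bsub>B\<^esub> u i" for i
      using B.U.coeff_a_inv[of u i] by (simp add: B.coeff_UP)
    then show "\<ominus>\<^bsub>UP B\<^esub> u \<in> {u \<in> carrier (UP B). \<forall>i. u i \<in> S}" using u subringE(5)[OF S] by auto
  next
    fix u v assume uv: "u \<in> {u \<in> carrier (UP B). \<forall>i. u i \<in> S}" "v \<in> {u \<in> carrier (UP B). \<forall>i. u i \<in> S}"
    then show "u \<oplus>\<^bsub>UP B\<^esub> v \<in> {u \<in> carrier (UP B). \<forall>i. u i \<in> S}"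
      using subringE(7)[OF S] by (auto simp: B.UP_fun)
    have "(u \<otimes>\<^bsub>UP B\<^esub> v) i \<in> S" for i
      using uv subringE(6)[OF S] by (simp add: B.UP_fun) (intro B.subring_finsum[OF S], auto)
    then show "u \<otimes>\<^bsub>UP B\<^esub> v \<in> {u \<in> carrier (UP B). \<forall>i. u i \<in> S}" using uv by auto
  qed (use subringE(2,3)[OF S] in \<open>auto simp: B.UP_fun\<close>)
qed

context adjoin
begin

text \<open>
  The orbit sums are the coefficients of the generating function \<open>\<Prod>\<^sub>l \<Sum>\<^sub>a\<^sub><\<^sub>n
  X\<^sup>N\<^sup>(\<^sup>i\<^sup>,\<^sup>a\<^sup>) x\<^sub>l\<^sup>a = \<Sum>\<^sub>\<alpha>
  X\<^sup>w\<^sup>(\<^sup>\<alpha>\<^sup>) x\<^sup>\<alpha>\<close>, where \<open>i\<close> is the block of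
  \<open>l\<close> and \<open>w\<close> the weight. The part of the product that belongs to one block is a norm, so it
  has coefficients in each subring that contains the coefficients of the polynomial with the roots
  \<open>x\<^sub>l\<close> of this block.
\<close>

lemma orbit_sum_in_subring:
  assumes d: "(\<Sum>i=1..k. d i) = n" and S: "subring S T"
    and g: "\<And>i m. i \<in> {1..k} \<Longrightarrow> root_prod T (block d i) xx m \<in> S"
  shows "(\<Oplus>\<^bsub>T\<^esub>\<alpha>\<in>W. if weight d k \<alpha> = \<epsilon> then mon \<alpha> else \<zero>\<^bsub>T\<^esub>) \<in> S"
proof -
  let ?B = "UP T" and ?b = "block_of d k"
  let ?P = "{u \<in> carrier ?B. \<forall>i. u i \<in> S}"
  have P: "subring ?P ?B" by (rule UP_coeff_subring[OF TF.T_cring S])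
  \<comment> \<open>the contribution to the weight of a position in block \<open>i\<close> with exponent \<open>a\<close>\<close>
  define N where "N i a = (n + 1) ^ (n * i + a)" for i a
  let ?q = "\<lambda>i l. \<Oplus>\<^bsub>?B\<^esub>a\<in>{..<n}. monom ?B \<one>\<^bsub>T\<^esub> (N i a) \<otimes>\<^bsub>?B\<^esub> monom ?B (xx l) 0 [^]\<^bsub>?B\<^esub> a"
  have bs: "block d i \<subseteq> {1..n}" if "i \<in> {1..k}" for i
    using block_sub[OF that, of d] unfolding d .
  have xb: "xx l \<in> carrier T" if "i \<in> {1..k}" "l \<in> block d i" for i l
    using bs[OF that(1)] that(2) by (intro xx_closed) auto
  have cstS: "monom ?B s m \<in> ?P" if "s \<in> S" for s m
    using that subringE(1,2)[OF S] by (auto simp: TU.UP_fun)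
  have q: "(\<Otimes>\<^bsub>?B\<^esub>l\<in>block d i. ?q i l) \<in> ?P" if i: "i \<in> {1..k}" for i
  proof (rule norm_in_subring[OF TU.P.is_cring P finite_block])
    show "monom ?B (xx l) 0 \<in> carrier ?B" if "l \<in> block d i" for l using xb[OF i that] by simp
    show "monom ?B \<one>\<^bsub>T\<^esub> (N i a) \<in> ?P" for a by (rule cstS[OF subringE(3)[OF S]])
    fix m
    have "root_prod ?B (block d i) (\<lambda>l. monom ?B (xx l) 0) = map_up (\<lambda>a. monom ?B a 0) (root_prod T (block d i) xx)"
      using xb[OF i] by (intro map_up_root_prod[symmetric] TF.T_cring TU.P.is_cring TU.c.homh) auto
    then show "root_prod ?B (block d i) (\<lambda>l. monom ?B (xx l) 0) m \<in> ?P"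
      using cstS[OF g[OF i]] by (simp add: map_up_def)
  qed
  have qc: "?q i l \<in> carrier ?B" if "l \<in> {1..n}" for i l
    using xx_closed[OF that] by (intro TU.P.finsum_closed) auto
  have "(\<Otimes>\<^bsub>?B\<^esub>i\<in>{1..k}. \<Otimes>\<^bsub>?B\<^esub>l\<in>block d i. ?q i l) \<in> ?P"
    by (rule TU.P.subring_finprod[OF P q])
  also have "(\<Otimes>\<^bsub>?B\<^esub>i\<in>{1..k}. \<Otimes>\<^bsub>?B\<^esub>l\<in>block d i. ?q i l) = (\<Otimes>\<^bsub>?B\<^esub>i\<in>{1..k}. \<Otimes>\<^bsub>?B\<^esub>l\<in>block d i. ?q (?b l) l)"
  proof (rule TU.P.finprod_cong'[OF refl])
    show "(\<lambda>i. \<Otimes>\<^bsub>?B\<^esub>l\<in>block d i. ?q (?b l) l) \<in> {1..k} \<rightarrow> carrier ?B"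
      using bs by (intro Pi_I TU.P.finprod_closed) (auto intro!: qc simp del: atLeastAtMost_iff)
    fix i assume i: "i \<in> {1..k}"
    show "(\<Otimes>\<^bsub>?B\<^esub>l\<in>block d i. ?q i l) = (\<Otimes>\<^bsub>?B\<^esub>l\<in>block d i. ?q (?b l) l)"
      using bs[OF i] block_of_eq[OF i]
      by (intro TU.P.finprod_cong' refl) (auto intro!: qc simp del: atLeastAtMost_iff)
  qed
  also have "\<dots> = (\<Otimes>\<^bsub>?B\<^esub>l\<in>(\<Union>i\<in>{1..k}. block d i). ?q (?b l) l)"
    using bs block_unique[of _ k _ _ d]
    by (intro TU.P.finprod_UN_disjoint[symmetric])
       (auto intro!: qc simp: pairwise_def disjnt_def simp del: atLeastAtMost_iff)
  also have "(\<Union>i\<in>{1..k}. block d i) = {1..n}" using blocks_union[of d k] d by simp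
  also have "(\<Otimes>\<^bsub>?B\<^esub>l\<in>{1..n}. ?q (?b l) l) =
     (\<Oplus>\<^bsub>?B\<^esub>\<alpha>\<in>W. \<Otimes>\<^bsub>?B\<^esub>l\<in>{1..n}. monom ?B \<one>\<^bsub>T\<^esub> (N (?b l) (\<alpha> l)) \<otimes>\<^bsub>?B\<^esub> monom ?B (xx l) 0 [^]\<^bsub>?B\<^esub> \<alpha> l)"
    using xx_closed by (intro TU.P.finprod_finsum_distrib) auto
  also have "\<dots> = (\<Oplus>\<^bsub>?B\<^esub>\<alpha>\<in>W. monom ?B (mon \<alpha>) (weight d k \<alpha>))"
  proof (intro TU.P.finsum_cong' refl)
    fix \<alpha>
    have "(\<Otimes>\<^bsub>?B\<^esub>l\<in>{1..n}. monom ?B \<one>\<^bsub>T\<^esub> (N (?b l) (\<alpha> l)) \<otimes>\<^bsub>?B\<^esub> monom ?B (xx l) 0 [^]\<^bsub>?B\<^esub> \<alpha> l) =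
       (\<Otimes>\<^bsub>?B\<^esub>l\<in>{1..n}. monom ?B (xx l [^]\<^bsub>T\<^esub> \<alpha> l) (N (?b l) (\<alpha> l)))"
    proof (intro TU.P.finprod_cong' refl)
      fix l assume l: "l \<in> {1..n}"
      note c = xx_closed[OF l]
      show "monom ?B \<one>\<^bsub>T\<^esub> (N (?b l) (\<alpha> l)) \<otimes>\<^bsub>?B\<^esub> monom ?B (xx l) 0 [^]\<^bsub>?B\<^esub> \<alpha> l =
          monom ?B (xx l [^]\<^bsub>T\<^esub> \<alpha> l) (N (?b l) (\<alpha> l))"
      proof -
        have cc: "xx l [^]\<^bsub>T\<^esub> \<alpha> l \<in> carrier T" using c by (rule TF.T.nat_pow_closed)
        have "monom ?B (xx l) 0 [^]\<^bsub>?B\<^esub> \<alpha> l = monom ?B (xx l [^]\<^bsub>T\<^esub> \<alpha> l) 0"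
          using TU.U.monom_pow[OF c, of 0 "\<alpha> l"] by (simp only: mult_0)
        moreover have "monom ?B \<one>\<^bsub>T\<^esub> (N (?b l) (\<alpha> l)) \<otimes>\<^bsub>?B\<^esub> monom ?B (xx l [^]\<^bsub>T\<^esub> \<alpha> l) 0 =
            monom ?B (\<one>\<^bsub>T\<^esub> \<otimes>\<^bsub>T\<^esub> xx l [^]\<^bsub>T\<^esub> \<alpha> l) (N (?b l) (\<alpha> l) + 0)"
          by (rule TU.U.monom_mult[symmetric]) (use cc in auto)
        ultimately show ?thesis using cc by (simp only: TF.T.l_one add_0_right)
      qed
    qed (use xx_closed in auto)
    also have "\<dots> = monom ?B (mon \<alpha>) (weight d k \<alpha>)"
      unfolding mon_def weight_def N_def using xx_closed by (intro TU.monom_prod) auto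
    finally show "(\<Otimes>\<^bsub>?B\<^esub>l\<in>{1..n}. monom ?B \<one>\<^bsub>T\<^esub> (N (?b l) (\<alpha> l)) \<otimes>\<^bsub>?B\<^esub> monom ?B (xx l) 0 [^]\<^bsub>?B\<^esub> \<alpha> l) = \<dots>" .
  qed (use mon_closed in auto)
  finally have "(\<Oplus>\<^bsub>?B\<^esub>\<alpha>\<in>W. monom ?B (mon \<alpha>) (weight d k \<alpha>)) \<epsilon> \<in> S" by blast
  also have "(\<Oplus>\<^bsub>?B\<^esub>\<alpha>\<in>W. monom ?B (mon \<alpha>) (weight d k \<alpha>)) \<epsilon> = (\<Oplus>\<^bsub>T\<^esub>\<alpha>\<in>W. monom ?B (mon \<alpha>) (weight d k \<alpha>) \<epsilon>)"
    using mon_closed by (intro TU.UP_finsum_fun fin_W) auto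
  also have "\<dots> = (\<Oplus>\<^bsub>T\<^esub>\<alpha>\<in>W. if weight d k \<alpha> = \<epsilon> then mon \<alpha> else \<zero>\<^bsub>T\<^esub>)"
    using mon_closed by (intro TF.T.finsum_cong' refl) (auto simp: TU.UP_fun)
  finally show ?thesis .
qed

text \<open>
  A fundamental theorem on symmetric polynomials for products of symmetric groups and in the quotient \<open>T\<close>
  of the polynomial ring: the coefficients of an invariant are constant on orbits, that is, on the level sets of the
  weight, so it is a linear combination of orbit sums.
\<close>

theorem Inv_young_generated:
  assumes d: "(\<Sum>i=1..k. d i) = n" and S: "subring S T"
    and sc: "\<And>r. r \<in> carrier R \<Longrightarrow> scal T r \<in> S"
    and g: "\<And>i m. i \<in> {1..k} \<Longrightarrow> root_prod T (block d i) xx m \<in> S"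
  shows "Inv (young_subgroup d k) \<subseteq> S"
proof
  fix t assume "t \<in> Inv (young_subgroup d k)"
  then have t: "t \<in> carrier T" "\<And>\<sigma>. \<sigma> \<in> young_subgroup d k \<Longrightarrow> perm_action R A n \<sigma> t = t" by (auto simp: Inv_def)
  obtain c where c: "\<And>\<alpha>. c \<alpha> \<in> carrier R" and tc: "t = (\<Oplus>\<^bsub>T\<^esub>\<alpha>\<in>W. scal T (c \<alpha>) \<otimes>\<^bsub>T\<^esub> mon \<alpha>)"
    using T_span[OF t(1)] by blast
  let ?w = "weight d k" and ?O = "\<lambda>\<epsilon>. \<Oplus>\<^bsub>T\<^esub>\<alpha>\<in>W. if weight d k \<alpha> = \<epsilon> then mon \<alpha> else \<zero>\<^bsub>T\<^esub>"
  have cw: "c \<alpha> = c \<beta>" if ab: "\<alpha> \<in> W" "\<beta> \<in> W" "?w \<alpha> = ?w \<beta>" for \<alpha> \<beta>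
  proof -
    obtain \<sigma> where \<sigma>: "\<sigma> \<in> young_subgroup d k" "\<alpha> = \<beta> \<circ> \<sigma>" using weight_orbit[OF d ab] by blast
    show ?thesis unfolding \<sigma>(2)
      by (rule Inv_coeff_const[OF c tc t(2)[OF \<sigma>(1)] young_permutes[OF d \<sigma>(1)] ab(2)])
  qed
  \<comment> \<open>the common coefficient of the monomials of weight \<open>\<epsilon>\<close>\<close>
  define cc where "cc \<epsilon> = c (SOME \<alpha>. \<alpha> \<in> W \<and> ?w \<alpha> = \<epsilon>)" for \<epsilon>
  have cc: "cc (?w \<alpha>) = c \<alpha>" if "\<alpha> \<in> W" for \<alpha>
  proof -
    have "\<exists>\<beta>. \<beta> \<in> W \<and> ?w \<beta> = ?w \<alpha>" using that by blast
    from someI_ex[OF this] show ?thesis unfolding cc_def using cw that by blast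
  qed
  have ccR: "cc \<epsilon> \<in> carrier R" for \<epsilon> using c by (simp add: cc_def)
  have "t = (\<Oplus>\<^bsub>T\<^esub>\<alpha>\<in>W. \<Oplus>\<^bsub>T\<^esub>\<epsilon>\<in>?w ` W. if ?w \<alpha> = \<epsilon> then scal T (cc \<epsilon>) \<otimes>\<^bsub>T\<^esub> mon \<alpha> else \<zero>\<^bsub>T\<^esub>)"
    unfolding tc
  proof (intro TF.T.finsum_cong' refl)
    fix \<alpha> assume \<alpha>: "\<alpha> \<in> W"
    have "(\<Oplus>\<^bsub>T\<^esub>\<epsilon>\<in>?w ` W. if ?w \<alpha> = \<epsilon> then scal T (cc \<epsilon>) \<otimes>\<^bsub>T\<^esub> mon \<alpha> else \<zero>\<^bsub>T\<^esub>) = scal T (cc (?w \<alpha>)) \<otimes>\<^bsub>T\<^esub> mon \<alpha>"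
      using \<alpha> fin_W ccR mon_closed by (intro TF.T.finsum_delta) auto
    then show "scal T (c \<alpha>) \<otimes>\<^bsub>T\<^esub> mon \<alpha> = (\<Oplus>\<^bsub>T\<^esub>\<epsilon>\<in>?w ` W. if ?w \<alpha> = \<epsilon> then scal T (cc \<epsilon>) \<otimes>\<^bsub>T\<^esub> mon \<alpha> else \<zero>\<^bsub>T\<^esub>)"
      using cc[OF \<alpha>] by simp
  qed (use ccR mon_closed in \<open>auto intro!: TF.T.finsum_closed\<close>)
  also have "\<dots> = (\<Oplus>\<^bsub>T\<^esub>\<epsilon>\<in>?w ` W. \<Oplus>\<^bsub>T\<^esub>\<alpha>\<in>W. if ?w \<alpha> = \<epsilon> then scal T (cc \<epsilon>) \<otimes>\<^bsub>T\<^esub> mon \<alpha> else \<zero>\<^bsub>T\<^esub>)"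
    using fin_W ccR mon_closed by (intro TF.T.finsum_swap) auto
  also have "\<dots> = (\<Oplus>\<^bsub>T\<^esub>\<epsilon>\<in>?w ` W. scal T (cc \<epsilon>) \<otimes>\<^bsub>T\<^esub> ?O \<epsilon>)"
  proof (intro TF.T.finsum_cong' refl)
    fix \<epsilon>
    have "scal T (cc \<epsilon>) \<otimes>\<^bsub>T\<^esub> ?O \<epsilon> = (\<Oplus>\<^bsub>T\<^esub>\<alpha>\<in>W. scal T (cc \<epsilon>) \<otimes>\<^bsub>T\<^esub> (if ?w \<alpha> = \<epsilon> then mon \<alpha> else \<zero>\<^bsub>T\<^esub>))"
      using fin_W ccR mon_closed by (intro TF.T.finsum_rdistr) auto
    also have "\<dots> = (\<Oplus>\<^bsub>T\<^esub>\<alpha>\<in>W. if ?w \<alpha> = \<epsilon> then scal T (cc \<epsilon>) \<otimes>\<^bsub>T\<^esub> mon \<alpha> else \<zero>\<^bsub>T\<^esub>)"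
      using ccR mon_closed by (intro TF.T.finsum_cong' refl) auto
    finally show "(\<Oplus>\<^bsub>T\<^esub>\<alpha>\<in>W. if ?w \<alpha> = \<epsilon> then scal T (cc \<epsilon>) \<otimes>\<^bsub>T\<^esub> mon \<alpha> else \<zero>\<^bsub>T\<^esub>) = scal T (cc \<epsilon>) \<otimes>\<^bsub>T\<^esub> ?O \<epsilon>" ..
  qed (use ccR mon_closed in \<open>auto intro!: TF.T.finsum_closed\<close>)
  finally have "t = \<dots>" .
  moreover have "\<dots> \<in> S"
    by (rule TF.T.subring_finsum[OF S], rule subringE(6)[OF S sc[OF ccR] orbit_sum_in_subring[OF d S g]])
  ultimately show "t \<in> S" by simp
qed

end

section \<open>Closure data and factorizations\<close>

lemma (in comm_algebra) subringI_scal: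
  assumes "X \<subseteq> carrier A" "\<And>r. r \<in> carrier R \<Longrightarrow> scal A r \<in> X"
    "\<And>a b. a \<in> X \<Longrightarrow> b \<in> X \<Longrightarrow> a \<otimes>\<^bsub>A\<^esub> b \<in> X" "\<And>a b. a \<in> X \<Longrightarrow> b \<in> X \<Longrightarrow> a \<oplus>\<^bsub>A\<^esub> b \<in> X"
  shows "subring X A"
proof (rule A.subringI')
  show "\<one>\<^bsub>A\<^esub> \<in> X" using assms(2)[of "\<one>\<^bsub>R\<^esub>"] by simp
  fix a assume a: "a \<in> X"
  have "scal A (\<ominus>\<^bsub>R\<^esub> \<one>\<^bsub>R\<^esub>) \<otimes>\<^bsub>A\<^esub> a = \<ominus>\<^bsub>A\<^esub> a" using a assms(1) by (simp add: A.l_minus subset_iff)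
  then show "\<ominus>\<^bsub>A\<^esub> a \<in> X" using assms(3)[OF assms(2) a, of "\<ominus>\<^bsub>R\<^esub> \<one>\<^bsub>R\<^esub>"] by simp
qed (use assms in auto)

lemma root_prod_blocks:
  assumes "cring B" "\<And>l. l \<in> {1..(\<Sum>i=1..k. d i)} \<Longrightarrow> b l \<in> carrier B"
  shows "(\<Otimes>\<^bsub>UP B\<^esub>i\<in>{1..k}. root_prod B (block d i) b) = root_prod B {1..(\<Sum>i=1..k. d i)} b"
proof -
  interpret B: up_cring B using assms by (intro up_cring.intro)
  have "root_prod B {1..(\<Sum>i=1..k. d i)} b = (\<Otimes>\<^bsub>UP B\<^esub>l\<in>(\<Union>i\<in>{1..k}. block d i). lin_fac B (b l))"
    unfolding root_prod_def blocks_union ..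
  also have "\<dots> = (\<Otimes>\<^bsub>UP B\<^esub>i\<in>{1..k}. root_prod B (block d i) b)"
    unfolding root_prod_def using assms(2) block_sub[of _ k d] block_unique[of _ k _ _ d]
    by (intro B.P.finprod_UN_disjoint)
       (auto simp: pairwise_def disjnt_def subset_iff simp del: atLeastAtMost_iff)
  finally show ?thesis ..
qed

definition block_offset :: "(nat \<Rightarrow> nat) \<Rightarrow> nat \<Rightarrow> nat" where "block_offset d i = (\<Sum>j=1..<i. d j)"

lemma block_offset_in_block: "m \<in> {1..d i} \<Longrightarrow> block_offset d i + m \<in> block d i"
  by (auto simp: block_offset_def block_def One_nat_def)

lemma block_offset_inverse: "l \<in> block d i \<Longrightarrow> l - block_offset d i \<in> {1..d i} \<and> block_offset d i + (l - block_offset d i) = l"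
  by (auto simp: block_offset_def block_def One_nat_def)

lemma bij_block_offset: "bij_betw (\<lambda>m. block_offset d i + m) {1..d i} (block d i)"
  by (rule bij_betwI[where g = "\<lambda>l. l - block_offset d i"]) (use block_offset_in_block block_offset_inverse in auto)

lemma card_block: "card (block d i) = d i"
  using bij_betw_same_card[OF bij_block_offset[of d i]] by simp

lemma (in up_cring) root_prod_block:
  assumes "\<And>l. l \<in> block d i \<Longrightarrow> b l \<in> carrier R"
  shows "root_prod R (block d i) b = root_prod R {1..d i} (\<lambda>m. b (block_offset d i + m))"
  using root_prod_reindex[where y = b, OF bij_block_offset assms] by simp

context adjoin
begin

text \<open>
  This is what the homomorphism from \<open>A\<close> that sends \<open>x\<close> to \<open>\<theta>\<^sub>l\<close>
  requires.
\<close>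

lemma eval_root_of_split:
  fixes K :: "('k, 'q) ring_scheme"
  assumes K: "cring K" "j \<in> ring_hom R K" and \<theta>: "\<And>l. l \<in> {1..n} \<Longrightarrow> \<theta> l \<in> carrier K"
    and s: "map_up j f = root_prod K {1..n} \<theta>" and l: "l \<in> {1..n}"
  shows "eval R K j (\<theta> l) f = \<zero>\<^bsub>K\<^esub>"
proof -
  have "eval R K j (\<theta> l) f = eval K K id (\<theta> l) (map_up j f)"
    using eval_map_up[OF is_cring K K(1) id_ring_hom \<theta>[OF l] f_closed] by simp
  also have "\<dots> = \<zero>\<^bsub>K\<^esub>" unfolding s using \<theta> l by (intro eval_root_prod_zero K) auto
  finally show ?thesis .
qed

lemma splitting_adjoin_exists:
  "\<exists>(K :: 'r tree ring) j h. split_adjoin R f n K j h \<and> inj_on j (carrier R)"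
proof -
  have "\<exists>(K :: 'r tree ring) j \<theta>. cring K \<and> j \<in> ring_hom R K \<and> inj_on j (carrier R) \<and>
    (\<forall>i\<in>{1..1::nat}. (\<forall>l\<in>{1..n}. \<theta> i l \<in> carrier K) \<and> map_up j f = root_prod K {1..n} (\<theta> i))"
    using monic by (intro splitting_ring_exists_family is_cring)
  then obtain K :: "'r tree ring" and j \<theta> where K: "cring K" "j \<in> ring_hom R K" "inj_on j (carrier R)"
    "\<And>l. l \<in> {1..n} \<Longrightarrow> \<theta> l \<in> carrier K" "map_up j f = root_prod K {1..n} \<theta>" by force
  have "\<forall>l\<in>{1..n}. \<exists>h. h \<in> ring_hom A K \<and> (\<forall>r\<in>carrier R. h (scal A r) = j r) \<and> h x = \<theta> l"
    using A_universal[OF K(1,2)] K(4) eval_root_of_split[OF K(1,2,4,5)] by blast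
  from bchoice[OF this] obtain h where h: "\<And>l. l \<in> {1..n} \<Longrightarrow> h l \<in> ring_hom A K"
    "\<And>l r. l \<in> {1..n} \<Longrightarrow> r \<in> carrier R \<Longrightarrow> h l (scal A r) = j r" "\<And>l. l \<in> {1..n} \<Longrightarrow> h l x = \<theta> l" by blast
  interpret K: up_cring K using K by (intro up_cring.intro)
  have "root_prod K {1..n} (\<lambda>l. h l x) = root_prod K {1..n} \<theta>"
    unfolding root_prod_def using h(3) K(4) by (intro K.P.finprod_cong') (auto simp del: atLeastAtMost_iff)
  then have "split_adjoin R f n K j h"
    using h K by (intro split_adjoin.intro adjoin_axioms split_adjoin_axioms.intro) auto
  then show ?thesis using K(3) by blast
qed

text \<open>
  This and \<open>char_poly_root\<close> are read off from the factorization of the characteristic polynomial over a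
  ring that contains \<open>R\<close> and in which \<open>f\<close> splits.
\<close>

lemma char_poly_monic:
  assumes a: "a \<in> carrier A"
  shows "monic_of_degree R n (mult_char_poly R A n a)"
proof -
  obtain K :: "'r tree ring" and j h where s: "split_adjoin R f n K j h" and inj: "inj_on j (carrier R)"
    using splitting_adjoin_exists by blast
  interpret s: split_adjoin R f n K j h by (rule s)
  interpret j: ring_hom_cring R K j by (rule ring_hom_cringI[OF is_cring s.K s.j])
  let ?c = "mult_char_poly R A n a"
  have c: "?c \<in> carrier (UP R)" by (rule mult_char_poly_closed[OF a])
  have "monic_of_degree K n (map_up j ?c)"
    unfolding s.char_poly_split[OF a] using s.h_closed[OF _ a] s.K.monic_root_prod[of "{1..n}" "\<lambda>l. h l a"] by simp
  then have "j (?c n) = j \<one>" "\<And>m. m > n \<Longrightarrow> j (?c m) = j \<zero>" by (auto simp: s.K.monic_iff map_up_def)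
  then show ?thesis using c inj_onD[OF inj] UP_val by (auto simp: monic_iff)
qed

lemma char_poly_root: "mult_char_poly R A n x = f"
proof -
  obtain K :: "'r tree ring" and j h where s: "split_adjoin R f n K j h" and inj: "inj_on j (carrier R)"
    using splitting_adjoin_exists by blast
  interpret s: split_adjoin R f n K j h by (rule s)
  have "map_up j (mult_char_poly R A n x) = map_up j f"
    unfolding s.char_poly_split[OF x_closed] s.split ..
  then have "j (mult_char_poly R A n x m) = j (f m)" for m by (metis map_up_def)
  then show ?thesis
    using inj_onD[OF inj] UP_val[OF mult_char_poly_closed[OF x_closed]] UP_val[OF f_closed] by (intro ext) blast
qed

lemma elem_sym_eq: "elem_sym R A n k a = esym T {1..n} (\<lambda>i. emb i a) k"
  by (simp add: elem_sym_def esym_def tensor_power_eq at_pos_eq Let_def)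

lemma char_coeff_eq:
  "a \<in> carrier A \<Longrightarrow> char_coeff R A n k a = (\<ominus> \<one>) [^] k \<otimes> mult_char_poly R A n a (n - k)"
  by (simp add: char_coeff_def coeff_UP mult_char_poly_closed)

end

locale young = adjoin R f n for R :: "('r, 'm) ring_scheme" (structure) and f n +
  fixes d :: "nat \<Rightarrow> nat" and k :: nat
  assumes d: "(\<Sum>i=1..k. d i) = n"
begin

abbreviation "G \<equiv> young_subgroup d k"
abbreviation "CD \<equiv> closure_data R A n G"
abbreviation "S \<equiv> T\<lparr>carrier := Inv G\<rparr>"

text \<open>
  Up to sign, the coefficients of these polynomials are the elementary symmetric polynomials in the roots of a block.
  They generate the invariants, and their images under a closure datum are the coefficients of the associated factors.
\<close>

definition "g i = root_prod T (block d i) xx"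

lemma block_n: "i \<in> {1..k} \<Longrightarrow> block d i \<subseteq> {1..n}"
  using block_sub[of i k d] unfolding d .

lemma G_perm: "\<sigma> \<in> G \<Longrightarrow> \<sigma> permutes {1..n}"
  by (rule young_permutes[OF d])

lemma Inv_sub: "subring (Inv G) T" by (rule Inv_subring[OF G_perm])

lemma Inv_T: "t \<in> Inv G \<Longrightarrow> t \<in> carrier T" by (simp add: Inv_def)

lemma S_cring: "cring S" by (rule TF.T.subring_cring[OF Inv_sub])

sublocale S: up_cring S by (rule up_cring.intro[OF S_cring])

lemma scal_Inv: "r \<in> carrier R \<Longrightarrow> scal T r \<in> Inv G" by (rule Inv_scal[OF G_perm])

lemma xx_block: "i \<in> {1..k} \<Longrightarrow> l \<in> block d i \<Longrightarrow> xx l \<in> carrier T"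
  using block_n xx_closed by blast

lemma g_closed: "i \<in> {1..k} \<Longrightarrow> g i \<in> carrier (UP T)"
  unfolding g_def using xx_block by (intro TU.root_prod_closed)

lemma g_Inv: assumes "i \<in> {1..k}" shows "g i m \<in> Inv G"
proof -
  have stab: "\<sigma> ` block d i = block d i" if "\<sigma> \<in> G" for \<sigma> using that assms by (simp add: young_subgroup_def)
  have "root_prod T (block d i) (\<lambda>l. emb l x) m \<in> Inv G"
    by (rule coeff_root_prod_Inv[OF G_perm block_n[OF assms] stab x_closed])
  then show ?thesis unfolding g_def xx_def[abs_def] .
qed

lemma root_prod_n_Inv: "a \<in> carrier A \<Longrightarrow> root_prod T {1..n} (\<lambda>l. emb l a) m \<in> Inv G"
  by (rule coeff_root_prod_Inv[OF G_perm subset_refl permutes_image[OF G_perm]])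

lemma UP_S: "p \<in> carrier (UP S) \<longleftrightarrow> p \<in> carrier (UP T) \<and> (\<forall>i. p i \<in> Inv G)"
  by (rule subring_UP[OF TF.T_cring Inv_sub])

lemma Inv_generated:
  assumes "\<And>a b. a \<in> Inv G \<Longrightarrow> b \<in> Inv G \<Longrightarrow> Q a \<Longrightarrow> Q b \<Longrightarrow> Q (a \<otimes>\<^bsub>T\<^esub> b)"
    "\<And>a b. a \<in> Inv G \<Longrightarrow> b \<in> Inv G \<Longrightarrow> Q a \<Longrightarrow> Q b \<Longrightarrow> Q (a \<oplus>\<^bsub>T\<^esub> b)"
    "\<And>r. r \<in> carrier R \<Longrightarrow> Q (scal T r)" "\<And>i m. i \<in> {1..k} \<Longrightarrow> Q (g i m)"
    and t: "t \<in> Inv G"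
  shows "Q t"
proof -
  have "subring {t \<in> Inv G. Q t} T"
    using assms(1-3) scal_Inv Inv_T subringE(6,7)[OF Inv_sub] by (intro TA.subringI_scal) auto
  then have "Inv G \<subseteq> {t \<in> Inv G. Q t}"
    using assms(3,4) scal_Inv g_Inv unfolding g_def by (intro Inv_young_generated[OF d]) auto
  then show ?thesis using t by blast
qed

lemma alg_hom_S_iff:
  "\<phi> \<in> alg_hom R S (self_alg R) \<longleftrightarrow> \<phi> \<in> ring_hom S R \<and> (\<forall>r\<in>carrier R. \<phi> (scal T r) = r)"
proof
  assume h: "\<phi> \<in> alg_hom R S (self_alg R)"
  then have hr: "\<phi> \<in> ring_hom S R" by (simp add: alg_hom_def self_alg_def)
  have "\<phi> (scal T r) = r" if "r \<in> carrier R" for r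
    using h that ring_hom_one[OF hr] subringE(3)[OF Inv_sub] by (simp add: alg_hom_def self_alg_def scal_def)
  then show "\<phi> \<in> ring_hom S R \<and> (\<forall>r\<in>carrier R. \<phi> (scal T r) = r)" using hr by blast
next
  assume h: "\<phi> \<in> ring_hom S R \<and> (\<forall>r\<in>carrier R. \<phi> (scal T r) = r)"
  then have hr: "\<phi> \<in> ring_hom S R" by blast
  have "\<phi> (r \<odot>\<^bsub>T\<^esub> t) = r \<otimes> \<phi> t" if "r \<in> carrier R" "t \<in> Inv G" for r t
    using that h ring_hom_mult[OF hr, of "scal T r" t] scal_Inv by (simp add: TA.smult_eq Inv_T)
  then show "\<phi> \<in> alg_hom R S (self_alg R)" using hr by (simp add: alg_hom_def self_alg_def)
qed

lemma hom_esym: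
  assumes \<phi>: "\<phi> \<in> ring_hom S R" "\<And>r. r \<in> carrier R \<Longrightarrow> \<phi> (scal T r) = r" and a: "a \<in> carrier A" and m: "m \<le> n"
  shows "\<phi> (esym T {1..n} (\<lambda>i. emb i a) m) = (\<ominus> \<one>) [^] m \<otimes> \<phi> (root_prod T {1..n} (\<lambda>i. emb i a) (n - m))"
proof -
  have "esym T {1..n} (\<lambda>i. emb i a) m = (\<ominus>\<^bsub>T\<^esub> \<one>\<^bsub>T\<^esub>) [^]\<^bsub>T\<^esub> m \<otimes>\<^bsub>T\<^esub> root_prod T {1..n} (\<lambda>i. emb i a) (n - m)"
    using TU.vieta[of "{1..n}" "\<lambda>i. emb i a" m] TF.emb_closed a m by simp
  also have "(\<ominus>\<^bsub>T\<^esub> \<one>\<^bsub>T\<^esub>) [^]\<^bsub>T\<^esub> m = scal T ((\<ominus> \<one>) [^] m)" by simp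
  finally show ?thesis
    using ring_hom_mult[OF \<phi>(1), of "scal T ((\<ominus> \<one>) [^] m)" "root_prod T {1..n} (\<lambda>i. emb i a) (n - m)"]
      scal_Inv root_prod_n_Inv[OF a] \<phi>(2) by (simp del: TA.s.hom_pow TA.s.hom_a_inv TA.s.hom_one)
qed

lemma CD_iff:
  "\<phi> \<in> CD \<longleftrightarrow> \<phi> \<in> ring_hom S R \<and> (\<forall>r\<in>carrier R. \<phi> (scal T r) = r) \<and> \<phi> \<in> extensional (Inv G) \<and>
     (\<forall>a\<in>carrier A. \<forall>m\<in>{1..n}. \<phi> (esym T {1..n} (\<lambda>i. emb i a) m) = (\<ominus> \<one>) [^] m \<otimes> mult_char_poly R A n a (n - m))"
  unfolding closure_data_def invariants_eq using alg_hom_S_iff by (auto simp: elem_sym_eq char_coeff_eq)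

lemma CD_D:
  assumes "\<phi> \<in> CD"
  shows "\<phi> \<in> ring_hom S R" "r \<in> carrier R \<Longrightarrow> \<phi> (scal T r) = r" "\<phi> \<in> extensional (Inv G)"
    "t \<in> Inv G \<Longrightarrow> \<phi> t \<in> carrier R"
  using assms ring_hom_closed[of \<phi> S R t] unfolding CD_iff by auto

lemma sign_cancel:
  assumes "a \<in> carrier R" "b \<in> carrier R" "(\<ominus> \<one>) [^] (m::nat) \<otimes> a = (\<ominus> \<one>) [^] m \<otimes> b"
  shows "a = b"
proof -
  have s: "(\<ominus> \<one>) [^] m \<otimes> (\<ominus> \<one>) [^] m = \<one>"
    by (induction m) (auto simp: l_minus r_minus)
  have "(\<ominus> \<one>) [^] m \<otimes> ((\<ominus> \<one>) [^] m \<otimes> a) = (\<ominus> \<one>) [^] m \<otimes> ((\<ominus> \<one>) [^] m \<otimes> b)" using assms(3) by simp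
  then show ?thesis using assms(1,2) s by (simp add: m_assoc[symmetric])
qed

text \<open>
  The condition on a closure datum concerns the coefficients of index below \<open>n\<close>. Those of higher index
  agree because both polynomials are monic of degree \<open>n\<close>.
\<close>

lemma CD_char_poly:
  assumes \<phi>: "\<phi> \<in> CD" and a: "a \<in> carrier A"
  shows "map_up \<phi> (root_prod T {1..n} (\<lambda>i. emb i a)) = mult_char_poly R A n a"
proof
  fix m
  let ?p = "root_prod T {1..n} (\<lambda>i. emb i a)" and ?c = "mult_char_poly R A n a"
  note D = CD_D[OF \<phi>]
  interpret h: ring_hom_cring S R \<phi> by (rule ring_hom_cringI[OF S_cring is_cring D(1)])
  have p: "monic_of_degree T n ?p"
    using TU.monic_root_prod[of "{1..n}" "\<lambda>i. emb i a"] TF.emb_closed a by simp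
  note c = char_poly_monic[OF a]
  show "map_up \<phi> ?p m = ?c m"
  proof (cases "m < n")
    case True
    have "\<phi> (esym T {1..n} (\<lambda>i. emb i a) (n - m)) = (\<ominus> \<one>) [^] (n - m) \<otimes> ?c (n - (n - m))"
      using \<phi> a True unfolding CD_iff by simp
    then have "(\<ominus> \<one>) [^] (n - m) \<otimes> \<phi> (?p m) = (\<ominus> \<one>) [^] (n - m) \<otimes> ?c m"
      using hom_esym[OF D(1,2) a, of "n - m"] True by simp
    moreover have "\<phi> (?p m) \<in> carrier R" by (rule D(4)[OF root_prod_n_Inv[OF a]])
    moreover have "?c m \<in> carrier R" by (rule UP_val[OF mult_char_poly_closed[OF a]])
    ultimately have "\<phi> (?p m) = ?c m" using sign_cancel by blast
    then show ?thesis by (simp add: map_up_def)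
  next
    case False
    have "\<phi> \<one>\<^bsub>T\<^esub> = \<one>" "\<phi> \<zero>\<^bsub>T\<^esub> = \<zero>" using h.hom_one h.hom_zero by simp_all
    moreover have "?p n = \<one>\<^bsub>T\<^esub>" "n < m \<Longrightarrow> ?p m = \<zero>\<^bsub>T\<^esub>" using p by (auto simp: TU.monic_iff)
    moreover have "?c n = \<one>" "n < m \<Longrightarrow> ?c m = \<zero>" using c by (auto simp: monic_iff)
    ultimately show ?thesis using False unfolding map_up_def by (cases "m = n") simp_all
  qed
qed

lemma datum_factors_eq: "datum_factors R f d k \<phi> = (\<lambda>i\<in>{1..k}. map_up \<phi> (g i))"
proof -
  have "coeff (UP T) (g i) m = g i m" if "i \<in> {1..k}" for i m using g_closed[OF that] by (simp add: TU.coeff_UP)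
  then show ?thesis
    unfolding datum_factors_def Let_def d tensor_power_eq at_pos_eq map_up_def
    by (auto simp: g_def root_prod_def lin_fac_def xx_def fun_eq_iff simp del: atLeastAtMost_iff)
qed

text \<open>
  The product of the \<open>g i\<close> is the product of all \<open>X - x\<^sup>(\<^sup>l\<^sup>)\<close>, and
  \<open>\<phi>\<close> carries it to the characteristic polynomial of \<open>x\<close>, that is, to \<open>f\<close>.
  The homomorphism \<open>\<phi>\<close> is defined on the invariants only, whence the detour through polynomials over
  this subring.
\<close>

lemma datum_factors_in:
  assumes \<phi>: "\<phi> \<in> CD"
  shows "datum_factors R f d k \<phi> \<in> factorizations R f d k"
proof -
  note D = CD_D[OF \<phi>]
  have id: "id \<in> ring_hom S T" using Inv_T by (auto simp: ring_hom_def)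
  interpret i: ring_hom_cring "UP S" "UP T" "map_up id"
    by (rule ring_hom_cringI[OF S.P.is_cring TU.P.is_cring map_up_hom[OF S_cring TF.T_cring id]])
  interpret p: ring_hom_cring "UP S" "UP R" "map_up \<phi>"
    by (rule ring_hom_cringI[OF S.P.is_cring P.is_cring map_up_hom[OF S_cring is_cring D(1)]])
  have gS: "g i \<in> carrier (UP S)" if "i \<in> {1..k}" for i using that g_closed g_Inv UP_S by simp
  have "monic_of_degree R (d i) (map_up \<phi> (g i))" if i: "i \<in> {1..k}" for i
  proof (rule monic_map_up[OF S_cring is_cring D(1)])
    have "monic_of_degree T (d i) (g i)"
      using TU.monic_root_prod[of "block d i" xx] xx_block[OF i] by (simp add: g_def card_block)
    then show "monic_of_degree S (d i) (g i)" using gS[OF i] by (simp add: S.monic_iff TU.monic_iff)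
  qed
  moreover have "f = (\<Otimes>\<^bsub>UP R\<^esub>i\<in>{1..k}. map_up \<phi> (g i))"
  proof -
    have "(\<Otimes>\<^bsub>UP S\<^esub>i\<in>{1..k}. g i) = map_up id (\<Otimes>\<^bsub>UP S\<^esub>i\<in>{1..k}. g i)" by (simp add: map_up_id)
    also have "\<dots> = (\<Otimes>\<^bsub>UP T\<^esub>i\<in>{1..k}. (map_up id \<circ> g) i)" using gS by (intro i.hom_finprod) auto
    also have "\<dots> = root_prod T {1..n} xx"
      using root_prod_blocks[where B = T and k = k and d = d and b = xx] xx_closed TF.T_cring by (simp add: map_up_id comp_def g_def d)
    finally have "map_up \<phi> (root_prod T {1..n} xx) = map_up \<phi> (\<Otimes>\<^bsub>UP S\<^esub>i\<in>{1..k}. g i)" by simp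
    also have "\<dots> = (\<Otimes>\<^bsub>UP R\<^esub>i\<in>{1..k}. (map_up \<phi> \<circ> g) i)" using gS by (intro p.hom_finprod) auto
    finally show ?thesis
      using CD_char_poly[OF \<phi> x_closed] char_poly_root by (simp add: xx_def[abs_def] comp_def)
  qed
  moreover have "finprod (UP R) (datum_factors R f d k \<phi>) {1..k} = (\<Otimes>\<^bsub>UP R\<^esub>i\<in>{1..k}. map_up \<phi> (g i))"
    unfolding datum_factors_eq using gS by (intro P.finprod_cong') (auto simp del: atLeastAtMost_iff)
  moreover have "datum_factors R f d k \<phi> \<in> extensional {1..k}"
    "\<And>i. i \<in> {1..k} \<Longrightarrow> datum_factors R f d k \<phi> i = map_up \<phi> (g i)" by (simp_all add: datum_factors_eq)
  ultimately show ?thesis unfolding factorizations_def by (simp del: atLeastAtMost_iff)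
qed

lemma datum_factors_inj: "inj_on (datum_factors R f d k) CD"
proof (rule inj_onI)
  fix \<phi> \<psi> assume \<phi>: "\<phi> \<in> CD" and \<psi>: "\<psi> \<in> CD" and eq: "datum_factors R f d k \<phi> = datum_factors R f d k \<psi>"
  note D = CD_D[OF \<phi>] and E = CD_D[OF \<psi>]
  have "\<phi> t = \<psi> t" if "t \<in> Inv G" for t
  proof (rule Inv_generated[OF _ _ _ _ that])
    fix i m assume "i \<in> {1..k}"
    then have "map_up \<phi> (g i) = map_up \<psi> (g i)" using fun_cong[OF eq, of i] by (simp add: datum_factors_eq)
    then show "\<phi> (g i m) = \<psi> (g i m)" by (metis map_up_def)
  qed (use D E ring_hom_mult[OF D(1)] ring_hom_mult[OF E(1)] ring_hom_add[OF D(1)] ring_hom_add[OF E(1)] in auto)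
  then show "\<phi> = \<psi>" by (rule extensionalityI[OF D(3) E(3)])
qed

lemma factorization_splits:
  fixes B :: "('b, 'q) ring_scheme"
  assumes F: "F \<in> factorizations R f d k" and B: "cring B" and j: "j \<in> ring_hom R B"
    and b: "\<And>l. l \<in> {1..n} \<Longrightarrow> b l \<in> carrier B"
    and s: "\<And>i. i \<in> {1..k} \<Longrightarrow> root_prod B (block d i) b = map_up j (F i)"
  shows "map_up j f = root_prod B {1..n} b"
proof -
  interpret B: up_cring B using B by (intro up_cring.intro)
  interpret m: ring_hom_cring "UP R" "UP B" "map_up j"
    by (rule ring_hom_cringI[OF P.is_cring B.P.is_cring map_up_hom[OF is_cring B j]])
  have F': "\<And>i. i \<in> {1..k} \<Longrightarrow> F i \<in> carrier (UP R)" "f = (\<Otimes>\<^bsub>UP R\<^esub>i\<in>{1..k}. F i)"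
    using F by (auto simp: factorizations_def monic_iff)
  have "map_up j f = (\<Otimes>\<^bsub>UP B\<^esub>i\<in>{1..k}. (map_up j \<circ> F) i)"
    unfolding F'(2) using F'(1) by (intro m.hom_finprod) auto
  also have "\<dots> = (\<Otimes>\<^bsub>UP B\<^esub>i\<in>{1..k}. root_prod B (block d i) b)"
    using s b block_n by (intro B.P.finprod_cong') (auto intro!: B.root_prod_closed simp del: atLeastAtMost_iff)
  also have "\<dots> = root_prod B {1..n} b" using root_prod_blocks[where B = B and k = k and d = d and b = b] B b by (simp add: d)
  finally show ?thesis .
qed

text \<open>
  Roots \<open>b l\<close> of the factors, grouped by blocks, define a homomorphism from the tensor power. Its
  restriction to the invariants is determined by the factorization, as the value at \<open>g i\<close> is the image of
  \<open>F i\<close>.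
\<close>

lemma factorization_hom:
  fixes B :: "('b, 'q) ring_scheme"
  assumes F: "F \<in> factorizations R f d k" and B: "cring B" and j: "j \<in> ring_hom R B"
    and b: "\<And>l. l \<in> {1..n} \<Longrightarrow> b l \<in> carrier B"
    and s: "\<And>i. i \<in> {1..k} \<Longrightarrow> root_prod B (block d i) b = map_up j (F i)"
  shows "\<exists>H\<in>ring_hom T B. (\<forall>r\<in>carrier R. H (scal T r) = j r) \<and> (\<forall>l\<in>{1..n}. H (xx l) = b l) \<and>
    (\<forall>i\<in>{1..k}. \<forall>m. H (g i m) = j (F i m))"
proof -
  interpret B: up_cring B using B by (intro up_cring.intro)
  have "eval R B j (b l) f = \<zero>\<^bsub>B\<^esub>" if "l \<in> {1..n}" for l
    by (rule eval_root_of_split[OF B j b factorization_splits[OF F B j b s] that])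
  then obtain H where H: "H \<in> ring_hom T B" "\<And>r. r \<in> carrier R \<Longrightarrow> H (scal T r) = j r"
    "\<And>l. l \<in> {1..n} \<Longrightarrow> H (xx l) = b l" using T_hom[OF B j, of b] b by blast
  have "H (g i m) = j (F i m)" if i: "i \<in> {1..k}" for i m
  proof -
    have "map_up H (g i) = root_prod B (block d i) (\<lambda>l. H (xx l))"
      unfolding g_def using xx_block[OF i] by (intro map_up_root_prod TF.T_cring B H(1))
    also have "\<dots> = root_prod B (block d i) b"
      unfolding root_prod_def using H(3) b block_n[OF i]
      by (intro B.P.finprod_cong') (auto simp: subset_iff simp del: atLeastAtMost_iff)
    also have "\<dots> = map_up j (F i)" by (rule s[OF i])
    finally show ?thesis by (metis map_up_def)
  qed
  then show ?thesis using H by blast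
qed

text \<open>
  Let \<open>R \<subseteq> K\<close> be a ring over which all factors split. The homomorphism \<open>H: T
  \<rightarrow> K\<close> given by the roots takes values in \<open>R\<close> on the generators of the invariants, so
  it restricts to \<open>\<phi>: T\<^sup>G \<rightarrow> R\<close>. The condition on a closure datum, for arbitrary
  \<open>a \<in> A\<close>, is the factorization of the characteristic polynomial of \<open>a\<close> over
  \<open>K\<close>.
\<close>

lemma datum_factors_surj:
  assumes F: "F \<in> factorizations R f d k"
  shows "\<exists>\<phi>\<in>CD. datum_factors R f d k \<phi> = F"
proof -
  have Fm: "\<And>i. i \<in> {1..k} \<Longrightarrow> monic_of_degree R (d i) (F i)" and Fe: "F \<in> extensional {1..k}"
    using F by (auto simp: factorizations_def)
  have Fc: "F i m \<in> carrier R" if "i \<in> {1..k}" for i m using Fm[OF that] by (simp add: monic_iff)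
  obtain K :: "'r tree ring" and j \<theta> where K: "cring K" "j \<in> ring_hom R K" "inj_on j (carrier R)"
    "\<And>i l. i \<in> {1..k} \<Longrightarrow> l \<in> {1..d i} \<Longrightarrow> \<theta> i l \<in> carrier K"
    "\<And>i. i \<in> {1..k} \<Longrightarrow> map_up j (F i) = root_prod K {1..d i} (\<theta> i)"
    using splitting_ring_exists_family[of R k d F, OF is_cring Fm] by blast
  interpret K: up_cring K using K(1) by (intro up_cring.intro)
  interpret j: ring_hom_cring R K j by (rule ring_hom_cringI[OF is_cring K(1,2)])
  \<comment> \<open>the roots of the factors, numbered consecutively block by block\<close>
  define b where "b l = \<theta> (block_of d k l) (l - block_offset d (block_of d k l))" for l
  have b: "b l \<in> carrier K" if "l \<in> {1..n}" for l
    using block_of[of l d k] that block_offset_inverse[of l d] K(4) unfolding b_def d by blast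
  have s: "root_prod K (block d i) b = map_up j (F i)" if i: "i \<in> {1..k}" for i
  proof -
    have "root_prod K (block d i) b = root_prod K {1..d i} (\<lambda>m. b (block_offset d i + m))"
      using b block_n[OF i] by (intro K.root_prod_block) auto
    also have "\<dots> = root_prod K {1..d i} (\<theta> i)"
      unfolding root_prod_def using block_of_eq[OF i block_offset_in_block] K(4)[OF i]
      by (intro K.P.finprod_cong') (auto simp: b_def simp del: atLeastAtMost_iff)
    finally show ?thesis using K(5)[OF i] by simp
  qed
  obtain H where H: "H \<in> ring_hom T K" "\<And>r. r \<in> carrier R \<Longrightarrow> H (scal T r) = j r"
    "\<And>l. l \<in> {1..n} \<Longrightarrow> H (xx l) = b l" "\<And>i m. i \<in> {1..k} \<Longrightarrow> H (g i m) = j (F i m)"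
    using factorization_hom[OF F K(1,2) b s] by blast
  have im: "\<exists>r\<in>carrier R. H t = j r" if "t \<in> Inv G" for t
  proof (rule Inv_generated[OF _ _ _ _ that])
    fix a b assume ab: "a \<in> Inv G" "b \<in> Inv G" "\<exists>r\<in>carrier R. H a = j r" "\<exists>r\<in>carrier R. H b = j r"
    then obtain r r' where r: "r \<in> carrier R" "r' \<in> carrier R" "H a = j r" "H b = j r'" by blast
    show "\<exists>r\<in>carrier R. H (a \<otimes>\<^bsub>T\<^esub> b) = j r"
      using r ring_hom_mult[OF H(1)] Inv_T ab(1,2) by (intro bexI[of _ "r \<otimes> r'"]) auto
    show "\<exists>r\<in>carrier R. H (a \<oplus>\<^bsub>T\<^esub> b) = j r"
      using r ring_hom_add[OF H(1)] Inv_T ab(1,2) by (intro bexI[of _ "r \<oplus> r'"]) auto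
  qed (use H(2,4) Fc in auto)
  define \<phi> where "\<phi> = (\<lambda>t\<in>Inv G. inv_into (carrier R) j (H t))"
  have \<phi>: "\<phi> t \<in> carrier R" "j (\<phi> t) = H t" if "t \<in> Inv G" for t
  proof -
    have "H t \<in> j ` carrier R" using im[OF that] by auto
    then show "\<phi> t \<in> carrier R" "j (\<phi> t) = H t"
      using that inv_into_into[of "H t" j "carrier R"] f_inv_into_f[of "H t" j "carrier R"] by (auto simp: \<phi>_def)
  qed
  have \<phi>I: "\<phi> t = r" if "t \<in> Inv G" "r \<in> carrier R" "H t = j r" for t r
    using \<phi>[OF that(1)] that by (intro inj_onD[OF K(3)]) auto
  have hom: "\<phi> \<in> ring_hom S R"
  proof (rule ring_hom_memI)
    show "\<phi> \<one>\<^bsub>S\<^esub> = \<one>" using subringE(3)[OF Inv_sub] ring_hom_one[OF H(1)] by (intro \<phi>I) auto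
    fix a assume a: "a \<in> carrier S"
    then show "\<phi> a \<in> carrier R" using \<phi>(1) by simp
    fix b assume b: "b \<in> carrier S"
    show "\<phi> (a \<otimes>\<^bsub>S\<^esub> b) = \<phi> a \<otimes> \<phi> b"
      using a b \<phi> ring_hom_mult[OF H(1)] Inv_T subringE(6)[OF Inv_sub] by (intro \<phi>I) auto
    show "\<phi> (a \<oplus>\<^bsub>S\<^esub> b) = \<phi> a \<oplus> \<phi> b"
      using a b \<phi> ring_hom_add[OF H(1)] Inv_T subringE(7)[OF Inv_sub] by (intro \<phi>I) auto
  qed
  have sc: "\<phi> (scal T r) = r" if "r \<in> carrier R" for r using that H(2) scal_Inv by (intro \<phi>I) auto
  have split: "split_adjoin R f n K j (\<lambda>l. H \<circ> emb l)"
  proof (intro split_adjoin.intro adjoin_axioms split_adjoin_axioms.intro K(1,2))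
    show "l \<in> {1..n} \<Longrightarrow> H \<circ> emb l \<in> ring_hom A K" for l by (rule ring_hom_trans[OF TF.emb_hom H(1)])
    show "l \<in> {1..n} \<Longrightarrow> r \<in> carrier R \<Longrightarrow> (H \<circ> emb l) (scal A r) = j r" for l r
      using TF.emb_scal H(2) by simp
    have "root_prod K {1..n} (\<lambda>l. (H \<circ> emb l) x) = root_prod K {1..n} b"
      unfolding root_prod_def using H(3) b
      by (intro K.P.finprod_cong') (auto simp: xx_def simp del: atLeastAtMost_iff)
    then show "map_up j f = root_prod K {1..n} (\<lambda>l. (H \<circ> emb l) x)"
      using factorization_splits[OF F K(1,2) b s] by simp
  qed
  have "\<phi> \<in> CD"
    unfolding CD_iff
  proof (intro conjI ballI hom)
    fix a m assume a: "a \<in> carrier A" and m: "m \<in> {1..n}"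
    let ?p = "root_prod T {1..n} (\<lambda>i. emb i a)" and ?c = "mult_char_poly R A n a"
    have "map_up H ?p = root_prod K {1..n} (\<lambda>l. H (emb l a))"
      using TF.emb_closed a by (intro map_up_root_prod TF.T_cring K(1) H(1)) auto
    also have "\<dots> = map_up j ?c" using split_adjoin.char_poly_split[OF split a] by simp
    finally have "H (?p i) = j (?c i)" for i by (metis map_up_def)
    then have "\<phi> (?p i) = ?c i" for i
      using root_prod_n_Inv[OF a] UP_val[OF mult_char_poly_closed[OF a]] by (intro \<phi>I) auto
    then show "\<phi> (esym T {1..n} (\<lambda>i. emb i a) m) = (\<ominus> \<one>) [^] m \<otimes> ?c (n - m)"
      using hom_esym[OF hom sc a, of m] m by simp
  qed (use sc in \<open>auto simp: \<phi>_def\<close>)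
  moreover have "datum_factors R f d k \<phi> = F"
  proof (rule extensionalityI[OF _ Fe])
    show "datum_factors R f d k \<phi> \<in> extensional {1..k}" by (simp add: datum_factors_eq)
    fix i assume i: "i \<in> {1..k}"
    have "\<phi> (g i m) = F i m" for m using i H(4) Fc g_Inv by (intro \<phi>I) auto
    then show "datum_factors R f d k \<phi> i = F i" using i by (simp add: datum_factors_eq map_up_def)
  qed
  ultimately show ?thesis by blast
qed

theorem datum_factors_bij: "bij_betw (datum_factors R f d k) CD (factorizations R f d k)"
  unfolding bij_betw_def using datum_factors_inj datum_factors_in datum_factors_surj by blast

subsection \<open>The universal property of the closure algebra\<close>

abbreviation "CL \<phi> \<equiv> closure_alg R A n G \<phi>"

context
  fixes \<phi> F
  assumes \<phi>: "\<phi> \<in> CD" and F: "F = datum_factors R f d k \<phi>"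
begin

lemma F_fact: "F \<in> factorizations R f d k" unfolding F by (rule datum_factors_in[OF \<phi>])

lemma base_change: "subring_base_change R T (Inv G) \<phi>"
  using CD_D[OF \<phi>] scal_Inv by (intro subring_base_change.intro TF.T_alg Inv_sub) auto

interpretation bc: subring_base_change R T "Inv G" \<phi> by (rule base_change)

lemma CL_eq: "CL \<phi> = bc.C"
  unfolding closure_alg_def Let_def tensor_power_eq invariants_eq ..

definition "closure_root l = bc.proj (xx l)"

lemma CL_alg: "comm_alg R (CL \<phi>)" unfolding CL_eq by (rule bc.C_alg)

lemma CL_cring: "cring (CL \<phi>)" using comm_algD(2)[OF CL_alg] .

lemma proj_hom: "bc.proj \<in> ring_hom T (CL \<phi>)" unfolding CL_eq by (rule bc.proj_hom)

lemma closure_root_closed: "l \<in> {1..n} \<Longrightarrow> closure_root l \<in> carrier (CL \<phi>)"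
  unfolding closure_root_def using ring_hom_closed[OF proj_hom xx_closed] .

lemma closure_root_split:
  assumes i: "i \<in> {1..k}"
  shows "root_prod (CL \<phi>) (block d i) closure_root = map_up (scal (CL \<phi>)) (F i)"
proof -
  have "root_prod (CL \<phi>) (block d i) closure_root = map_up bc.proj (g i)"
    unfolding g_def closure_root_def using xx_block[OF i] by (intro map_up_root_prod[symmetric] TF.T_cring CL_cring proj_hom)
  also have "\<dots> = map_up (scal (CL \<phi>)) (F i)"
    using bc.proj_Sc[OF g_Inv[OF i]] i by (simp add: map_up_def F datum_factors_eq CL_eq)
  finally show ?thesis .
qed

lemma CL_generated:
  assumes X: "subring X (CL \<phi>)" "\<And>r. r \<in> carrier R \<Longrightarrow> scal (CL \<phi>) r \<in> X" "\<And>l. l \<in> {1..n} \<Longrightarrow> closure_root l \<in> X"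
  shows "carrier (CL \<phi>) \<subseteq> X"
proof -
  have "bc.proj t \<in> X" if "t \<in> carrier T" for t
    using that
  proof (induction rule: T_gen)
    case (scal r)
    then show ?case using X(2)[of r] unfolding CL_eq by (simp add: bc.C_scal)
  next
    case (root l)
    then show ?case using X(3) by (simp add: closure_root_def)
  next
    case (add a b)
    then show ?case using ring_hom_add[OF proj_hom add(1,2)] subringE(7)[OF X(1)] by simp
  next
    case (mult a b)
    then show ?case using ring_hom_mult[OF proj_hom mult(1,2)] subringE(6)[OF X(1)] by simp
  qed
  then show ?thesis using bc.proj_surj by (auto simp: CL_eq)
qed

text \<open>
  Together with \<open>CL_generated\<close> and \<open>closure_root_split\<close>: the homomorphisms from the closure
  algebra to a ring \<open>B\<close> over \<open>R\<close> are the same as the families \<open>b\<close> in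
  \<open>B\<close> with \<open>\<Prod>(X - b l) = F i\<close>, the product over the \<open>i\<close>-th block. For
  such a family, the homomorphism from \<open>T\<close> agrees on the invariants with \<open>\<phi>\<close>, as it
  does so on the coefficients of the \<open>g i\<close>.
\<close>

lemma CL_universal:
  fixes B :: "('b, 'q) ring_scheme"
  assumes B: "cring B" and j: "j \<in> ring_hom R B" and b: "\<And>l. l \<in> {1..n} \<Longrightarrow> b l \<in> carrier B"
    and s: "\<And>i. i \<in> {1..k} \<Longrightarrow> root_prod B (block d i) b = map_up j (F i)"
  shows "\<exists>w\<in>ring_hom (CL \<phi>) B. (\<forall>r\<in>carrier R. w (scal (CL \<phi>) r) = j r) \<and> (\<forall>l\<in>{1..n}. w (closure_root l) = b l)"
proof -
  obtain H where H: "H \<in> ring_hom T B" "\<And>r. r \<in> carrier R \<Longrightarrow> H (scal T r) = j r"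
    "\<And>l. l \<in> {1..n} \<Longrightarrow> H (xx l) = b l" "\<And>i m. i \<in> {1..k} \<Longrightarrow> H (g i m) = j (F i m)"
    using factorization_hom[OF F_fact B j b s] by blast
  note D = CD_D[OF \<phi>]
  have "H t = H (scal T (\<phi> t))" if "t \<in> Inv G" for t
  proof (rule Inv_generated[OF _ _ _ _ that])
    fix a b assume ab: "a \<in> Inv G" "b \<in> Inv G" "H a = H (scal T (\<phi> a))" "H b = H (scal T (\<phi> b))"
    show "H (a \<otimes>\<^bsub>T\<^esub> b) = H (scal T (\<phi> (a \<otimes>\<^bsub>T\<^esub> b)))"
      using ab ring_hom_mult[OF H(1)] ring_hom_mult[OF D(1), of a b] D(4) Inv_T by simp
    show "H (a \<oplus>\<^bsub>T\<^esub> b) = H (scal T (\<phi> (a \<oplus>\<^bsub>T\<^esub> b)))"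
      using ab ring_hom_add[OF H(1)] ring_hom_add[OF D(1), of a b] D(4) Inv_T by simp
  next
    fix i m assume i: "i \<in> {1..k}"
    have "\<phi> (g i m) = F i m" using i by (simp add: F datum_factors_eq map_up_def)
    then show "H (g i m) = H (scal T (\<phi> (g i m)))"
      using H(2)[OF D(4)[OF g_Inv[OF i, of m]]] H(4)[OF i] by simp
  qed (use D(2) in simp)
  then obtain w where w: "w \<in> ring_hom bc.C B" "\<And>t. t \<in> carrier T \<Longrightarrow> w (bc.proj t) = H t"
    using bc.C_universal[OF B H(1)] by blast
  then show ?thesis using H(2,3) bc.C_scal xx_closed
    by (intro bexI[of _ w]) (auto simp: CL_eq closure_root_def)
qed

end

end

section \<open>The Ferrand homomorphism and the tensor product of the closure algebras\<close>

lemma block_single: "block (\<lambda>_. n) 1 = {1..n}"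
  by (simp add: block_def One_nat_def)

lemma young_single: "young_subgroup (\<lambda>_. n) 1 = carrier (sym_group n)"
proof -
  have "\<sigma> ` block (\<lambda>_. n) i = block (\<lambda>_. n) i" if "\<sigma> permutes {1..n}" "i \<in> {1..1}" for \<sigma> i
    using that permutes_image[OF that(1)] block_single[of n] by simp
  then show ?thesis unfolding young_subgroup_def sym_group_carrier by (simp add: sym_group_def cong: conj_cong)
qed

context adjoin
begin

lemma factorizations_single: "factorizations R f (\<lambda>_. n) 1 = {\<lambda>i\<in>{1..1}. f}"
proof -
  have prod: "(\<Otimes>\<^bsub>UP R\<^esub>i\<in>{1..1}. F i) = F 1" if "F 1 \<in> carrier (UP R)" for F :: "nat \<Rightarrow> nat \<Rightarrow> 'r"
    using that by simp
  show ?thesis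
  proof (intro equalityI subsetI)
    fix F assume "F \<in> factorizations R f (\<lambda>_. n) 1"
    then have F: "F \<in> extensional {1..1}" "F 1 \<in> carrier (UP R)" "f = (\<Otimes>\<^bsub>UP R\<^esub>i\<in>{1..1}. F i)"
      by (auto simp: factorizations_def monic_iff)
    then have "F 1 = f" using prod by simp
    then have "F = (\<lambda>i\<in>{1..1}. f)" using F(1) by (intro extensionalityI[of F "{1..1}"]) simp_all
    then show "F \<in> {\<lambda>i\<in>{1..1}. f}" by simp
  next
    fix F assume "F \<in> {\<lambda>i\<in>{1..1::nat}. f}"
    then have F: "F = (\<lambda>i\<in>{1..1}. f)" by simp
    show "F \<in> factorizations R f (\<lambda>_. n) 1"
      using monic f_closed by (auto simp: factorizations_def F)
  qed
qed

lemma young_one: "young R f n (\<lambda>_. n) 1"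
  by (intro young.intro adjoin_axioms young_axioms.intro) simp

interpretation y: young R f n "\<lambda>_. n" 1 by (rule young_one)

text \<open>
  For a single block the only factorization is \<open>f = f\<close>, so the bijection with factorizations shows that
  there is exactly one closure datum.
\<close>

lemma ferrand_hom_datum: "ferrand_hom R A n \<in> closure_data R A n (carrier (sym_group n))"
proof -
  have bij: "bij_betw (datum_factors R f (\<lambda>_. n) 1) (closure_data R A n (carrier (sym_group n))) {\<lambda>i\<in>{1..1}. f}"
    using y.datum_factors_bij unfolding young_single factorizations_single .
  have "card (closure_data R A n (carrier (sym_group n))) = 1" using bij_betw_same_card[OF bij] by simp
  then obtain \<phi> where "closure_data R A n (carrier (sym_group n)) = {\<phi>}" by (rule card_1_singletonE)
  then have "\<exists>!\<phi>. \<phi> \<in> closure_data R A n (carrier (sym_group n))" by simp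
  then show ?thesis unfolding ferrand_hom_def by (rule theI')
qed

lemma ferrand_hom_factors: "(\<lambda>i\<in>{1..1}. f) = datum_factors R f (\<lambda>_. n) 1 (ferrand_hom R A n)"
  using y.datum_factors_in[unfolded young_single, OF ferrand_hom_datum] unfolding factorizations_single by simp

abbreviation "FA \<equiv> closure_alg R A n (carrier (sym_group n)) (ferrand_hom R A n)"

definition "ferrand_root = y.closure_root (ferrand_hom R A n)"

lemmas ferrand_datum = ferrand_hom_datum[folded young_single] ferrand_hom_factors

lemma FA_alg: "comm_alg R FA"
  using y.CL_alg[OF ferrand_datum] unfolding young_single .

lemma ferrand_root_closed: "m \<in> {1..n} \<Longrightarrow> ferrand_root m \<in> carrier FA"
  using y.closure_root_closed[OF ferrand_datum] unfolding young_single ferrand_root_def .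

lemma ferrand_root_split: "root_prod FA {1..n} ferrand_root = map_up (scal FA) f"
  using y.closure_root_split[OF ferrand_datum, of 1] unfolding young_single ferrand_root_def block_single by simp

lemma FA_generated:
  assumes "subring X FA" "\<And>r. r \<in> carrier R \<Longrightarrow> scal FA r \<in> X" "\<And>m. m \<in> {1..n} \<Longrightarrow> ferrand_root m \<in> X"
  shows "carrier FA \<subseteq> X"
  using y.CL_generated[OF ferrand_datum, unfolded young_single, folded ferrand_root_def, OF assms] .

text \<open>
  For a single block, the families represented by the closure algebra are the tuples of roots in a full splitting of
  \<open>f\<close>.
\<close>

lemma FA_universal:
  fixes B :: "('b, 'q) ring_scheme"
  assumes B: "cring B" "j \<in> ring_hom R B" "\<And>m. m \<in> {1..n} \<Longrightarrow> b m \<in> carrier B"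
    and s: "root_prod B {1..n} b = map_up j f"
  shows "\<exists>w\<in>ring_hom FA B. (\<forall>r\<in>carrier R. w (scal FA r) = j r) \<and> (\<forall>m\<in>{1..n}. w (ferrand_root m) = b m)"
proof -
  have "root_prod B (block (\<lambda>_. n) i) b = map_up j ((\<lambda>i\<in>{1..1}. f) i)" if "i \<in> {1..1}" for i
    using that s block_single by simp
  from y.CL_universal[OF ferrand_datum B this] show ?thesis unfolding young_single ferrand_root_def .
qed

end

context young
begin

text \<open>
  Both algebras represent the families \<open>b\<close> with \<open>\<Prod>(X - b l) = F i\<close> over each block:
  the closure algebra by \<open>CL_universal\<close>, and the tensor product because a family is the same as one
  family for every factor. The homomorphisms \<open>w\<close> and \<open>V\<close> that come from the two universal
  properties match the generators \<open>z l\<close> and \<open>y l\<close>, so they are inverse to each other.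
\<close>

lemma closure_alg_iso:
  assumes \<phi>: "\<phi> \<in> CD" and F: "F = datum_factors R f d k \<phi>"
  shows "alg_isomorphic R (CL \<phi>) (tensor_prod R {1..k} (\<lambda>i.
    closure_alg R (adjoin_root R (F i)) (d i) (carrier (sym_group (d i))) (ferrand_hom R (adjoin_root R (F i)) (d i))))"
proof -
  have Fm: "monic_of_degree R (d i) (F i)" if "i \<in> {1..k}" for i
    using F_fact[OF \<phi> F] that by (simp add: factorizations_def)
  have adj: "adjoin R (F i) (d i)" if "i \<in> {1..k}" for i by (rule adjoinI[OF is_cring Fm[OF that]])
  define Ci where "Ci i = closure_alg R (adjoin_root R (F i)) (d i) (carrier (sym_group (d i)))
    (ferrand_hom R (adjoin_root R (F i)) (d i))" for i
  note CiD = adjoin.FA_alg[OF adj, folded Ci_def] adjoin.ferrand_root_closed[OF adj, folded Ci_def]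
    adjoin.ferrand_root_split[OF adj, folded Ci_def] adjoin.FA_generated[OF adj, folded Ci_def]
  define zi where "zi i = adjoin.ferrand_root R (F i) (d i)" for i
  define C where "C = CL \<phi>"
  define z where "z = closure_root \<phi>"
  have C_alg: "comm_alg R C" unfolding C_def by (rule CL_alg[OF \<phi> F])
  interpret C: comm_algebra R C by (rule comm_algebraI[OF C_alg])
  interpret CU: up_cring C by (intro up_cring.intro C.A.is_cring)
  interpret TD: tensor_family R "{1..k}" Ci using CiD(1) by (intro tensor_family.intro is_cring) auto
  define D where "D = TD.T"
  have D_alg: "comm_alg R D" unfolding D_def by (rule TD.T_alg)
  interpret D: comm_algebra R D by (rule comm_algebraI[OF D_alg])
  interpret DU: up_cring D by (intro up_cring.intro D.A.is_cring)
  note emb_hom = TD.emb_hom[folded D_def] and emb_scal = TD.emb_scal[folded D_def]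
  have Ci_cring: "cring (Ci i)" and Ci_scal: "scal (Ci i) \<in> ring_hom R (Ci i)" if "i \<in> {1..k}" for i
    using comm_algD[OF CiD(1)[OF that]] by auto
  have zi_closed: "zi i m \<in> carrier (Ci i)" if "i \<in> {1..k}" "m \<in> {1..d i}" for i m
    using CiD(2)[OF that] by (simp add: zi_def)
  have z_closed: "z l \<in> carrier C" if "l \<in> {1..n}" for l using closure_root_closed[OF \<phi> F that] by (simp add: z_def C_def)
  have in_n: "block_offset d i + m \<in> {1..n}" if "i \<in> {1..k}" "m \<in> {1..d i}" for i m
    using block_offset_in_block[where i = i and d = d, OF that(2)] block_n[OF that(1)] by blast
  \<comment> \<open>the generator of the factor of the block of \<open>l\<close> that corresponds to the position of \<open>l\<close> in this block\<close>
  define y where "y l = TD.emb (block_of d k l) (zi (block_of d k l) (l - block_offset d (block_of d k l)))" for l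
  have y_block: "y (block_offset d i + m) = TD.emb i (zi i m)" if "i \<in> {1..k}" "m \<in> {1..d i}" for i m
    using block_of_eq[OF that(1) block_offset_in_block[where i = i and d = d, OF that(2)]] by (simp add: y_def)
  have y_closed: "y l \<in> carrier D" if "l \<in> {1..n}" for l
    using block_of[of l d k] that block_offset_inverse[of l d] zi_closed TD.emb_closed unfolding y_def d D_def by blast
  have y_split: "root_prod D (block d i) y = map_up (scal D) (F i)" if i: "i \<in> {1..k}" for i
  proof -
    have "root_prod D (block d i) y = root_prod D {1..d i} (\<lambda>m. y (block_offset d i + m))"
      using y_closed block_n[OF i] by (intro DU.root_prod_block) auto
    also have "\<dots> = root_prod D {1..d i} (\<lambda>m. TD.emb i (zi i m))"
      unfolding root_prod_def using y_block[OF i] ring_hom_closed[OF emb_hom[OF i] zi_closed[OF i]]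
      by (intro DU.P.finprod_cong') (auto simp del: atLeastAtMost_iff)
    also have "\<dots> = map_up (TD.emb i) (root_prod (Ci i) {1..d i} (zi i))"
      using zi_closed[OF i] by (intro map_up_root_prod[symmetric] Ci_cring[OF i] D.A.is_cring emb_hom[OF i])
    also have "\<dots> = map_up (TD.emb i) (map_up (scal (Ci i)) (F i))" using CiD(3)[OF i] by (simp add: zi_def)
    also have "\<dots> = map_up (scal D) (F i)"
      using emb_scal[OF i] UP_val[of "F i"] Fm[OF i] by (auto simp: map_up_def fun_eq_iff monic_iff)
    finally show ?thesis .
  qed
  obtain w where w: "w \<in> ring_hom C D" "\<And>r. r \<in> carrier R \<Longrightarrow> w (scal C r) = scal D r"
    "\<And>l. l \<in> {1..n} \<Longrightarrow> w (z l) = y l"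
    using CL_universal[OF \<phi> F D.A.is_cring D.scal_hom y_closed y_split] unfolding C_def z_def by blast
  have ex: "\<exists>v\<in>ring_hom (Ci i) C. (\<forall>r\<in>carrier R. v (scal (Ci i) r) = scal C r) \<and>
      (\<forall>m\<in>{1..d i}. v (zi i m) = z (block_offset d i + m))" if i: "i \<in> {1..k}" for i
    unfolding Ci_def zi_def
  proof (rule adjoin.FA_universal[OF adj[OF i] C.A.is_cring C.scal_hom])
    show "z (block_offset d i + m) \<in> carrier C" if "m \<in> {1..d i}" for m by (rule z_closed[OF in_n[OF i that]])
    have "root_prod C {1..d i} (\<lambda>m. z (block_offset d i + m)) = root_prod C (block d i) z"
      using z_closed block_n[OF i] by (intro CU.root_prod_block[symmetric]) auto
    also have "\<dots> = map_up (scal C) (F i)" unfolding C_def z_def by (rule closure_root_split[OF \<phi> F i])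
    finally show "root_prod C {1..d i} (\<lambda>m. z (block_offset d i + m)) = map_up (scal C) (F i)" .
  qed
  have "\<forall>i\<in>{1..k}. \<exists>v. v \<in> ring_hom (Ci i) C \<and> (\<forall>r\<in>carrier R. v (scal (Ci i) r) = scal C r) \<and>
      (\<forall>m\<in>{1..d i}. v (zi i m) = z (block_offset d i + m))" by (intro ballI ex[unfolded Bex_def])
  from bchoice[OF this] obtain v where v: "\<And>i. i \<in> {1..k} \<Longrightarrow> v i \<in> ring_hom (Ci i) C"
    "\<And>i r. i \<in> {1..k} \<Longrightarrow> r \<in> carrier R \<Longrightarrow> v i (scal (Ci i) r) = scal C r"
    "\<And>i m. i \<in> {1..k} \<Longrightarrow> m \<in> {1..d i} \<Longrightarrow> v i (zi i m) = z (block_offset d i + m)" by blast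
  obtain V where V: "V \<in> ring_hom D C" "\<And>r. r \<in> carrier R \<Longrightarrow> V (scal D r) = scal C r"
    "\<And>i a. i \<in> {1..k} \<Longrightarrow> a \<in> carrier (Ci i) \<Longrightarrow> V (TD.emb i a) = v i a"
    using TD.T_universal[OF C.A.is_cring C.scal_hom v(1,2)] unfolding D_def by blast
  interpret w: ring_hom_cring C D w by (rule ring_hom_cringI[OF C.A.is_cring D.A.is_cring w(1)])
  interpret V: ring_hom_cring D C V by (rule ring_hom_cringI[OF D.A.is_cring C.A.is_cring V(1)])
  have Vw: "V (w c) = c" if "c \<in> carrier C" for c
  proof -
    have "subring {c \<in> carrier C. V (w c) = c} C"
      using w(2) V(2) by (intro C.subringI_scal) auto
    moreover have "V (w (z l)) = z l" if l: "l \<in> {1..n}" for l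
    proof -
      obtain i where i: "i \<in> {1..k}" "l \<in> block d i" using block_of[of l d k] l unfolding d by blast
      then show ?thesis
        using block_offset_inverse[OF i(2)] y_block[OF i(1), of "l - block_offset d i"] V(3)[OF i(1) zi_closed[OF i(1), of "l - block_offset d i"]]
          v(3)[OF i(1), of "l - block_offset d i"] w(3)[OF l] by simp
    qed
    ultimately have "carrier C \<subseteq> {c \<in> carrier C. V (w c) = c}"
      using w(2) V(2) z_closed by (intro CL_generated[OF \<phi> F, folded C_def z_def]) simp_all
    then show ?thesis using that by blast
  qed
  have wv: "w (v i a) = TD.emb i a" if i: "i \<in> {1..k}" and a: "a \<in> carrier (Ci i)" for i a
  proof -
    interpret Ci: comm_algebra R "Ci i" by (rule comm_algebraI[OF CiD(1)[OF i]])
    have "subring {a \<in> carrier (Ci i). w (v i a) = TD.emb i a} (Ci i)"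
      using w(2) v(2)[OF i] emb_scal[OF i] ring_hom_mult[OF w(1)] ring_hom_mult[OF v(1)[OF i]] ring_hom_mult[OF emb_hom[OF i]]
        ring_hom_add[OF w(1)] ring_hom_add[OF v(1)[OF i]] ring_hom_add[OF emb_hom[OF i]] ring_hom_closed[OF v(1)[OF i]]
      by (intro Ci.subringI_scal) auto
    then have "carrier (Ci i) \<subseteq> {a \<in> carrier (Ci i). w (v i a) = TD.emb i a}"
      using w(2) v(2)[OF i] emb_scal[OF i] v(3)[OF i] y_block[OF i] w(3)[OF in_n[OF i]] zi_closed[OF i]
      by (intro CiD(4)[OF i]) (auto simp: zi_def[symmetric] simp del: atLeastAtMost_iff)
    then show ?thesis using a by blast
  qed
  have wV: "w (V t) = t" if "t \<in> carrier D" for t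
    using that unfolding D_def
  proof (induction rule: TD.T_induct)
    case (scal r)
    then show ?case using V(2) w(2) by (simp add: D_def)
  next
    case (emb i a)
    then show ?case using V(3) wv by simp
  next
    case (add s t)
    then show ?case
      using ring_hom_add[OF V(1)] ring_hom_add[OF w(1)] ring_hom_closed[OF V(1)] by (simp add: D_def)
  next
    case (mult s t)
    then show ?case
      using ring_hom_mult[OF V(1)] ring_hom_mult[OF w(1)] ring_hom_closed[OF V(1)] by (simp add: D_def)
  qed
  have "bij_betw w (carrier C) (carrier D)"
    using ring_hom_closed[OF w(1)] ring_hom_closed[OF V(1)] Vw wV by (intro bij_betwI[where g = V]) auto
  moreover have "w \<in> alg_hom R C D" using w(1,2) alg_hom_iff[OF C_alg D_alg] by blast
  ultimately have "alg_isomorphic R C D" unfolding alg_isomorphic_def alg_iso_def by blast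
  then show ?thesis unfolding C_def D_def Ci_def .
qed

end

theorem theorem7p4:
  fixes R :: "('r, 'm) ring_scheme" and f :: "nat \<Rightarrow> 'r" and n k :: nat and d :: "nat \<Rightarrow> nat"
  assumes "cring R"
    and "monic_of_degree R n f"
    and "(\<Sum>i=1..k. d i) = n"
  shows "bij_betw (datum_factors R f d k)
           (closure_data R (adjoin_root R f) n (young_subgroup d k))
           (factorizations R f d k) \<and>
         (\<forall>F\<in>factorizations R f d k.
           alg_isomorphic R
             (closure_alg R (adjoin_root R f) n (young_subgroup d k)
               (the_inv_into (closure_data R (adjoin_root R f) n (young_subgroup d k))
                 (datum_factors R f d k) F))
             (tensor_prod R {1..k} (\<lambda>i.
               closure_alg R (adjoin_root R (F i)) (d i) (carrier (sym_group (d i)))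
                 (ferrand_hom R (adjoin_root R (F i)) (d i)))))"
proof -
  interpret young R f n d k
    using assms by (intro young.intro adjoinI young_axioms.intro)
  let ?\<phi> = "the_inv_into CD (datum_factors R f d k)"
  have "alg_isomorphic R (CL (?\<phi> F)) (tensor_prod R {1..k} (\<lambda>i.
      closure_alg R (adjoin_root R (F i)) (d i) (carrier (sym_group (d i)))
        (ferrand_hom R (adjoin_root R (F i)) (d i))))" if "F \<in> factorizations R f d k" for F
  proof (rule closure_alg_iso)
    have im: "F \<in> datum_factors R f d k ` CD" using that datum_factors_bij by (simp add: bij_betw_def)
    show "?\<phi> F \<in> CD" by (rule the_inv_into_into[OF datum_factors_inj im subset_refl])
    show "F = datum_factors R f d k (?\<phi> F)" by (rule f_the_inv_into_f[OF datum_factors_inj im, symmetric])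
  qed
  then show ?thesis using datum_factors_bij by blast
qed

end
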